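(* Let $\mathcal C$ and $\mathcal D$ be $\mathbb K$-linear graded $A_\infty$ categories, equipped with choices of $\mathbb K$-bases $\mathcal B_{\mathcal C}$ and $\mathcal B_{\mathcal D}$ for their morphism spaces. If $F:\mathcal C\to\mathcal D$ is an $A_\infty$ functor, then the induced map $F_*:HC^-_\bullet(\mathcal C)\to HC^-_\bullet(\mathcal D)$ respects the Getzler--Gauss--Manin connections: for every $v\in\mathrm{Der}_\Bbbk\mathbb K$, $$F_*\circ[u\nabla_v^{\mathcal B_{\mathcal C}}]=[u\nabla_v^{\mathcal B_{\mathcal D}}]\circ F_*$$ on the level of cohomology.
   Context: **Conventions.** $\Bbbk\subset\mathbb K$ are fields. A grading datum is fixed: an abelian group $Y$ with homomorphisms $\mathbb Z\to Y\to\mathbb Z/2$ of nonzero composition. Everything graded is $Y$-graded; an integer degree means its image in $Y$; in signs, $|a|$ is the image of the degree in $\mathbb Z/2$, and $\sigma'=\sigma-1$. $u$ has degree $2$; completions in $u$ are degreewise. **$A_\infty$ categories.** An $A_\infty$ category $\mathcal C$ has a set of objects, graded vector spaces $hom^\bullet(X,Y)$ and, with $\mathcal C(X_0,\ldots,X_s)=hom^\bullet(X_0,X_1)[1]\otimes\cdots\otimes hom^\bullet(X_{s-1},X_s)[1]$, degree-$1$ maps $\mu^s:\mathcal C(X_0,\ldots,X_s)\to\mathcal C(X_0,X_s)$, $s\ge1$ ($\mu^0=0$), with $\sum(-1)^{|a_1|'+\cdots+|a_j|'}\mu^*(a_1,\ldots,a_j,\mu^*(a_{j+1},\ldots,a_k),a_{k+1},\ldots,a_s)=0$.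 The cohomology category ($\mathrm{Hom}^\bullet(X,Y)=H^\bullet(hom^\bullet(X,Y),\mu^1)$, $[a_1]\cdot[a_2]=(-1)^{|a_2|}[\mu^2(a_2,a_1)]$) is always assumed to have units. An $A_\infty$ functor $F:\mathcal C\to\mathcal D$ is a map on objects with degree-$0$ maps $F^s:\mathcal C(X_0,\ldots,X_s)\to\mathcal D(FX_0,FX_s)$, $s\ge1$, with $\sum\mu^*(F^*(a_1,\ldots),\ldots,F^*(\ldots,a_s))=\sum(-1)^{|a_1|'+\cdots+|a_j|'}F^*(a_1,\ldots,a_j,\mu^*(a_{j+1},\ldots),\ldots,a_s)$. **Hochschild and cyclic chains.** $CC_\bullet(\mathcal C)=\bigoplus\mathcal C(X_0,\ldots,X_s,X_0)[-1]$ with generators $a_0[a_1|\ldots|a_s]$; $\varepsilon_j=|a_0|'+\cdots+|a_j|'$; $t(a_0[a_1|\ldots|a_s])=(-1)^{|a_s|'\varepsilon_{s-1}}a_s[a_0|\ldots|a_{s-1}]$. Overbrace convention: in a formula for $P(a_0[a_1|\ldots|a_s])$, an overbrace over the inputs in positions $p,\ldots,q$ (counted from $0$) means $\sum_{i=p}^qP\circ t^i$, i.e. one sums over all cyclic permutations of the inputs, with Koszul signs for reduced degrees, for which the original $a_0$ lands under the brace; other strings of inputs may be empty. The differential is $b(a_0[a_1|\ldots|a_s])=\sum_j\mu^*(\overbrace{a_0,\ldots,a_j})[a_{j+1}|\ldots|a_s]+\sum(-1)^{\varepsilon_j}a_0[\ldots|\mu^*(a_{j+1},\ldots,a_k)|\ldots|a_s]$.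 Let $\mathcal C^+$ be $\mathcal C$ with an element $e^+$ adjoined to each $hom^\bullet(X,X)$, with $\mu^2(e^+,a)=a=(-1)^{|a|}\mu^2(a,e^+)$ and all other $\mu^s(\ldots,e^+,\ldots)=0$. $CC^{nu}_\bullet(\mathcal C)$ is the quotient of $CC_\bullet(\mathcal C^+)$ by the span of chains with $a_i=e^+$ for some $i>0$ and of the length-zero chains $e^+$. Put $B(a_0[a_1|\ldots|a_s])=e^+[\overbrace{a_0|\ldots|a_s}]$. $HC^-_\bullet(\mathcal C)$ is the cohomology of $CC^-_\bullet(\mathcal C)=(CC^{nu}_\bullet(\mathcal C)[[u]],b+uB)$. **Induced map.** $F_*(a_0[a_1|\ldots|a_s])=\sum F^*(\overbrace{a_0,\ldots})[F^*(\ldots)|\ldots|F^*(\ldots,a_s)]$, extended to $CC^{nu}_\bullet$ by $F^1(e^+)=e^+$ and $F^s(\ldots,e^+,\ldots)=0$ for $s\ge2$, and $u$-linearly to $CC^-_\bullet$. **Connection.** Given $\mathbb K$-bases $\mathcal B$ of the $hom$ spaces, $v\in\mathrm{Der}_\Bbbk\mathbb K$ acts on coefficients of chains and on matrix entries of $\mu^*$, giving $v(\mu^* )$ (extended by zero on $e^+$; $|v(\mu^* )|'=1$). For a Hochschild cochain $\varphi$ put $b^{1|1}(\varphi|a_0[\ldots|a_s])=\sum(-1)^{|\varphi|'\varepsilon_j}\mu^*(a_0,\ldots,a_j,\varphi^*(a_{j+1},\ldots),\overbrace{\ldots,a_k})[a_{k+1}|\ldots|a_s]$, $B^{1|1}(\varphi|a_0[\ldots|a_s])=\sum(-1)^{|\varphi|'\varepsilon_j}e^+[a_0|\ldots|a_j|\varphi^*(a_{j+1},\ldots)|\overbrace{\ldots|a_s}]$.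 Then $\nabla^{\mathcal B}_v\alpha=v(\alpha)-u^{-1}b^{1|1}(v(\mu^* )|\alpha)-B^{1|1}(v(\mu^* )|\alpha)$, and $u\nabla_v^{\mathcal B}$ induces a map on $HC^-_\bullet$ denoted $[u\nabla^{\mathcal B}_v]$. *)

theory Defs
  imports Complex_Main "HOL-Library.Poly_Mapping" "HOL-Library.Z2" "HOL-Library.Product_Plus"
begin

section \<open>Grading data and signs\<close>

class grading_datum = ab_group_add +
  fixes deg_of_int :: "int \<Rightarrow> 'a"
    and parity :: "'a \<Rightarrow> bit"
  assumes deg_of_int_add: "deg_of_int (m + n) = deg_of_int m + deg_of_int n"
    and parity_add: "parity (x + y) = parity x + parity y"
    and parity_deg_of_int_nonzero: "(\<lambda>n. parity (deg_of_int n)) \<noteq> (\<lambda>_. 0)"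

definition bsign :: "bit \<Rightarrow> 'k::ring_1"
  where "bsign s = (if s = 0 then 1 else - 1)"


section \<open>Homogeneous morphisms and $A_\infty$ categories\<close>

text \<open>A graded vector space is the family of its homogeneous pieces, which are subspaces of one
  ambient space \<open>'a\<close>. The pieces may overlap inside \<open>'a\<close> (all contain \<open>0\<close>), so a homogeneous
  morphism is an element labelled by its source, target and unshifted degree.\<close>

datatype ('o, 'y, 'a) mor = Mor (src: 'o) (tgt: 'o) (deg: 'y) (elt: 'a)

definition with_elt :: "('o, 'y, 'a) mor \<Rightarrow> 'b \<Rightarrow> ('o, 'y, 'b) mor"
  where "with_elt m a = Mor (src m) (tgt m) (deg m) a"

definition rdeg :: "('o, 'y::grading_datum, 'a) mor list \<Rightarrow> 'y"
  where "rdeg w = (\<Sum>m\<leftarrow>w. deg m - deg_of_int 1)"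

text \<open>\<open>eps [a\<^sub>0, \<dots>, a\<^sub>j]\<close> is $\varepsilon_j$; also $\varepsilon_{-1} = 0$.\<close>

definition eps :: "('o, 'y::grading_datum, 'a) mor list \<Rightarrow> bit"
  where "eps w = parity (rdeg w)"

text \<open>The labelled value of an operation \<open>f\<close> of reduced degree \<open>d\<close> (a degree \<open>d\<close> map
  between the shifted spaces) on a nonempty path, with object map \<open>Fo\<close>.\<close>

definition apply_op ::
    "('o \<Rightarrow> 'p) \<Rightarrow> (('o, 'y, 'a) mor list \<Rightarrow> 'b) \<Rightarrow> 'y::grading_datum \<Rightarrow>
      ('o, 'y, 'a) mor list \<Rightarrow> ('p, 'y, 'b) mor"
  where "apply_op Fo f d w =
    Mor (Fo (src (hd w))) (Fo (tgt (last w))) (rdeg w + d + deg_of_int 1) (f w)"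

record ('k, 'o, 'y, 'a) ainf_data =
  scl :: "'k \<Rightarrow> 'a \<Rightarrow> 'a"
  Obj :: "'o set"
  Hom :: "'o \<Rightarrow> 'o \<Rightarrow> 'y \<Rightarrow> 'a set"
  mu :: "('o, 'y, 'a) mor list \<Rightarrow> 'a"

definition is_mor :: "('k, 'o, 'y, 'a) ainf_data \<Rightarrow> ('o, 'y, 'a) mor \<Rightarrow> bool"
  where "is_mor C m \<longleftrightarrow>
    src m \<in> Obj C \<and> tgt m \<in> Obj C \<and> elt m \<in> Hom C (src m) (tgt m) (deg m)"

definition is_path :: "('k, 'o, 'y, 'a) ainf_data \<Rightarrow> ('o, 'y, 'a) mor list \<Rightarrow> bool"
  where "is_path C w \<longleftrightarrow>
    w \<noteq> [] \<and> (\<forall>m\<in>set w. is_mor C m) \<and> successively (\<lambda>m n. tgt m = src n) w"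

text \<open>A family of degree \<open>d\<close> linear maps
  $\mathcal C(X_0,\dots,X_s) \to \mathcal D(\mathit{Fo} X_0, \mathit{Fo} X_s)$, $s \ge 1$.\<close>

definition multilinear_op ::
    "('k, 'o, 'y, 'a::ab_group_add) ainf_data \<Rightarrow> ('k, 'p, 'y, 'b::ab_group_add) ainf_data \<Rightarrow>
      ('o \<Rightarrow> 'p) \<Rightarrow> (('o, 'y, 'a) mor list \<Rightarrow> 'b) \<Rightarrow> 'y::grading_datum \<Rightarrow> bool"
  where "multilinear_op C D Fo f d \<longleftrightarrow>
    (\<forall>w. is_path C w \<longrightarrow> is_mor D (apply_op Fo f d w)) \<and>
    (\<forall>p (m :: ('o, 'y, 'a) mor) q a b. is_path C (p @ with_elt m a # q) \<longrightarrow> is_path C (p @ with_elt m b # q) \<longrightarrow>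
      f (p @ with_elt m (a + b) # q) = f (p @ with_elt m a # q) + f (p @ with_elt m b # q)) \<and>
    (\<forall>p (m :: ('o, 'y, 'a) mor) q a c. is_path C (p @ with_elt m a # q) \<longrightarrow>
      f (p @ with_elt m (scl C c a) # q) = scl D c (f (p @ with_elt m a # q)))"

definition slice :: "nat \<Rightarrow> nat \<Rightarrow> 'c list \<Rightarrow> 'c list"
  where "slice j k w = drop j (take k w)"

abbreviation mu_mor ::
    "('k, 'o, 'y::grading_datum, 'a) ainf_data \<Rightarrow> ('o, 'y, 'a) mor list \<Rightarrow> ('o, 'y, 'a) mor"
  where "mu_mor C \<equiv> apply_op id (mu C) (deg_of_int 1)"

text \<open>The cohomological unit axiom uses
  $[a_1]\cdot[a_2] = (-1)^{|a_2|}[\mu^2(a_2,a_1)]$ and $|e| = 0$.\<close>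

locale ainf_category =
  fixes C :: "('k::field, 'o, 'y::grading_datum, 'a::ab_group_add) ainf_data"
  assumes scl: "vector_space (scl C)"
    and Hom: "X \<in> Obj C \<Longrightarrow> Y \<in> Obj C \<Longrightarrow> module.subspace (scl C) (Hom C X Y y)"
    and mu: "multilinear_op C C id (mu C) (deg_of_int 1)"
    and ainf_relation: "is_path C w \<Longrightarrow>
      (\<Sum>j<length w. \<Sum>k\<in>{j<..length w}.
        scl C (bsign (eps (take j w)))
          (mu C (take j w @ mu_mor C (slice j k w) # drop k w))) = 0"
    and cohomology_unit: "X \<in> Obj C \<Longrightarrow> \<exists>e\<in>Hom C X X 0. mu C [Mor X X 0 e] = 0 \<and>
      (\<forall>Y\<in>Obj C. \<forall>y. \<forall>a\<in>Hom C X Y y. mu C [Mor X Y y a] = 0 \<longrightarrow>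
        (\<exists>h\<in>Hom C X Y (y - deg_of_int 1).
          mu C [Mor X X 0 e, Mor X Y y a] - a = mu C [Mor X Y (y - deg_of_int 1) h])) \<and>
      (\<forall>Y\<in>Obj C. \<forall>y. \<forall>a\<in>Hom C Y X y. mu C [Mor Y X y a] = 0 \<longrightarrow>
        (\<exists>h\<in>Hom C Y X (y - deg_of_int 1).
          scl C (bsign (parity y)) (mu C [Mor Y X y a, Mor X X 0 e]) - a
            = mu C [Mor Y X (y - deg_of_int 1) h]))"

text \<open>All ways to cut a list into consecutive nonempty blocks.\<close>

definition splittings :: "'c list \<Rightarrow> 'c list list set"
  where "splittings w = {bs. concat bs = w \<and> [] \<notin> set bs}"

lemma finite_splittings: "finite (splittings w)"
proof -
  have len: "length bs \<le> length (concat bs)" if "[] \<notin> set bs" for bs :: "'c list list"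
    using that
  proof (induction bs)
    case (Cons b bs)
    then show ?case by (cases b) auto
  qed simp
  let ?L = "{b. set b \<subseteq> set w \<and> length b \<le> length w}"
  have "splittings w \<subseteq> {bs. set bs \<subseteq> ?L \<and> length bs \<le> length w}"
  proof
    fix bs assume "bs \<in> splittings w"
    then have bs: "concat bs = w" "[] \<notin> set bs" by (auto simp: splittings_def)
    have "length b \<le> length w" if "b \<in> set bs" for b
      using that bs(1) member_le_sum_list[of "length b" "map length bs"]
      by (auto simp: length_concat)
    with bs len[OF bs(2)] show "bs \<in> {bs. set bs \<subseteq> ?L \<and> length bs \<le> length w}" by auto
  qed
  moreover have "finite {bs. set bs \<subseteq> ?L \<and> length bs \<le> length w}"
    by (intro finite_lists_length_le) simp
  ultimately show ?thesis by (rule finite_subset)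
qed

definition ainf_functor ::
    "('k::field, 'o, 'y::grading_datum, 'a::ab_group_add) ainf_data \<Rightarrow>
      ('k, 'p, 'y, 'b::ab_group_add) ainf_data \<Rightarrow>
      ('o \<Rightarrow> 'p) \<Rightarrow> (('o, 'y, 'a) mor list \<Rightarrow> 'b) \<Rightarrow> bool"
  where "ainf_functor C D Fo F \<longleftrightarrow>
    multilinear_op C D Fo F 0 \<and>
    (\<forall>w. is_path C w \<longrightarrow>
      (\<Sum>bs\<in>splittings w. mu D (map (apply_op Fo F 0) bs)) =
      (\<Sum>j<length w. \<Sum>k\<in>{j<..length w}.
        scl D (bsign (eps (take j w)))
          (F (take j w @ mu_mor C (slice j k w) # drop k w))))"

text \<open>Bases of the graded vector spaces $hom^\bullet(X,Y)$ are homogeneous.\<close>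

definition hom_bases ::
    "('k::field, 'o, 'y, 'a::ab_group_add) ainf_data \<Rightarrow> ('o \<Rightarrow> 'o \<Rightarrow> 'y \<Rightarrow> 'a set) \<Rightarrow> bool"
  where "hom_bases C B \<longleftrightarrow>
    (\<forall>X\<in>Obj C. \<forall>Y\<in>Obj C. \<forall>y.
      \<not> module.dependent (scl C) (B X Y y) \<and> module.span (scl C) (B X Y y) = Hom C X Y y)"


section \<open>Adjoining strict units\<close>

text \<open>\<open>(a, c)\<close> stands for $a + c\,e^+$.\<close>

definition e_plus :: "'o \<Rightarrow> ('o, 'y::grading_datum, 'a::ab_group_add \<times> 'k::field) mor"
  where "e_plus X = Mor X X 0 (0, 1)"

definition drop_e :: "('o, 'y, 'a \<times> 'k) mor \<Rightarrow> ('o, 'y, 'a) mor"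
  where "drop_e m = with_elt m (fst (elt m))"

definition e_coeff :: "('o, 'y, 'a \<times> 'k) mor \<Rightarrow> 'k"
  where "e_coeff m = snd (elt m)"

definition mu_plus ::
    "('k::field, 'o, 'y::grading_datum, 'a::ab_group_add) ainf_data \<Rightarrow>
      ('o, 'y, 'a \<times> 'k) mor list \<Rightarrow> 'a \<times> 'k"
  where "mu_plus C w = (case w of
      [m, n] \<Rightarrow>
        (mu C [drop_e m, drop_e n]
          + scl C (e_coeff m) (elt (drop_e n))
          + scl C (bsign (parity (deg m)) * e_coeff n) (elt (drop_e m)),
         e_coeff m * e_coeff n)
    | _ \<Rightarrow> (mu C (map drop_e w), 0))"

definition ainf_plus ::
    "('k::field, 'o, 'y::grading_datum, 'a::ab_group_add) ainf_data \<Rightarrow>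
      ('k, 'o, 'y, 'a \<times> 'k) ainf_data"
  where "ainf_plus C = \<lparr>
    scl = (\<lambda>r x. (scl C r (fst x), r * snd x)),
    Obj = Obj C,
    Hom = (\<lambda>X Y y. {(a, c). a \<in> Hom C X Y y \<and> (c \<noteq> 0 \<longrightarrow> X = Y \<and> y = 0)}),
    mu = mu_plus C \<rparr>"

definition F_plus ::
    "(('o, 'y, 'a) mor list \<Rightarrow> 'b) \<Rightarrow> ('o, 'y, 'a \<times> 'k::field) mor list \<Rightarrow> 'b \<times> 'k"
  where "F_plus F w = (F (map drop_e w), (case w of [m] \<Rightarrow> e_coeff m | _ \<Rightarrow> 0))"

definition basis_plus ::
    "('o \<Rightarrow> 'o \<Rightarrow> 'y::grading_datum \<Rightarrow> 'a::ab_group_add set) \<Rightarrow>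
      'o \<Rightarrow> 'o \<Rightarrow> 'y \<Rightarrow> ('a \<times> 'k::field) set"
  where "basis_plus B X Y y =
    (\<lambda>\<beta>. (\<beta>, 0)) ` B X Y y \<union> (if X = Y \<and> y = 0 then {(0, 1)} else {})"


section \<open>Hochschild chains\<close>

text \<open>The word \<open>[a\<^sub>0, a\<^sub>1, \<dots>, a\<^sub>s]\<close> stands for $a_0[a_1|\dots|a_s]$. Formal chains are finite
  linear combinations of words. The tensor products are the quotient of formal chains by the
  multilinearity relations; that quotient and the one defining $CC^{nu}_\bullet$ are taken
  together, by the subspace \<open>null_chains\<close> below. All operators are given on formal chains.\<close>

type_synonym ('k, 'o, 'y, 'a) chain = "('o, 'y, 'a) mor list \<Rightarrow>\<^sub>0 'k"

definition csc :: "'k::field \<Rightarrow> ('w \<Rightarrow>\<^sub>0 'k) \<Rightarrow> ('w \<Rightarrow>\<^sub>0 'k)"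
  where "csc c x = Poly_Mapping.map ((*) c) x"

lemma lookup_csc: "Poly_Mapping.lookup (csc c x) w = c * Poly_Mapping.lookup x w"
  by (simp add: csc_def Poly_Mapping.map.rep_eq when_def)

interpretation chain: vector_space "csc :: 'k::field \<Rightarrow> ('w \<Rightarrow>\<^sub>0 'k) \<Rightarrow> ('w \<Rightarrow>\<^sub>0 'k)"
  by standard (auto intro!: poly_mapping_eqI simp: lookup_csc lookup_add algebra_simps)

definition lin :: "('k \<Rightarrow> 'b \<Rightarrow> 'b) \<Rightarrow> ('w \<Rightarrow> 'b) \<Rightarrow> ('w \<Rightarrow>\<^sub>0 'k::zero) \<Rightarrow> 'b::comm_monoid_add"
  where "lin sc P x = (\<Sum>w\<in>Poly_Mapping.keys x. sc (Poly_Mapping.lookup x w) (P w))"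

abbreviation clin ::
    "('w \<Rightarrow> 'v \<Rightarrow>\<^sub>0 'k) \<Rightarrow> ('w \<Rightarrow>\<^sub>0 'k) \<Rightarrow> ('v \<Rightarrow>\<^sub>0 'k::field)"
  where "clin \<equiv> lin csc"

abbreviation word :: "'w \<Rightarrow> 'w \<Rightarrow>\<^sub>0 'k::field"
  where "word w \<equiv> Poly_Mapping.single w 1"

definition cyc_word :: "('k, 'o, 'y, 'a) ainf_data \<Rightarrow> ('o, 'y, 'a) mor list \<Rightarrow> bool"
  where "cyc_word C w \<longleftrightarrow> is_path C w \<and> tgt (last w) = src (hd w)"

definition formal_chains ::
    "('k::field, 'o, 'y::grading_datum, 'a) ainf_data \<Rightarrow> 'y \<Rightarrow> ('k, 'o, 'y, 'a) chain set"
  where "formal_chains C y =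
    {x. \<forall>w\<in>Poly_Mapping.keys x. cyc_word C w \<and> rdeg w + deg_of_int 1 = y}"

definition tensor_relations ::
    "('k::field, 'o, 'y, 'a::ab_group_add) ainf_data \<Rightarrow> ('k, 'o, 'y, 'a) chain set"
  where "tensor_relations C =
    {word (p @ with_elt m (a + b) # q) - word (p @ with_elt m a # q) - word (p @ with_elt m b # q)
      | p (m :: ('o, 'y, 'a) mor) q a b. cyc_word C (p @ with_elt m a # q) \<and> cyc_word C (p @ with_elt m b # q)} \<union>
    {word (p @ with_elt m (scl C c a) # q) - csc c (word (p @ with_elt m a # q))
      | p (m :: ('o, 'y, 'a) mor) q a c. cyc_word C (p @ with_elt m a # q)}"

definition degenerate_words ::
    "('k::field, 'o, 'y::grading_datum, 'a::ab_group_add) ainf_data \<Rightarrow>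
      ('o, 'y, 'a \<times> 'k) mor list set"
  where "degenerate_words C =
    {w. cyc_word (ainf_plus C) w \<and> (\<exists>i X. 0 < i \<and> i < length w \<and> w ! i = e_plus X)} \<union>
    {[e_plus X] | X. X \<in> Obj C}"

text \<open>$CC^{nu}_\bullet(\mathcal C)$ in degree \<open>y\<close> is \<open>formal_chains (ainf_plus C) y\<close> modulo
  \<open>null_chains C\<close>.\<close>

definition null_chains ::
    "('k::field, 'o, 'y::grading_datum, 'a::ab_group_add) ainf_data \<Rightarrow>
      ('k, 'o, 'y, 'a \<times> 'k) chain set"
  where "null_chains C =
    chain.span (tensor_relations (ainf_plus C) \<union> word ` degenerate_words C)"

definition cyc ::
    "('k::field, 'o, 'y::grading_datum, 'a) chain \<Rightarrow> ('k, 'o, 'y, 'a) chain"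
  where "cyc = clin (\<lambda>w. csc (bsign (eps [last w] * eps (butlast w))) (word (last w # butlast w)))"

text \<open>\<open>overbrace p q P w\<close> is the sum of $P \circ t^i$ over \<open>p \<le> i \<le> q\<close>, evaluated at \<open>w\<close>.\<close>

definition overbrace ::
    "nat \<Rightarrow> nat \<Rightarrow> (('o, 'y::grading_datum, 'a) mor list \<Rightarrow> 'v \<Rightarrow>\<^sub>0 'k::field) \<Rightarrow>
      ('o, 'y, 'a) mor list \<Rightarrow> ('v \<Rightarrow>\<^sub>0 'k)"
  where "overbrace p q P w = (\<Sum>i\<in>{p..q}. clin P ((cyc ^^ i) (word w)))"

definition hochschild_b ::
    "('k::field, 'o, 'y::grading_datum, 'a) ainf_data \<Rightarrow>
      ('o, 'y, 'a) mor list \<Rightarrow> ('k, 'o, 'y, 'a) chain"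
  where "hochschild_b C w =
    (\<Sum>j<length w.
      overbrace 0 j (\<lambda>w. word (mu_mor C (take (Suc j) w) # drop (Suc j) w)) w) +
    (\<Sum>j\<in>{1..<length w}. \<Sum>k\<in>{j<..length w}.
      csc (bsign (eps (take j w))) (word (take j w @ mu_mor C (slice j k w) # drop k w)))"

definition connes_B ::
    "('o, 'y::grading_datum, 'a::ab_group_add \<times> 'k::field) mor list \<Rightarrow>
      ('k, 'o, 'y, 'a \<times> 'k) chain"
  where "connes_B w = overbrace 0 (length w - 1) (\<lambda>w. word (e_plus (src (hd w)) # w)) w"

definition induced_chain_map ::
    "('o \<Rightarrow> 'p) \<Rightarrow> (('o, 'y::grading_datum, 'a) mor list \<Rightarrow> 'b) \<Rightarrow>
      ('o, 'y, 'a) mor list \<Rightarrow> ('k::field, 'p, 'y, 'b) chain"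
  where "induced_chain_map Fo F w =
    (\<Sum>p\<in>{1..length w}. overbrace 0 (p - 1)
      (\<lambda>w. \<Sum>bs\<in>splittings (drop p w).
        word (apply_op Fo F 0 (take p w) # map (apply_op Fo F 0) bs)) w)"


section \<open>Negative cyclic homology\<close>

text \<open>\<open>x :: nat \<Rightarrow> _ chain\<close> stands for $\sum_i x_i u^i$. As $|u| = 2$, a series of degree \<open>y\<close> has
  \<open>x i\<close> of degree \<open>y - 2 i\<close>, and there is no other condition: the completion is degreewise.
  A series represents \<open>0\<close> in $CC^-_\bullet$ when all its coefficients lie in \<open>null_chains\<close>.\<close>

definition formal_series ::
    "('k::field, 'o, 'y::grading_datum, 'a) ainf_data \<Rightarrow> 'y \<Rightarrow> (nat \<Rightarrow> ('k, 'o, 'y, 'a) chain) set"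
  where "formal_series C y = {x. \<forall>i. x i \<in> formal_chains C (y - deg_of_int (2 * int i))}"

definition u_times :: "(nat \<Rightarrow> 'c::zero) \<Rightarrow> nat \<Rightarrow> 'c"
  where "u_times x i = (case i of 0 \<Rightarrow> 0 | Suc j \<Rightarrow> x j)"

definition neg_d ::
    "('k::field, 'o, 'y::grading_datum, 'a::ab_group_add) ainf_data \<Rightarrow>
      (nat \<Rightarrow> ('k, 'o, 'y, 'a \<times> 'k) chain) \<Rightarrow> nat \<Rightarrow> ('k, 'o, 'y, 'a \<times> 'k) chain"
  where "neg_d C x i =
    clin (hochschild_b (ainf_plus C)) (x i) + u_times (\<lambda>i. clin connes_B (x i)) i"

definition neg_cocycles ::
    "('k::field, 'o, 'y::grading_datum, 'a::ab_group_add) ainf_data \<Rightarrow> 'y \<Rightarrow>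
      (nat \<Rightarrow> ('k, 'o, 'y, 'a \<times> 'k) chain) set"
  where "neg_cocycles C y =
    {x \<in> formal_series (ainf_plus C) y. \<forall>i. neg_d C x i \<in> null_chains C}"

definition cohomologous ::
    "('k::field, 'o, 'y::grading_datum, 'a::ab_group_add) ainf_data \<Rightarrow> 'y \<Rightarrow>
      (nat \<Rightarrow> ('k, 'o, 'y, 'a \<times> 'k) chain) rel"
  where "cohomologous C y =
    {(x, x'). x \<in> neg_cocycles C y \<and> x' \<in> neg_cocycles C y \<and>
      (\<exists>z\<in>formal_series (ainf_plus C) (y - deg_of_int 1).
        \<forall>i. x' i - x i - neg_d C z i \<in> null_chains C)}"

definition HC_neg ::
    "('k::field, 'o, 'y::grading_datum, 'a::ab_group_add) ainf_data \<Rightarrow> 'y \<Rightarrow>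
      (nat \<Rightarrow> ('k, 'o, 'y, 'a \<times> 'k) chain) set set"
  where "HC_neg C y = neg_cocycles C y // cohomologous C y"

text \<open>The map on classes induced by \<open>T\<close>, where \<open>r\<close> is the cohomology relation of the target. If
  \<open>T\<close> descends to classes, as the chain maps used below do, the union is a single class.\<close>

definition induced :: "'d rel \<Rightarrow> ('c \<Rightarrow> 'd) \<Rightarrow> 'c set \<Rightarrow> 'd set"
  where "induced r T \<xi> = (\<Union>x\<in>\<xi>. r `` {T x})"

definition HC_map ::
    "('k::field, 'p, 'y::grading_datum, 'b::ab_group_add) ainf_data \<Rightarrow>
      ('o \<Rightarrow> 'p) \<Rightarrow> (('o, 'y, 'a::ab_group_add) mor list \<Rightarrow> 'b) \<Rightarrow> 'y \<Rightarrow>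
      (nat \<Rightarrow> ('k, 'o, 'y, 'a \<times> 'k) chain) set \<Rightarrow> (nat \<Rightarrow> ('k, 'p, 'y, 'b \<times> 'k) chain) set"
  where "HC_map D Fo F y =
    induced (cohomologous D y) (\<lambda>x i. clin (induced_chain_map Fo (F_plus F)) (x i))"


section \<open>The Getzler--Gauss--Manin connection\<close>

definition is_subfield :: "'k::field set \<Rightarrow> bool"
  where "is_subfield k \<longleftrightarrow> 0 \<in> k \<and> 1 \<in> k \<and>
    (\<forall>a\<in>k. \<forall>b\<in>k. a + b \<in> k \<and> a * b \<in> k) \<and> (\<forall>a\<in>k. - a \<in> k \<and> inverse a \<in> k)"

definition Der :: "'k::field set \<Rightarrow> ('k \<Rightarrow> 'k) set"
  where "Der k = {v. (\<forall>a b. v (a + b) = v a + v b) \<and> (\<forall>c\<in>k. \<forall>a. v (c * a) = c * v a) \<and>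
    (\<forall>a b. v (a * b) = v a * b + a * v b)}"

definition coord ::
    "('k::field, 'o, 'y, 'a::ab_group_add) ainf_data \<Rightarrow> ('o \<Rightarrow> 'o \<Rightarrow> 'y \<Rightarrow> 'a set) \<Rightarrow>
      ('o, 'y, 'a) mor \<Rightarrow> 'a \<Rightarrow> 'k"
  where "coord C B m = module.representation (scl C) (B (src m) (tgt m) (deg m)) (elt m)"

text \<open>The tensor \<open>w\<close> written out as a linear combination of words in basis elements.\<close>

definition expand ::
    "('k::field, 'o, 'y, 'a::ab_group_add) ainf_data \<Rightarrow> ('o \<Rightarrow> 'o \<Rightarrow> 'y \<Rightarrow> 'a set) \<Rightarrow>
      ('o, 'y, 'a) mor list \<Rightarrow> ('k, 'o, 'y, 'a) chain"
  where "expand C B w =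
    (\<Sum>\<beta>s\<in>listset (map (\<lambda>m. {\<beta>. coord C B m \<beta> \<noteq> 0}) w).
      Poly_Mapping.single (map2 with_elt w \<beta>s) (prod_list (map2 (coord C B) w \<beta>s)))"

definition act_coeffs ::
    "('k::field, 'o, 'y, 'a::ab_group_add) ainf_data \<Rightarrow> ('o \<Rightarrow> 'o \<Rightarrow> 'y \<Rightarrow> 'a set) \<Rightarrow>
      ('k \<Rightarrow> 'k) \<Rightarrow> ('k, 'o, 'y, 'a) chain \<Rightarrow> ('k, 'o, 'y, 'a) chain"
  where "act_coeffs C B v x = Poly_Mapping.map v (clin (expand C B) x)"

text \<open>\<open>v_mu\<close> is $v(\mu^*)$: the multilinear operation whose matrix entries are obtained by
  applying \<open>v\<close> to those of $\mu^*$.\<close>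

definition v_mu ::
    "('k::field, 'o, 'y::grading_datum, 'a::ab_group_add) ainf_data \<Rightarrow>
      ('o \<Rightarrow> 'o \<Rightarrow> 'y \<Rightarrow> 'a set) \<Rightarrow> ('k \<Rightarrow> 'k) \<Rightarrow> ('o, 'y, 'a) mor list \<Rightarrow> 'a"
  where "v_mu C B v w = lin (scl C)
    (\<lambda>w'. \<Sum>\<gamma> | coord C B (mu_mor C w') \<gamma> \<noteq> 0. scl C (v (coord C B (mu_mor C w') \<gamma>)) \<gamma>)
    (expand C B w)"

definition v_mu_plus ::
    "('k::field, 'o, 'y::grading_datum, 'a::ab_group_add) ainf_data \<Rightarrow>
      ('o \<Rightarrow> 'o \<Rightarrow> 'y \<Rightarrow> 'a set) \<Rightarrow> ('k \<Rightarrow> 'k) \<Rightarrow> ('o, 'y, 'a \<times> 'k) mor list \<Rightarrow> 'a \<times> 'k"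
  where "v_mu_plus C B v w = (v_mu C B v (map drop_e w), 0)"

text \<open>In \<open>b11\<close> and \<open>B11\<close>, \<open>d\<close> is the reduced degree of the cochain \<open>\<phi>\<close>, and the rotated word is
  cut after \<open>j\<close>, \<open>l\<close> and \<open>k\<close> letters; \<open>\<phi>\<close> takes the letters at positions \<open>j, \<dots>, l - 1\<close> and the
  brace lies over the positions \<open>l, \<dots>, k - 1\<close>. The length-zero component of \<open>\<phi>\<close> is taken to
  vanish, as that of $v(\mu^*)$ does, whence \<open>j < l\<close>.\<close>

definition b11 ::
    "('k::field, 'o, 'y::grading_datum, 'a) ainf_data \<Rightarrow> (('o, 'y, 'a) mor list \<Rightarrow> 'a) \<Rightarrow> 'y \<Rightarrow>
      ('o, 'y, 'a) mor list \<Rightarrow> ('k, 'o, 'y, 'a) chain"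
  where "b11 C \<phi> d w =
    (\<Sum>j<length w. \<Sum>l\<in>{j<..<length w}. \<Sum>k\<in>{l<..length w}.
      overbrace l (k - 1)
        (\<lambda>w. csc (bsign (parity d * eps (take j w)))
          (word (mu_mor C (take j w @ apply_op id \<phi> d (slice j l w) # slice l k w) # drop k w))) w)"

definition B11 ::
    "(('o, 'y::grading_datum, 'a::ab_group_add \<times> 'k::field) mor list \<Rightarrow> 'a \<times> 'k) \<Rightarrow> 'y \<Rightarrow>
      ('o, 'y, 'a \<times> 'k) mor list \<Rightarrow> ('k, 'o, 'y, 'a \<times> 'k) chain"
  where "B11 \<phi> d w =
    (\<Sum>j<length w. \<Sum>l\<in>{j<..<length w}.
      overbrace l (length w - 1)
        (\<lambda>w. csc (bsign (parity d * eps (take j w)))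
          (word (e_plus (src (hd w)) # take j w @ apply_op id \<phi> d (slice j l w) # drop l w))) w)"

text \<open>$u\nabla^{\mathcal B}_v$\<close>

definition u_nabla ::
    "('k::field, 'o, 'y::grading_datum, 'a::ab_group_add) ainf_data \<Rightarrow>
      ('o \<Rightarrow> 'o \<Rightarrow> 'y \<Rightarrow> 'a set) \<Rightarrow> ('k \<Rightarrow> 'k) \<Rightarrow>
      (nat \<Rightarrow> ('k, 'o, 'y, 'a \<times> 'k) chain) \<Rightarrow> nat \<Rightarrow> ('k, 'o, 'y, 'a \<times> 'k) chain"
  where "u_nabla C B v x i =
    u_times (\<lambda>i. act_coeffs (ainf_plus C) (basis_plus B) v (x i)) i
    - clin (b11 (ainf_plus C) (v_mu_plus C B v) (deg_of_int 1)) (x i)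
    - u_times (\<lambda>i. clin (B11 (v_mu_plus C B v) (deg_of_int 1)) (x i)) i"

definition HC_u_nabla ::
    "('k::field, 'o, 'y::grading_datum, 'a::ab_group_add) ainf_data \<Rightarrow>
      ('o \<Rightarrow> 'o \<Rightarrow> 'y \<Rightarrow> 'a set) \<Rightarrow> ('k \<Rightarrow> 'k) \<Rightarrow> 'y \<Rightarrow>
      (nat \<Rightarrow> ('k, 'o, 'y, 'a \<times> 'k) chain) set \<Rightarrow> (nat \<Rightarrow> ('k, 'o, 'y, 'a \<times> 'k) chain) set"
  where "HC_u_nabla C B v y = induced (cohomologous C (y + deg_of_int 2)) (u_nabla C B v)"

end

(* A chain of cyclic words is expanded in bases into words over an alphabet with plain, marked and
   unit letters (the mark sits on a_0), and every operator becomes an element of the convolution ring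
   of maps from words to linear combinations of words, composed with the sum N of all cyclic rotations.
   Differentiating the functor equation along v shows that v(F) is a primitive of
   F(.., v(mu_C), ..) - v(mu_D)(F, .., F); the contraction with v(F) (noncommutative Cartan homotopy
   formula) together with the correction term that applies F around v(mu_C) and a_0 is therefore a
   homotopy between F_* u nabla and u nabla F_*. *)
theory Submission
  imports Defs 
begin

section \<open>Linear extension of maps on words\<close>

text \<open>Chain identities here mix three kinds of bookkeeping: overbraces, Koszul signs and the
  special role of a_0. Marking a_0 and precomposing with the norm absorbs the first and the last:
  exchanging two factors of a product becomes invisible (\<open>opp_NN\<close>), and the norm
  conjugates b into an ordinary coderivation (\<open>NN_bb\<close>). Signs are carried by the
  operators \<open>sg p\<close>, so the Cartan formula becomes ring arithmetic.

  The price is that word operators see neither objects nor degrees beyond parity, and do not see the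
  quotient that defines chains. Hence the comparison map \<open>Q0\<close> from formal chains to
  marked words, which detects null chains up to the word \<open>[Unit]\<close>; a section
  \<open>RR\<close> that carries the homotopy back; and a typing argument giving the lifted homotopy
  the right ends and degree.

  The bases of C and D are unrelated, so v acts differently on both sides. The defect is the
  derivative of the matrix of F, and the Lie derivative along it is the derivative of F_*. To keep a
  single set of objects, D is replaced by its pullback to the objects of C.\<close>

lemma csc_simps [simp]: "csc 0 x = 0" "csc c 0 = 0" "csc 1 x = x"
  by (auto intro!: poly_mapping_eqI simp: lookup_csc)

lemma csc_single [simp]: "csc c (Poly_Mapping.single w d) = Poly_Mapping.single w (c * d)"
  by (auto intro!: poly_mapping_eqI simp: lookup_csc lookup_single when_def)

lemma csc_add: "csc c (x + y) = csc c x + csc c y"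
  and csc_diff: "csc c (x - y) = csc c x - csc c y"
  and csc_minus: "csc c (- x) = - csc c x"
  and csc_neg: "csc (- c) x = - csc c x"
  and csc_csc: "csc c (csc d x) = csc (c * d) x"
  and csc_plus: "csc (c + d) x = csc c x + csc d x"
  by (auto intro!: poly_mapping_eqI simp: lookup_csc lookup_add lookup_minus algebra_simps)

lemma csc_sum: "csc c (sum f A) = (\<Sum>a\<in>A. csc c (f a))"
  by (rule poly_mapping_eqI) (simp add: lookup_csc lookup_sum sum_distrib_left)

lemma csc_conv_mult: "csc c x = Poly_Mapping.single 0 c * x"
  by (simp add: csc_def mult_map_scale_conv_mult)

lemma csc_mult_left: "csc c x * y = csc c (x * y)"
  by (simp add: csc_conv_mult mult.assoc)

lemma lin_superset:
  assumes "finite S" "Poly_Mapping.keys x \<subseteq> S"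
  shows "clin P x = (\<Sum>w\<in>S. csc (Poly_Mapping.lookup x w) (P w))"
  unfolding lin_def using assms
  by (intro sum.mono_neutral_left) (auto simp: in_keys_iff)

lemma clin_0 [simp]: "clin P 0 = 0"
  by (simp add: lin_def)

lemma clin_single [simp]: "clin P (Poly_Mapping.single w c) = csc c (P w)"
  by (subst lin_superset[of "{w}"]) auto

lemma clin_add: "clin P (x + y) = clin P x + clin P y"
proof -
  let ?S = "Poly_Mapping.keys x \<union> Poly_Mapping.keys y"
  have "Poly_Mapping.keys (x + y) \<subseteq> ?S" by (rule keys_add)
  then show ?thesis
    by (simp add: lin_superset[of ?S] lookup_add csc_plus sum.distrib)
qed

lemma clin_csc: "clin P (csc c x) = csc c (clin P x)"
proof -
  have "Poly_Mapping.keys (csc c x) \<subseteq> Poly_Mapping.keys x"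
    by (auto simp: in_keys_iff lookup_csc)
  then show ?thesis
    by (simp add: lin_superset[of "Poly_Mapping.keys x"] lookup_csc csc_csc csc_sum)
qed

lemma clin_minus: "clin P (- x) = - clin P x"
  using clin_csc[of P "- 1" x] by (simp add: csc_neg)

lemma clin_diff: "clin P (x - y) = clin P x - clin P y"
  using clin_add[of P x "- y"] by (simp add: clin_minus)

lemma clin_sum: "clin P (sum f A) = (\<Sum>a\<in>A. clin P (f a))"
  by (induction A rule: infinite_finite_induct) (auto simp: clin_add)

lemma clin_add_fun: "clin (\<lambda>w. P w + Q w) x = clin P x + clin Q x"
  by (simp add: lin_def csc_add sum.distrib)

lemma clin_diff_fun: "clin (\<lambda>w. P w - Q w) x = clin P x - clin Q x"
  by (simp add: lin_def csc_diff sum_subtractf)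

lemma clin_minus_fun: "clin (\<lambda>w. - P w) x = - clin P x"
  by (simp add: lin_def csc_minus sum_negf)

lemma clin_0_fun [simp]: "clin (\<lambda>w. 0) x = 0"
  by (simp add: lin_def)

lemma clin_csc_fun: "clin (\<lambda>w. csc c (P w)) x = csc c (clin P x)"
  by (simp add: lin_def csc_sum csc_csc mult.commute)

lemma clin_sum_fun: "clin (\<lambda>w. \<Sum>a\<in>A. P a w) x = (\<Sum>a\<in>A. clin (P a) x)"
  by (induction A rule: infinite_finite_induct) (auto simp: clin_add_fun)

lemma clin_cong:
  "x = y \<Longrightarrow> (\<And>w. w \<in> Poly_Mapping.keys y \<Longrightarrow> P w = Q w) \<Longrightarrow> clin P x = clin Q y"
  by (simp add: lin_def)

lemma clin_clin: "clin P (clin Q x) = clin (\<lambda>w. clin P (Q w)) x"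
  by (subst (2 3) lin_def) (simp add: clin_sum clin_csc)

lemma clin_word [simp]: "clin (\<lambda>w. word w) x = x"
  by (rule poly_mapping_eqI)
    (simp add: lin_def lookup_sum lookup_single when_def sum.delta in_keys_iff)

lemma poly_sum: "x = (\<Sum>w\<in>Poly_Mapping.keys x. Poly_Mapping.single w (Poly_Mapping.lookup x w))"
  for x :: "'w \<Rightarrow>\<^sub>0 'k::field"
  using clin_word[of x, symmetric] by (simp add: lin_def)

lemma mult_clin_left: "clin P x * y = clin (\<lambda>w. P w * y) x"
  by (simp add: lin_def sum_distrib_right csc_mult_left)

lemma csc_mult_right: "x * csc c y = csc c (x * y)" for x :: "'w::monoid_add \<Rightarrow>\<^sub>0 'k::field"
proof -
  have *: "word w * csc c y = csc c (word w * y)" for w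
    by (simp add: csc_conv_mult mult.assoc[symmetric] mult_single)
  have "x * csc c y = clin word x * csc c y"
    by simp
  also have "\<dots> = csc c (clin word x * y)"
    by (simp only: mult_clin_left * clin_csc_fun)
  finally show ?thesis by simp
qed

lemma mult_clin_right: "x * clin P y = clin (\<lambda>w. x * P w) y"
  for x :: "'w::monoid_add \<Rightarrow>\<^sub>0 'k::field"
  by (simp add: lin_def sum_distrib_left csc_mult_right)

lemma clin_mult: "clin P x * clin Q y = clin (\<lambda>u. clin (\<lambda>v. P u * Q v) y) x"
  by (simp add: mult_clin_left) (simp add: mult_clin_right)

text \<open>Turns the product of the monoid algebra into a double linear extension, so that
  identities of bilinear maps only have to be checked on words.\<close>

lemma mult_conv_clin: "x * y = clin (\<lambda>u. clin (\<lambda>v. word (u + v)) y) x"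
  for x :: "'w::monoid_add \<Rightarrow>\<^sub>0 'k::field"
  using clin_mult[of word x word y] by (simp add: mult_single)

lemma clin_swap: "clin (\<lambda>u. clin (\<lambda>v. P u v) y) x = clin (\<lambda>v. clin (\<lambda>u. P u v) x) y"
  by (simp add: lin_def csc_sum csc_csc sum.swap[of _ "Poly_Mapping.keys y"] mult.commute)

lemma keys_csc: "Poly_Mapping.keys (csc c x) \<subseteq> Poly_Mapping.keys x"
  by (auto simp: in_keys_iff lookup_csc)

lemma keys_clin: "Poly_Mapping.keys (clin P x) \<subseteq> (\<Union>w\<in>Poly_Mapping.keys x. Poly_Mapping.keys (P w))"
proof -
  have "Poly_Mapping.keys (sum f A) \<subseteq> (\<Union>a\<in>A. Poly_Mapping.keys (f a))"
    for f :: "'d \<Rightarrow> ('e \<Rightarrow>\<^sub>0 'f::field)" and A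
    by (induction A rule: infinite_finite_induct) (use keys_add in fastforce)+
  then show ?thesis
    unfolding lin_def using keys_csc by fastforce
qed

lemma keys_sum_subset: "Poly_Mapping.keys (sum f A) \<subseteq> (\<Union>a\<in>A. Poly_Mapping.keys (f a))"
  for f :: "'b \<Rightarrow> ('a \<Rightarrow>\<^sub>0 'c::comm_monoid_add)"
  by (induction A rule: infinite_finite_induct) (use keys_add in fastforce)+


section \<open>The convolution ring of word operators\<close>

instantiation list :: (type) monoid_add
begin
definition zero_list_def: "0 = []"
definition plus_list_def: "xs + ys = xs @ ys"
instance by standard (auto simp: zero_list_def plus_list_def)
end

lemma word_Nil [simp]: "Poly_Mapping.single [] 1 = 1"
  by (metis single_one zero_list_def)

lemma word_Nil_Nil [simp]: "Poly_Mapping.single ([], []) 1 = 1"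
  by (metis single_one zero_list_def zero_prod_def)

lemma word_append: "word (u @ v) = word u * word v"
  by (simp add: mult_single plus_list_def)

lemma word_Cons: "word (a # v) = word [a] * word v"
  using word_append[of "[a]" v] by simp

text \<open>Wrapping these maps in a type of their own makes ring arithmetic available: a sum over
  the cuts of a word becomes a product under convolution.\<close>

typedef (overloaded) ('a, 'w, 'k) wop = "UNIV :: ('a list \<Rightarrow> 'w \<Rightarrow>\<^sub>0 'k::field) set"
  morphisms ap Op by simp

lemma ap_Op [simp]: "ap (Op f) w = f w"
  by (simp add: Op_inverse)

lemma wop_eqI: "(\<And>w. ap X w = ap Y w) \<Longrightarrow> X = Y"
  by (metis ap_inject ext)

lemma wop_eq_iff: "X = Y \<longleftrightarrow> (\<forall>w. ap X w = ap Y w)"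
  by (auto intro: wop_eqI)

text \<open>Associativity of convolution: cutting the prefix again or cutting the suffix again
  enumerates the same triples of prefix, middle and suffix.\<close>

lemma triple_split_sum:
  fixes f :: "'a list \<Rightarrow> 'a list \<Rightarrow> 'a list \<Rightarrow> 'b::comm_monoid_add"
  shows "(\<Sum>i\<le>length w. \<Sum>j\<le>i. f (take j w) (drop j (take i w)) (drop i w)) =
    (\<Sum>i\<le>length w. \<Sum>j\<le>length w - i. f (take i w) (take j (drop i w)) (drop (i + j) w))"
proof -
  have "(\<Sum>i\<le>length w. \<Sum>j\<le>i. f (take j w) (drop j (take i w)) (drop i w)) =
    (\<Sum>(i, j)\<in>(SIGMA i:{..length w}. {..i}). f (take j w) (drop j (take i w)) (drop i w))"
    by (simp add: sum.Sigma)
  also have "\<dots> = (\<Sum>(i, j)\<in>(SIGMA i:{..length w}. {..length w - i}).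
      f (take i w) (take j (drop i w)) (drop (i + j) w))"
    by (rule sum.reindex_bij_witness[where i = "\<lambda>(i, j). (i + j, i)" and j = "\<lambda>(i, j). (j, i - j)"])
      (auto simp: drop_take)
  finally show ?thesis by (simp add: sum.Sigma)
qed

instantiation wop :: (type, monoid_add, field) ring_1
begin

definition "0 = Op (\<lambda>_. 0)"
definition "1 = Op (\<lambda>w. if w = [] then 1 else 0)"
definition "X + Y = Op (\<lambda>w. ap X w + ap Y w)"
definition "- X = Op (\<lambda>w. - ap X w)"
definition "X - Y = Op (\<lambda>w. ap X w - ap Y w)"
definition "X * Y = Op (\<lambda>w. \<Sum>i\<le>length w. ap X (take i w) * ap Y (drop i w))"

lemmas ap_defs = zero_wop_def one_wop_def plus_wop_def uminus_wop_def minus_wop_def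

lemma ap_simps [simp]:
  "ap 0 w = 0" "ap (X + Y) w = ap X w + ap Y w" "ap (- X) w = - ap X w"
  "ap (X - Y) w = ap X w - ap Y w" "ap 1 [] = 1" "ap 1 (a # v) = 0"
  by (auto simp: ap_defs)

lemma ap_fun: "ap 0 = (\<lambda>w. 0)" "ap (X + Y) = (\<lambda>w. ap X w + ap Y w)" "ap (- X) = (\<lambda>w. - ap X w)"
  "ap (X - Y) = (\<lambda>w. ap X w - ap Y w)"
  by (auto simp: fun_eq_iff)

lemma ap_one: "ap 1 w = (if w = [] then 1 else 0)"
  by (simp add: one_wop_def)

lemma ap_times: "ap (X * Y) w = (\<Sum>i\<le>length w. ap X (take i w) * ap Y (drop i w))"
  by (simp add: times_wop_def)

instance
proof
  fix X Y Z :: "('a, 'b, 'c) wop"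
  show "X * Y * Z = X * (Y * Z)"
  proof (rule wop_eqI)
    fix w
    have "ap (X * Y * Z) w = (\<Sum>i\<le>length w. \<Sum>j\<le>i.
        ap X (take j w) * ap Y (drop j (take i w)) * ap Z (drop i w))"
      by (auto simp: ap_times sum_distrib_right min_def intro!: sum.cong)
    also have "\<dots> = (\<Sum>i\<le>length w. \<Sum>j\<le>length w - i.
        ap X (take i w) * ap Y (take j (drop i w)) * ap Z (drop (i + j) w))"
      by (rule triple_split_sum)
    also have "\<dots> = ap (X * (Y * Z)) w"
      by (auto simp: ap_times sum_distrib_left mult.assoc add.commute intro!: sum.cong)
    finally show "ap (X * Y * Z) w = ap (X * (Y * Z)) w" .
  qed
  show "1 * X = X"
  proof (rule wop_eqI)
    fix w
    have "ap (1 * X) w = (\<Sum>i\<le>length w. if i = 0 then ap X w else 0)"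
      unfolding ap_times by (rule sum.cong) (auto simp: ap_one)
    then show "ap (1 * X) w = ap X w" by (simp add: sum.delta)
  qed
  show "X * 1 = X"
  proof (rule wop_eqI)
    fix w
    have "ap (X * 1) w = (\<Sum>i\<le>length w. if i = length w then ap X w else 0)"
      unfolding ap_times by (rule sum.cong) (auto simp: ap_one)
    then show "ap (X * 1) w = ap X w" by (simp add: sum.delta)
  qed
  show "(0::('a, 'b, 'c) wop) \<noteq> 1"
    by (simp add: wop_eq_iff) (metis ap_simps(5) zero_neq_one)
qed (auto simp: wop_eq_iff ap_times algebra_simps sum.distrib)

end

lemma ap_sum: "ap (sum f A) w = (\<Sum>a\<in>A. ap (f a) w)"
  by (induction A rule: infinite_finite_induct) auto

lemma ap_times_Nil [simp]: "ap (X * Y) [] = ap X [] * ap Y []"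
  by (simp add: ap_times)

definition post :: "('w \<Rightarrow> 'v \<Rightarrow>\<^sub>0 'k) \<Rightarrow> ('a, 'w, 'k::field) wop \<Rightarrow> ('a, 'v, 'k) wop"
  where "post \<beta> X = Op (\<lambda>w. clin \<beta> (ap X w))"

text \<open>Composition of linear maps, as opposed to the ring product, which is
  convolution.\<close>

definition comp :: "('b, 'w, 'k) wop \<Rightarrow> ('a, 'b list, 'k::field) wop \<Rightarrow> ('a, 'w, 'k) wop"  (infixr "\<odot>" 75)
  where "X \<odot> Y = post (ap X) Y"

definition idw :: "('a, 'a list, 'k::field) wop"
  where "idw = Op word"

lemma ap_post [simp]: "ap (post \<beta> X) w = clin \<beta> (ap X w)"
  by (simp add: post_def)

lemma ap_post_fun: "ap (post \<beta> X) = (\<lambda>w. clin \<beta> (ap X w))"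
  by (simp add: fun_eq_iff)

lemma ap_comp [simp]: "ap (X \<odot> Y) w = clin (ap X) (ap Y w)"
  by (simp add: comp_def)

lemma ap_idw [simp]: "ap idw w = word w"
  by (simp add: idw_def)

lemma ap_comp_fun: "ap (X \<odot> Y) = (\<lambda>w. clin (ap X) (ap Y w))"
  and ap_idw_fun: "ap idw = word"
  by (simp_all add: fun_eq_iff)

lemma post_linear [simp]:
  "post \<beta> 0 = 0" "post \<beta> (- X) = - post \<beta> X"
  "post \<beta> (X + Y) = post \<beta> X + post \<beta> Y" "post \<beta> (X - Y) = post \<beta> X - post \<beta> Y"
  by (auto simp: wop_eq_iff clin_add clin_diff clin_minus)

lemma comp_linear [simp]:
  "X \<odot> 0 = 0" "X \<odot> (- Y) = - (X \<odot> Y)"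
  "X \<odot> (Y + Y') = X \<odot> Y + X \<odot> Y'" "X \<odot> (Y - Y') = X \<odot> Y - X \<odot> Y'"
  by (auto simp: comp_def)

lemma comp_linear_left [simp]:
  "0 \<odot> X = 0" "(- Y) \<odot> X = - (Y \<odot> X)"
  "(Y + Y') \<odot> X = Y \<odot> X + Y' \<odot> X" "(Y - Y') \<odot> X = Y \<odot> X - Y' \<odot> X"
  by (auto simp: wop_eq_iff ap_fun clin_add_fun clin_diff_fun clin_minus_fun)

lemma comp_idw [simp]: "X \<odot> idw = X" "idw \<odot> Y = Y"
  by (auto simp: wop_eq_iff ap_idw_fun)

lemma comp_assoc: "(X \<odot> Y) \<odot> Z = X \<odot> (Y \<odot> Z)"
  by (auto simp: wop_eq_iff clin_clin ap_comp_fun ap_post_fun)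

lemma post_comp: "post \<beta> X \<odot> Y = post \<beta> (X \<odot> Y)"
  by (auto simp: wop_eq_iff clin_clin ap_comp_fun ap_post_fun)

definition bs :: "bit \<Rightarrow> ('a, 'w::monoid_add, 'k::field) wop" where "bs p = bsign p"

lemma bsign_cases: "(p = 0 \<Longrightarrow> P) \<Longrightarrow> (p = 1 \<Longrightarrow> P) \<Longrightarrow> P" for p :: bit
  by (cases p) auto

lemma bsign_0 [simp]: "bsign 0 = 1" and bsign_1 [simp]: "bsign 1 = - 1"
  by (auto simp: bsign_def)

lemma bsign_add: "bsign (p + q) = bsign p * (bsign q :: 'k::ring_1)"
  by (cases p; cases q) auto

lemma bsign_sq [simp]: "bsign p * bsign p = (1 :: 'k::ring_1)"
  by (cases p) auto

lemma bit_add_self [simp]: "p + p = (0::bit)" "p + (p + q) = q"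
  by (cases p; cases q; simp)+


section \<open>Deconcatenation\<close>

definition inl :: "'w \<Rightarrow> ('w::monoid_add \<times> 'v::monoid_add \<Rightarrow>\<^sub>0 'k::field)" where "inl u = word (u, 0)"
definition inr :: "'v \<Rightarrow> ('w::monoid_add \<times> 'v::monoid_add \<Rightarrow>\<^sub>0 'k::field)" where "inr v = word (0, v)"

text \<open>The monoid algebra of the product monoid serves as tensor square of the algebra of
  words; \<open>inl\<close> and \<open>inr\<close> include the two factors.\<close>

definition dec :: "'a list \<Rightarrow> ('a list \<times> 'a list \<Rightarrow>\<^sub>0 'k::field)"
  where "dec w = (\<Sum>i\<le>length w. word (take i w, drop i w))"

definition box :: "('a, 'w, 'k) wop \<Rightarrow> ('a, 'w, 'k::field) wop \<Rightarrow> 'a list \<times> 'a list \<Rightarrow> ('w::monoid_add \<Rightarrow>\<^sub>0 'k)"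
  where "box X Y = (\<lambda>(u, v). ap X u * ap Y v)"

abbreviation lft where "lft \<equiv> post inl"
abbreviation rgt where "rgt \<equiv> post inr"
abbreviation Dec where "Dec \<equiv> post dec"

lemma post_times:
  assumes "\<And>u v. \<beta> (u + v) = \<beta> u * \<beta> v"
  shows "post \<beta> (X * Y) = post \<beta> X * post \<beta> Y"
proof -
  have "clin \<beta> (x * y) = clin \<beta> x * clin \<beta> y" for x y
    by (subst mult_conv_clin) (simp add: clin_clin assms clin_mult)
  then show ?thesis by (auto simp: wop_eq_iff ap_times clin_sum)
qed

lemma post_one:
  assumes "\<beta> 0 = 1"
  shows "post \<beta> 1 = 1"
  using assms by (auto simp: wop_eq_iff ap_one simp flip: single_one)

lemma lft_times [simp]: "lft (X * Y) = lft X * lft Y" and rgt_times [simp]: "rgt (X * Y) = rgt X * rgt Y"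
  by (rule post_times; simp add: inl_def inr_def mult_single)+

lemma lft_one [simp]: "lft 1 = 1" and rgt_one [simp]: "rgt 1 = 1"
  by (rule post_one; simp add: inl_def inr_def zero_prod_def[symmetric])+

lemma Dec_one [simp]: "Dec 1 = 1"
  by (rule post_one) (simp add: dec_def zero_list_def)

text \<open>A cut of \<open>u @ v\<close> falls into \<open>u\<close> or into \<open>v\<close>; the
  cut at the seam is counted on both sides, hence the subtracted term.\<close>

lemma dec_append: "dec (u @ v) = dec u * inr v + inl u * dec v - inl u * (inr v :: _ \<Rightarrow>\<^sub>0 'k::field)"
proof -
  have atMost_insert: "{..length v} = insert 0 {0<..length v}"
    by auto
  let ?f = "\<lambda>i. word (take i (u @ v), drop i (u @ v)) :: _ \<Rightarrow>\<^sub>0 'k"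
  have *: "{..length u + length v} = {..length u} \<union> ((+) (length u)) ` {0<..length v}"
    unfolding image_add_greaterThanAtMost by auto
  have "dec (u @ v) = sum ?f {..length u} + sum ?f (((+) (length u)) ` {0<..length v})"
    unfolding dec_def length_append * by (rule sum.union_disjoint) auto
  also have "sum ?f {..length u} = dec u * inr v"
    by (simp add: dec_def sum_distrib_right inr_def mult_single plus_list_def zero_list_def)
  also have "sum ?f (((+) (length u)) ` {0<..length v}) = (\<Sum>i\<in>{0<..length v}. inl u * word (take i v, drop i v))"
    by (subst sum.reindex) (auto simp: inl_def mult_single plus_list_def zero_list_def)
  also have "\<dots> = (\<Sum>i\<in>{..length v}. inl u * word (take i v, drop i v)) - inl u * word (take 0 v, drop 0 v)"
    by (simp add: atMost_insert)
  also have "\<dots> = inl u * dec v - inl u * inr v"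
    by (simp add: dec_def sum_distrib_left inr_def zero_list_def)
  finally show ?thesis by simp
qed

lemma Dec_times: "Dec (X * Y) = Dec X * rgt Y + lft X * Dec Y - lft X * rgt Y"
proof -
  have "clin dec (x * y) = clin dec x * clin inr y + clin inl x * clin dec y - clin inl x * clin inr y"
    for x y :: "'b list \<Rightarrow>\<^sub>0 'c"
    by (subst mult_conv_clin)
      (simp add: clin_clin plus_list_def dec_append clin_add_fun clin_diff_fun clin_mult)
  then show ?thesis
    by (auto simp: wop_eq_iff ap_times clin_sum sum.distrib sum_subtractf)
qed

definition letter_valued :: "('a, 'b list, 'k::field) wop \<Rightarrow> bool"
  where "letter_valued g \<longleftrightarrow> (\<forall>w. \<forall>u\<in>Poly_Mapping.keys (ap g w). length u = 1)"

lemma letter_valuedD: "letter_valued g \<Longrightarrow> u \<in> Poly_Mapping.keys (ap g w) \<Longrightarrow> \<exists>a. u = [a]"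
  by (metis letter_valued_def length_0_conv length_Suc_conv One_nat_def)

text \<open>A single letter has only the two trivial cuts, so letters are primitive.\<close>

lemma Dec_letter: "letter_valued g \<Longrightarrow> Dec g = lft g + rgt g"
  by (rule wop_eqI, simp flip: clin_add_fun, rule clin_cong)
    (auto simp: dec_def inl_def inr_def zero_list_def dest!: letter_valuedD)

lemma post_box: "post (box X Y) (lft A * rgt B) = (X \<odot> A) * (Y \<odot> B)"
  for A B :: "('a, 'd list, 'c::field) wop" and X Y :: "('d, 'w::monoid_add, 'c) wop"
proof -
  have "clin (box X Y) (clin inl x * clin inr y) = clin (ap X) x * clin (ap Y) y"
    for x y :: "'d list \<Rightarrow>\<^sub>0 'c"
    by (simp add: clin_mult clin_clin inl_def inr_def mult_single box_def)
  then show ?thesis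
    by (auto simp: wop_eq_iff ap_times clin_sum)
qed

text \<open>Convolution is the coproduct, then \<open>X\<close> tensor \<open>Y\<close>, then
  multiplication. Precomposition of a product with \<open>Z\<close> is therefore governed by the
  coproduct of \<open>Z\<close> alone.\<close>

lemma times_comp: "(X * Y) \<odot> Z = post (box X Y) (Dec Z)"
proof -
  have "clin (box X Y) (dec w) = ap (X * Y) w" for w
    by (simp add: dec_def clin_sum box_def ap_times)
  then show ?thesis by (auto simp: wop_eq_iff clin_clin ap_comp_fun ap_post_fun)
qed

text \<open>The hypothesis says that \<open>F\<close> is a coalgebra map; such maps act
  multiplicatively on the convolution ring by precomposition.\<close>

lemma times_comp_grouplike:
  "Dec F = lft F * rgt F \<Longrightarrow> (X * Y) \<odot> F = (X \<odot> F) * (Y \<odot> F)"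
  by (simp add: times_comp post_box)

section \<open>Parity and rotations\<close>

declare add_bit_eq_xor [simp del] mult_bit_eq_and [simp del]

section \<open>Koszul signs and operators that are homogeneous in parity\<close>

class letter =
  fixes par :: "'a \<Rightarrow> bit"

definition epar :: "'a::letter list \<Rightarrow> bit"
  where "epar w = sum_list (map par w)"

lemma epar_simps [simp]: "epar [] = 0" "epar (a # w) = par a + epar w" "epar (u @ v) = epar u + epar v"
  by (auto simp: epar_def)

lemma epar_take_drop: "epar (take i w) + epar (drop i w) = epar w"
  by (metis append_take_drop_id epar_simps(3))

lemma epar_drop_take: "epar (drop i w) + epar (take i w) = epar w"
  by (metis epar_take_drop add.commute)

text \<open>The Koszul sign for moving something of parity \<open>p\<close> past the whole word. As
  a factor \<open>A \<odot> sg p\<close> in a product it records that the operator to its right has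
  jumped over the letters read by \<open>A\<close>.\<close>

definition sg :: "bit \<Rightarrow> ('a::letter, 'a list, 'k::field) wop"
  where "sg p = Op (\<lambda>w. Poly_Mapping.single w (bsign (p * epar w)))"

definition homog :: "bit \<Rightarrow> ('a::letter, 'b::letter list, 'k::field) wop \<Rightarrow> bool"
  where "homog p X \<longleftrightarrow> (\<forall>w. \<forall>u\<in>Poly_Mapping.keys (ap X w). epar u = epar w + p)"

lemma bs_mult: "ap (bsign p * X) w = csc (bsign p) (ap X w)"
  by (cases p) (auto simp: csc_neg)

lemma bs_comp [simp]: "(bsign p * X) \<odot> Y = bsign p * (X \<odot> Y)" "X \<odot> (bsign p * Z) = bsign p * (X \<odot> Z)"
  by (cases p; simp)+

lemma bs_commute: "X * (bsign p * Y) = bsign p * (X * Y)" for X :: "'a::ring_1"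
  by (cases p) auto

lemma ap_sg [simp]: "ap (sg p) w = Poly_Mapping.single w (bsign (p * epar w))"
  by (simp add: sg_def)

lemma ap_comp_sg: "ap (X \<odot> sg p) w = csc (bsign (p * epar w)) (ap X w)"
  by simp

lemma sg_0 [simp]: "sg 0 = idw"
  by (rule wop_eqI) simp

lemma sg_sg: "sg p \<odot> sg q = sg (p + q)"
  by (rule wop_eqI) (cases p; cases q; simp)

lemma times_sg: "(X * Y) \<odot> sg p = (X \<odot> sg p) * (Y \<odot> sg p)"
  by (rule wop_eqI)
    (simp add: ap_times csc_sum csc_mult_left csc_mult_right csc_csc bsign_add[symmetric]
      distrib_left[symmetric] epar_take_drop epar_drop_take del: ap_comp add: ap_comp_sg)

lemma one_sg [simp]: "1 \<odot> sg p = 1"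
  by (rule wop_eqI) (simp add: ap_one)

lemma sg_times: "sg p \<odot> (X * Y) = (sg p \<odot> X) * (sg p \<odot> Y)"
  unfolding comp_def
  by (rule post_times) (simp add: mult_single plus_list_def bsign_add distrib_left)

lemma sg_one [simp]: "sg p \<odot> 1 = 1"
  by (rule wop_eqI) (simp add: ap_one flip: word_Nil)

lemma homog_sg: "homog q X \<Longrightarrow> sg p \<odot> X = bsign (p * q) * (X \<odot> sg p)"
proof (rule wop_eqI)
  fix w assume "homog q X"
  then have "clin (ap (sg p)) (ap X w) = clin (\<lambda>u. csc (bsign (p * (epar w + q))) (word u)) (ap X w)"
    by (intro clin_cong) (auto simp: homog_def)
  then show "ap (sg p \<odot> X) w = ap (bsign (p * q) * (X \<odot> sg p)) w"
    by (simp only: ap_comp clin_csc_fun clin_word bs_mult ap_sg clin_single csc_csc)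
      (simp add: distrib_left bsign_add mult.commute)
qed

lemma homog_0 [simp]: "homog p 0"
  by (simp add: homog_def)

lemma homog_one [simp]: "homog 0 1"
  by (auto simp: homog_def ap_one zero_list_def split: if_splits)

lemma homog_add [intro]: "homog p X \<Longrightarrow> homog p Y \<Longrightarrow> homog p (X + Y)"
  unfolding homog_def using keys_add by fastforce

lemma homog_minus [intro]: "homog p X \<Longrightarrow> homog p (- X)"
  unfolding homog_def by (simp add: in_keys_iff)

lemma homog_diff [intro]: "homog p X \<Longrightarrow> homog p Y \<Longrightarrow> homog p (X - Y)"
  using homog_add[of p X "- Y"] homog_minus[of p Y] by simp

lemma keys_ap_times:
  "u \<in> Poly_Mapping.keys (ap (X * Y) w) \<Longrightarrow>
    \<exists>i a b. u = a + b \<and> a \<in> Poly_Mapping.keys (ap X (take i w)) \<and> b \<in> Poly_Mapping.keys (ap Y (drop i w))"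
  unfolding ap_times using keys_sum_subset keys_mult by fastforce

lemma homog_times [intro]: "homog p X \<Longrightarrow> homog q Y \<Longrightarrow> homog (p + q) (X * Y)"
  unfolding homog_def
proof safe
  fix w u assume XY: "\<forall>w. \<forall>u\<in>Poly_Mapping.keys (ap X w). epar u = epar w + p"
    "\<forall>w. \<forall>u\<in>Poly_Mapping.keys (ap Y w). epar u = epar w + q" and "u \<in> Poly_Mapping.keys (ap (X * Y) w)"
  then obtain i a b where *: "u = a + b" "a \<in> Poly_Mapping.keys (ap X (take i w))"
    "b \<in> Poly_Mapping.keys (ap Y (drop i w))"
    using keys_ap_times by blast
  then have "epar u = epar (take i w) + epar (drop i w) + (p + q)"
    using XY by (auto simp: plus_list_def ac_simps)
  then show "epar u = epar w + (p + q)" by (simp add: epar_take_drop)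
qed

lemma keys_ap_comp:
  "u \<in> Poly_Mapping.keys (ap (X \<odot> Y) w) \<Longrightarrow> \<exists>v\<in>Poly_Mapping.keys (ap Y w). u \<in> Poly_Mapping.keys (ap X v)"
  using keys_clin by fastforce

lemma homog_comp [intro]: "homog p X \<Longrightarrow> homog q Y \<Longrightarrow> homog (p + q) (X \<odot> Y)"
  unfolding homog_def using keys_ap_comp by (metis add.assoc add.commute)

lemma homog_sgn [simp]: "homog 0 (sg p)"
  by (auto simp: homog_def split: if_splits)

lemma homog_idw [simp]: "homog 0 idw"
  by (auto simp: homog_def)

section \<open>Cyclic rotations of words and the norm\<close>

definition mulrev :: "'a::letter list \<times> 'a list \<Rightarrow> ('a list \<Rightarrow>\<^sub>0 'k::field)"
  where "mulrev = (\<lambda>(u, v). Poly_Mapping.single (v @ u) (bsign (epar u * epar v)))"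

text \<open>Convolution in the opposite order, with the sign of exchanging the two pieces of the
  word: the effect of a rotation on a product.\<close>

definition opp :: "('a::letter, 'b list, 'k::field) wop \<Rightarrow> ('a, 'b list, 'k) wop \<Rightarrow> ('a, 'b list, 'k) wop"  (infixl "\<oslash>" 70)
  where "X \<oslash> Y = Op (\<lambda>z. \<Sum>i\<le>length z. csc (bsign (epar (take i z) * epar (drop i z)))
    (ap Y (drop i z) * ap X (take i z)))"

definition rotn :: "nat \<Rightarrow> 'a::letter list \<Rightarrow> ('a list \<Rightarrow>\<^sub>0 'k::field)"
  where "rotn i w = mulrev (take (length w - i) w, drop (length w - i) w)"

text \<open>The norm operator of cyclic theory. Chain operators will be written with
  \<open>NN\<close> applied first, which replaces the overbraces.\<close>

definition NN :: "('a::letter, 'a list, 'k::field) wop"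
  where "NN = Op (\<lambda>w. \<Sum>i<length w. rotn i w)"

definition tt :: "('a::letter, 'a list, 'k::field) wop"
  where "tt = Op (rotn 1)"

lemma rotn_append: "length v = i \<Longrightarrow> rotn i (u @ v) = Poly_Mapping.single (v @ u) (bsign (epar u * epar v))"
  by (simp add: rotn_def mulrev_def)

text \<open>The cases are whether the second rotation stays inside the piece not yet moved or wraps
  around. Either way the word falls into three blocks, and the signs agree for all parities of
  these.\<close>

lemma clin_rotn_rotn:
  fixes w :: "'a::letter list"
  assumes "i < length w" "j \<le> length w"
  shows "clin (rotn j) (rotn i w) = (rotn ((i + j) mod length w) w :: _ \<Rightarrow>\<^sub>0 'k::field)"
proof (cases "i + j \<le> length w")
  case True
  define n where "n = length w"
  define u where "u = take (n - i) w"
  define a where "a = take (n - (i + j)) u"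
  define b where "b = drop (n - (i + j)) u"
  define c where "c = drop (n - i) w"
  have w: "w = a @ b @ c" "length c = i" "length b = j"
  proof -
    have "w = u @ c" by (simp add: u_def c_def)
    also have "u = a @ b" by (simp add: a_def b_def)
    finally show "w = a @ b @ c" by simp
  qed (use True assms in \<open>auto simp: a_def b_def c_def u_def n_def\<close>)
  have "clin (rotn j) (rotn i w) = csc (bsign (epar (a @ b) * epar c)) (rotn j ((c @ a) @ b) :: _ \<Rightarrow>\<^sub>0 'k)"
    by (simp add: w rotn_append[of c i "a @ b", simplified append_assoc])
  also have "\<dots> = Poly_Mapping.single (b @ c @ a) (bsign (epar (a @ b) * epar c) * bsign (epar (c @ a) * epar b))"
    by (simp add: w rotn_append[of b j "c @ a", simplified append_assoc])
  also have "bsign (epar (a @ b) * epar c) * bsign (epar (c @ a) * epar b) = (bsign (epar a * epar (b @ c)) :: 'k)"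
    by (cases "epar a"; cases "epar b"; cases "epar c"; simp)
  also have "Poly_Mapping.single (b @ c @ a) \<dots> = rotn (i + j) w"
    by (simp add: w rotn_append[of "b @ c" "i + j" a, simplified append_assoc])
  also have "\<dots> = rotn ((i + j) mod length w) w"
  proof (cases "i + j = length w")
    case True
    then show ?thesis by (simp add: rotn_def mulrev_def)
  next
    case False
    then show ?thesis using \<open>i + j \<le> length w\<close> by simp
  qed
  finally show ?thesis .
next
  case False
  define n where "n = length w"
  define l where "l = i + j - n"
  define u where "u = drop (n - i) w"
  define a where "a = take (n - i) w"
  define b where "b = take (i - l) u"
  define c where "c = drop (i - l) u"
  have w: "w = a @ b @ c" "length c = l" "length a = n - i"
  proof -
    have "w = a @ u" by (simp add: u_def a_def)
    also have "u = b @ c" by (simp add: b_def c_def)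
    finally show "w = a @ b @ c" .
  qed (use False assms in \<open>auto simp: a_def b_def c_def u_def n_def l_def\<close>)
  have bc: "length (b @ c) = i" "length (c @ a) = j"
    using False assms by (auto simp: a_def b_def c_def u_def n_def l_def)
  have "clin (rotn j) (rotn i w) = csc (bsign (epar a * epar (b @ c))) (rotn j (b @ (c @ a)) :: _ \<Rightarrow>\<^sub>0 'k)"
    by (simp add: w rotn_append[OF bc(1), of a, simplified append_assoc])
  also have "\<dots> = Poly_Mapping.single (c @ a @ b) (bsign (epar a * epar (b @ c)) * bsign (epar b * epar (c @ a)))"
    by (simp add: w rotn_append[OF bc(2), of b, simplified append_assoc])
  also have "bsign (epar a * epar (b @ c)) * bsign (epar b * epar (c @ a)) = (bsign (epar (a @ b) * epar c) :: 'k)"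
    by (cases "epar a"; cases "epar b"; cases "epar c"; simp)
  also have "Poly_Mapping.single (c @ a @ b) \<dots> = rotn l w"
    by (simp add: w rotn_append[of c l "a @ b", simplified append_assoc])
  also have "\<dots> = rotn ((i + j) mod length w) w"
  proof -
    have "(i + j) mod n = l"
      using False assms by (simp add: le_mod_geq n_def l_def)
    then show ?thesis by (simp add: n_def)
  qed
  finally show ?thesis .
qed

text \<open>A further rotation permutes the summands of the norm cyclically.\<close>

lemma clin_rotn_NN: "j \<le> length w \<Longrightarrow> clin (rotn j) (ap NN w) = ap NN w"
proof (cases "w = []")
  case False
  assume j: "j \<le> length w"
  let ?n = "length w"
  have "clin (rotn j) (ap NN w) = (\<Sum>i<?n. rotn ((i + j) mod ?n) w)"
    by (simp add: NN_def clin_sum clin_rotn_rotn j)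
  also have "\<dots> = (\<Sum>i<?n. rotn i w)"
  proof (rule sum.reindex_bij_witness[where i = "\<lambda>i. (i + (?n - j)) mod ?n" and j = "\<lambda>i. (i + j) mod ?n"])
    fix i assume i: "i \<in> {..<?n}"
    have "i + j + (?n - j) = i + ?n" "i + (?n - j) + j = i + ?n" using j by auto
    then show "((i + j) mod ?n + (?n - j)) mod ?n = i" "((i + (?n - j)) mod ?n + j) mod ?n = i"
      using i by (simp_all only: mod_add_left_eq mod_add_self2) auto
  qed (use False in auto)
  finally show ?thesis by (simp add: NN_def)
qed (simp add: NN_def)

lemma keys_NN: "z \<in> Poly_Mapping.keys (ap NN w) \<Longrightarrow> length z = length w"
  unfolding NN_def using keys_sum_subset
  by (fastforce simp: rotn_def mulrev_def split: if_splits)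

text \<open>Exchanging the two factors of a product is a rotation of the input, and the norm absorbs
  rotations. All cyclic cancellations below rest on this.\<close>

lemma opp_NN: "(X \<oslash> Y) \<odot> NN = (Y * X) \<odot> NN"
proof (rule wop_eqI)
  fix w :: "'a list"
  let ?n = "length w"
  let ?T = "\<lambda>j z. ap Y (take j z) * ap X (drop j z)"
  \<comment> \<open>With \<open>j\<close> the length of the piece moved to the front, each summand
    is the product in the order \<open>Y\<close>, \<open>X\<close>, cut after \<open>j\<close>
    letters of the \<open>j\<close>-th rotation.\<close>
  have 1: "ap (X \<oslash> Y) z = (\<Sum>j\<le>length z. clin (?T j) (rotn j z))" for z
    unfolding opp_def ap_Op
    by (rule sum.reindex_bij_witness[where i = "\<lambda>i. length z - i" and j = "\<lambda>i. length z - i"])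
      (auto simp: rotn_def mulrev_def)
  have "ap ((X \<oslash> Y) \<odot> NN) w = clin (\<lambda>z. \<Sum>j\<le>?n. clin (?T j) (rotn j z)) (ap NN w)"
    unfolding ap_comp by (rule clin_cong) (auto simp: 1 keys_NN)
  also have "\<dots> = (\<Sum>j\<le>?n. clin (?T j) (clin (rotn j) (ap NN w)))"
    by (simp add: clin_sum_fun clin_clin)
  also have "\<dots> = clin (\<lambda>z. \<Sum>j\<le>?n. ?T j z) (ap NN w)"
    by (simp add: clin_rotn_NN clin_sum_fun)
  also have "\<dots> = ap ((Y * X) \<odot> NN) w"
    unfolding ap_comp by (rule clin_cong) (auto simp: ap_times keys_NN)
  finally show "ap ((X \<oslash> Y) \<odot> NN) w = ap ((Y * X) \<odot> NN) w" .
qed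

lemma clin_mulrev: "clin mulrev (clin inl x * clin inr y) = clin (\<lambda>u. clin (\<lambda>v. mulrev (u, v)) y) x"
  by (simp add: clin_mult clin_clin inl_def inr_def mult_single)

text \<open>The sign of exchanging the outputs has exponent (|a| + p)(|b| + q). Its mixed terms
  become the twists by \<open>sg q\<close> and \<open>sg p\<close>, the term |a||b| belongs to
  \<oslash>, and p q remains outside.\<close>

lemma post_mulrev:
  assumes "homog p X" "homog q Y"
  shows "post mulrev (lft X * rgt Y) = bsign (p * q) * ((X \<odot> sg q) \<oslash> (Y \<odot> sg p))"
proof (rule wop_eqI)
  fix w
  have "clin mulrev (clin inl (ap X a) * clin inr (ap Y b)) =
    csc (bsign ((epar a + p) * (epar b + q))) (ap Y b * ap X a)" for a b
  proof -
    have "clin (\<lambda>u. clin (\<lambda>v. mulrev (u, v)) (ap Y b)) (ap X a) =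
      clin (\<lambda>u. clin (\<lambda>v. csc (bsign ((epar a + p) * (epar b + q))) (word (v @ u))) (ap Y b)) (ap X a)"
      using assms by (intro clin_cong refl) (auto simp: homog_def mulrev_def)
    also have "\<dots> = csc (bsign ((epar a + p) * (epar b + q)))
        (clin (\<lambda>u. clin (\<lambda>v. word (v @ u)) (ap Y b)) (ap X a))"
      by (simp add: clin_csc_fun flip: csc_single)
    also have "clin (\<lambda>u. clin (\<lambda>v. word (v @ u)) (ap Y b)) (ap X a) = ap Y b * ap X a"
      by (subst clin_swap) (simp add: mult_conv_clin plus_list_def)
    finally show ?thesis by (simp add: clin_mulrev)
  qed
  moreover have sgn: "bsign ((\<alpha> + p) * (\<beta> + q)) = bsign (p * q) * (bsign (\<alpha> * \<beta>) * (bsign (p * \<beta>) * bsign (q * \<alpha>) :: 'c))" for \<alpha> \<beta>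
    by (cases \<alpha>; cases \<beta>; cases p; cases q; simp)
  ultimately have "clin mulrev (clin inl (ap X a) * clin inr (ap Y b)) = csc (bsign (p * q) *
      (bsign (epar a * epar b) * (bsign (p * epar b) * bsign (q * epar a)))) (ap Y b * ap X a)" for a b
    by simp
  then show "ap (post mulrev (lft X * rgt Y)) w = ap (bsign (p * q) * ((X \<odot> sg q) \<oslash> (Y \<odot> sg p))) w"
    unfolding bs_mult
    by (simp add: ap_times clin_sum opp_def csc_sum csc_mult_left csc_mult_right csc_csc ac_simps)
qed

text \<open>The rotations of \<open>c # v\<close> correspond to the cuts of \<open>v\<close>, with
  the second piece moved in front of \<open>c\<close>. The letter makes the count exact: both
  trivial cuts of \<open>v\<close> give a rotation, and they differ unless \<open>v\<close> is
  empty, when there is one cut and one rotation. The norm thus becomes a coproduct.\<close>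

lemma NN_letter_times:
  fixes P :: "('a, 'b::letter list, 'k::field) wop"
  assumes "letter_valued P"
  shows "NN \<odot> (P * R) = post mulrev (lft P * Dec R)"
proof -
  have cons: "ap NN (c # v) = (clin mulrev (inl [c] * dec v) :: _ \<Rightarrow>\<^sub>0 'k)" for c :: 'b and v
  proof -
    have "ap NN (c # v) = (\<Sum>i\<le>length v. mulrev (c # take i v, drop i v) :: _ \<Rightarrow>\<^sub>0 'k)"
      unfolding NN_def ap_Op rotn_def
      by (rule sum.reindex_bij_witness[where i = "\<lambda>i. length v - i" and j = "\<lambda>i. length v - i"])
        (auto simp: Suc_diff_le)
    then show ?thesis
      by (simp add: dec_def sum_distrib_left clin_sum inl_def mult_single plus_list_def zero_list_def)
  qed
  have *: "ap NN (u @ v) = (clin mulrev (inl u * dec v) :: _ \<Rightarrow>\<^sub>0 'k)"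
    if "u \<in> Poly_Mapping.keys (ap P w)" for u v w
    using letter_valuedD[OF assms that] cons by auto
  have "clin (ap NN) (ap P w * y) = clin mulrev (clin inl (ap P w) * clin dec y)" for w y
  proof -
    have "clin (ap NN) (ap P w * y) = clin (\<lambda>u. clin (\<lambda>v. ap NN (u @ v)) y) (ap P w)"
      by (subst mult_conv_clin) (simp add: clin_clin plus_list_def)
    also have "\<dots> = clin (\<lambda>u. clin (\<lambda>v. clin mulrev (inl u * dec v)) y) (ap P w)"
      by (intro clin_cong refl) (use * in blast)
    also have "\<dots> = clin mulrev (clin inl (ap P w) * clin dec y)"
      by (simp add: clin_mult clin_clin)
    finally show ?thesis .
  qed
  then show ?thesis
    by (auto simp: wop_eq_iff ap_times clin_sum)
qed

lemma tt_times_letter: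
  assumes "letter_valued P"
  shows "tt \<odot> (R * P) = post mulrev (lft R * rgt P)"
proof -
  have "clin (ap tt) (x * ap P w) = clin mulrev (clin inl x * clin inr (ap P w))" for w x
  proof -
    have "clin (ap tt) (x * ap P w) = clin (\<lambda>u. clin (\<lambda>v. ap tt (u @ v)) (ap P w)) x"
      by (subst mult_conv_clin) (simp add: clin_clin plus_list_def)
    also have "\<dots> = clin (\<lambda>u. clin (\<lambda>v. mulrev (u, v)) (ap P w)) x"
      using letter_valuedD[OF assms] by (intro clin_cong refl) (fastforce simp: tt_def rotn_def)
    finally show ?thesis by (simp add: clin_mulrev)
  qed
  then show ?thesis
    by (auto simp: wop_eq_iff ap_times clin_sum)
qed


section \<open>Coalgebra homomorphisms\<close>

function geo_word :: "('a list \<Rightarrow> ('b list \<Rightarrow>\<^sub>0 'k::field)) \<Rightarrow> 'a list \<Rightarrow> ('b list \<Rightarrow>\<^sub>0 'k)"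
  where "geo_word f w = (if w = [] then 1 else \<Sum>i\<in>{1..length w}. f (take i w) * geo_word f (drop i w))"
  by auto
termination by (relation "measure (\<lambda>(f, w). length w)") auto

declare geo_word.simps [simp del]

text \<open>The series 1 + f + f * f + ..., that is 1/(1 - f); for letter-valued \<open>f\<close>
  this is the coalgebra map with components \<open>f\<close>. Only nonempty prefixes are fed to
  \<open>f\<close>, so the sum is finite on each word.\<close>

definition geo :: "('a, 'b list, 'k::field) wop \<Rightarrow> ('a, 'b list, 'k) wop"
  where "geo f = Op (geo_word (ap f))"

lemma geo_rec:
  fixes f :: "('a, 'b list, 'k::field) wop"
  assumes "ap f [] = 0"
  shows "geo f = 1 + f * geo f"
proof (rule wop_eqI)
  fix w :: "'a list"
  have "{..length w} = insert 0 {1..length w}" by auto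
  then show "ap (geo f) w = ap (1 + f * geo f) w"
    by (subst geo_def, subst ap_Op, subst geo_word.simps) (simp add: ap_times assms ap_one geo_def)
qed

text \<open>Since \<open>f\<close> consumes at least one letter, the value of \<open>X\<close> on a
  word is determined by its values on shorter words.\<close>

lemma fixpoint_zero:
  assumes "ap f [] = 0" "X = f * X"
  shows "X = 0"
proof (rule wop_eqI)
  fix w show "ap X w = ap 0 w"
  proof (induction w rule: length_induct)
    case (1 w)
    have "ap X w = ap (f * X) w"
      by (rule arg_cong2[OF assms(2) refl])
    also have "\<dots> = (\<Sum>i\<le>length w. ap f (take i w) * ap X (drop i w))"
      by (rule ap_times)
    also have "\<dots> = 0"
    proof (rule sum.neutral, safe)
      fix i show "ap f (take i w) * ap X (drop i w) = 0"
        using 1 assms(1) by (cases "take i w = []") (auto simp: ap_fun)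
    qed
    finally show ?case by simp
  qed
qed

lemma geo_unique:
  assumes "ap f [] = 0" "X = A + f * X" 
  shows "X = geo f * A"
proof -
  have "X - geo f * A = f * (X - geo f * A)"
    using assms geo_rec[OF assms(1)]
    by (metis (no_types, lifting) add_diff_cancel_left distrib_right mult.assoc mult_1 right_diff_distrib)
  from fixpoint_zero[OF assms(1) this] show ?thesis by simp
qed

lemma geo_rec_right:
  fixes f :: "('a, 'b list, 'k::field) wop"
  assumes "ap f [] = 0"
  shows "geo f = 1 + geo f * f"
proof -
  have "1 = (1 - f) + f * (1::('a, 'b list, 'k) wop)" by simp
  then have "1 = geo f * (1 - f)" by (rule geo_unique[OF assms])
  then show ?thesis by (metis diff_eq_eq mult.right_neutral right_diff_distrib)
qed

lemma geo_unique_right: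
  assumes "ap f [] = 0" "X = A + X * f" 
  shows "X = A * geo f"
proof -
  have "X * (1 - f) = A"
    using assms(2) by (metis add_diff_cancel_right' mult.right_neutral right_diff_distrib)
  moreover have "(1 - f) * geo f = 1"
    using geo_rec[OF assms(1)] by (metis add_diff_cancel_right' left_diff_distrib mult_1)
  ultimately show ?thesis by (metis mult.assoc mult.right_neutral)
qed

text \<open>The coproduct satisfies a recursion in its first tensor factor. Multiplied by
  \<open>lft (geo f)\<close> from the left, its recursive terms cancel against those of
  \<open>lft (geo f)\<close> itself, so the argument stays inside the ring.\<close>

lemma Dec_geo:
  assumes "ap f [] = 0" "letter_valued f"
  shows "Dec (geo f) = lft (geo f) * rgt (geo f)"
proof -
  let ?F = "geo f"
  have "lft ?F = lft (1 + ?F * f)" by (rule arg_cong[OF geo_rec_right[OF assms(1)]])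
  also have "\<dots> = 1 + lft ?F * lft f" by simp
  finally have l: "lft ?F = 1 + lft ?F * lft f" .
  have "rgt ?F = rgt (1 + f * ?F)" by (rule arg_cong[OF geo_rec[OF assms(1)]])
  also have "\<dots> = 1 + rgt f * rgt ?F" by simp
  finally have r: "rgt ?F = 1 + rgt f * rgt ?F" .
  have "Dec ?F = Dec (1 + f * ?F)" by (rule arg_cong[OF geo_rec[OF assms(1)]])
  also have "\<dots> = 1 + rgt f * rgt ?F + lft f * Dec ?F"
    by (simp add: Dec_times Dec_letter[OF assms(2)] algebra_simps)
  also have "\<dots> = rgt ?F + lft f * Dec ?F"
    by (rule arg_cong2[where f = "(+)", OF r[symmetric] refl])
  finally have "lft ?F * Dec ?F = lft ?F * (rgt ?F + lft f * Dec ?F)"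
    by (rule arg_cong)
  also have "\<dots> = lft ?F * rgt ?F + lft ?F * lft f * Dec ?F"
    by (simp add: algebra_simps)
  finally have "lft ?F * Dec ?F = \<dots>" .
  moreover have "lft ?F * Dec ?F = Dec ?F + lft ?F * lft f * Dec ?F"
    by (subst l) (simp add: algebra_simps)
  ultimately show ?thesis by simp
qed

lemma clin_one_list [simp]: "clin P (1 :: 'a list \<Rightarrow>\<^sub>0 'k::field) = P []"
  by (simp flip: word_Nil)

lemma sg_even: "homog 0 X \<Longrightarrow> sg p \<odot> X = X \<odot> sg p"
  by (simp add: homog_sg)

definition lin1 :: "('a, 'w::monoid_add, 'k::field) wop \<Rightarrow> bool"
  where "lin1 f \<longleftrightarrow> (\<forall>w. length w \<noteq> 1 \<longrightarrow> ap f w = 0)"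

lemma lin1_Nil: "lin1 f \<Longrightarrow> ap f [] = 0"
  by (simp add: lin1_def)

lemma ap_lin1_times: "lin1 f \<Longrightarrow> ap (f * Y) (a # w) = ap f [a] * ap Y w"
proof -
  assume "lin1 f"
  then have "ap (f * Y) (a # w) = (\<Sum>i\<le>length (a # w). if i = 1 then ap f [a] * ap Y w else 0)"
    unfolding ap_times by (intro sum.cong) (auto simp: lin1_def)
  also have "\<dots> = ap f [a] * ap Y w"
    by (subst sum.delta) auto
  finally show ?thesis .
qed

text \<open>A map that sees only one-letter words behaves as an infinitesimal character: in a
  concatenation equal to one letter, one piece is that letter and the other is empty. The ring unit
  \<open>1\<close> is the projection to the empty word and detects the latter.\<close>

lemma lin1_times:
  assumes "lin1 f"
  shows "f \<odot> (X * Y) = (f \<odot> X) * (1 \<odot> Y) + (1 \<odot> X) * (f \<odot> Y)"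
proof -
  have *: "ap f (u @ v) = ap f u * ap 1 v + ap 1 u * ap f v" for u v
    using assms by (cases u; cases v) (auto simp: lin1_def ap_one)
  have "clin (ap f) (x * y) = clin (ap f) x * clin (ap 1) y + clin (ap 1) x * clin (ap f) y" for x y
    by (subst mult_conv_clin) (simp add: clin_clin plus_list_def * clin_mult clin_add_fun)
  then show ?thesis by (auto simp: wop_eq_iff ap_times clin_sum sum.distrib)
qed

lemma one_comp_times: "1 \<odot> (X * Y) = (1 \<odot> X) * (1 \<odot> Y)"
  unfolding comp_def by (rule post_times) (auto simp: ap_one plus_list_def)

lemma one_comp_one [simp]: "1 \<odot> 1 = 1"
  by (rule wop_eqI) (simp add: ap_one flip: word_Nil)

lemma lin1_one: "lin1 f \<Longrightarrow> f \<odot> 1 = 0"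
  by (rule wop_eqI) (simp add: ap_one lin1_def flip: word_Nil)

lemma one_comp_letter: 
  assumes "letter_valued g"
  shows "1 \<odot> g = 0"
proof (rule wop_eqI)
  fix w
  have "clin (ap 1) (ap g w) = clin (\<lambda>_. 0) (ap g w)"
    by (intro clin_cong) (auto dest!: letter_valuedD[OF assms])
  then show "ap (1 \<odot> g) w = ap 0 w" by simp
qed

lemma one_comp_geo:
  assumes "letter_valued f" "ap f [] = 0"
  shows "1 \<odot> geo f = 1"
proof -
  have "1 \<odot> geo f = 1 \<odot> (1 + f * geo f)"
    by (rule arg_cong[OF geo_rec[OF assms(2)]])
  then show ?thesis
    by (simp only: comp_linear one_comp_times one_comp_letter[OF assms(1)]) simp
qed

lemma lin1_geo:
  assumes "lin1 h" "letter_valued f" "ap f [] = 0"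
  shows "h \<odot> geo f = h \<odot> f"
proof -
  have "h \<odot> geo f = h \<odot> (1 + f * geo f)"
    by (rule arg_cong[OF geo_rec[OF assms(3)]])
  then show ?thesis
    by (simp only: comp_linear lin1_times[OF assms(1)] one_comp_letter[OF assms(2)]
        one_comp_geo[OF assms(2,3)] lin1_one[OF assms(1)]) simp
qed

lemma ap_geo_Nil [simp]: "ap f [] = 0 \<Longrightarrow> ap (geo f) [] = 1"
  by (simp add: geo_def geo_word.simps)

lemma ap_geo_Cons: "lin1 f \<Longrightarrow> ap (geo f) (a # w) = ap f [a] * ap (geo f) w"
proof -
  assume f: "lin1 f"
  have "ap (geo f) (a # w) = ap (1 + f * geo f) (a # w)"
    by (rule arg_cong2[OF geo_rec[OF lin1_Nil[OF f]] refl])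
  then show ?thesis by (simp add: ap_lin1_times[OF f])
qed

lemma ap_geo_append: "lin1 f \<Longrightarrow> ap (geo f) (u @ v) = ap (geo f) u * ap (geo f) v"
  by (induction u) (auto simp: ap_geo_Cons lin1_Nil mult.assoc)

lemma geo_lin1_times: "lin1 f \<Longrightarrow> geo f \<odot> (X * Y) = (geo f \<odot> X) * (geo f \<odot> Y)"
  unfolding comp_def by (rule post_times) (simp add: plus_list_def ap_geo_append)

lemma geo_lin1_one: "lin1 f \<Longrightarrow> geo f \<odot> 1 = 1"
  by (rule wop_eqI) (simp add: ap_one lin1_Nil flip: word_Nil)

lemma geo_lin1_letter:
  assumes "lin1 f" "letter_valued g"
  shows "geo f \<odot> g = f \<odot> g"
proof (rule wop_eqI)
  fix w
  have "clin (ap (geo f)) (ap g w) = clin (ap f) (ap g w)"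
    using assms(1) by (intro clin_cong) (auto simp: ap_geo_Cons lin1_Nil dest!: letter_valuedD[OF assms(2)])
  then show "ap (geo f \<odot> g) w = ap (f \<odot> g) w" by simp
qed

text \<open>Both sides solve the same recursion: a composite of coalgebra maps is the coalgebra map
  of the composed components.\<close>

lemma geo_geo:
  assumes "ap f [] = 0" "letter_valued g" "ap g [] = 0"
  shows "geo f \<odot> geo g = geo (f \<odot> geo g)"
proof -
  have "geo f \<odot> geo g = (1 + f * geo f) \<odot> geo g"
    by (rule arg_cong2[OF geo_rec[OF assms(1)] refl])
  then have "geo f \<odot> geo g = 1 + (f \<odot> geo g) * (geo f \<odot> geo g)"
    using assms by (simp add: times_comp_grouplike Dec_geo one_comp_geo)
  moreover have "ap (f \<odot> geo g) [] = 0"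
    using assms by (simp flip: word_Nil)
  ultimately show ?thesis using geo_unique[of "f \<odot> geo g" "geo f \<odot> geo g" 1] by simp
qed

lemma homog_geo:
  assumes "ap f [] = 0" "homog 0 f"
  shows "homog 0 (geo f)"
  unfolding homog_def
proof (intro allI ballI)
  fix w u
  assume "u \<in> Poly_Mapping.keys (ap (geo f) w)"
  then show "epar u = epar w + 0"
  proof (induction w arbitrary: u rule: length_induct)
    case (1 w)
    show ?case
    proof (cases "w = []")
      case True
      with 1 assms(1) show ?thesis by (simp add: zero_list_def)
    next
      case False
      have "ap (geo f) w = ap (1 + f * geo f) w"
        by (rule arg_cong2[OF geo_rec[OF assms(1)] refl])
      then have "u \<in> Poly_Mapping.keys (ap (f * geo f) w)"
        using 1(2) False by (simp add: ap_one)
      then obtain i a b where *: "u = a + b" "a \<in> Poly_Mapping.keys (ap f (take i w))"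
        "b \<in> Poly_Mapping.keys (ap (geo f) (drop i w))"
        using keys_ap_times by blast
      then have "take i w \<noteq> []" using assms(1) by (metis empty_iff keys_zero)
      then have "length (drop i w) < length w" by (cases i; cases w) auto
      then have "epar b = epar (drop i w)" using 1(1) *(3) by simp
      moreover have "epar a = epar (take i w)" using assms(2) *(2) by (simp add: homog_def)
      ultimately show ?thesis using *(1) by (simp add: plus_list_def epar_take_drop)
    qed
  qed
qed

lemma sg_geo: "ap f [] = 0 \<Longrightarrow> homog 0 f \<Longrightarrow> sg p \<odot> geo f = geo f \<odot> sg p"
  by (simp add: sg_even homog_geo)

lemma geo_sg: "ap f [] = 0 \<Longrightarrow> geo (f \<odot> sg p) = geo f \<odot> sg p"
proof -
  assume f: "ap f [] = 0"
  have "geo f \<odot> sg p = (1 + f * geo f) \<odot> sg p"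
    by (rule arg_cong2[OF geo_rec[OF f] refl])
  then have "geo f \<odot> sg p = 1 + (f \<odot> sg p) * (geo f \<odot> sg p)"
    by (simp add: times_sg)
  moreover have "ap (f \<odot> sg p) [] = 0" using f by simp
  ultimately show ?thesis using geo_unique[of "f \<odot> sg p" "geo f \<odot> sg p" 1] by simp
qed

lemma Dec_comp_sg: "Dec X = lft A * rgt B \<Longrightarrow> Dec (X \<odot> sg p) = lft (A \<odot> sg p) * rgt (B \<odot> sg p)"
  by (metis post_comp times_sg)

lemma Dec_idw: "Dec idw = lft idw * rgt (idw :: ('a, 'a list, 'k::field) wop)"
  by (rule wop_eqI) (simp add: ap_times dec_def inl_def inr_def mult_single)

lemma Dec_sg: "Dec (sg p) = lft (sg p) * rgt (sg p)"
  using Dec_comp_sg[OF Dec_idw] by simp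

lemma letter_valued_comp: "letter_valued X \<Longrightarrow> letter_valued (X \<odot> Y)"
  unfolding letter_valued_def by (intro allI ballI, drule keys_ap_comp) blast

lemma letter_valued_add: "letter_valued X \<Longrightarrow> letter_valued Y \<Longrightarrow> letter_valued (X + Y)"
  unfolding letter_valued_def using keys_add by fastforce

lemma letter_valued_minus: "letter_valued X \<Longrightarrow> letter_valued (- X)"
  unfolding letter_valued_def by (simp add: in_keys_iff)

lemma letter_valued_diff: "letter_valued X \<Longrightarrow> letter_valued Y \<Longrightarrow> letter_valued (X - Y)"
  using letter_valued_add[of X "- Y"] letter_valued_minus[of Y] by simp

lemma letter_valued_bs: "letter_valued X \<Longrightarrow> letter_valued (bsign p * X)"
  by (cases p) (auto intro: letter_valued_minus)

lemma letter_valued_0: "letter_valued 0"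
  by (simp add: letter_valued_def)

lemma sg_comp_letter_valued: "letter_valued X \<Longrightarrow> letter_valued (sg p \<odot> X)"
  unfolding letter_valued_def
  using keys_ap_comp by (fastforce split: if_splits)

section \<open>Coderivations along coalgebra maps\<close>

abbreviation grpl :: "('a, 'b list, 'k::field) wop \<Rightarrow> bool"
  where "grpl A \<equiv> Dec A = lft A * rgt A"

text \<open>\<open>A * g * B\<close> is a coderivation along \<open>A\<close> and \<open>B\<close>:
  a cut of its output lies to the right or to the left of the letter made by \<open>g\<close>. With
  two such letters, in \<open>Dec5\<close>, a cut between them gives a third term.\<close>

lemma Dec3:
  assumes "grpl A" "letter_valued g" "grpl B"
  shows "Dec (A * g * B) = lft A * rgt (A * g * B) + lft (A * g * B) * rgt B"
  by (simp add: Dec_times assms Dec_letter algebra_simps)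

lemma Dec5:
  assumes "grpl A" "letter_valued g" "grpl B" "letter_valued h" "grpl C"
  shows "Dec (A * g * B * h * C) =
    lft A * rgt (A * g * B * h * C) + lft (A * g * B) * rgt (B * h * C) + lft (A * g * B * h * C) * rgt C"
  by (simp add: Dec_times assms Dec_letter algebra_simps)

lemma times_comp3:
  assumes "grpl A" "letter_valued g" "grpl B"
  shows "(X * Y) \<odot> (A * g * B) = (X \<odot> A) * (Y \<odot> (A * g * B)) + (X \<odot> (A * g * B)) * (Y \<odot> B)"
  by (simp only: times_comp Dec3[OF assms] post_linear post_box)

lemma times_comp5:
  assumes "grpl A" "letter_valued g" "grpl B" "letter_valued h" "grpl C"
  shows "(X * Y) \<odot> (A * g * B * h * C) =
    (X \<odot> A) * (Y \<odot> (A * g * B * h * C)) + (X \<odot> (A * g * B)) * (Y \<odot> (B * h * C)) +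
    (X \<odot> (A * g * B * h * C)) * (Y \<odot> C)"
  by (simp only: times_comp Dec5[OF assms] post_linear post_box)

lemma times_comp_letter:
  "letter_valued g \<Longrightarrow> (X * Y) \<odot> g = (X \<odot> g) * (Y \<odot> 1) + (X \<odot> 1) * (Y \<odot> g)"
proof -
  assume g: "letter_valued g"
  have "Dec g = lft g * rgt 1 + lft 1 * rgt g"
    using Dec_letter[OF g] by simp
  then show ?thesis by (simp only: times_comp post_linear post_box)
qed


section \<open>Marked words\<close>

text \<open>A Hochschild chain is a word with a distinguished entry a_0. The mark keeps this entry
  visible under rotation, and \<open>Unit\<close> stands for an entry a_0 equal to the formal
  unit.\<close>

datatype 'l lt = Plain 'l | Marked 'l | Unit

text \<open>The formal unit has degree 0, hence odd reduced degree; so \<open>Unit\<close> is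
  odd.\<close>

instantiation lt :: (letter) letter
begin
definition "par a = (case a of Plain x \<Rightarrow> par x | Marked x \<Rightarrow> par x | Unit \<Rightarrow> 1)"
instance ..
end

lemma par_lt [simp]: "par (Plain x) = par x" "par (Marked x) = par x" "par Unit = 1"
  by (auto simp: par_lt_def)

definition on_letter :: "('a \<Rightarrow> 'w \<Rightarrow>\<^sub>0 'k) \<Rightarrow> ('a, 'w, 'k::field) wop"
  where "on_letter \<phi> = Op (\<lambda>w. if length w = 1 then \<phi> (hd w) else 0)"

lemma lin1_on_letter: "lin1 (on_letter \<phi>)"
  by (simp add: lin1_def on_letter_def)

lemma ap_on_letter [simp]: "ap (on_letter \<phi>) [a] = \<phi> a" "ap (on_letter \<phi>) [] = 0"
  "ap (on_letter \<phi>) (a # b # w) = 0"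
  by (auto simp: on_letter_def)

lemma lin1_cases: "(w = [] \<Longrightarrow> P) \<Longrightarrow> (\<And>a. w = [a] \<Longrightarrow> P) \<Longrightarrow> (\<And>a b v. w = a # b # v \<Longrightarrow> P) \<Longrightarrow> P"
  by (metis list.exhaust)

lemma lin1_eqI:
  assumes "lin1 X" "lin1 Y" "\<And>a. ap X [a] = ap Y [a]"
  shows "X = Y"
  by (rule wop_eqI) (metis assms lin1_def length_0_conv length_Suc_conv One_nat_def)

lemma lin1_comp_on_letter: "lin1 (X \<odot> on_letter \<phi>)"
  by (simp add: lin1_def on_letter_def)

lemma letter_valued_on_letter:
  assumes "\<And>a u. u \<in> Poly_Mapping.keys (\<phi> a) \<Longrightarrow> length u = 1"
  shows "letter_valued (on_letter \<phi>)"
  unfolding letter_valued_def by (auto simp: on_letter_def assms split: if_splits)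

lemma homog_on_letter:
  assumes "\<And>a u. u \<in> Poly_Mapping.keys (\<phi> a) \<Longrightarrow> epar u = par a + p"
  shows "homog p (on_letter \<phi>)"
  unfolding homog_def
proof (intro allI ballI)
  fix w u assume "u \<in> Poly_Mapping.keys (ap (on_letter \<phi>) w)"
  then show "epar u = epar w + p"
    by (cases w rule: lin1_cases) (auto simp: assms)
qed

text \<open>The suffixes u and m stand for unmarked and marked input. \<open>su\<close> and
  \<open>sm\<close> erase the decoration, \<open>iu\<close> and \<open>Mt\<close> add it;
  \<open>Es\<close> erases a \<open>Unit\<close> and \<open>et\<close> creates one out of the empty
  word, both being odd.\<close>

definition su :: "('l lt, 'l list, 'k::field) wop"
  where "su = on_letter (\<lambda>a. case a of Plain x \<Rightarrow> word [x] | _ \<Rightarrow> 0)"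
definition sm :: "('l lt, 'l list, 'k::field) wop"
  where "sm = on_letter (\<lambda>a. case a of Marked x \<Rightarrow> word [x] | _ \<Rightarrow> 0)"
definition iu :: "('l, 'l lt list, 'k::field) wop"
  where "iu = on_letter (\<lambda>x. word [Plain x])"
definition Mt :: "('l, 'l lt list, 'k::field) wop"
  where "Mt = on_letter (\<lambda>x. word [Marked x])"
definition Es :: "('l lt, 'w::monoid_add, 'k::field) wop"
  where "Es = on_letter (\<lambda>a. case a of Unit \<Rightarrow> 1 | _ \<Rightarrow> 0)"
definition et :: "('l, 'm lt list, 'k::field) wop"
  where "et = Op (\<lambda>w. if w = [] then word [Unit] else 0)"

text \<open>\<open>stu\<close> strips words consisting of plain letters, \<open>stm\<close> those
  with exactly one marked letter among plain ones. Both vanish on all other words, in particular on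
  those containing \<open>Unit\<close>.\<close>

definition stu :: "('l lt, 'l list, 'k::field) wop" where "stu = geo su"
definition stm :: "('l lt, 'l list, 'k::field) wop" where "stm = stu * sm * stu"
definition ut :: "('l, 'l lt list, 'k::field) wop" where "ut = geo iu"

lemma lin1s [simp]: "lin1 su" "lin1 sm" "lin1 iu" "lin1 Mt" "lin1 Es"
  by (simp_all add: su_def sm_def iu_def Mt_def Es_def lin1_on_letter)

lemma ap_Nils [simp]: "ap su [] = 0" "ap sm [] = 0" "ap iu [] = 0" "ap Mt [] = 0" "ap Es [] = 0"
  by (simp_all add: lin1_Nil)

lemma lvs [simp]: "letter_valued su" "letter_valued sm" "letter_valued iu" "letter_valued Mt" "letter_valued et"
  by (auto simp: su_def sm_def iu_def Mt_def letter_valued_def on_letter_def et_def split: lt.splits if_splits)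

lemma homogs [simp]: "homog 0 su" "homog 0 sm" "homog 0 iu" "homog 0 Mt" "homog 1 Es" "homog 1 et"
  unfolding su_def sm_def iu_def Mt_def Es_def
  by (auto intro!: homog_on_letter split: lt.splits if_splits simp: zero_list_def)
    (auto simp: homog_def et_def split: if_splits)

lemma homog_st [simp]: "homog 0 stu" "homog 0 stm" "homog 0 ut"
  using homog_times[OF homog_times[OF homog_geo homogs(2)] homog_geo, of su su]
  by (simp_all add: stu_def stm_def ut_def homog_geo)

lemma grpl_st [simp]: "grpl stu" "grpl ut"
  by (simp_all add: stu_def ut_def Dec_geo)

lemma sg_st: "sg p \<odot> stu = stu \<odot> sg p" "sg p \<odot> stm = stm \<odot> sg p" "sg p \<odot> ut = ut \<odot> sg p"
  "sg p \<odot> su = su \<odot> sg p" "sg p \<odot> sm = sm \<odot> sg p" "sg p \<odot> iu = iu \<odot> sg p" "sg p \<odot> Mt = Mt \<odot> sg p"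
  "sg p \<odot> et = bsign p * et"
  by (simp_all add: sg_even) (auto simp: wop_eq_iff bs_mult et_def)

lemma Es_sg: "Es \<odot> sg p = bsign p * Es"
proof (rule wop_eqI)
  fix w :: "'a lt list" show "ap (Es \<odot> sg p) w = ap (bsign p * Es) w"
    by (cases w rule: lin1_cases) (auto simp: bs_mult Es_def split: lt.splits)
qed

lemma one_comp_st [simp]: "1 \<odot> stu = 1" "1 \<odot> ut = 1"
  by (simp_all add: stu_def ut_def one_comp_geo)

lemma stu_simps [simp]: "ap stu [] = 1" "ap stu (Plain x # w) = word [x] * ap stu w"
    "ap stu (Marked x # w) = 0" "ap stu (Unit # w) = 0"
  by (simp_all add: stu_def ap_geo_Cons) (simp_all add: su_def)

lemma stm_rec: "stm = sm * stu + su * stm"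
proof -
  have "stm = (1 + su * stu) * sm * stu"
    unfolding stm_def stu_def by (rule arg_cong[OF geo_rec, where f = "\<lambda>x. x * sm * geo su"]) simp
  then show ?thesis by (simp add: stm_def algebra_simps)
qed

lemma stm_simps [simp]:
  fixes w :: "'a lt list"
  shows "ap stm [] = (0 :: _ \<Rightarrow>\<^sub>0 'b::field)" "ap stm (Plain x # w) = word [x] * (ap stm w :: _ \<Rightarrow>\<^sub>0 'b)"
    "ap stm (Marked x # w) = word [x] * (ap stu w :: _ \<Rightarrow>\<^sub>0 'b)" "ap stm (Unit # w) = (0 :: _ \<Rightarrow>\<^sub>0 'b)"
proof -
  have "ap stm (a # w) = ap (sm * stu + su * stm) (a # w)" for a :: "'a lt"
    by (rule arg_cong2[OF stm_rec refl])
  then have *: "ap stm (a # w) = ap sm [a] * ap stu w + ap su [a] * (ap stm w :: _ \<Rightarrow>\<^sub>0 'b)" for a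
    by (simp add: ap_lin1_times)
  show "ap stm (Plain x # w) = word [x] * (ap stm w :: _ \<Rightarrow>\<^sub>0 'b)"
    "ap stm (Marked x # w) = word [x] * (ap stu w :: _ \<Rightarrow>\<^sub>0 'b)" "ap stm (Unit # w) = (0 :: _ \<Rightarrow>\<^sub>0 'b)"
    unfolding * by (simp_all add: su_def sm_def)
qed (simp add: stm_def)

lemma ut_word [simp]: "ap ut w = (word (map Plain w) :: _ \<Rightarrow>\<^sub>0 'k::field)"
proof (induction w)
  case (Cons a w)
  then have "ap ut (a # w) = ap iu [a] * (word (map Plain w) :: _ \<Rightarrow>\<^sub>0 'k)"
    by (simp add: ut_def ap_geo_Cons)
  then show ?case by (simp add: iu_def mult_single plus_list_def)
qed (simp add: ut_def)

lemma ap_stu_append: "ap stu (u @ v) = ap stu u * ap stu v"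
  by (simp add: stu_def ap_geo_append)

lemma ap_stm_append: "ap stm (u @ v) = ap stm u * ap stu v + ap stu u * ap stm v"
proof (induction u)
  case (Cons a u)
  then show ?case by (cases a) (simp_all add: ap_stu_append algebra_simps)
qed simp

lemma stu_times: "stu \<odot> (X * Y) = (stu \<odot> X) * (stu \<odot> Y)"
  and ut_times: "ut \<odot> (V * W) = (ut \<odot> V) * (ut \<odot> W)"
  by (simp_all add: stu_def ut_def geo_lin1_times)

text \<open>The single mark of a concatenation lies in one of the two pieces, so \<open>stm\<close>
  is a derivation over \<open>stu\<close>.\<close>

lemma stm_times: "stm \<odot> (X * Y) = (stm \<odot> X) * (stu \<odot> Y) + (stu \<odot> X) * (stm \<odot> Y)"
  for X Y :: "('a, 'l lt list, 'k::field) wop"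
proof -
  have "clin (ap stm) (x * y) = clin (ap stm) x * clin (ap stu) y + clin (ap stu) x * clin (ap stm) y"
    for x y :: "'l lt list \<Rightarrow>\<^sub>0 'k"
    by (subst mult_conv_clin) (simp add: clin_clin plus_list_def ap_stm_append clin_mult clin_add_fun)
  then show ?thesis by (auto simp: wop_eq_iff ap_times clin_sum sum.distrib)
qed

lemma times_stu: "(X * Y) \<odot> stu = (X \<odot> stu) * (Y \<odot> stu)"
  and times_ut: "(X' * Y') \<odot> ut = (X' \<odot> ut) * (Y' \<odot> ut)"
  by (simp_all add: times_comp_grouplike)

lemma times_stm: "(X * Y) \<odot> stm = (X \<odot> stm) * (Y \<odot> stu) + (X \<odot> stu) * (Y \<odot> stm)"
  unfolding stm_def by (subst times_comp3) (simp_all add: add.commute)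

lemma stu_ut [simp]: "stu \<odot> ut = idw"
proof -
  have "ap stu (map Plain w) = (word w :: _ \<Rightarrow>\<^sub>0 'b::field)" for w :: "'a list"
    by (induction w) (simp_all add: mult_single plus_list_def)
  then show "stu \<odot> ut = (idw :: ('a, _, 'b) wop)" by (intro wop_eqI) simp
qed

lemma stm_ut [simp]: "stm \<odot> ut = 0"
proof -
  have "ap stm (map Plain w) = (0 :: _ \<Rightarrow>\<^sub>0 'b::field)" for w :: "'a list"
    by (induction w) simp_all
  then show "stm \<odot> ut = (0 :: ('a, _, 'b) wop)" by (intro wop_eqI) simp
qed

lemma st_comps [simp]: "stu \<odot> Mt = 0" "stu \<odot> et = 0" "stm \<odot> et = 0"
  "stu \<odot> 1 = 1" "ut \<odot> 1 = 1" "stm \<odot> 1 = 0" "Es \<odot> Mt = 0" "Es \<odot> et = 1" "Es \<odot> 1 = 0"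
  "1 \<odot> Mt = 0" "1 \<odot> et = 0"
  by (auto simp: wop_eq_iff Mt_def et_def on_letter_def ap_one Es_def
     split: if_splits)

lemma one_comp_stm [simp]: "1 \<odot> stm = 0"
  by (simp add: stm_def one_comp_times one_comp_letter)

lemma ap_et [simp]: "ap et [] = word [Unit]" "ap et (a # w) = 0"
  by (simp_all add: et_def)

lemma Es_ut [simp]: "Es \<odot> ut = 0"
proof (rule wop_eqI)
  fix w :: "'a list" show "ap (Es \<odot> ut) w = ap 0 w"
    by (cases w rule: lin1_cases) (auto simp: Es_def)
qed

lemma et_stu [simp]: "et \<odot> stu = (et :: ('a lt, 'b lt list, 'k::field) wop)"
proof (rule wop_eqI)
  let ?et = "et :: ('a, 'b lt list, 'k) wop"
  fix w :: "'a lt list" show "ap (?et \<odot> stu) w = ap et w"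
  proof (cases w)
    case (Cons a v)
    have "clin (ap ?et) (word [x] * y) = 0" for x y
      by (simp add: mult_conv_clin clin_clin et_def plus_list_def)
    then show ?thesis using Cons by (cases a) simp_all
  qed simp
qed

lemma comp_tail: "X \<odot> Y = Z \<Longrightarrow> X \<odot> (Y \<odot> W) = Z \<odot> W"
  by (simp flip: comp_assoc)

lemma grpl_comp: "grpl A \<Longrightarrow> grpl B \<Longrightarrow> grpl (A \<odot> B)"
  by (simp add: post_comp[symmetric] times_comp_grouplike)

lemma grpl_sg [simp]: "grpl (sg p)"
  by (rule Dec_sg)

lemma grpl_idw [simp]: "grpl idw"
  by (rule Dec_idw)

lemma ap_Es: "ap Es w = (if w = [Unit] then 1 else 0)"
  by (cases w rule: lin1_cases) (auto simp: Es_def split: lt.splits)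

text \<open>The values of \<open>Es\<close> are multiples of the empty word, hence scalars, and can
  be pulled out of a composition.\<close>

lemma comp_Es: "X \<odot> (Es * Y) = Es * (X \<odot> Y)" "X \<odot> (Y * Es) = (X \<odot> Y) * Es"
  by (auto simp: wop_eq_iff ap_times clin_sum ap_Es intro!: sum.cong)

text \<open>The shape of the components of an A-infinity operation or functor: one output letter, no
  curvature term, parity \<open>p\<close>.\<close>

definition op1 :: "bit \<Rightarrow> ('l::letter, 'm::letter list, 'k::field) wop \<Rightarrow> bool"
  where "op1 p g \<longleftrightarrow> letter_valued g \<and> ap g [] = 0 \<and> homog p g"

lemma op1D [simp]: assumes "op1 p g" shows "letter_valued g" "ap g [] = 0" "homog p g"
  using assms by (auto simp: op1_def)

text \<open>Below, the suffix u refers to wholly plain words and m to words with one distinguished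
  letter, as in the expansion of an operation over dual numbers. The summand \<open>Es * et\<close>
  of \<open>im\<close> and \<open>fm\<close> lets \<open>Unit\<close> pass unchanged.\<close>

definition iot where "iot = Mt \<odot> stu"
definition im :: "('l::letter lt, 'l lt list, 'k::field) wop" where "im = Mt \<odot> stm + Es * et"
definition muu where "muu m0 = ut \<odot> m0 \<odot> stu"
text \<open>The last two summands multiply e^+ with a neighbour on the right and on the left. The
  product of a with e^+ on its right is (-1)^|a| a; in terms of the reduced degree this is the twist
  by \<open>sg 1\<close> with a minus sign.\<close>

definition mm where "mm m0 = Mt \<odot> m0 \<odot> stm + Es * iot - (iot \<odot> sg 1) * Es"
definition Iu :: "('l::letter lt, 'l lt list, 'k::field) wop" where "Iu = ut \<odot> stu"
definition Gu where "Gu = Iu \<odot> sg 1"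
definition Im where "Im = Iu * im * Iu"
definition Gm where "Gm = Gu * (im \<odot> sg 1) * Gu"
text \<open>The bar coderivation on undecorated words. \<open>muhu\<close> is its copy on plain
  letters and \<open>muhm\<close> the part on words with one distinguished letter: the operation
  either takes that letter, or acts to its right, or to its left.\<close>

definition muh0 where "muh0 m0 = sg 1 * m0 * idw"
definition muhu where "muhu m0 = Gu * muu m0 * Iu"
definition muhm where "muhm m0 = Gu * mm m0 * Iu + Gu * (im \<odot> sg 1) * Gu * muu m0 * Iu + Gu * muu m0 * Iu * im * Iu"
definition fm where "fm f0 = Mt \<odot> f0 \<odot> stm + Es * et"
definition Fu where "Fu f0 = ut \<odot> geo f0 \<odot> stu"
definition Fm where "Fm f0 = Fu f0 * fm f0 * Fu f0"

lemma stu_ut_tail [simp]: "stu \<odot> (ut \<odot> W) = W" "stm \<odot> (ut \<odot> W) = 0"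
  by (simp_all add: comp_tail[OF stu_ut] comp_tail[OF stm_ut])

lemma stu_Mt_tail [simp]: "stu \<odot> (Mt \<odot> W) = 0" "Es \<odot> (Mt \<odot> W) = 0" "Es \<odot> (ut \<odot> W) = 0" "1 \<odot> (Mt \<odot> W) = 0"
  "1 \<odot> (ut \<odot> W) = 1 \<odot> W" "1 \<odot> (stu \<odot> W') = 1 \<odot> W'" "1 \<odot> (stm \<odot> W') = 0"
  by (simp_all add: comp_tail[OF st_comps(1)] comp_tail[OF st_comps(7)] comp_tail[OF Es_ut] comp_tail[OF one_comp_st(2)]
     comp_tail[OF one_comp_st(1)] comp_tail[OF one_comp_stm] comp_tail[OF st_comps(10)])

lemma et_stu_tail [simp]: "et \<odot> (stu \<odot> W) = et \<odot> W"
  by (simp add: comp_tail[OF et_stu])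

lemma letter_proj: "letter_valued g \<Longrightarrow> stm \<odot> (Mt \<odot> g) = g"
proof (rule wop_eqI)
  fix w assume g: "letter_valued g"
  have "clin (\<lambda>w. clin (ap stm) (ap Mt w)) (ap g w) = clin word (ap g w)"
    by (intro clin_cong) (auto dest!: letter_valuedD[OF g] simp: Mt_def)
  then show "ap (stm \<odot> (Mt \<odot> g)) w = ap g w"
    by (simp add: clin_clin)
qed

lemma letter_valued_lin1_comp: "lin1 h \<Longrightarrow> letter_valued h \<Longrightarrow> letter_valued (h \<odot> X)"
  by (rule letter_valued_comp)

lemma lin1_geo_stu: "lin1 h \<Longrightarrow> h \<odot> stu = h \<odot> su"
  by (simp add: stu_def lin1_geo)

lemma lin1_stm: "lin1 h \<Longrightarrow> h \<odot> stm = h \<odot> sm"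
  by (simp add: stm_def lin1_times one_comp_times one_comp_letter lin1_geo_stu)

lemma letter_proj_st: "stm \<odot> (Mt \<odot> stu) = su" "stm \<odot> (Mt \<odot> stm) = sm"
  by (simp_all add: lin1_geo_stu lin1_stm letter_proj)

lemma letter_proj_st_tail: "stm \<odot> (Mt \<odot> (stu \<odot> W)) = su \<odot> W" "stm \<odot> (Mt \<odot> (stm \<odot> W)) = sm \<odot> W"
  using comp_tail[OF letter_proj_st(1)] comp_tail[OF letter_proj_st(2)] by (simp_all add: comp_assoc)

lemma sg_tail: "sg p \<odot> (stu \<odot> W) = stu \<odot> (sg p \<odot> W)" "sg p \<odot> (stm \<odot> W) = stm \<odot> (sg p \<odot> W)"
  "sg p \<odot> (ut \<odot> W') = ut \<odot> (sg p \<odot> W')" "sg p \<odot> (Mt \<odot> W') = Mt \<odot> (sg p \<odot> W')"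
  by (simp_all add: comp_tail[OF sg_st(1)] comp_tail[OF sg_st(2)] comp_tail[OF sg_st(3)] comp_tail[OF sg_st(7)] comp_assoc)

lemma sg_sg_simp [simp]: "sg p \<odot> sg q = sg (p + q)" "sg p \<odot> (sg q \<odot> W) = sg (p + q) \<odot> W"
  by (simp_all add: sg_sg comp_tail[OF sg_sg])

lemma Es_sg_tail: "Es \<odot> (sg p \<odot> W) = bsign p * (Es \<odot> W)"
  by (simp add: comp_tail[OF Es_sg])

lemma times_sg_tail: "(X * Y) \<odot> (sg p \<odot> W) = ((X \<odot> sg p) * (Y \<odot> sg p)) \<odot> W"
  by (simp add: comp_tail[OF times_sg])

lemma et_sg [simp]: "et \<odot> sg p = et"
  by (auto simp: wop_eq_iff et_def)

lemma sg_Es: "sg p \<odot> Es = Es"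
  by (auto simp: wop_eq_iff ap_Es)

lemma sg_op1: "op1 q g \<Longrightarrow> sg p \<odot> g = bsign (p * q) * (g \<odot> sg p)"
  by (simp add: homog_sg)

lemma sg_op1_tail: "op1 q g \<Longrightarrow> sg p \<odot> (g \<odot> W) = bsign (p * q) * (g \<odot> (sg p \<odot> W))"
  by (simp add: comp_tail[OF sg_op1] comp_assoc)

lemma sg_geo1: "op1 0 f \<Longrightarrow> sg p \<odot> geo f = geo f \<odot> sg p" "op1 0 f \<Longrightarrow> sg p \<odot> (geo f \<odot> W) = geo f \<odot> (sg p \<odot> W)"
  by (simp_all add: sg_geo comp_tail[OF sg_geo] comp_assoc)

text \<open>A normal form: compositions are distributed over products, \<open>sg\<close> travels to
  the right, and \<open>Es\<close> is pulled out.\<close>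

lemmas nf = comp_assoc stu_times stm_times ut_times times_stu times_sg sg_times sg_st sg_tail comp_Es Es_sg Es_sg_tail
  sg_op1 sg_op1_tail sg_geo1 one_comp_times sg_Es times_sg_tail

lemma grpl_Iu [simp]: "grpl Iu" "grpl Gu"
  unfolding Gu_def Iu_def by (simp_all add: grpl_comp)

lemma grpl_Fu [simp]: "op1 0 f \<Longrightarrow> grpl (Fu f)" "op1 0 f \<Longrightarrow> grpl (Fu f \<odot> sg p)"
  unfolding Fu_def by (simp_all add: grpl_comp Dec_geo)

lemma letter_valued_lt: "letter_valued g \<Longrightarrow> letter_valued (ut \<odot> (g \<odot> W))"
  by (simp add: ut_def geo_lin1_letter letter_valued_comp)

lemma letter_valued_Es: "letter_valued X \<Longrightarrow> letter_valued (Es * X)" "letter_valued X \<Longrightarrow> letter_valued (X * Es)"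
  unfolding letter_valued_def
  by (auto dest!: keys_ap_times simp: ap_Es plus_list_def split: if_splits simp flip: zero_list_def)

lemma letter_valued_ops [simp]: "op1 p g \<Longrightarrow> letter_valued (muu g)" "letter_valued (mm m)" "letter_valued im"
  "letter_valued (im \<odot> sg 1)" "letter_valued (fm f)" "letter_valued (fm f \<odot> sg p)" "letter_valued (mm m \<odot> W)"
  by (simp add: muu_def letter_valued_lt) (unfold mm_def im_def iot_def fm_def,
    auto intro!: letter_valued_add letter_valued_diff letter_valued_comp letter_valued_Es)

lemma times_muhu: "op1 1 m \<Longrightarrow>
  (X * Y) \<odot> muhu m = (X \<odot> Gu) * (Y \<odot> muhu m) + (X \<odot> muhu m) * (Y \<odot> Iu)"
  unfolding muhu_def by (subst times_comp3) simp_all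

lemma times_Im: "(X * Y) \<odot> Im = (X \<odot> Iu) * (Y \<odot> Im) + (X \<odot> Im) * (Y \<odot> Iu)"
  unfolding Im_def by (subst times_comp3) simp_all

lemma times_muhm: "op1 1 m \<Longrightarrow> (X * Y) \<odot> muhm m =
  (X \<odot> Gu) * (Y \<odot> muhm m) + (X \<odot> muhm m) * (Y \<odot> Iu) + (X \<odot> muhu m) * (Y \<odot> Im) + (X \<odot> Gm) * (Y \<odot> muhu m)"
  unfolding muhm_def comp_linear
  by (simp only: times_comp3[OF grpl_Iu(2) letter_valued_ops(2) grpl_Iu(1)]
      times_comp5[OF grpl_Iu(2) letter_valued_ops(4) grpl_Iu(2) letter_valued_ops(1) grpl_Iu(1)]
      times_comp5[OF grpl_Iu(2) letter_valued_ops(1) grpl_Iu(1) letter_valued_ops(3) grpl_Iu(1)])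
    (simp add: Im_def Gm_def muhu_def algebra_simps)

lemma times_muh0: "op1 1 m \<Longrightarrow> (X * Y) \<odot> muh0 m = (X \<odot> sg 1) * (Y \<odot> muh0 m) + (X \<odot> muh0 m) * Y"
  unfolding muh0_def by (subst times_comp3) simp_all

lemma times_Fm: "op1 0 f \<Longrightarrow> (X * Y) \<odot> Fm f = (X \<odot> Fu f) * (Y \<odot> Fm f) + (X \<odot> Fm f) * (Y \<odot> Fu f)"
  unfolding Fm_def by (subst times_comp3) simp_all

lemma st_ops [simp]: "stu \<odot> Iu = stu" "stu \<odot> Gu = stu \<odot> sg 1" "stm \<odot> Iu = 0" "stm \<odot> Gu = 0"
  "stu \<odot> muu g = g \<odot> stu" "stm \<odot> muu g = 0" "stu \<odot> mm m = 0" "stu \<odot> im = 0" "stm \<odot> im = sm"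
  "stu \<odot> fm f = 0" "stu \<odot> Fu f = geo f \<odot> stu" "stm \<odot> Fu f = 0"
  by (simp_all add: Iu_def Gu_def muu_def mm_def im_def fm_def Fu_def iot_def nf letter_proj_st)

lemma st_ops_tail [simp]: "stu \<odot> (Iu \<odot> W) = stu \<odot> W" "stm \<odot> (Iu \<odot> W) = 0" "stu \<odot> (im \<odot> W) = 0" "stm \<odot> (im \<odot> W) = sm \<odot> W"
  "stu \<odot> (mm m \<odot> W') = 0" "stu \<odot> (Gu \<odot> W) = stu \<odot> (sg 1 \<odot> W)" "stu \<odot> (muu g \<odot> W') = g \<odot> (stu \<odot> W')" "stm \<odot> (muu g \<odot> W') = 0"
  "stu \<odot> (Fu f \<odot> W') = geo f \<odot> (stu \<odot> W')" "stm \<odot> (Fu f \<odot> W') = 0" "stu \<odot> (fm f \<odot> W') = 0"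
  by (simp_all add: st_ops[THEN comp_tail] comp_assoc)

lemma st_ops2 [simp]:
  "stu \<odot> muhu m = muh0 m \<odot> stu" "stm \<odot> muhu m = 0" "stu \<odot> Im = 0" "stm \<odot> Im = stm" "stu \<odot> Gm = 0" "stm \<odot> Gm = stm \<odot> sg 1"
  "stu \<odot> Fm f = 0" "stu \<odot> muhm m = 0"
  by (simp_all add: muhu_def muh0_def Im_def Gm_def Fm_def muhm_def nf) (simp_all add: stm_def nf)

lemma stu_rec: "stu = 1 + su * stu" "stu = 1 + stu * su"
  unfolding stu_def by (rule geo_rec geo_rec_right; simp)+

lemma su_stu: "su * stu = stu - 1" "stu * su = stu - 1"
  by (metis stu_rec(1) add_diff_cancel_left', metis stu_rec(2) add_diff_cancel_left')

lemma su_stu_sg: "(stu \<odot> sg p) * (su \<odot> sg p) = (stu \<odot> sg p) - 1"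
  using arg_cong[OF su_stu(2), of "\<lambda>x. x \<odot> sg p"] by (simp add: times_sg)

lemma stm_mm: "op1 1 m \<Longrightarrow> stm \<odot> mm m = m \<odot> stm + Es * su - (su \<odot> sg 1) * Es"
  unfolding mm_def iot_def
  by (simp add: nf letter_proj_st letter_proj letter_proj_st_tail letter_valued_comp)

text \<open>With marks forgotten, multiplying \<open>Unit\<close> by its left and by its right
  neighbour gives the same word with opposite signs. These terms telescope, and only a
  \<open>Unit\<close> at one of the ends of the word leaves a trace.\<close>

lemma stm_muhm:
  assumes "op1 1 m"
  shows "stm \<odot> muhm m = muh0 m \<odot> stm + Es * stu - (stu \<odot> sg 1) * Es"
proof -
  have "(stu \<odot> sg 1) * (Es * su - (su \<odot> sg 1) * Es) * stu =
    (stu \<odot> sg 1) * Es * (su * stu) - ((stu \<odot> sg 1) * (su \<odot> sg 1)) * Es * stu"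
    by (simp add: algebra_simps)
  also have "\<dots> = Es * stu - (stu \<odot> sg 1) * Es"
    by (simp add: su_stu su_stu_sg algebra_simps)
  finally have tele: "(stu \<odot> sg 1) * (Es * su - (su \<odot> sg 1) * Es) * stu = Es * stu - (stu \<odot> sg 1) * Es" .
  have m0: "muh0 m \<odot> stm = (stm \<odot> sg 1) * (m \<odot> stu) * stu + (stu \<odot> sg 1) * (m \<odot> stm) * stu + (stu \<odot> sg 1) * (m \<odot> stu) * stm"
    unfolding muh0_def by (simp add: times_stm nf algebra_simps)
  have "stm \<odot> muhm m = (stu \<odot> sg 1) * (m \<odot> stm + Es * su - (su \<odot> sg 1) * Es) * stu
     + (stu \<odot> sg 1) * (sm \<odot> sg 1) * (stu \<odot> sg 1) * (m \<odot> stu) * stu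
     + (stu \<odot> sg 1) * (m \<odot> stu) * stu * sm * stu"
    unfolding muhm_def using assms by (simp add: nf stm_mm)
  also have "\<dots> = (stu \<odot> sg 1) * (Es * su - (su \<odot> sg 1) * Es) * stu + (stu \<odot> sg 1) * (m \<odot> stm) * stu
     + (stm \<odot> sg 1) * (m \<odot> stu) * stu + (stu \<odot> sg 1) * (m \<odot> stu) * stm"
    by (simp add: stm_def times_sg algebra_simps)
  finally show ?thesis unfolding tele m0 by (simp add: algebra_simps)
qed

lemma ap_et_comp: "ap (et \<odot> X) w = (word [Unit] * ap (1 \<odot> X) w :: 'b lt list \<Rightarrow>\<^sub>0 'k)"
  for X :: "('d, 'a list, 'k::field) wop"
proof -
  have "ap et = (\<lambda>w :: 'a list. word [Unit] * (ap 1 w :: 'b lt list \<Rightarrow>\<^sub>0 'k))"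
    by (auto simp: fun_eq_iff ap_one et_def)
  then show ?thesis by (simp add: mult_clin_right)
qed

lemma ap_et_if: "ap et w = (if w = [] then word [Unit] else 0)"
  by (simp add: et_def)

lemma et_eq:
  fixes X :: "('d, 'a list, 'k::field) wop"
  shows "(1 :: ('a, 'b lt list, 'k) wop) \<odot> X = 1 \<Longrightarrow> (et :: ('a, 'b lt list, 'k) wop) \<odot> X = et"
    "(1 :: ('a, 'b lt list, 'k) wop) \<odot> X = 0 \<Longrightarrow> (et :: ('a, 'b lt list, 'k) wop) \<odot> X = 0"
  by (auto simp: wop_eq_iff ap_et_comp ap_one ap_et_if simp del: ap_comp)

lemma one_comp_letter': "letter_valued g \<Longrightarrow> 1 \<odot> (g \<odot> W) = 0"
  by (simp add: one_comp_letter letter_valued_comp)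

lemma one_comp_geo1 [simp]: "op1 0 f \<Longrightarrow> 1 \<odot> geo f = 1" "op1 0 f \<Longrightarrow> 1 \<odot> (geo f \<odot> W) = 1 \<odot> W"
  by (simp_all add: one_comp_geo comp_tail[OF one_comp_geo])

lemma one_ops [simp]: "1 \<odot> Iu = 1" "1 \<odot> Gu = 1" "op1 0 f \<Longrightarrow> 1 \<odot> Fu f = 1"
  "op1 p g \<Longrightarrow> 1 \<odot> muu g = 0" "1 \<odot> mm m = 0" "1 \<odot> im = 0" "1 \<odot> (im \<odot> W) = 0" "1 \<odot> fm f = 0"
  "op1 1 m \<Longrightarrow> 1 \<odot> muhu m = 0" "1 \<odot> muhm m = 0" "1 \<odot> Im = 0" "1 \<odot> Gm = 0" "1 \<odot> Fm f = 0"
  by (simp_all add: Iu_def Gu_def Fu_def one_comp_letter one_comp_letter' muhu_def muhm_def Im_def Gm_def Fm_def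
      one_comp_times comp_assoc)

lemma Es_times: "Es \<odot> (X * Y) = (Es \<odot> X) * (1 \<odot> Y) + (1 \<odot> X) * (Es \<odot> Y)"
  and Mt_times: "Mt \<odot> (X' * Y') = (Mt \<odot> X') * (1 \<odot> Y') + (1 \<odot> X') * (Mt \<odot> Y')"
  by (simp_all add: lin1_times)

lemma one_comp_sg [simp]: "1 \<odot> sg p = 1" "1 \<odot> (sg p \<odot> W) = 1 \<odot> W"
  by (simp_all add: comp_tail[OF one_sg])

lemma Es_im [simp]: "Es \<odot> im = Es"
  by (simp add: im_def comp_Es)

lemmas st_ops2_tail [simp] = st_ops2[THEN comp_tail]
lemmas Es_im_tail [simp] = Es_im[THEN comp_tail]

lemma Es_ops [simp]: "Es \<odot> Iu = 0" "Es \<odot> Gu = 0" "Es \<odot> Fu f = 0" "Es \<odot> muu g = 0" "Es \<odot> mm m = 0" "Es \<odot> (mm m \<odot> W) = 0"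
  "op1 1 m \<Longrightarrow> Es \<odot> muhu m = 0" "op1 1 m \<Longrightarrow> Es \<odot> muhm m = 0" "Es \<odot> Im = Es" "Es \<odot> Gm = - Es" "Es \<odot> fm f = Es"
  "op1 0 f \<Longrightarrow> Es \<odot> Fm f = Es" 
proof -
  show mm: "Es \<odot> mm m = 0" and "Es \<odot> Iu = 0" "Es \<odot> Gu = 0" "Es \<odot> Fu f = 0" "Es \<odot> muu g = 0" "Es \<odot> fm f = Es" 
    by (simp_all add: Iu_def Gu_def Fu_def muu_def mm_def fm_def iot_def comp_Es comp_assoc)
  from comp_tail[OF mm] show "Es \<odot> (mm m \<odot> W) = 0" by simp
qed (simp_all add: muhu_def muhm_def Im_def Gm_def Fm_def Es_times comp_Es one_comp_times, 
    simp_all add: Iu_def Gu_def Fu_def muu_def mm_def fm_def iot_def Es_times comp_Es comp_assoc Es_sg)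

lemma Iu_idem [simp]: "Iu \<odot> Iu = Iu" "Iu \<odot> Gu = Gu" "Gu \<odot> Iu = Gu" "Iu \<odot> muu g = muu g" "muu g \<odot> Iu = muu g"
  "Fu f \<odot> Iu = Fu f" "Iu \<odot> Fu f = Fu f" "Fu f \<odot> Gu = Fu f \<odot> sg 1" "muu g \<odot> Gu = muu g \<odot> sg 1" 
  by (simp_all add: Iu_def Gu_def muu_def Fu_def nf)

lemmas Iu_idem_tail [simp] = Iu_idem[THEN comp_tail]

lemma sg_lt_ops: "sg p \<odot> Iu = Iu \<odot> sg p" "op1 0 f \<Longrightarrow> sg p \<odot> Fu f = Fu f \<odot> sg p"
  "op1 q g \<Longrightarrow> sg p \<odot> muu g = bsign (p * q) * (muu g \<odot> sg p)"
  by (simp_all add: Iu_def Fu_def muu_def nf)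

lemma sg_lt_ops_tail: "sg p \<odot> (Iu \<odot> W) = Iu \<odot> (sg p \<odot> W)" "op1 0 f \<Longrightarrow> sg p \<odot> (Fu f \<odot> W') = Fu f \<odot> (sg p \<odot> W')"
  "op1 q g \<Longrightarrow> sg p \<odot> (muu g \<odot> W') = bsign (p * q) * (muu g \<odot> (sg p \<odot> W'))"
  using sg_lt_ops[THEN comp_tail] by (simp_all add: comp_assoc)

lemma Gu_Fu [simp]: "op1 0 f \<Longrightarrow> Gu \<odot> Fu f = Fu f \<odot> sg 1" "op1 0 f \<Longrightarrow> Gu \<odot> (Fu f \<odot> W) = Fu f \<odot> (sg 1 \<odot> W)"
  by (simp_all add: Gu_def comp_assoc sg_lt_ops sg_lt_ops_tail)

lemma mm_fm_u [simp]: "op1 0 f \<Longrightarrow> mm m \<odot> Fu f = 0" "op1 0 f \<Longrightarrow> fm f' \<odot> Fu f = 0" "op1 0 f \<Longrightarrow> im \<odot> Fu f = 0"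
  "im \<odot> Iu = 0" "im \<odot> Gu = 0" "mm m \<odot> Iu = 0" "mm m \<odot> Gu = 0" "fm f \<odot> Iu = 0" "fm f \<odot> Gu = 0"
  by (simp_all add: mm_def fm_def im_def iot_def nf times_comp_grouplike)

lemmas mm_fm_u_tail [simp] = mm_fm_u[THEN comp_tail]

lemma Mt_geo [simp]: "op1 0 f \<Longrightarrow> Mt \<odot> geo f = Mt \<odot> f" "op1 0 f \<Longrightarrow> Mt \<odot> (geo f \<odot> W) = Mt \<odot> (f \<odot> W)"
proof -
  show "op1 0 f \<Longrightarrow> Mt \<odot> geo f = Mt \<odot> f" by (simp add: lin1_geo)
  from comp_tail[OF this] show "op1 0 f \<Longrightarrow> Mt \<odot> (geo f \<odot> W) = Mt \<odot> (f \<odot> W)" by (simp add: comp_assoc)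
qed

lemma stm_fm [simp]: "op1 p f \<Longrightarrow> stm \<odot> fm f = f \<odot> stm"
  by (simp add: fm_def comp_Es comp_assoc letter_proj letter_valued_comp)

text \<open>The derivative of a geometric series: the terms are sorted by the component that
  receives the marked letter.\<close>

lemma stm_Fm [simp]: assumes "op1 0 f" shows "stm \<odot> Fm f = geo f \<odot> stm"
proof -
  have "geo f \<odot> stm = (1 + f * geo f) \<odot> stm"
    by (rule arg_cong2[OF geo_rec refl]) (use assms in simp)
  then have "geo f \<odot> stm = (f \<odot> stm) * (geo f \<odot> stu) + (f \<odot> stu) * (geo f \<odot> stm)"
    by (simp add: times_stm)
  moreover have "ap (f \<odot> stu) [] = 0" using assms by simp
  ultimately have "geo f \<odot> stm = geo (f \<odot> stu) * ((f \<odot> stm) * (geo f \<odot> stu))"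
    by (intro geo_unique)
  also have "geo (f \<odot> stu) = geo f \<odot> stu"
    using assms by (simp add: stu_def geo_geo)
  finally show ?thesis
    using assms by (simp add: Fm_def nf mult.assoc)
qed

lemma im_Fm [simp]: "op1 0 f \<Longrightarrow> im \<odot> Fm f = fm f"
  by (simp add: im_def fm_def comp_assoc times_Fm et_eq)

lemma sg_im: "sg p \<odot> im = im \<odot> sg p"
  by (simp add: im_def nf mult.assoc bs_commute)

lemma sg_Fm: "op1 0 f \<Longrightarrow> sg p \<odot> Fm f = Fm f \<odot> sg p" "op1 0 f \<Longrightarrow> sg p \<odot> fm f = fm f \<odot> sg p"
  by (simp_all add: Fm_def fm_def nf mult.assoc sg_lt_ops bs_commute)

lemmas im_Fm_tail [simp] = im_Fm[THEN comp_tail]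

lemma u_Fm [simp]: "Fu f' \<odot> Fm f = 0" "muu g \<odot> Fm f = 0" "Iu \<odot> Fm f = 0"
  by (simp_all add: Iu_def muu_def Fu_def nf)

lemmas u_Fm_tail [simp] = u_Fm[THEN comp_tail]

lemma Gu_Fm [simp]: "op1 0 f \<Longrightarrow> Gu \<odot> Fm f = 0" "op1 0 f \<Longrightarrow> Gu \<odot> (Fm f \<odot> W) = 0"
  by (simp_all add: Gu_def comp_assoc sg_Fm comp_tail[OF sg_Fm(1)])

lemma Im_Fm [simp]: "op1 0 f \<Longrightarrow> Im \<odot> Fm f = Fm f" "op1 0 f \<Longrightarrow> Gm \<odot> Fm f = Fm f \<odot> sg 1"
  by (simp_all add: Im_def Gm_def times_Fm comp_assoc sg_Fm) (simp_all add: Fm_def times_sg)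

lemma Im_Fu [simp]: "op1 0 f \<Longrightarrow> Im \<odot> Fu f = 0" "op1 0 f \<Longrightarrow> Gm \<odot> Fu f = 0"
  by (simp_all add: Im_def Gm_def times_comp_grouplike comp_assoc sg_lt_ops comp_tail[OF mm_fm_u(3)])

lemma mm_Fm: "op1 0 f \<Longrightarrow> mm m \<odot> Fm f = Mt \<odot> m \<odot> geo f \<odot> stm + Es * (Mt \<odot> f \<odot> stu) - (Mt \<odot> f \<odot> stu \<odot> sg 1) * Es"
  by (simp add: mm_def iot_def times_Fm nf sg_lt_ops)

lemma fm_muhm: "op1 0 f \<Longrightarrow> op1 1 m \<Longrightarrow> fm f \<odot> muhm m =
  Mt \<odot> f \<odot> muh0 m \<odot> stm + Es * (Mt \<odot> f \<odot> stu) - (Mt \<odot> f \<odot> stu \<odot> sg 1) * Es"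
  by (simp add: fm_def comp_assoc stm_muhm times_muhm et_eq comp_Es)

lemma Mt_muh0 [simp]: "op1 1 m \<Longrightarrow> Mt \<odot> muh0 m = Mt \<odot> m" "op1 1 m \<Longrightarrow> Mt \<odot> (muh0 m \<odot> W) = Mt \<odot> (m \<odot> W)"
proof -
  show *: "op1 1 m \<Longrightarrow> Mt \<odot> muh0 m = Mt \<odot> m"
    by (simp add: muh0_def Mt_times one_comp_times one_comp_letter)
  from comp_tail[OF this] show "op1 1 m \<Longrightarrow> Mt \<odot> (muh0 m \<odot> W) = Mt \<odot> (m \<odot> W)"
    by (simp add: comp_assoc)
qed

lemma sg_muh: "op1 1 m \<Longrightarrow> sg p \<odot> muhu m = bsign p * (muhu m \<odot> sg p)"
    "op1 1 m \<Longrightarrow> sg p \<odot> muh0 m = bsign p * (muh0 m \<odot> sg p)"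
  by (simp_all add: muhu_def muh0_def sg_times times_sg Gu_def comp_assoc sg_lt_ops sg_lt_ops_tail sg_op1 bs_commute add.commute mult.assoc)

text \<open>Stated for two operations, so that the unit terms carry the difference
  \<open>m - m'\<close> and visibly vanish for \<open>m' = m\<close>.\<close>

lemma im_muhm: "op1 1 m \<Longrightarrow> op1 1 m' \<Longrightarrow> mm m \<odot> muhm m' =
  Mt \<odot> m \<odot> muh0 m' \<odot> stm + Es * (Mt \<odot> (m - m') \<odot> stu) - (Mt \<odot> (m - m') \<odot> stu \<odot> sg 1) * Es"
  by (simp add: mm_def iot_def comp_assoc stm_muhm times_muhm et_eq comp_Es nf sg_muh comp_tail[OF st_ops2(1)] algebra_simps)

text \<open>The A-infinity relations and the functor equation as identities in the convolution ring.
  Objects and degrees have disappeared; parities are all that is kept.\<close>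

locale functor_ops =
  fixes mC :: "('l::letter, 'l list, 'k::field) wop" and mD :: "('m::letter, 'm list, 'k) wop"
    and f0 :: "('l, 'm list, 'k) wop"
  assumes mC [simp]: "op1 1 mC" and mD [simp]: "op1 1 mD" and f0 [simp]: "op1 0 f0"
    and mC_sq: "mC \<odot> muh0 mC = 0" and mD_sq: "mD \<odot> muh0 mD = 0"
    and functor_eq: "mD \<odot> geo f0 = f0 \<odot> muh0 mC"
begin

text \<open>The functor equation survives the adjunction of units: since \<open>fm\<close> preserves
  \<open>Unit\<close>, both sides contain the same products of \<open>Unit\<close> with a component
  of the functor.\<close>

lemma mm_functor: "mm mD \<odot> Fm f0 = fm f0 \<odot> muhm mC"
  using comp_tail[OF functor_eq, of stm] by (simp add: mm_Fm fm_muhm comp_assoc)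

lemma mm_sq: "mm mD \<odot> muhm mD = 0"
  using comp_tail[OF mD_sq, of stm] by (simp add: im_muhm comp_assoc)

lemma mu_functor: "muu mD \<odot> Fu f0 = muu f0 \<odot> muhu mC"
  using comp_tail[OF functor_eq, of stu] by (simp add: muu_def Fu_def comp_assoc)

end

lemma one_muh0 [simp]: "op1 1 m \<Longrightarrow> 1 \<odot> muh0 m = 0"
  by (simp add: muh0_def one_comp_times one_comp_letter)

lemma homog_times': "homog p X \<Longrightarrow> homog q Y \<Longrightarrow> r = p + q \<Longrightarrow> homog r (X * Y)"
  by auto

lemma homog_comp': "homog p X \<Longrightarrow> homog q Y \<Longrightarrow> r = p + q \<Longrightarrow> homog r (X \<odot> Y)"
  by auto

lemma homog_geo1 [simp]: "op1 0 f \<Longrightarrow> homog 0 (geo f)"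
  by (simp add: homog_geo)

lemma homog_mu [simp]: "op1 p g \<Longrightarrow> homog p (muu g)"
  unfolding muu_def using homog_comp[OF homog_st(3) homog_comp[OF op1D(3) homog_st(1)]] by simp

lemma homog_lt [simp]: "homog 0 Iu" "homog 0 Gu" "homog 0 im" "homog 0 (im \<odot> sg q)" "op1 0 f \<Longrightarrow> homog 0 (Fu f)"
  unfolding Iu_def Gu_def im_def Fu_def
  by (auto intro!: homog_comp'[where p = 0 and q = 0] homog_add homog_times'[where p = 1 and q = 1])

lemma homog_fm [simp]: "op1 0 f \<Longrightarrow> homog 0 (fm f)"
  unfolding fm_def by (auto intro!: homog_comp'[where p = 0 and q = 0] homog_add homog_times'[where p = 1 and q = 1])

lemma homog_iot: "homog 0 iot"
  unfolding iot_def by (auto intro!: homog_comp'[where p = 0 and q = 0])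

lemma homog_mm [simp]: "op1 1 m \<Longrightarrow> homog 1 (mm m)"
proof -
  assume m: "op1 1 m"
  have "homog 1 (Mt \<odot> m \<odot> stm)"
    using homog_comp[OF homogs(4) homog_comp[OF op1D(3)[OF m] homog_st(2)]] by simp
  moreover have "homog 1 (Es * iot)" "homog 1 ((iot \<odot> sg 1) * Es)"
    using homog_times[OF homogs(5) homog_iot] homog_times[OF homog_comp[OF homog_iot homog_sgn] homogs(5)] by simp_all
  ultimately show ?thesis
    unfolding mm_def by blast
qed

lemma homog_muhu [simp]: "op1 1 m \<Longrightarrow> homog 1 (muhu m)"
  unfolding muhu_def using homog_times[OF homog_times[OF homog_lt(2) homog_mu] homog_lt(1)] by simp

lemma Dec_muhu: "op1 1 m \<Longrightarrow> Dec (muhu m) = lft Gu * rgt (muhu m) + lft (muhu m) * rgt Iu"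
  unfolding muhu_def by (subst Dec3) simp_all

text \<open>A product headed by one letter: the norm cuts the tail, \<open>F\<close> being a
  coalgebra map splits along the cut, and the piece rotated to the front passes \<open>P\<close> and
  acquires its sign.\<close>

lemma NN_PF:
  assumes "letter_valued P" "homog p P" "grpl F" "homog 0 F"
  shows "NN \<odot> ((P * F) \<odot> NN) = ((F \<odot> sg p) * P * F) \<odot> NN"
proof -
  have "NN \<odot> (P * F) = post mulrev (lft (P * F) * rgt F)"
    using assms by (simp add: NN_letter_times mult.assoc)
  also have "\<dots> = (P * F) \<oslash> (F \<odot> sg p)"
    by (subst post_mulrev[of p _ 0]) (use homog_times[OF assms(2,4)] assms(4) in auto)
  finally have "NN \<odot> ((P * F) \<odot> NN) = ((P * F) \<oslash> (F \<odot> sg p)) \<odot> NN"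
    by (simp flip: comp_assoc)
  then show ?thesis by (simp add: opp_NN mult.assoc)
qed

section \<open>The Hochschild differential and the induced map, factored through the norm\<close>

definition bbar where "bbar m = mm m * Iu + (im \<odot> sg 1) * muhu m"
definition Fbar where "Fbar f = fm f * Fu f"
text \<open>The norm brings a_0 to every position. The first summand of \<open>bbar\<close> uses the
  rotations in which the operation reaches a_0; the second is nonzero only on the one with a_0 in
  front, since \<open>im\<close> reads a single distinguished letter.\<close>

definition bb where "bb m = bbar m \<odot> NN"
definition FF where "FF f = Fbar f \<odot> NN"

lemma muhm_alt: "muhm m = Gu * mm m * Iu + Gm * muu m * Iu + Gu * muu m * Im"
  by (simp add: muhm_def Gm_def Im_def mult.assoc)

text \<open>The purpose of the norm: it converts the Hochschild differential, which treats a_0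
  specially, into the coderivation \<open>muhm\<close>, which treats all positions alike. The pieces
  of \<open>bbar\<close> are rotated by \<open>opp_NN\<close> into the three summands of
  \<open>muhm\<close>.\<close>

lemma NN_bb:
  assumes m: "op1 1 m"
  shows "NN \<odot> bb m = muhm m \<odot> NN"
proof -
  let ?P = "im \<odot> sg 1 :: ('a lt, 'a lt list, 'b) wop"
  have "NN \<odot> (?P * muhu m) = post mulrev (lft (?P * Gu) * rgt (muhu m)) + post mulrev (lft (?P * muhu m) * rgt Iu)"
    by (simp add: NN_letter_times Dec_muhu m distrib_left mult.assoc)
  also have "post mulrev (lft (?P * Gu) * rgt (muhu m)) = ((?P * Gu) \<odot> sg 1) \<oslash> muhu m"
    by (subst post_mulrev[of 0 _ 1]) (auto intro!: homog_times'[where p = 0 and q = 0] homog_muhu m)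
  also have "post mulrev (lft (?P * muhu m) * rgt Iu) = (?P * muhu m) \<oslash> (Iu \<odot> sg 1)"
    by (subst post_mulrev[of 1 _ 0]) (use homog_times[OF homog_lt(4) homog_muhu[OF m]] in auto)
  finally have "NN \<odot> ((?P * muhu m) \<odot> NN) = (((?P * Gu) \<odot> sg 1) \<oslash> muhu m + (?P * muhu m) \<oslash> (Iu \<odot> sg 1)) \<odot> NN"
    by (simp flip: comp_assoc)
  also have "\<dots> = (muhu m * im * Iu + Gm * muu m * Iu) \<odot> NN"
    by (simp add: opp_NN times_sg comp_assoc Gm_def Gu_def muhu_def mult.assoc)
  finally have "NN \<odot> ((?P * muhu m) \<odot> NN) = (muhu m * im * Iu + Gm * muu m * Iu) \<odot> NN" .
  then show ?thesis
    using NN_PF[of "mm m" 1 Iu] m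
    by (simp add: bb_def bbar_def muhm_alt Gu_def Im_def muhu_def mult.assoc)
qed

lemma NN_FF: "op1 0 f \<Longrightarrow> NN \<odot> FF f = Fm f \<odot> NN"
  using NN_PF[of "fm f" 0 "Fu f"] by (simp add: FF_def Fbar_def Fm_def)

lemma times_Gm: "(X * Y) \<odot> Gm = (X \<odot> Gu) * (Y \<odot> Gm) + (X \<odot> Gm) * (Y \<odot> Gu)"
  unfolding Gm_def by (subst times_comp3) simp_all

lemma sg_Gu: "sg p \<odot> Gu = Iu \<odot> sg (p + 1)"
  by (simp add: Gu_def sg_lt_ops_tail)

lemma fm_muhu [simp]: "fm f \<odot> muhu m = 0" "mm m' \<odot> muhu m = 0" "im \<odot> muhu m = 0" if "op1 1 m"
  using that by (simp_all add: fm_def mm_def im_def iot_def comp_assoc times_muhu et_eq comp_Es times_Gm nf sg_Gu)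

lemma fm_Gm [simp]: "fm f \<odot> Gm = fm f \<odot> sg 1" "mm m \<odot> Gm = mm m \<odot> sg 1"
  by (simp_all add: fm_def mm_def iot_def comp_assoc et_eq comp_Es times_Gm nf sg_Gu)

lemma Fu_muhm [simp]: "Fu f \<odot> muhm m = 0" "muu g \<odot> muhm m = 0" "Iu \<odot> muhm m = 0" "muu g \<odot> Gm = 0" "Fu f \<odot> Gm = 0"
    "Fu f \<odot> Im = 0" "muu g \<odot> Im = 0"
  by (simp_all add: Fu_def muu_def Iu_def comp_assoc)

lemma muhu_alt: "muhu m = ut \<odot> muh0 m \<odot> stu"
  by (simp add: muhu_def muh0_def muu_def Gu_def Iu_def nf)

context functor_ops
begin

lemmas op1s [simp] = op1D[OF mC] op1D[OF mD] op1D[OF f0]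

text \<open>The equation for components lifts to coalgebra maps, as \<open>geo f0\<close> followed
  after \<open>muh0 mC\<close> solves an affine recursion whose solution is unique.\<close>

lemma muhu_functor: "muhu mD \<odot> Fu f0 = Fu f0 \<odot> muhu mC"
proof -
  have *: "muh0 mD \<odot> geo f0 = geo f0 \<odot> muh0 mC"
  proof -
    have "geo f0 \<odot> muh0 mC = (1 + f0 * geo f0) \<odot> muh0 mC"
      by (rule arg_cong2[OF geo_rec refl]) (rule op1D[OF f0])
    also have "\<dots> = (f0 \<odot> muh0 mC) * geo f0 + (f0 \<odot> sg 1) * (geo f0 \<odot> muh0 mC)"
      by (simp add: times_muh0)
    finally have "geo f0 \<odot> muh0 mC = geo (f0 \<odot> sg 1) * ((f0 \<odot> muh0 mC) * geo f0)"
      by (intro geo_unique) simp_all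
    then show ?thesis
      by (simp add: geo_sg muh0_def times_comp_grouplike Dec_geo functor_eq[unfolded muh0_def] sg_geo mult.assoc)
  qed
  then show ?thesis
    using comp_tail[OF *, of stu] by (simp add: muhu_alt Fu_def comp_assoc)
qed

lemma bbar_Fm: "bbar mD \<odot> Fm f0 = Fbar f0 \<odot> muhm mC"
proof -
  have "bbar mD \<odot> Fm f0 = (fm f0 \<odot> muhm mC) * Fu f0 + (fm f0 \<odot> sg 1) * (Fu f0 \<odot> muhu mC)"
    by (simp add: bbar_def times_Fm comp_assoc sg_Fm sg_lt_ops mm_functor muhu_functor)
  also have "\<dots> = Fbar f0 \<odot> muhm mC"
    by (simp add: Fbar_def times_muhm)
  finally show ?thesis .
qed

text \<open>Once the inner norm is moved to the right on both sides, the claim is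
  \<open>bbar_Fm\<close>, in which no rotation occurs any more.\<close>

lemma FF_bb: "bb mD \<odot> FF f0 = FF f0 \<odot> bb mC"
  using comp_tail[OF bbar_Fm, of NN] by (simp add: bb_def FF_def comp_assoc NN_bb[unfolded bb_def] NN_FF[unfolded FF_def])

end


section \<open>The formal unit\<close>

definition pre :: "('l::letter, 'l lt list, 'k::field) wop" where "pre = et * ut"
definition headM :: "('l::letter, 'l lt list, 'k::field) wop" where "headM = Mt * ut"
text \<open>Connes' operator: after all rotations the mark is dropped, because e^+ takes over the
  place of a_0. Chains with \<open>Unit\<close> as distinguished letter are killed by
  \<open>stm\<close>, in accordance with the degeneracy of e^+ in later places.\<close>

definition BB where "BB = pre \<odot> stm \<odot> NN"

lemma ap_pre [simp]: "ap pre a = word (Unit # map Plain a)"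
proof -
  have "ap pre a = (\<Sum>i\<le>length a. if i = 0 then word [Unit] * word (map Plain a) else 0)"
    unfolding pre_def ap_times by (rule sum.cong) (auto simp: ap_et_if)
  then show ?thesis by (simp add: sum.delta mult_single plus_list_def)
qed

lemma ap_headM [simp]: "ap headM (a # y) = word (Marked a # map Plain y)" "ap headM [] = 0"
  by (simp_all add: headM_def ap_lin1_times) (simp add: Mt_def mult_single plus_list_def)

lemma NN_pre_eq: "NN \<odot> pre = pre \<oslash> (ut \<odot> sg 1)"
proof -
  have "NN \<odot> pre = post mulrev (lft (et * ut) * rgt ut)"
    unfolding pre_def by (simp add: NN_letter_times mult.assoc)
  also have "\<dots> = pre \<oslash> (ut \<odot> sg 1)"
    unfolding pre_def by (subst post_mulrev[of 1 _ 0]) (use homog_times[OF homogs(6) homog_st(3)] in auto)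
  finally show ?thesis .
qed

lemma ap_times_Es:
  fixes X Y :: "('a, 'w::monoid_add, 'k::field) wop"
  shows "ap ((X \<odot> stu) * Es * (Y \<odot> stu)) (map Plain b @ Unit # map Plain a) = ap X b * ap Y a"
proof -
  have stu: "ap stu (map Plain w) = (word w :: _ \<Rightarrow>\<^sub>0 'k)" for w :: "'a list"
    by (induction w) (simp_all add: mult_single plus_list_def)
  let ?w = "map Plain b @ Unit # map Plain a"
  have Es: "ap (Es * (Y \<odot> stu)) (c # v) = (if c = Unit then ap (Y \<odot> stu) v else 0)" for c v
    by (simp add: ap_lin1_times ap_Es del: ap_comp)
  have "ap ((X \<odot> stu) * (Es * (Y \<odot> stu))) ?w = (\<Sum>i\<le>length ?w. if i = length b then ap X b * ap Y a else 0)"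
    unfolding ap_times[of "X \<odot> stu"]
  proof (rule sum.cong[OF refl])
    fix i assume "i \<in> {..length ?w}"
    then consider "i < length b" | "i = length b" | "length b < i" "i < length ?w" | "i = length ?w"
      by fastforce
    then show "ap (X \<odot> stu) (take i ?w) * ap (Es * (Y \<odot> stu)) (drop i ?w) = (if i = length b then ap X b * ap Y a else 0)"
    proof cases
      case 1
      have "drop i ?w = ?w ! i # drop (Suc i) ?w" by (rule Cons_nth_drop_Suc[symmetric]) (use 1 in simp)
      then have "ap (Es * (Y \<odot> stu)) (drop i ?w) = 0"
        using 1 by (metis Es nth_append length_map nth_map lt.distinct(3))
      with 1 show ?thesis by simp
    next
      case 2
      then show ?thesis by (simp add: Es stu)
    next
      case 3
      have "drop i ?w = ?w ! i # drop (Suc i) ?w" by (rule Cons_nth_drop_Suc[symmetric]) (use 3 in simp)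
      moreover have "?w ! i \<noteq> Unit"
        using 3 by (cases "i - length b") (auto simp: nth_append)
      ultimately have "ap (Es * (Y \<odot> stu)) (drop i ?w) = 0"
        by (metis Es)
      with 3 show ?thesis by simp
    next
      case 4
      then show ?thesis by simp
    qed
  qed
  also have "\<dots> = ap X b * ap Y a"
    by (subst sum.delta) auto
  finally show ?thesis by (simp add: mult.assoc)
qed

text \<open>The rotations of \<open>Unit # z\<close> are the words \<open>b @ Unit # a\<close> with
  \<open>z = a @ b\<close>, and \<open>Es\<close> in the middle locates the cut. The twist of
  \<open>X\<close> is the sign of moving \<open>b\<close> past the odd \<open>Unit\<close>.\<close>

lemma Es_NN_pre: "((X \<odot> stu) * Es * (Y \<odot> stu)) \<odot> (NN \<odot> pre) = Y \<oslash> (X \<odot> sg 1)"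
proof (rule wop_eqI)
  fix z
  define W where "W = (X \<odot> stu) * Es * (Y \<odot> stu)"
  have "ap W (map Plain b @ Unit # map Plain a) = ap X b * ap Y a" for a b
    unfolding W_def by (rule ap_times_Es)
  then have "ap (W \<odot> (NN \<odot> pre)) z = ap (Y \<oslash> (X \<odot> sg 1)) z"
    unfolding NN_pre_eq
    by (simp add: opp_def clin_sum clin_csc mult_single plus_list_def csc_mult_left csc_csc)
  then show "ap (((X \<odot> stu) * Es * (Y \<odot> stu)) \<odot> (NN \<odot> pre)) z = ap (Y \<oslash> (X \<odot> sg 1)) z"
    by (simp only: W_def)
qed

definition noE :: "('l lt, 'w, 'k::field) wop \<Rightarrow> bool"
  where "noE X \<longleftrightarrow> (\<forall>w. Unit \<in> set w \<longrightarrow> ap X w = 0)"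

lemma noE_st [simp]: "noE stu" "noE stm" "noE Iu" "noE (X \<odot> stu)" "noE (X \<odot> stm)"
proof -
  have 1: "ap stu w = 0" if "Unit \<in> set w" for w :: "'x lt list"
    using that
  proof (induction w)
    case (Cons a w)
    then show ?case by (cases a) auto
  qed simp
  have 2: "ap stm w = 0" if "Unit \<in> set w" for w :: "'x lt list"
    using that
  proof (induction w)
    case (Cons a w)
    then show ?case by (cases a) (auto simp: 1)
  qed simp
  show "noE stu" "noE stm" "noE Iu" "noE (X \<odot> stu)" "noE (X \<odot> stm)"
    by (auto simp: noE_def 1 2 Iu_def)
qed

lemma noE_closed: "noE X \<Longrightarrow> noE Y \<Longrightarrow> noE (X * Y)" "noE Z \<Longrightarrow> noE (W \<odot> Z)" "noE X \<Longrightarrow> noE Y \<Longrightarrow> noE (X + Y)"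
  "noE Z \<Longrightarrow> noE (Z \<odot> sg p)"
proof -
  show "noE X \<Longrightarrow> noE Y \<Longrightarrow> noE (X * Y)"
    unfolding noE_def ap_times
  proof (intro allI impI sum.neutral ballI)
    fix w :: "'a lt list" and i
    assume *: "\<forall>w. Unit \<in> set w \<longrightarrow> ap X w = 0" "\<forall>w. Unit \<in> set w \<longrightarrow> ap Y w = 0" "Unit \<in> set w"
    then have "Unit \<in> set (take i w) \<or> Unit \<in> set (drop i w)"
      by (metis Un_iff append_take_drop_id set_append)
    with * show "ap X (take i w) * ap Y (drop i w) = 0" by auto
  qed
qed (auto simp: noE_def)

lemma noE_NN_pre:
  fixes X :: "('l::letter lt, 'w::monoid_add, 'k::field) wop"
  shows "noE X \<Longrightarrow> X \<odot> (NN \<odot> pre) = 0"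
proof (rule wop_eqI)
  fix z :: "'l list" assume X: "noE X"
  have "Unit \<in> set u" if u: "u \<in> Poly_Mapping.keys (ap (NN \<odot> pre :: ('l, 'l lt list, 'k) wop) z)" for u
  proof -
    obtain v where v: "v \<in> Poly_Mapping.keys (ap pre z :: _ \<Rightarrow>\<^sub>0 'k)" "u \<in> Poly_Mapping.keys (ap NN v :: _ \<Rightarrow>\<^sub>0 'k)"
      using keys_ap_comp[OF u] by blast
    have "Unit \<in> set v"
      using v(1) by simp
    moreover have "set u = set v"
    proof -
      obtain i where "u \<in> Poly_Mapping.keys (rotn i v :: _ \<Rightarrow>\<^sub>0 'k)"
        using v(2) keys_sum_subset unfolding NN_def by fastforce
      then have "u = drop (length v - i) v @ take (length v - i) v"
        by (auto simp: rotn_def mulrev_def split: if_splits)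
      then show ?thesis by (metis Un_commute append_take_drop_id set_append)
    qed
    ultimately show ?thesis by simp
  qed
  with X have "clin (ap X) (ap (NN \<odot> pre) z) = clin (\<lambda>_. 0) (ap (NN \<odot> pre) z)"
    by (intro clin_cong) (auto simp: noE_def)
  then show "ap (X \<odot> (NN \<odot> pre)) z = ap 0 z" by simp
qed

lemma opp_one [simp]: "X \<oslash> 1 = X"
proof (rule wop_eqI)
  fix z
  have "ap (X \<oslash> 1) z = (\<Sum>i\<le>length z. if i = length z then ap X z else 0)"
    unfolding opp_def ap_Op by (rule sum.cong) (auto simp: ap_one)
  then show "ap (X \<oslash> 1) z = ap X z" by (simp add: sum.delta)
qed

lemma opp_minus [simp]: "(- X) \<oslash> Y = - (X \<oslash> Y)" "X \<oslash> (- Y) = - (X \<oslash> Y)"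
  by (auto simp: wop_eq_iff opp_def csc_minus sum_negf)

lemma opp_bs [simp]: "(bsign p * X) \<oslash> Y = bsign p * (X \<oslash> Y)" "X \<oslash> (bsign p * Y) = bsign p * (X \<oslash> Y)"
  by (cases p; simp)+

lemma headM_tt: "ut \<oslash> Mt = headM \<odot> tt"
proof (rule wop_eqI)
  fix z :: "'a list"
  show "ap (ut \<oslash> Mt) z = ap (headM \<odot> tt) z"
  proof (cases z rule: rev_cases)
    case (snoc y a)
    have "ap (ut \<oslash> Mt) z = (\<Sum>i\<le>length z. if i = length y then
        csc (bsign (epar y * par a)) (word (Marked a # map Plain y)) else 0)"
      unfolding opp_def ap_Op
    proof (rule sum.cong[OF refl])
      fix i assume "i \<in> {..length z}"
      then consider "i < length y" | "i = length y" | "i = Suc (length y)"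
        using snoc by fastforce
      then show "csc (bsign (epar (take i z) * epar (drop i z))) (ap Mt (drop i z) * ap ut (take i z)) =
          (if i = length y then csc (bsign (epar y * par a)) (word (Marked a # map Plain y)) else 0)"
        by cases (auto simp: snoc Mt_def on_letter_def mult_single plus_list_def)
    qed
    then show ?thesis using snoc
      by (simp add: sum.delta tt_def rotn_def mulrev_def)
  qed (simp add: opp_def headM_def tt_def rotn_def mulrev_def)
qed

text \<open>On e^+[z] the differential multiplies e^+ by the first entry or by the last one, giving
  z and its rotation with a new mark, or acts inside z. The resulting 1 - t is the one that the norm
  kills in the classical proof of bB + Bb = 0.\<close>

lemma bbar_pre: assumes m: "op1 1 m" shows "bb m \<odot> pre = headM - headM \<odot> tt - pre \<odot> muh0 m"
proof -
  \<comment> \<open>Summands are sorted by whether they read a \<open>Unit\<close>: those that do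
    not vanish on rotations of \<open>Unit # z\<close>, the others have the shape treated by
    \<open>Es_NN_pre\<close>.\<close>
  have 1: "bbar m = (Mt \<odot> m \<odot> stm) * Iu + ((1 \<odot> stu) * Es * (headM \<odot> stu) - ((Mt \<odot> sg 1) \<odot> stu) * Es * (ut \<odot> stu)
      + ((Mt \<odot> stm \<odot> sg 1) * (ut \<odot> muh0 m \<odot> stu) - (1 \<odot> stu) * Es * ((et * (ut \<odot> muh0 m)) \<odot> stu)))"
    by (simp add: bbar_def mm_def im_def iot_def headM_def Iu_def nf muhu_alt algebra_simps)
  have N: "noE ((Mt \<odot> m \<odot> stm) * Iu)" "noE ((Mt \<odot> stm \<odot> sg 1) * (ut \<odot> muh0 m \<odot> stu))"
    by (intro noE_closed noE_st)+
  have "bb m \<odot> pre = bbar m \<odot> (NN \<odot> pre)"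
    by (simp add: bb_def comp_assoc)
  also have "\<dots> = headM - ut \<oslash> Mt - et * (ut \<odot> muh0 m)"
    by (simp only: 1 comp_linear_left noE_NN_pre[OF N(1)] noE_NN_pre[OF N(2)] Es_NN_pre)
      (simp add: comp_assoc)
  also have "et * (ut \<odot> muh0 m) = pre \<odot> muh0 m"
    using m by (simp add: pre_def times_muh0 et_eq)
  finally show ?thesis by (simp add: headM_tt)
qed

section \<open>The Cartan homotopy formula\<close>

definition Z12 where "Z12 f p g = (Fu f \<odot> sg p) * muu g * Fu f"
text \<open>The coalgebra map of \<open>f\<close> with one extra component \<open>g\<close> standing
  to the left of the distinguished letter.\<close>

definition Z13 where "Z13 f p g = (Fu f \<odot> sg p) * muu g * Fm f"
text \<open>For \<open>f\<close> the identity and \<open>g\<close> equal to v(mu), \<open>ii\<close>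
  is b^{1|1} and \<open>SS\<close> is B^{1|1}. For general \<open>f\<close> they are contractions
  with a prenatural transformation from \<open>f\<close> to itself.\<close>

definition ibar where "ibar m f p g = (mm m \<odot> Z13 f p g) * Fu f"
definition ii where "ii m f p g = ibar m f p g \<odot> NN"
definition SS where "SS f p g = pre \<odot> stm \<odot> Z13 f p g \<odot> NN"
text \<open>The Lie derivative: one component of the induced map is replaced by \<open>g\<close>,
  either the one containing a_0 or one of the tail.\<close>

definition Lbar where "Lbar f p g = (Mt \<odot> g \<odot> stm) * Fu f + (fm f \<odot> sg p) * Z12 f p g"
definition LL where "LL f p g = Lbar f p g \<odot> NN"
text \<open>The differential, up to sign conventions, of \<open>g\<close> as a prenatural
  transformation in the A-infinity category of functors.\<close>

definition del where "del mC mD f p g = mD \<odot> ((geo f \<odot> sg p) * g * geo f) - bsign p * (g \<odot> muh0 mC)"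

lemma times_Z12: "op1 0 f \<Longrightarrow> op1 p g \<Longrightarrow>
  (X * Y) \<odot> Z12 f p g = (X \<odot> Fu f \<odot> sg p) * (Y \<odot> Z12 f p g) + (X \<odot> Z12 f p g) * (Y \<odot> Fu f)"
  unfolding Z12_def by (subst times_comp3) simp_all

lemma times_Z13: "op1 0 f \<Longrightarrow> op1 p g \<Longrightarrow> (X * Y) \<odot> Z13 f p g =
  (X \<odot> Fu f \<odot> sg p) * (Y \<odot> Z13 f p g) + (X \<odot> Z12 f p g) * (Y \<odot> Fm f) + (X \<odot> Z13 f p g) * (Y \<odot> Fu f)"
  unfolding Z13_def Z12_def Fm_def mult.assoc[symmetric]
  by (subst times_comp5) simp_all

lemma homog_Z12: "op1 0 f \<Longrightarrow> op1 p g \<Longrightarrow> homog p (Z12 f p g)"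
  unfolding Z12_def
  using homog_times[OF homog_times[OF homog_comp[OF homog_lt(5) homog_sgn] homog_mu] homog_lt(5)] by simp

lemma homog_Fm: "op1 0 f \<Longrightarrow> homog 0 (Fm f)"
  unfolding Fm_def
  using homog_times[OF homog_times[OF homog_lt(5) homog_fm] homog_lt(5)] by simp

lemma homog_Z13: "op1 0 f \<Longrightarrow> op1 p g \<Longrightarrow> homog p (Z13 f p g)"
  unfolding Z13_def
  using homog_times[OF homog_times[OF homog_comp[OF homog_lt(5) homog_sgn] homog_mu] homog_Fm] by simp

lemma Z_simps [simp]:
  assumes f: "op1 0 f" and g: "op1 p g"
  shows "Iu \<odot> Z12 f p g = Z12 f p g" "Iu \<odot> Z13 f p g = 0" "muu g' \<odot> Z13 f p g = 0" "Fu f' \<odot> Z13 f p g = 0"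
    "stu \<odot> Z13 f p g = 0" "stu \<odot> Z12 f p g = ((geo f \<odot> sg p) * g * geo f) \<odot> stu" "stm \<odot> Z12 f p g = 0"
    "Es \<odot> Z12 f p g = 0" "Es \<odot> Z13 f p g = 0" "1 \<odot> Z12 f p g = 0" "1 \<odot> Z13 f p g = 0"
proof -
  show s: "stu \<odot> Z13 f p g = 0" "stu \<odot> Z12 f p g = ((geo f \<odot> sg p) * g * geo f) \<odot> stu" "stm \<odot> Z12 f p g = 0"
    using f g by (simp_all add: Z13_def Z12_def nf)
  show "Iu \<odot> Z13 f p g = 0" "muu g' \<odot> Z13 f p g = 0" "Fu f' \<odot> Z13 f p g = 0"
    by (simp_all add: Iu_def muu_def Fu_def comp_assoc s)
  show "Iu \<odot> Z12 f p g = Z12 f p g"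
    by (simp add: Iu_def comp_assoc s) (use f g in \<open>simp add: Z12_def Fu_def muu_def nf\<close>)
  show "Es \<odot> Z12 f p g = 0" "Es \<odot> Z13 f p g = 0" "1 \<odot> Z12 f p g = 0" "1 \<odot> Z13 f p g = 0"
    using f g by (simp_all add: Z12_def Z13_def Es_times one_comp_times comp_tail[OF Es_ops(3)])
qed

lemmas Es_Fu_tail [simp] = Es_ops(3)[THEN comp_tail]

lemma mm_Z12 [simp]: "op1 0 f \<Longrightarrow> op1 p g \<Longrightarrow> mm m \<odot> Z12 f p g = 0"
  "op1 0 f \<Longrightarrow> op1 p g \<Longrightarrow> im \<odot> Z12 f p g = 0" "op1 0 f \<Longrightarrow> op1 p g \<Longrightarrow> fm f' \<odot> Z12 f p g = 0"
  by (simp_all add: mm_def im_def fm_def iot_def comp_assoc times_Z12)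

lemma Gu_Z12 [simp]: "op1 0 f \<Longrightarrow> op1 p g \<Longrightarrow> Gu \<odot> Z12 f p g = bsign p * (Z12 f p g \<odot> sg 1)"
  by (simp add: Gu_def comp_assoc homog_sg[OF homog_Z12] flip: comp_assoc[of Iu])

lemma Gm_alt: "Gm = sg 1 \<odot> Im"
  by (simp add: Gm_def Im_def nf sg_lt_ops sg_im Gu_def)

lemma stm_Z13: "op1 0 f \<Longrightarrow> op1 p g \<Longrightarrow>
    stm \<odot> Z13 f p g = ((geo f \<odot> sg p) \<odot> stu) * (g \<odot> stu) * (geo f \<odot> stm)"
  by (simp add: Z13_def nf)

lemma im_Z13 [simp]: "op1 0 f \<Longrightarrow> op1 p g \<Longrightarrow> im \<odot> Z13 f p g = 0"
  by (simp add: im_def comp_assoc times_Z13 et_eq stm_Z13 Mt_times one_comp_letter' one_comp_times one_comp_letter)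

lemma Im_Z13 [simp]: assumes "op1 0 f" "op1 p g" shows "Im \<odot> Z13 f p g = Z13 f p g" "Gm \<odot> Z13 f p g = bsign p * (Z13 f p g \<odot> sg 1)"
proof -
  show 1: "Im \<odot> Z13 f p g = Z13 f p g"
    using assms by (simp add: Im_def times_Z13 comp_assoc) (simp add: Z12_def Z13_def Fm_def mult.assoc)
  then show "Gm \<odot> Z13 f p g = bsign p * (Z13 f p g \<odot> sg 1)"
    using homog_sg[OF homog_Z13[OF assms], of 1] by (simp add: Gm_alt comp_assoc)
qed

lemma fm_Im [simp]: "fm f \<odot> Im = fm f" "mm m \<odot> Im = mm m" "im \<odot> Im = im"
  by (simp_all add: fm_def mm_def im_def iot_def comp_assoc times_Im et_eq comp_Es nf sg_lt_ops)

lemma Z13_muhm: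
  assumes "op1 0 f" "op1 p g" "op1 1 m"
  shows "Z13 f p g \<odot> muhm m = (Fu f \<odot> sg (p + 1)) * (muu g \<odot> sg 1) * (Fm f \<odot> muhm m) +
    (Fu f \<odot> sg (p + 1)) * (muu g \<odot> muhu m) * Fm f + bsign p * (((Fu f \<odot> muhu m) \<odot> sg p) * muu g * Fm f)"
proof -
  have Im: "Fm f \<odot> Im = Fm f" "Fm f \<odot> Gu = 0" "Fm f \<odot> muhu m = 0" "Fm f \<odot> Iu = 0"
    using assms by (simp_all add: Fm_def times_Im times_comp_grouplike times_muhu)
  show ?thesis
    unfolding Z13_def using assms
    by (simp add: times_muhm times_muhu times_Im times_comp_grouplike comp_assoc Im sg_muh sg_Gu sg_lt_ops comp_tail[OF Fu_muhm(1)] algebra_simps)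
qed

context functor_ops
begin

lemma Fm_muhm: "Fm f0 \<odot> muhm mC = muhm mD \<odot> Fm f0"
proof -
  have "Fm f0 \<odot> muhm mC = (Fu f0 \<odot> sg 1) * (fm f0 \<odot> muhm mC) * Fu f0
     + ((Fu f0 * fm f0) \<odot> sg 1) * (Fu f0 \<odot> muhu mC) + (Fu f0 \<odot> muhu mC) * fm f0 * Fu f0"
    by (simp add: Fm_def times_muhm times_muhu times_Im comp_assoc algebra_simps times_sg times_comp_grouplike times_Gm) 
  moreover have "muhm mD \<odot> Fm f0 = (Fu f0 \<odot> sg 1) * (fm f0 \<odot> muhm mC) * Fu f0
     + (Fm f0 \<odot> sg 1) * (muu mD \<odot> Fu f0) * Fu f0 + (Fu f0 \<odot> sg 1) * (muu mD \<odot> Fu f0) * Fm f0"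
    by (simp add: muhm_alt times_Fm comp_assoc algebra_simps times_comp_grouplike mm_functor) 
  moreover have "Fu f0 \<odot> muhu mC = (Fu f0 \<odot> sg 1) * (muu mD \<odot> Fu f0) * Fu f0"
    unfolding muhu_functor[symmetric] by (simp add: muhu_def times_comp_grouplike)
  ultimately show ?thesis
    by (simp add: Fm_def times_sg algebra_simps)
qed

lemma Fu_muhu: "Fu f0 \<odot> muhu mC = (Fu f0 \<odot> sg 1) * (muu mD \<odot> Fu f0) * Fu f0"
  unfolding muhu_functor[symmetric] by (simp add: muhu_def times_comp_grouplike)

lemma mu_del: "op1 p g \<Longrightarrow> muu (del mC mD f0 p g) = muu mD \<odot> Z12 f0 p g - bsign p * (muu g \<odot> muhu mC)"
  by (simp add: muu_def del_def comp_assoc muhu_alt)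

text \<open>The functor equation cancels all terms in which \<open>mD\<close> meets only components
  of \<open>f0\<close>. Around \<open>g\<close> but not around the distinguished letter,
  \<open>mD\<close> combines with \<open>mC\<close> inside \<open>g\<close> to \<open>del\<close>;
  around both it gives the last summand, which is the contraction before the norm.\<close>

lemma muhm_Z13:
  assumes g: "op1 p g"
  shows "muhm mD \<odot> Z13 f0 p g = bsign p * (Z13 f0 p g \<odot> muhm mC)
    + (Fu f0 \<odot> sg (p + 1)) * muu (del mC mD f0 p g) * Fm f0
    + (Fu f0 \<odot> sg (p + 1)) * (mm mD \<odot> Z13 f0 p g) * Fu f0"
proof -
  have A: "muhm mD \<odot> Z13 f0 p g = (Fu f0 \<odot> sg (p + 1)) * (mm mD \<odot> Z13 f0 p g) * Fu f0
    + bsign p * (Z12 f0 p g \<odot> sg 1) * (mm mD \<odot> Fm f0) * Fu f0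
    + bsign p * (Z13 f0 p g \<odot> sg 1) * (muu mD \<odot> Fu f0) * Fu f0
    + (Fu f0 \<odot> sg (p + 1)) * (muu mD \<odot> Fu f0 \<odot> sg p) * Z13 f0 p g
    + (Fu f0 \<odot> sg (p + 1)) * (muu mD \<odot> Z12 f0 p g) * Fm f0
    + bsign p * (Z12 f0 p g \<odot> sg 1) * (muu mD \<odot> Fu f0) * Fm f0"
    using g by (simp add: muhm_alt times_Z13 times_Z12 times_Fm times_comp_grouplike comp_assoc algebra_simps)
  have D: "Fm f0 \<odot> muhm mC = (Fu f0 \<odot> sg 1) * (mm mD \<odot> Fm f0) * Fu f0
     + (Fm f0 \<odot> sg 1) * (muu mD \<odot> Fu f0) * Fu f0 + (Fu f0 \<odot> sg 1) * (muu mD \<odot> Fu f0) * Fm f0"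
    unfolding Fm_muhm by (simp add: muhm_alt times_Fm comp_assoc algebra_simps times_comp_grouplike) 
  have Z: "Z12 f0 p g \<odot> sg 1 = (Fu f0 \<odot> sg (p + 1)) * (muu g \<odot> sg 1) * (Fu f0 \<odot> sg 1)"
    "Z13 f0 p g \<odot> sg 1 = (Fu f0 \<odot> sg (p + 1)) * (muu g \<odot> sg 1) * (Fm f0 \<odot> sg 1)"
    by (simp_all add: Z12_def Z13_def times_sg comp_assoc)
  show ?thesis
    unfolding A Z13_muhm[OF f0 g mC] D Z mu_del[OF g] Fu_muhu times_sg comp_assoc
    by (cases p) (simp_all add: Z13_def algebra_simps)
qed

text \<open>The common core of the commutators of b with the contraction \<open>ii\<close> and with
  the correction \<open>hh\<close>: both have the form of a single letter \<open>P\<close> carrying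
  the mark, followed by the functor on the tail. The hypotheses say that \<open>P\<close> reads
  exactly one distinguished letter and returns a marked one.\<close>

lemma bb_letter:
  assumes P: "letter_valued P" "homog p P" "Mt \<odot> stm \<odot> P = P" "stu \<odot> P = 0" "(Es :: ('m lt, 'm lt list, 'k) wop) \<odot> P = 0"
    "P \<odot> Gu = 0" "P \<odot> muhu mC = 0" "P \<odot> Gm = P \<odot> sg 1"
  shows "bb mD \<odot> ((P * Fu f0) \<odot> NN) - bsign p * (((P * Fu f0) \<odot> NN) \<odot> bb mC) =
    ((mm mD \<odot> ((Fu f0 \<odot> sg p) * P * Fu f0) - bsign p * (P \<odot> muhm mC)) * Fu f0) \<odot> NN"
proof -
  define W where "W = (Fu f0 \<odot> sg p) * P * Fu f0"
  have times_W: "(X * Y) \<odot> W = (X \<odot> Fu f0 \<odot> sg p) * (Y \<odot> W) + (X \<odot> W) * (Y \<odot> Fu f0)"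
    for X Y :: "('m lt, 'm lt list, 'k) wop"
    unfolding W_def by (subst times_comp3) (simp_all add: P)
  have stW: "stu \<odot> W = 0" "stm \<odot> W = (geo f0 \<odot> stu \<odot> sg p) * (stm \<odot> P) * (geo f0 \<odot> stu)"
    by (simp_all add: W_def nf P)
  have EsW: "(Es :: ('m lt, 'm lt list, 'k) wop) \<odot> W = 0"
    by (simp add: W_def Es_times P one_comp_letter)
  have "Mt \<odot> stm \<odot> W = P"
    by (simp add: stW Mt_times one_comp_times) (use P(3) in \<open>simp add: comp_assoc\<close>)
  then have imW: "im \<odot> W = P"
    by (simp add: im_def comp_assoc times_W EsW)
  have IuW: "Iu \<odot> W = 0" "muu mD \<odot> W = 0"
    by (simp_all add: Iu_def muu_def comp_assoc stW)
  have "muhu mD \<odot> W = 0"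
    by (simp add: muhu_alt comp_assoc stW)
  moreover have "sg 1 \<odot> W = bsign p * (W \<odot> sg 1)"
    using homog_sg[of p W 1] homog_times[OF homog_times[OF homog_comp[OF homog_lt(5)[OF f0] homog_sgn] P(2)] homog_lt(5)[OF f0]]
    by (simp add: W_def)
  ultimately have W: "bbar mD \<odot> W = (mm mD \<odot> W) * Fu f0 + bsign p * (P \<odot> sg 1) * (muhu mD \<odot> Fu f0)"
    by (simp add: bbar_def times_W IuW comp_assoc comp_tail[OF imW] sg_lt_ops_tail)
  have "NN \<odot> ((P * Fu f0) \<odot> NN) = W \<odot> NN"
    unfolding W_def by (rule NN_PF) (simp_all add: P)
  then have 1: "bb mD \<odot> ((P * Fu f0) \<odot> NN) = ((mm mD \<odot> W) * Fu f0 + bsign p * (P \<odot> sg 1) * (muhu mD \<odot> Fu f0)) \<odot> NN"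
    using comp_tail[OF W, of NN] by (simp add: bb_def comp_assoc)
  have "((P * Fu f0) \<odot> NN) \<odot> bb mC = ((P * Fu f0) \<odot> muhm mC) \<odot> NN"
    by (simp add: comp_assoc NN_bb)
  also have "(P * Fu f0) \<odot> muhm mC = (P \<odot> muhm mC) * Fu f0 + (P \<odot> sg 1) * (muhu mD \<odot> Fu f0)"
    by (simp add: times_muhm P muhu_functor)
  finally show ?thesis
    unfolding 1 W_def[symmetric]
    by (cases p) (simp_all add: algebra_simps)
qed

lemma op1_del: "op1 p g \<Longrightarrow> op1 (p + 1) (del mC mD f0 p g)"
proof -
  assume g: "op1 p g"
  have "homog (p + 1) (mD \<odot> ((geo f0 \<odot> sg p) * g * geo f0))"
    using homog_comp[OF op1s(6) homog_times[OF homog_times[OF homog_comp[OF homog_geo1[OF f0] homog_sgn] op1D(3)[OF g]] homog_geo1[OF f0]]]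
    by (simp add: add.commute)
  moreover have "homog (p + 1) (bsign p * (g \<odot> muh0 mC))"
    using homog_comp[OF op1D(3)[OF g] homog_times[OF homog_times[OF homog_sgn op1s(3)] homog_idw]]
    by (cases p) (auto simp: muh0_def)
  ultimately show ?thesis
    using g unfolding op1_def del_def
    by (auto intro!: letter_valued_diff letter_valued_bs letter_valued_comp simp: bs_mult muh0_def)
qed

lemma Z13_right: 
  assumes "op1 p g"
  shows "Z13 f0 p g \<odot> Gu = 0" "Z13 f0 p g \<odot> muhu mC = 0" "Z13 f0 p g \<odot> Gm = Z13 f0 p g \<odot> sg 1"
proof -
  have Fm: "Fm f0 \<odot> Gu = 0" "Fm f0 \<odot> muhu mC = 0" "Fm f0 \<odot> Iu = 0" "Fm f0 \<odot> Gm = Fm f0 \<odot> sg 1"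
    by (simp_all add: Fm_def times_Gm times_comp_grouplike times_muhu times_sg)
  have sgGm: "sg p \<odot> Gm = Gm \<odot> sg p"
    by (simp add: Gm_def sg_times sg_im times_sg Gu_def comp_assoc sg_lt_ops_tail add.commute comp_tail[OF sg_im])
  show "Z13 f0 p g \<odot> Gu = 0" "Z13 f0 p g \<odot> muhu mC = 0" "Z13 f0 p g \<odot> Gm = Z13 f0 p g \<odot> sg 1"
    using assms by (simp_all add: Z13_def times_Gm times_comp_grouplike times_muhu times_sg Fm comp_assoc sg_Gu sgGm comp_tail[OF Fu_muhm(5)] add.commute)
qed

lemma Mt_stm_mm: "op1 1 m \<Longrightarrow> Mt \<odot> stm \<odot> mm m \<odot> W = mm m \<odot> W"
proof -
  assume m: "op1 1 m"
  have "Mt \<odot> stm \<odot> mm m = mm m"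
    by (simp add: stm_mm[OF m]) (simp add: mm_def iot_def nf lin1_geo_stu comp_tail[OF lin1_geo_stu])
  from comp_tail[OF this] show ?thesis by (simp add: comp_assoc)
qed

text \<open>By \<open>bb_letter\<close> everything is expressed through \<open>mm mD\<close> applied
  to the terms of \<open>muhm_Z13\<close>. The composite with the coderivation of D vanishes by the
  A-infinity relation, and the term with \<open>del\<close> is what remains.\<close>

lemma cartan_b:
  assumes g: "op1 p g"
  shows "bb mD \<odot> ii mD f0 p g + bsign p * (ii mD f0 p g \<odot> bb mC) = - ii mD f0 (p + 1) (del mC mD f0 p g)"
proof -
  define P where "P = mm mD \<odot> Z13 f0 p g"
  have "homog (p + 1) P"
    unfolding P_def using homog_comp[OF homog_mm[OF mD] homog_Z13[OF f0 g]] by (simp add: add.commute)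
  then have e1: "bb mD \<odot> ((P * Fu f0) \<odot> NN) - bsign (p + 1) * (((P * Fu f0) \<odot> NN) \<odot> bb mC) =
    ((mm mD \<odot> ((Fu f0 \<odot> sg (p + 1)) * P * Fu f0) - bsign (p + 1) * (P \<odot> muhm mC)) * Fu f0) \<odot> NN"
    by (intro bb_letter) (use g in \<open>simp_all add: P_def Mt_stm_mm comp_assoc Z13_right\<close>)
  have "mm mD \<odot> muhm mD \<odot> Z13 f0 p g = 0"
    using comp_tail[OF mm_sq] by simp
  then have e2: "mm mD \<odot> ((Fu f0 \<odot> sg (p + 1)) * P * Fu f0) - bsign (p + 1) * (P \<odot> muhm mC) =
      - (mm mD \<odot> ((Fu f0 \<odot> sg (p + 1)) * muu (del mC mD f0 p g) * Fm f0))"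
    unfolding muhm_Z13[OF g] P_def[symmetric]
    by (cases p) (simp_all add: P_def comp_assoc eq_neg_iff_add_eq_0 algebra_simps)
  show ?thesis
    unfolding ii_def ibar_def P_def[symmetric] Z13_def[of f0 "p + 1"]
    using e1[unfolded e2] by (cases p) simp_all
qed

text \<open>Since the output of \<open>g\<close> stands to the left of the distinguished letter,
  \<open>Unit\<close> can only be multiplied from the left, and only by that output: one unit term
  survives.\<close>

lemma mm_Z13: "op1 p g \<Longrightarrow> mm m \<odot> Z13 f0 p g = (Mt \<odot> m \<odot> stm \<odot> Z13 f0 p g) - bsign p * ((Mt \<odot> g \<odot> stu \<odot> sg 1) * Es)"
proof -
  assume g: "op1 p g"
  have "iot \<odot> Z12 f0 p g = Mt \<odot> g \<odot> stu"
    using g by (simp add: iot_def comp_assoc Mt_times one_comp_times one_comp_letter' one_comp_letter nf)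
  moreover have "(iot \<odot> sg 1) \<odot> Z12 f0 p g = bsign p * ((iot \<odot> Z12 f0 p g) \<odot> sg 1)"
    using homog_sg[OF homog_Z12[OF f0 g], of 1] by (simp add: comp_assoc)
  ultimately show ?thesis
    using g by (simp add: mm_def times_Z13 comp_assoc bs_commute mult.assoc)
qed

text \<open>Contraction of a chain headed by e^+: the higher operations vanish on the formal unit,
  so only the product of the output of \<open>g\<close> with e^+ contributes, by
  \<open>mm_Z13\<close>.\<close>

lemma ii_pre:
  assumes g: "op1 p g"
  shows "ii mD f0 p g \<odot> pre = - (bsign p * ((ut \<odot> geo f0) \<oslash> (Mt \<odot> g)))"
proof -
  have N: "noE ((Mt \<odot> mD \<odot> stm \<odot> Z13 f0 p g) * Fu f0)"
    unfolding stm_Z13[OF f0 g] Fu_def by (intro noE_closed noE_st)+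
  have "ibar mD f0 p g = (Mt \<odot> mD \<odot> stm \<odot> Z13 f0 p g) * Fu f0
      - bsign p * (((Mt \<odot> g \<odot> sg 1) \<odot> stu) * Es * ((ut \<odot> geo f0) \<odot> stu))"
    unfolding ibar_def mm_Z13[OF g] by (simp add: Fu_def nf left_diff_distrib mult.assoc) 
  then have "ii mD f0 p g \<odot> pre = ((Mt \<odot> mD \<odot> stm \<odot> Z13 f0 p g) * Fu f0
      - bsign p * (((Mt \<odot> g \<odot> sg 1) \<odot> stu) * Es * ((ut \<odot> geo f0) \<odot> stu))) \<odot> (NN \<odot> pre)"
    by (simp only: ii_def comp_assoc)
  also have "\<dots> = - (bsign p * ((ut \<odot> geo f0) \<oslash> (Mt \<odot> g)))"
    by (simp only: comp_linear_left bs_comp noE_NN_pre[OF N] Es_NN_pre) (simp add: comp_assoc)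
  finally show ?thesis .
qed

end

lemma opp_Es: "X \<oslash> Es = (X \<odot> sg 1) * Es"
proof (rule wop_eqI)
  fix z
  show "ap (X \<oslash> Es) z = ap ((X \<odot> sg 1) * Es) z"
    unfolding opp_def ap_Op ap_times
    by (rule sum.cong) (auto simp: ap_Es)
qed

definition oppbox :: "('a::letter, 'b list, 'k::field) wop \<Rightarrow> ('a, 'b list, 'k) wop \<Rightarrow> 'a list \<times> 'a list \<Rightarrow> ('b list \<Rightarrow>\<^sub>0 'k)"
  where "oppbox X Y = (\<lambda>(u, v). csc (bsign (epar u * epar v)) (ap Y v * ap X u))"

lemma opp_comp: "(X \<oslash> Y) \<odot> Z = post (oppbox X Y) (Dec Z)"
proof -
  have "clin (oppbox X Y) (dec w) = ap (X \<oslash> Y) w" for w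
    by (simp add: dec_def clin_sum oppbox_def opp_def)
  then show ?thesis by (auto simp: wop_eq_iff clin_clin)
qed

lemma post_oppbox:
  fixes A B :: "('a::letter, 'd::letter list, 'c::field) wop"
  assumes "homog 0 A" "homog 0 B"
  shows "post (oppbox X Y) (lft A * rgt B) = (X \<odot> A) \<oslash> (Y \<odot> B)"
proof (rule wop_eqI)
  fix w :: "'a list"
  have "clin (oppbox X Y) (clin inl (ap A u) * clin inr (ap B v)) =
     csc (bsign (epar u * epar v)) (clin (ap Y) (ap B v) * clin (ap X) (ap A u))" for u v
  proof -
    have "clin (oppbox X Y) (clin inl (ap A u) * clin inr (ap B v)) =
      clin (\<lambda>u'. clin (\<lambda>v'. oppbox X Y (u', v')) (ap B v)) (ap A u)"
      by (simp add: clin_mult clin_clin inl_def inr_def mult_single)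
    also have "\<dots> = clin (\<lambda>u'. clin (\<lambda>v'. csc (bsign (epar u * epar v)) (ap Y v' * ap X u')) (ap B v)) (ap A u)"
      using assms by (intro clin_cong refl) (auto simp: homog_def oppbox_def)
    also have "\<dots> = csc (bsign (epar u * epar v)) (clin (\<lambda>v'. clin (\<lambda>u'. ap Y v' * ap X u') (ap A u)) (ap B v))"
      by (subst clin_swap) (simp add: clin_csc_fun)
    finally show ?thesis by (simp add: clin_mult)
  qed
  then show "ap (post (oppbox X Y) (lft A * rgt B)) w = ap ((X \<odot> A) \<oslash> (Y \<odot> B)) w"
    by (simp add: ap_times clin_sum opp_def)
qed

lemma opp_stm:
  fixes X Y :: "('l::letter, 'm list, 'k::field) wop"
  shows "(X \<oslash> Y) \<odot> stm = (X \<odot> stu) \<oslash> (Y \<odot> stm) + (X \<odot> stm) \<oslash> (Y \<odot> stu)"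
proof -
  have "Dec stm = lft stu * rgt stm + lft stm * rgt (stu :: ('l lt, 'l list, 'k) wop)"
    unfolding stm_def by (rule Dec3) simp_all
  then show ?thesis by (simp add: opp_comp post_oppbox)
qed

lemma headM_letter: "letter_valued X \<Longrightarrow> headM \<odot> (X * Y) = (Mt \<odot> X) * (ut \<odot> Y)"
proof -
  assume X: "letter_valued X"
  have h: "ap headM (u @ v) = ap Mt u * ap ut v" if "u \<in> Poly_Mapping.keys (ap X w)" for u v w
    using letter_valuedD[OF X that] by (auto simp: Mt_def mult_single plus_list_def)
  have "clin (ap headM) (ap X w * y) = clin (ap Mt) (ap X w) * clin (ap ut) y" for w y
  proof -
    have "clin (ap headM) (ap X w * y) = clin (\<lambda>u. clin (\<lambda>v. ap headM (u @ v)) y) (ap X w)"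
      by (subst mult_conv_clin) (simp add: clin_clin plus_list_def)
    also have "\<dots> = clin (\<lambda>u. clin (\<lambda>v. ap Mt u * ap ut v) y) (ap X w)"
      by (intro clin_cong refl) (use h in blast)
    finally show ?thesis by (simp add: clin_mult)
  qed
  then show ?thesis
    by (auto simp: wop_eq_iff ap_times clin_sum)
qed

lemma NN_opp_tail: "letter_valued c \<Longrightarrow> homog p X \<Longrightarrow> homog 0 c \<Longrightarrow> tt \<odot> (X * c) \<odot> NN = ((c \<odot> sg p) * X) \<odot> NN"
proof -
  assume *: "letter_valued c" "homog p X" "homog 0 c"
  have "tt \<odot> (X * c) = X \<oslash> (c \<odot> sg p)"
    using post_mulrev[OF *(2,3)] by (simp add: tt_times_letter *(1))
  from comp_tail[OF this, of NN] show ?thesis by (simp add: opp_NN)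
qed

context functor_ops
begin

definition Zb where "Zb p g = ((geo f0 \<odot> sg p) \<odot> stu) * (g \<odot> stu) * (geo f0 \<odot> stm)"
definition Zu where "Zu p g = ((geo f0 \<odot> sg p) * g * geo f0) \<odot> stu"

lemma Zb_left: "Zb p g = (g \<odot> stu) * (geo f0 \<odot> stm) + (f0 \<odot> stu \<odot> sg p) * Zb p g"
proof -
  have "(geo f0 \<odot> sg p) \<odot> stu = ((1 + f0 * geo f0) \<odot> sg p) \<odot> stu"
    by (rule arg_cong[OF geo_rec]) simp
  also have "\<dots> = 1 + (f0 \<odot> stu \<odot> sg p) * ((geo f0 \<odot> sg p) \<odot> stu)"
    by (simp add: nf)
  finally have *: "(geo f0 \<odot> sg p) \<odot> stu = \<dots>" .
  have "Zb p g = (1 + (f0 \<odot> stu \<odot> sg p) * ((geo f0 \<odot> sg p) \<odot> stu)) * (g \<odot> stu) * (geo f0 \<odot> stm)"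
    unfolding Zb_def by (rule arg_cong[OF *])
  then show ?thesis by (simp add: Zb_def algebra_simps)
qed

lemma Zb_right: "Zb p g = Zu p g * (f0 \<odot> stm) + Zb p g * (f0 \<odot> stu)"
proof -
  have "geo f0 \<odot> stm = (1 + geo f0 * f0) \<odot> stm"
    by (rule arg_cong[OF geo_rec_right]) simp
  also have "\<dots> = (geo f0 \<odot> stu) * (f0 \<odot> stm) + (geo f0 \<odot> stm) * (f0 \<odot> stu)"
    by (simp add: times_stm add.commute)
  finally have *: "geo f0 \<odot> stm = \<dots>" .
  have "Zb p g = ((geo f0 \<odot> sg p) \<odot> stu) * (g \<odot> stu) * ((geo f0 \<odot> stu) * (f0 \<odot> stm) + (geo f0 \<odot> stm) * (f0 \<odot> stu))"
    unfolding Zb_def by (rule arg_cong[OF *])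
  also have "\<dots> = Zu p g * (f0 \<odot> stm) + Zb p g * (f0 \<odot> stu)"
    unfolding Zb_def Zu_def times_stu by (simp only: distrib_left mult.assoc)
  finally show ?thesis .
qed

lemma homog_Zb: "op1 p g \<Longrightarrow> homog p (Zb p g)" "op1 p g \<Longrightarrow> homog p (Zu p g)"
  unfolding Zb_def Zu_def times_stu
  using homog_times[OF homog_times[OF homog_comp[OF homog_comp[OF homog_geo1[OF f0] homog_sgn] homog_st(1)]
    homog_comp[OF op1D(3) homog_st(1)]] homog_comp[OF homog_geo1[OF f0] homog_st(2)]]
   homog_times[OF homog_times[OF homog_comp[OF homog_comp[OF homog_geo1[OF f0] homog_sgn] homog_st(1)]
    homog_comp[OF op1D(3) homog_st(1)]] homog_comp[OF homog_geo1[OF f0] homog_st(1)]]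
  by simp_all

text \<open>Here \<open>Zb\<close> is \<open>Z13\<close> with the mark forgotten. A word of it
  starting with a component of \<open>f0\<close> that does not contain a_0 is the rotation of one
  ending with it, so these cancel. What survives has \<open>g\<close> in front or, after rotation,
  the component containing a_0 in front.\<close>

lemma rot_Zb:
  assumes g: "op1 p g"
  shows "Zb p g \<odot> NN - tt \<odot> Zb p g \<odot> NN =
    ((g \<odot> stu) * (geo f0 \<odot> stm)) \<odot> NN - ((f0 \<odot> stm \<odot> sg p) * Zu p g) \<odot> NN"
proof -
  have f: "letter_valued (f0 \<odot> stm)" "letter_valued (f0 \<odot> stu)" "homog 0 (f0 \<odot> stm)" "homog 0 (f0 \<odot> stu)"
    using homog_comp[OF op1s(9) homog_st(1)] homog_comp[OF op1s(9) homog_st(2)] by (simp_all add: letter_valued_comp)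
  have "tt \<odot> Zb p g \<odot> NN = tt \<odot> (Zu p g * (f0 \<odot> stm)) \<odot> NN + tt \<odot> (Zb p g * (f0 \<odot> stu)) \<odot> NN"
    by (subst Zb_right) simp
  also have "\<dots> = ((f0 \<odot> stm \<odot> sg p) * Zu p g) \<odot> NN + ((f0 \<odot> stu \<odot> sg p) * Zb p g) \<odot> NN"
    using f homog_Zb[OF g] by (simp add: NN_opp_tail comp_assoc)
  finally have "tt \<odot> Zb p g \<odot> NN = \<dots>" .
  moreover have "Zb p g \<odot> NN = ((g \<odot> stu) * (geo f0 \<odot> stm)) \<odot> NN + ((f0 \<odot> stu \<odot> sg p) * Zb p g) \<odot> NN"
    by (subst Zb_left) simp
  ultimately show ?thesis by simp
qed

text \<open>The part of the Cartan formula of first order in u. By \<open>bbar_pre\<close>, b after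
  \<open>SS\<close> produces 1 - t, which \<open>rot_Zb\<close> reduces to boundary words. Those
  with \<open>g\<close> in front cancel against the contraction after B; the rest are the summands
  of the Lie derivative.\<close>

lemma cartan_B:
  assumes g: "op1 p g"
  shows "bb mD \<odot> SS f0 p g + bsign p * (SS f0 p g \<odot> bb mC) + BB \<odot> ii mD f0 p g + bsign p * (ii mD f0 p g \<odot> BB) =
    - LL f0 p g - SS f0 (p + 1) (del mC mD f0 p g)"
proof -
  have Zb: "stm \<odot> Z13 f0 p g = Zb p g" "stm \<odot> (Z13 f0 p g \<odot> W) = Zb p g \<odot> W" for W
    using stm_Z13[OF f0 g] comp_tail[OF stm_Z13[OF f0 g]] by (simp_all add: Zb_def)
  have Zu: "stu \<odot> Z12 f0 p g = Zu p g"
    using g by (simp add: Zu_def)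
  have pre_Zu: "pre \<odot> Zu p g = et * Z12 f0 p g"
    using g by (simp add: pre_def Zu_def Z12_def times_stu times_comp3 grpl_comp Dec_geo letter_valued_comp et_eq
       one_comp_times one_comp_letter Fu_def muu_def nf Dec_comp_sg)
  have 1: "bb mD \<odot> SS f0 p g = headM \<odot> (Zb p g \<odot> NN - tt \<odot> Zb p g \<odot> NN) - pre \<odot> muh0 mD \<odot> Zb p g \<odot> NN"
    using comp_tail[OF bbar_pre[OF mD], of "Zb p g \<odot> NN"] by (simp add: SS_def Zb comp_assoc)
  have P: "letter_valued (mm mD \<odot> Z13 f0 p g)" "homog (p + 1) (mm mD \<odot> Z13 f0 p g)"
    using homog_comp[OF homog_mm[OF mD] homog_Z13[OF f0 g]] by (simp_all add: add.commute)
  \<comment> \<open>\<open>SS\<close> after b and B after the contraction are two of the terms of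
    \<open>muhm_Z13\<close>, which trades them for the coderivation of D and
    \<open>del\<close>.\<close>
  have 2: "bsign p * (SS f0 p g \<odot> bb mC) + BB \<odot> ii mD f0 p g =
      pre \<odot> stm \<odot> muhm mD \<odot> Z13 f0 p g \<odot> NN - SS f0 (p + 1) (del mC mD f0 p g)"
    using NN_PF[OF P grpl_Fu(1)[OF f0] homog_lt(5)[OF f0]] comp_tail[OF muhm_Z13[OF g], of NN]
    by (simp add: SS_def BB_def ii_def ibar_def comp_assoc NN_bb Z13_def[of f0 "p + 1"])
  have "stm \<odot> muhm mD \<odot> Z13 f0 p g = muh0 mD \<odot> Zb p g - bsign p * ((Zu p g \<odot> sg 1) * Es)"
    using comp_tail[OF stm_muhm[OF mD], of "Z13 f0 p g"] g homog_sg[OF homog_Z12[OF f0 g], of 1]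
    by (simp add: times_Z13 Zb comp_assoc comp_tail[OF Zu] bs_commute) (cases p; simp)
  from comp_tail[OF this, of NN]
  have "stm \<odot> muhm mD \<odot> Z13 f0 p g \<odot> NN = muh0 mD \<odot> Zb p g \<odot> NN - bsign p * ((Es * Zu p g) \<odot> NN)"
    using opp_NN[of "Zu p g" Es] by (simp add: comp_assoc opp_Es)
  then have 3: "pre \<odot> stm \<odot> muhm mD \<odot> Z13 f0 p g \<odot> NN = pre \<odot> muh0 mD \<odot> Zb p g \<odot> NN
      - bsign p * ((Es * (et * Z12 f0 p g)) \<odot> NN)"
    by (simp add: comp_Es pre_Zu flip: comp_assoc[of pre "Es * _"])
  have "ii mD f0 p g \<odot> BB = - (bsign p * (((ut \<odot> geo f0) \<oslash> (Mt \<odot> g)) \<odot> stm \<odot> NN))"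
    using comp_tail[OF ii_pre[OF g]] by (simp add: BB_def comp_assoc)
  also have "((ut \<odot> geo f0) \<oslash> (Mt \<odot> g)) \<odot> stm \<odot> NN =
     ((Mt \<odot> g \<odot> stm) * Fu f0) \<odot> NN + ((Mt \<odot> g \<odot> stu) * (ut \<odot> geo f0 \<odot> stm)) \<odot> NN"
    using comp_tail[OF opp_stm[of "ut \<odot> geo f0" "Mt \<odot> g"], of NN] by (simp add: opp_NN comp_assoc Fu_def)
  finally have 4: "ii mD f0 p g \<odot> BB = - (bsign p * (((Mt \<odot> g \<odot> stm) * Fu f0) \<odot> NN + ((Mt \<odot> g \<odot> stu) * (ut \<odot> geo f0 \<odot> stm)) \<odot> NN))" .
  have 5: "headM \<odot> ((g \<odot> stu) * (geo f0 \<odot> stm)) \<odot> NN = ((Mt \<odot> g \<odot> stu) * (ut \<odot> geo f0 \<odot> stm)) \<odot> NN"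
    by (rule comp_tail, rule headM_letter) (use g in \<open>simp add: letter_valued_comp\<close>)
  have utZ: "ut \<odot> Zu p g = Z12 f0 p g"
    by (simp add: Zu_def Z12_def nf Fu_def muu_def)
  have 6: "headM \<odot> ((f0 \<odot> stm \<odot> sg p) * Zu p g) \<odot> NN = ((Mt \<odot> f0 \<odot> stm \<odot> sg p) * Z12 f0 p g) \<odot> NN"
    unfolding utZ[symmetric] by (rule comp_tail, rule headM_letter) (simp add: letter_valued_comp)
  have 7: "LL f0 p g = ((Mt \<odot> g \<odot> stm) * Fu f0) \<odot> NN + ((Mt \<odot> f0 \<odot> stm \<odot> sg p) * Z12 f0 p g) \<odot> NN
      + bsign p * ((Es * (et * Z12 f0 p g)) \<odot> NN)"
    by (simp add: LL_def Lbar_def fm_def nf algebra_simps)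
  show ?thesis
    unfolding 1 rot_Zb[OF g] 4 7 comp_linear 5 6
    using 2[unfolded 3] by (cases p) (simp_all add: algebra_simps)
qed

end

definition idl :: "('l::letter, 'l list, 'k::field) wop"
  where "idl = on_letter (\<lambda>x. word [x])"

lemma op1_idl [simp]: "op1 0 idl"
  unfolding op1_def idl_def by (auto intro!: letter_valued_on_letter homog_on_letter split: if_splits)

lemma geo_idl [simp]: "geo idl = idw"
proof (rule wop_eqI)
  fix w :: "'a list"
  show "ap (geo idl) w = ap idw w"
    by (induction w) (simp_all add: idl_def lin1_on_letter ap_geo_Cons mult_single plus_list_def)
qed

lemma Mt_idl: "Mt \<odot> idl = Mt"
  by (rule lin1_eqI) (simp_all add: idl_def lin1_comp_on_letter)

lemma id_ops [simp]: "Fu idl = Iu" "fm idl = im" "Fm idl = Im" "Z12 idl 1 g = muhu g"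
  by (simp_all add: Fu_def Iu_def fm_def im_def comp_tail[OF Mt_idl] Fm_def Im_def Z12_def muhu_def Gu_def)

lemma lin1_idl: "lin1 idl"
  by (simp add: idl_def lin1_on_letter)

lemma idl_letter: "letter_valued g \<Longrightarrow> idl \<odot> g = g"
proof (rule wop_eqI)
  fix w assume g: "letter_valued g"
  have "clin (ap idl) (ap g w) = clin word (ap g w)"
    by (intro clin_cong) (auto dest!: letter_valuedD[OF g] simp: idl_def)
  then show "ap (idl \<odot> g) w = ap g w" by simp
qed

lemma idl_muh0: "op1 1 m \<Longrightarrow> idl \<odot> muh0 m = m"
  by (simp add: muh0_def lin1_times[OF lin1_idl] one_comp_times one_comp_letter idl_letter)

lemma functor_ops_idl: "op1 1 m \<Longrightarrow> m \<odot> muh0 m = 0 \<Longrightarrow> functor_ops m m idl"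
  by unfold_locales (simp_all add: idl_muh0)

text \<open>The correction term, with F applied around both \<open>\<phi>\<close> and a_0. For
  closed \<open>\<phi>\<close> it is a homotopy between contracting with \<open>\<phi>\<close>
  before F_* and contracting along \<open>f\<close> with the pushed forward cochain
  \<open>f \<odot> muh0 \<phi>\<close>.\<close>

definition hh where "hh f \<phi> = ((fm f \<odot> Z13 idl 1 \<phi>) * Fu f) \<odot> NN"

lemma mu_0 [simp]: "muu 0 = 0"
  by (simp add: muu_def)

lemma geo_muh0:
  assumes "op1 0 f" "op1 1 \<phi>"
  shows "geo f \<odot> muh0 \<phi> = (geo f \<odot> sg 1) * (f \<odot> muh0 \<phi>) * geo f"
proof -
  have "geo f \<odot> muh0 \<phi> = (1 + f * geo f) \<odot> muh0 \<phi>"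
    by (rule arg_cong2[OF geo_rec refl]) (use assms in simp)
  also have "\<dots> = (f \<odot> muh0 \<phi>) * geo f + (f \<odot> sg 1) * (geo f \<odot> muh0 \<phi>)"
    using assms by (simp add: times_muh0)
  finally have "geo f \<odot> muh0 \<phi> = geo (f \<odot> sg 1) * ((f \<odot> muh0 \<phi>) * geo f)"
    using assms(1) by (intro geo_unique) simp_all
  also have "\<dots> = (geo f \<odot> sg 1) * (f \<odot> muh0 \<phi>) * geo f"
    using assms by (simp add: geo_sg mult.assoc)
  finally show ?thesis .
qed

lemma op1_comp_muh0: "op1 0 f \<Longrightarrow> op1 1 \<phi> \<Longrightarrow> op1 1 (f \<odot> muh0 \<phi>)"
proof -
  assume f: "op1 0 f" and \<phi>: "op1 1 \<phi>"
  have "homog 1 (f \<odot> muh0 \<phi>)"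
    using homog_comp[OF op1D(3)[OF f] homog_times[OF homog_times[OF homog_sgn op1D(3)[OF \<phi>]] homog_idw]]
    by (simp add: muh0_def)
  moreover have "letter_valued (f \<odot> muh0 \<phi>)" "ap (f \<odot> muh0 \<phi>) [] = 0"
    using f \<phi> by (simp_all add: letter_valued_comp muh0_def)
  ultimately show ?thesis by (simp only: op1_def)
qed

lemma op1_comp_geo: "op1 0 f \<Longrightarrow> op1 p \<psi> \<Longrightarrow> op1 p (\<psi> \<odot> geo f)"
proof -
  assume f: "op1 0 f" and \<phi>: "op1 p \<psi>"
  have "homog p (\<psi> \<odot> geo f)"
    using homog_comp[OF op1D(3)[OF \<phi>] homog_geo1[OF f]] by simp
  moreover have "letter_valued (\<psi> \<odot> geo f)" "ap (\<psi> \<odot> geo f) [] = 0"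
    using f \<phi> by (simp_all add: letter_valued_comp)
  ultimately show ?thesis by (simp only: op1_def)
qed

lemma Fu_muhu_general: "op1 0 f \<Longrightarrow> op1 1 \<phi> \<Longrightarrow> Fu f \<odot> muhu \<phi> = (Fu f \<odot> sg 1) * muu (f \<odot> muh0 \<phi>) * Fu f"
  by (simp add: Fu_def muhu_alt comp_assoc comp_tail[OF geo_muh0] muu_def nf)

context functor_ops
begin

text \<open>No component of the functor takes \<open>Unit\<close> together with other letters, so
  only the rotation headed by \<open>Unit\<close> contributes, and the tail is mapped by the
  coalgebra map.\<close>

lemma FF_pre: "FF f0 \<odot> pre = pre \<odot> geo f0"
proof -
  have N: "noE ((Mt \<odot> f0 \<odot> stm) * Fu f0)"
    unfolding Fu_def by (intro noE_closed noE_st)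
  have "Fbar f0 = (Mt \<odot> f0 \<odot> stm) * Fu f0 + (1 \<odot> stu) * Es * ((et * (ut \<odot> geo f0)) \<odot> stu)"
    by (simp add: Fbar_def fm_def Fu_def nf algebra_simps)
  then have "FF f0 \<odot> pre = ((Mt \<odot> f0 \<odot> stm) * Fu f0 + (1 \<odot> stu) * Es * ((et * (ut \<odot> geo f0)) \<odot> stu)) \<odot> (NN \<odot> pre)"
    by (simp only: FF_def comp_assoc)
  also have "\<dots> = et * (ut \<odot> geo f0)"
    by (simp only: comp_linear_left noE_NN_pre[OF N] Es_NN_pre) simp
  finally show ?thesis
    by (simp add: pre_def times_comp_grouplike Dec_geo et_eq)
qed

lemma FF_BB: "FF f0 \<odot> BB = BB \<odot> FF f0"
  by (simp add: BB_def comp_tail[OF FF_pre] comp_tail[OF stm_Fm[OF f0]] comp_assoc NN_FF)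

lemma mm_Z13_times:
  assumes "op1 1 \<psi>"
  shows "ii mD idl 1 \<psi> \<odot> FF f0 = ii mD f0 1 (\<psi> \<odot> geo f0)"
    and "SS idl 1 \<psi> \<odot> FF f0 = SS f0 1 (\<psi> \<odot> geo f0)"
proof -
  have Z: "Z13 idl 1 \<psi> \<odot> Fm f0 = Z13 f0 1 (\<psi> \<odot> geo f0)"
    by (simp add: Z13_def times_Fm times_comp_grouplike comp_assoc sg_lt_ops) (simp add: muu_def Fu_def nf)
  have Z': "Z13 idl 1 \<psi> \<odot> Fu f0 = 0"
    by (simp add: Z13_def times_comp_grouplike)
  have "ii mD idl 1 \<psi> \<odot> FF f0 = (ibar mD idl 1 \<psi> \<odot> Fm f0) \<odot> NN"
    by (simp add: ii_def comp_assoc NN_FF)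
  also have "ibar mD idl 1 \<psi> \<odot> Fm f0 = ibar mD f0 1 (\<psi> \<odot> geo f0)"
    by (simp add: ibar_def times_Fm comp_assoc Z Z')
  finally show "ii mD idl 1 \<psi> \<odot> FF f0 = ii mD f0 1 (\<psi> \<odot> geo f0)"
    by (simp add: ii_def)
  show "SS idl 1 \<psi> \<odot> FF f0 = SS f0 1 (\<psi> \<odot> geo f0)"
    by (simp add: SS_def comp_assoc NN_FF comp_tail[OF Z])
qed

context
  fixes \<phi> :: "('l, 'l list, 'k) wop"
  assumes \<phi>: "op1 1 \<phi>" and closed: "mC \<odot> muh0 \<phi> + \<phi> \<odot> muh0 mC = 0"
begin

interpretation idC: functor_ops mC mC idl
  by (rule functor_ops_idl) (simp_all add: mC_sq)

lemma Z13_sym: "Z13 idl 1 \<phi> \<odot> muhm mC = Iu * (mm mC \<odot> Z13 idl 1 \<phi>) * Iu - muhm mC \<odot> Z13 idl 1 \<phi>"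
proof -
  have "del mC mC idl 1 \<phi> = 0"
    using closed by (simp add: del_def muh0_def)
  then show ?thesis
    using idC.muhm_Z13[OF \<phi>] by simp
qed

text \<open>The component of F that contains the output of \<open>\<phi>\<close> either contains a_0
  as well, or it does not and the cochain is pushed forward.\<close>

lemma Fm_Z13: "Fm f0 \<odot> Z13 idl 1 \<phi> = (Fu f0 \<odot> sg 1) * (fm f0 \<odot> Z13 idl 1 \<phi>) * Fu f0 + Z13 f0 1 (f0 \<odot> muh0 \<phi>)"
  using \<phi> by (simp add: Fm_def[of f0] times_Im times_Z13 comp_assoc Fu_muhu_general Z13_def[of f0] distrib_right mult.assoc)

lemma hh_P: "letter_valued (fm f0 \<odot> Z13 idl 1 \<phi>)" "homog 1 (fm f0 \<odot> Z13 idl 1 \<phi>)"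
    "fm f0 \<odot> Z13 idl 1 \<phi> = Mt \<odot> f0 \<odot> stm \<odot> Z13 idl 1 \<phi>"
  using homog_comp[OF homog_fm[OF f0] homog_Z13[OF op1_idl \<phi>]] \<phi>
  by (simp_all add: letter_valued_comp fm_def comp_assoc times_Z13 comp_tail[OF Es_ops(1)])

text \<open>After \<open>bb_letter\<close>, closedness of \<open>\<phi>\<close>, in the form
  \<open>Z13_sym\<close>, moves the coderivation of C past \<open>\<phi>\<close>; the functor
  equation then replaces it by the operation of D around \<open>Fm f0\<close>, which
  \<open>Fm_Z13\<close> splits.\<close>

lemma bb_hh: "bb mD \<odot> hh f0 \<phi> + hh f0 \<phi> \<odot> bb mC = FF f0 \<odot> ii mC idl 1 \<phi> - ii mD f0 1 (f0 \<odot> muh0 \<phi>)"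
proof -
  let ?Z = "Z13 idl 1 \<phi>"
  let ?P = "fm f0 \<odot> ?Z"
  let ?Q = "mm mC \<odot> ?Z"
  let ?W = "(Fu f0 \<odot> sg 1) * ?P * Fu f0"
  have MtP: "Mt \<odot> stm \<odot> ?P = ?P"
    unfolding hh_P(3) using letter_proj[of "f0 \<odot> stm \<odot> ?Z"] by (simp add: letter_valued_comp)
  have 1: "bb mD \<odot> hh f0 \<phi> + hh f0 \<phi> \<odot> bb mC = ((mm mD \<odot> ?W + (?P \<odot> muhm mC)) * Fu f0) \<odot> NN"
    using bb_letter[of ?P 1, OF hh_P(1,2) MtP] \<phi> idC.Z13_right[OF \<phi>]
    by (simp add: hh_def comp_assoc comp_tail[OF Es_ops(11)])
  have "?P \<odot> muhm mC = fm f0 \<odot> (Iu * ?Q * Iu) - (fm f0 \<odot> muhm mC) \<odot> ?Z"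
    by (simp add: comp_assoc Z13_sym)
  also have "(fm f0 \<odot> muhm mC) \<odot> ?Z = mm mD \<odot> ?W + mm mD \<odot> Z13 f0 1 (f0 \<odot> muh0 \<phi>)"
    unfolding mm_functor[symmetric] by (simp add: comp_assoc Fm_Z13)
  finally have 2: "mm mD \<odot> ?W + (?P \<odot> muhm mC) = fm f0 \<odot> (Iu * ?Q * Iu) - mm mD \<odot> Z13 f0 1 (f0 \<odot> muh0 \<phi>)"
    by simp
  have Q: "letter_valued ?Q" "homog 0 ?Q"
    using homog_comp[OF homog_mm[OF mC] homog_Z13[OF op1_idl \<phi>]] by simp_all
  have "FF f0 \<odot> ii mC idl 1 \<phi> = Fbar f0 \<odot> NN \<odot> ((?Q * Iu) \<odot> NN)"
    by (simp add: FF_def ii_def ibar_def comp_assoc)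
  also have "\<dots> = (Fbar f0 \<odot> (Iu * ?Q * Iu)) \<odot> NN"
    using NN_PF[OF Q, of Iu] by (simp add: comp_assoc)
  also have "Fbar f0 \<odot> (Iu * ?Q * Iu) = (fm f0 \<odot> (Iu * ?Q * Iu)) * Fu f0"
    unfolding Fbar_def by (subst times_comp3) (simp_all add: Q)
  finally have "FF f0 \<odot> ii mC idl 1 \<phi> = ((fm f0 \<odot> (Iu * ?Q * Iu)) * Fu f0) \<odot> NN" .
  then show ?thesis
    unfolding 1 2 by (simp add: ii_def ibar_def left_diff_distrib)
qed

lemma BB_hh: "BB \<odot> hh f0 \<phi> + hh f0 \<phi> \<odot> BB = FF f0 \<odot> SS idl 1 \<phi> - SS f0 1 (f0 \<odot> muh0 \<phi>)"
proof -
  let ?Z = "Z13 idl 1 \<phi>"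
  have N: "noE ((Mt \<odot> f0 \<odot> stm \<odot> ?Z) * Fu f0)"
    unfolding stm_Z13[OF op1_idl \<phi>] Fu_def by (intro noE_closed noE_st)
  have "hh f0 \<phi> \<odot> pre = 0"
    using noE_NN_pre[OF N] by (simp add: hh_def hh_P(3) comp_assoc)
  then have 1: "hh f0 \<phi> \<odot> BB = 0"
    using comp_tail[of "hh f0 \<phi>" pre 0] by (simp add: BB_def)
  have 2: "BB \<odot> hh f0 \<phi> = pre \<odot> stm \<odot> ((Fu f0 \<odot> sg 1) * (fm f0 \<odot> ?Z) * Fu f0) \<odot> NN"
    using NN_PF[OF hh_P(1,2) grpl_Fu(1)[OF f0] homog_lt(5)[OF f0]] by (simp add: BB_def hh_def comp_assoc)
  have "FF f0 \<odot> SS idl 1 \<phi> = pre \<odot> (geo f0 \<odot> stm) \<odot> ?Z \<odot> NN"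
    using comp_tail[OF FF_pre] by (simp add: SS_def comp_assoc)
  also have "\<dots> = pre \<odot> stm \<odot> (Fm f0 \<odot> ?Z) \<odot> NN"
    by (simp only: stm_Fm[OF f0, symmetric] comp_assoc)
  finally show ?thesis
    unfolding 1 2 Fm_Z13 by (simp add: SS_def comp_assoc)
qed

end

end

lemma mu_diff: "muu (g - g') = muu g - muu g'"
  by (simp add: muu_def)

lemma ii_diff: "ii m f p (g - g') = ii m f p g - ii m f p g'" "SS f p (g - g') = SS f p g - SS f p g'"
  by (simp_all add: ii_def ibar_def SS_def Z13_def mu_diff right_diff_distrib left_diff_distrib)

lemma stm_NN_pre: "stm \<odot> NN \<odot> pre = 0"
  by (rule noE_NN_pre) simp

lemma stm_NN_pre_tail: "stm \<odot> NN \<odot> pre \<odot> W = 0"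
  using comp_tail[OF stm_NN_pre, of W] by (simp only: comp_assoc comp_linear_left)

text \<open>Outputs of B and S contain a \<open>Unit\<close>, and the operators applied next vanish
  on every rotation of such words. Hence no terms of second order in u occur.\<close>

lemma BB_SS: "BB \<odot> BB = 0" "BB \<odot> SS f p g = 0" "op1 0 f \<Longrightarrow> op1 p g \<Longrightarrow> SS f p g \<odot> BB = 0"
proof -
  show "BB \<odot> BB = 0" "BB \<odot> SS f p g = 0" 
    by (simp_all add: BB_def SS_def comp_assoc stm_NN_pre_tail)
  assume fg: "op1 0 f" "op1 p g"
  have "noE (stm \<odot> Z13 f p g)"
    unfolding stm_Z13[OF fg] by (intro noE_closed noE_st)
  then have n: "(stm \<odot> Z13 f p g) \<odot> (NN \<odot> pre) = 0"
    by (rule noE_NN_pre)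
  have "stm \<odot> Z13 f p g \<odot> NN \<odot> pre \<odot> stm \<odot> NN = 0"
    using comp_tail[OF n, of "stm \<odot> NN"] by (simp only: comp_assoc comp_linear_left)
  then show "SS f p g \<odot> BB = 0"
    by (simp only: BB_def SS_def comp_assoc comp_linear)
qed

section \<open>Differentiating matrix entries\<close>

definition der :: "('k::field \<Rightarrow> 'k) \<Rightarrow> bool"
  where "der v \<longleftrightarrow> (\<forall>a b. v (a + b) = v a + v b) \<and> (\<forall>a b. v (a * b) = v a * b + a * v b)"

lemma derD: assumes "der v"
  shows "v (a + b) = v a + v b" "v (a * b) = v a * b + a * v b" "v 0 = 0" "v 1 = 0" "v (- a) = - v a"
    "v (a - b) = v a - v b"
proof -
  show add: "v (a + b) = v a + v b" and mult: "v (a * b) = v a * b + a * v b" for a b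
    using assms by (auto simp: der_def)
  show v0: "v 0 = 0" using add[of 0 0] by (metis add.right_neutral add_cancel_right_right)
  show "v 1 = 0" using mult[of 1 1] by (metis add_cancel_right_right mult_1 mult.right_neutral)
  show neg: "v (- a) = - v a" for a using add[of a "- a"] v0 by (simp add: eq_neg_iff_add_eq_0 add.commute)
  show "v (a - b) = v a - v b" using add[of a "- b"] neg by simp
qed

abbreviation mapv :: "('k \<Rightarrow> 'k) \<Rightarrow> ('w \<Rightarrow>\<^sub>0 'k::field) \<Rightarrow> ('w \<Rightarrow>\<^sub>0 'k)"
  where "mapv \<equiv> Poly_Mapping.map"

lemma lookup_mapv: "der v \<Longrightarrow> Poly_Mapping.lookup (mapv v x) w = v (Poly_Mapping.lookup x w)"
  by (simp add: Poly_Mapping.map.rep_eq when_def derD)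

lemma mapv_simps:
  assumes "der v"
  shows "mapv v (x + y) = mapv v x + mapv v y" "mapv v (x - y) = mapv v x - mapv v y" "mapv v 0 = 0"
    "mapv v (- x) = - mapv v x" "mapv v (csc c x) = csc (v c) x + csc c (mapv v x)"
    "mapv v (Poly_Mapping.single w c) = Poly_Mapping.single w (v c)"
  by (auto intro!: poly_mapping_eqI
      simp: lookup_mapv[OF assms] lookup_add lookup_minus lookup_csc lookup_single when_def derD[OF assms])

lemma mapv_sum: "der v \<Longrightarrow> mapv v (sum f A) = (\<Sum>a\<in>A. mapv v (f a))"
  by (induction A rule: infinite_finite_induct) (auto simp: mapv_simps)

lemma keys_mapv: "der v \<Longrightarrow> Poly_Mapping.keys (mapv v x) \<subseteq> Poly_Mapping.keys x"
  by (auto simp: in_keys_iff lookup_mapv derD)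

text \<open>The Leibniz rule: the derivation hits the coefficients of the argument or the matrix
  entries of the map.\<close>

lemma mapv_clin:
  assumes "der v"
  shows "mapv v (clin P x) = clin P (mapv v x) + clin (\<lambda>w. mapv v (P w)) x"
proof -
  note keys = subsetD[OF keys_mapv[OF assms]]
  have "clin P (mapv v x) = (\<Sum>w\<in>Poly_Mapping.keys x. csc (v (Poly_Mapping.lookup x w)) (P w))"
    by (subst lin_superset[of "Poly_Mapping.keys x"]) (auto simp: lookup_mapv[OF assms] dest: keys)
  then show ?thesis
    unfolding lin_def by (simp add: mapv_sum[OF assms] mapv_simps[OF assms] sum.distrib)
qed

lemma mapv_word [simp]: "der v \<Longrightarrow> mapv v (word w) = 0"
  by (simp add: mapv_simps derD)

lemma mapv_mult:
  assumes "der v"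
  shows "mapv v (x * y) = mapv v x * y + x * mapv v y"
  unfolding mult_conv_clin
  by (simp add: mapv_clin[OF assms] clin_add_fun assms)

text \<open>Differentiation of the matrix entries. Acting on coefficients by \<open>v\<close> is not
  linear over the field, but its commutator with a linear operator is linear, namely this
  one.\<close>

definition opv :: "('k \<Rightarrow> 'k) \<Rightarrow> ('a, 'w, 'k::field) wop \<Rightarrow> ('a, 'w, 'k) wop"
  where "opv v X = Op (\<lambda>w. mapv v (ap X w))"

lemma ap_opv [simp]: "ap (opv v X) w = mapv v (ap X w)"
  by (simp add: opv_def)

lemma ap_opv_fun: "ap (opv v X) = (\<lambda>w. mapv v (ap X w))"
  by (simp add: fun_eq_iff)

lemma mapv_one: "der v \<Longrightarrow> mapv v 1 = 0"
  by (simp add: mapv_simps derD flip: single_one)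

lemma mapv_ap: "der v \<Longrightarrow> mapv v (clin (ap X) x) = clin (ap X) (mapv v x) + clin (ap (opv v X)) x"
  by (simp add: mapv_clin ap_opv_fun)

context
  fixes v :: "'k::field \<Rightarrow> 'k"
  assumes v: "der v"
begin

lemma opv_simps:
  "opv v (X + Y) = opv v X + opv v Y" "opv v (X - Y) = opv v X - opv v Y" "opv v 0 = 0"
  "opv v (Z \<odot> W) = opv v Z \<odot> W + Z \<odot> opv v W" "opv v (X' * Y') = opv v X' * Y' + X' * opv v Y'"
  "opv v 1 = 0"
  by (auto simp: wop_eq_iff mapv_simps[OF v] mapv_clin[OF v] ap_times mapv_sum[OF v] mapv_mult[OF v] sum.distrib ap_one ap_opv_fun mapv_one v)

text \<open>The derivative of 1/(1 - f), in a noncommutative ring.\<close>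

lemma opv_geo: "ap f [] = 0 \<Longrightarrow> opv v (geo f) = geo f * opv v f * geo f"
proof -
  assume f: "ap f [] = 0"
  have "opv v (geo f) = opv v (1 + f * geo f)"
    by (rule arg_cong[OF geo_rec[OF f]])
  then have "opv v (geo f) = opv v f * geo f + f * opv v (geo f)"
    by (simp add: opv_simps)
  from geo_unique[OF f this] show ?thesis by (simp add: mult.assoc)
qed

lemma opv_letter [simp]: "opv v su = 0" "opv v sm = 0" "opv v iu = 0" "opv v Mt = 0" "opv v Es = 0"
proof -
  show "opv v su = 0" "opv v sm = 0" "opv v iu = 0" "opv v Mt = 0" "opv v Es = 0"
    unfolding su_def sm_def iu_def Mt_def Es_def on_letter_def
    by (auto simp: wop_eq_iff v mapv_simps(3)[OF v] mapv_one split: lt.splits)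
qed

lemma opv_zero [simp]:
  "opv v (sg p) = 0" "opv v et = 0" "opv v NN = 0" "opv v idw = 0" "opv v stu = 0" "opv v stm = 0" "opv v ut = 0" "opv v pre = 0"
proof -
  show "opv v stu = 0" "opv v ut = 0" "opv v stm = 0"
    by (simp_all add: stu_def ut_def stm_def opv_geo opv_simps)
  show "opv v pre = 0" "opv v (sg p) = 0" "opv v et = 0" "opv v idw = 0" "opv v NN = 0"
    by (auto simp: wop_eq_iff bsign_def mapv_simps[OF v] derD[OF v] ap_et_if NN_def mapv_sum[OF v] rotn_def mulrev_def v
      if_distrib[of v] cong: if_cong)
qed

lemma opv_op1: "op1 p g \<Longrightarrow> op1 p (opv v g)"
  unfolding op1_def letter_valued_def homog_def
  by (auto simp: mapv_simps(3)[OF v] dest!: subsetD[OF keys_mapv[OF v]])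

text \<open>The norm, the marks and the units have constant matrix entries, so \<open>v\<close>
  differentiates only the operations. Here and in \<open>opv_FF\<close> the result is a Lie
  derivative, which is what connects the Cartan formula with the connection.\<close>

lemma opv_bb: "opv v (bb m) = LL idl 1 (opv v m)"
  by (simp add: bb_def bbar_def LL_def Lbar_def mm_def im_def iot_def muhu_def muu_def Gu_def Iu_def opv_simps
    comp_tail[OF Mt_idl] fm_def comp_assoc Z12_def Fu_def)

lemma opv_FF: "op1 0 f \<Longrightarrow> opv v (FF f) = LL f 0 (opv v f)"
  by (simp add: FF_def Fbar_def LL_def Lbar_def fm_def Fu_def Z12_def muu_def opv_simps opv_geo comp_assoc nf)

lemma opv_BB: "opv v BB = 0"
  by (simp add: BB_def opv_simps)

lemma opv_muh0: "opv v (muh0 m) = muh0 (opv v m)"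
  by (simp add: muh0_def opv_simps)

end

section \<open>Series in u: the differential, the connection and the homotopy\<close>

definition ser_d where "ser_d m x i = clin (ap (bb m)) (x i) + u_times (\<lambda>i. clin (ap BB) (x i)) i"
definition ser_nabla where "ser_nabla m v x i = u_times (\<lambda>i. mapv v (x i)) i
  - clin (ap (ii m idl 1 (opv v m))) (x i) - u_times (\<lambda>i. clin (ap (SS idl 1 (opv v m))) (x i)) i"
definition ser_F where "ser_F f x i = clin (ap (FF f)) (x i)"
text \<open>The contraction with v(f) is completed by its S-part at first order in u. The correction
  \<open>hh\<close> has no companion: its commutators with b and with B yield both orders at once,
  by \<open>bb_hh\<close> and \<open>BB_hh\<close>.\<close>

definition ser_H where "ser_H mC mD f v x i = clin (ap (ii mD f 0 (opv v f) - hh f (opv v mC))) (x i)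
  + u_times (\<lambda>i. clin (ap (SS f 0 (opv v f))) (x i)) i"

lemma clin_ap_comp: "clin (ap X) (clin (ap Y) x) = clin (ap (X \<odot> Y)) x"
  by (simp add: ap_comp_fun clin_clin)

lemma u_times_clin: "u_times (\<lambda>i. clin P (x i)) i = clin P (u_times x i)"
  by (cases i) (simp_all add: u_times_def)

lemma u_times_simps:
  "u_times (\<lambda>i. x i + y i) i = u_times x i + (u_times y i :: 'c::ab_group_add)"
  "u_times (\<lambda>i. x i - y i) i = u_times x i - u_times y i"
  by (simp_all add: u_times_def split: nat.splits)

lemma u_times_mapv: "der v \<Longrightarrow> u_times (\<lambda>i. mapv v (x i)) = (\<lambda>i. mapv v (u_times x i))"
  by (auto simp: fun_eq_iff u_times_def mapv_simps split: nat.splits)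

lemma ap_clin_diff: "clin (ap (X - Y)) x = clin (ap X) x - clin (ap Y) x"
  "clin (ap (X + Y)) x = clin (ap X) x + clin (ap Y) x" "clin (ap (- X)) x = - clin (ap X) x"
  "clin (ap 0) x = 0"
  by (simp_all add: ap_fun clin_diff_fun clin_add_fun clin_minus_fun)

context functor_ops
begin

lemma ser_F_d: "ser_F f0 (ser_d mC x) = ser_d mD (ser_F f0 x)"
  by (rule ext) (simp add: ser_F_def ser_d_def u_times_clin clin_add clin_ap_comp FF_bb FF_BB)

context
  fixes v :: "'k \<Rightarrow> 'k"
  assumes v: "der v"
begin

lemma closedC: "mC \<odot> muh0 (opv v mC) + opv v mC \<odot> muh0 mC = 0"
proof -
  have "opv v (mC \<odot> muh0 mC) = opv v 0"
    by (simp only: mC_sq)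
  then show ?thesis by (simp add: opv_simps[OF v] opv_muh0[OF v] add.commute)
qed

text \<open>Differentiate the functor equation; the terms with the derivative of \<open>f0\<close>
  are exactly its differential.\<close>

lemma del_opv: "del mC mD f0 0 (opv v f0) = f0 \<odot> muh0 (opv v mC) - opv v mD \<odot> geo f0"
proof -
  have "opv v (mD \<odot> geo f0) = opv v (f0 \<odot> muh0 mC)"
    by (simp only: functor_eq)
  then show ?thesis
    by (simp add: opv_simps[OF v] opv_muh0[OF v] opv_geo[OF v] del_def algebra_simps)
qed

text \<open>The derivative of \<open>mC\<close> is closed, so the Cartan formula for the identity
  functor leaves only the Lie derivative along it, and this cancels the derivative of b.\<close>

lemma ser_d_nabla: "ser_nabla mC v (ser_d mC x) = ser_d mC (ser_nabla mC v x)"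
proof (rule ext)
  fix i
  interpret idC: functor_ops mC mC idl
    by (rule functor_ops_idl) (simp_all add: mC_sq)
  let ?\<phi> = "opv v mC"
  let ?y = "u_times x i" and ?z = "u_times (u_times x) i"
  note \<phi> = opv_op1[OF v mC]
  have "del mC mC idl 1 ?\<phi> = 0"
    using closedC by (simp add: del_def muh0_def)
  then have c: "bb mC \<odot> ii mC idl 1 ?\<phi> = ii mC idl 1 ?\<phi> \<odot> bb mC"
    "bb mC \<odot> SS idl 1 ?\<phi> - SS idl 1 ?\<phi> \<odot> bb mC + BB \<odot> ii mC idl 1 ?\<phi> - ii mC idl 1 ?\<phi> \<odot> BB = - LL idl 1 ?\<phi>"
    using idC.cartan_b[OF \<phi>] idC.cartan_B[OF \<phi>] by (simp_all add: ii_def ibar_def SS_def Z13_def)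
  have "clin (ap (bb mC \<odot> SS idl 1 ?\<phi> - SS idl 1 ?\<phi> \<odot> bb mC + BB \<odot> ii mC idl 1 ?\<phi> - ii mC idl 1 ?\<phi> \<odot> BB)) ?y
     = clin (ap (- LL idl 1 ?\<phi>)) ?y"
    by (simp only: c)
  then show "ser_nabla mC v (ser_d mC x) i = ser_d mC (ser_nabla mC v x) i"
    unfolding ser_nabla_def ser_d_def
    by (simp add: u_times_clin u_times_simps clin_add clin_diff clin_ap_comp ap_clin_diff c(1) mapv_simps[OF v]
        mapv_ap[OF v] BB_SS \<phi> opv_bb[OF v] opv_BB[OF v] u_times_mapv[OF v] algebra_simps)
qed

text \<open>Compared in each power of u: fact \<open>0\<close> is the part without u, fact
  \<open>1\<close> the part of first order, where the Lie derivative along v(f) is the derivative of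
  F_*. The second order vanishes by \<open>BB_SS\<close>.\<close>

lemma ser_homotopy:
  "ser_F f0 (ser_nabla mC v x) i - ser_nabla mD v (ser_F f0 x) i = ser_d mD (ser_H mC mD f0 v x) i + ser_H mC mD f0 v (ser_d mC x) i"
proof -
  let ?\<phi> = "opv v mC" and ?\<psi> = "opv v mD" and ?g = "opv v f0"
  let ?y = "u_times x i" and ?z = "u_times (u_times x) i"
  let ?J = "ii mD f0 0 ?g" and ?S = "SS f0 0 ?g" and ?h = "hh f0 ?\<phi>"
  note g = opv_op1[OF v f0] and \<phi> = opv_op1[OF v mC] and \<psi> = opv_op1[OF v mD]
  have b: "bb mD \<odot> ?J + ?J \<odot> bb mC = - ii mD f0 1 (f0 \<odot> muh0 ?\<phi>) + ii mD f0 1 (?\<psi> \<odot> geo f0)"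
    using cartan_b[OF g] by (simp add: del_opv ii_diff)
  have B: "bb mD \<odot> ?S + ?S \<odot> bb mC + BB \<odot> ?J + ?J \<odot> BB =
      - LL f0 0 ?g - SS f0 1 (f0 \<odot> muh0 ?\<phi>) + SS f0 1 (?\<psi> \<odot> geo f0)"
    using cartan_B[OF g] by (simp add: del_opv ii_diff)
  note h = bb_hh[OF \<phi> closedC] BB_hh[OF \<phi> closedC] and F = mm_Z13_times[OF \<psi>]
  have h': "FF f0 \<odot> ii mC idl 1 ?\<phi> = bb mD \<odot> ?h + ?h \<odot> bb mC + ii mD f0 1 (f0 \<odot> muh0 ?\<phi>)"
    "FF f0 \<odot> SS idl 1 ?\<phi> = BB \<odot> ?h + ?h \<odot> BB + SS f0 1 (f0 \<odot> muh0 ?\<phi>)"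
    using h by simp_all
  have b': "ii mD f0 1 (?\<psi> \<odot> geo f0) = bb mD \<odot> ?J + ?J \<odot> bb mC + ii mD f0 1 (f0 \<odot> muh0 ?\<phi>)"
    "SS f0 1 (?\<psi> \<odot> geo f0) = bb mD \<odot> ?S + ?S \<odot> bb mC + BB \<odot> ?J + ?J \<odot> BB + LL f0 0 ?g + SS f0 1 (f0 \<odot> muh0 ?\<phi>)"
    using b B by simp_all
  have 0: "FF f0 \<odot> ii mC idl 1 ?\<phi> - ii mD idl 1 ?\<psi> \<odot> FF f0 = - (bb mD \<odot> (?J - ?h) + (?J - ?h) \<odot> bb mC)"
    unfolding F h' b' by simp
  have 1: "LL f0 0 ?g + FF f0 \<odot> SS idl 1 ?\<phi> - SS idl 1 ?\<psi> \<odot> FF f0 =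
      - (bb mD \<odot> ?S + ?S \<odot> bb mC + BB \<odot> (?J - ?h) + (?J - ?h) \<odot> BB)"
    unfolding F h' b' by simp
  have "clin (ap (FF f0 \<odot> ii mC idl 1 ?\<phi> - ii mD idl 1 ?\<psi> \<odot> FF f0)) (x i) =
      clin (ap (- (bb mD \<odot> (?J - ?h) + (?J - ?h) \<odot> bb mC))) (x i)"
    by (simp only: 0)
  moreover have "clin (ap (LL f0 0 ?g + FF f0 \<odot> SS idl 1 ?\<phi> - SS idl 1 ?\<psi> \<odot> FF f0)) ?y =
      clin (ap (- (bb mD \<odot> ?S + ?S \<odot> bb mC + BB \<odot> (?J - ?h) + (?J - ?h) \<odot> BB))) ?y"
    by (simp only: 1)
  ultimately show ?thesis
    unfolding ser_nabla_def ser_d_def ser_F_def ser_H_def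
    by (simp add: u_times_clin u_times_simps clin_add clin_diff clin_ap_comp ap_clin_diff mapv_simps[OF v]
        mapv_ap[OF v] BB_SS g opv_FF[OF v] u_times_mapv[OF v] algebra_simps)
qed

end

end

section \<open>Expansion in bases\<close>

instantiation mor :: (type, grading_datum, type) letter
begin
definition "par m = parity (deg m - deg_of_int 1)"
instance ..
end

lemma parity_0 [simp]: "parity (0::'y::grading_datum) = 0"
  using parity_add[of "0::'y" 0] by simp

lemma parity_sum_list: "parity (sum_list (map f w)) = sum_list (map (\<lambda>m. parity (f m)) w)"
  by (induction w) (simp_all add: parity_add)

lemma eps_epar: "eps w = epar w"
  by (simp add: eps_def rdeg_def epar_def parity_sum_list par_mor_def[abs_def])

lemma rdeg_simps [simp]: "rdeg [] = 0" "rdeg (m # w) = deg m - deg_of_int 1 + rdeg w" "rdeg (u @ w) = rdeg u + rdeg w"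
  by (simp_all add: rdeg_def)

lemma with_elt_simps [simp]: "src (with_elt m a) = src m" "tgt (with_elt m a) = tgt m" "deg (with_elt m a) = deg m"
  "elt (with_elt m a) = a" "with_elt (with_elt m a) b = with_elt m b" "with_elt m (elt m) = m"
  by (simp_all add: with_elt_def)

lemma with_elt_inj [simp]: "with_elt m a = with_elt m b \<longleftrightarrow> a = b"
  by (simp add: with_elt_def)

lemma par_with_elt [simp]: "par (with_elt m a) = par m"
  by (simp add: par_mor_def)

lemma is_path_Cons: "is_path C (m # w) \<longleftrightarrow> is_mor C m \<and> (w = [] \<or> is_path C w \<and> tgt m = src (hd w))"
  by (cases w) (auto simp: is_path_def)

lemma is_path_append: "u \<noteq> [] \<Longrightarrow> v \<noteq> [] \<Longrightarrow>
    is_path C (u @ v) \<longleftrightarrow> is_path C u \<and> is_path C v \<and> tgt (last u) = src (hd v)"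
  by (auto simp: is_path_def successively_append_iff)

lemma not_path_Nil [simp]: "\<not> is_path C []"
  by (simp add: is_path_def)

locale based =
  fixes C :: "('k::field, 'o, 'y::grading_datum, 'a::ab_group_add) ainf_data"
    and B :: "'o \<Rightarrow> 'o \<Rightarrow> 'y \<Rightarrow> 'a set"
  assumes vs: "vector_space (scl C)"
    and Hom: "X \<in> Obj C \<Longrightarrow> Y \<in> Obj C \<Longrightarrow> module.subspace (scl C) (Hom C X Y y)"
    and bases: "hom_bases C B"
begin

sublocale V: vector_space "scl C"
  by (rule vs)

abbreviation lx :: "('o, 'y, 'a) mor \<Rightarrow> ('k, 'o, 'y, 'a) chain" where "lx m \<equiv> expand C B [m]"
abbreviation S :: "('o, 'y, 'a) mor \<Rightarrow> 'a set" where "S m \<equiv> {\<beta>. coord C B m \<beta> \<noteq> 0}"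

lemma finite_S [simp]: "finite (S m)"
  unfolding coord_def by (rule V.finite_representation)

lemma lx_eq: "lx m = (\<Sum>\<beta>\<in>S m. Poly_Mapping.single [with_elt m \<beta>] (coord C B m \<beta>))"
proof -
  have "listset [S m] = (\<lambda>\<beta>. [\<beta>]) ` S m"
    by (auto simp: set_Cons_def)
  then have "lx m = sum (\<lambda>\<beta>s. Poly_Mapping.single (map2 with_elt [m] \<beta>s) (prod_list (map2 (coord C B) [m] \<beta>s))) ((\<lambda>\<beta>. [\<beta>]) ` S m)"
    unfolding expand_def by simp
  also have "\<dots> = (\<Sum>\<beta>\<in>S m. Poly_Mapping.single [with_elt m \<beta>] (coord C B m \<beta>))"
    by (subst sum.reindex) (auto simp: inj_on_def)
  finally show ?thesis .
qed

lemma expand_Nil [simp]: "expand C B [] = 1"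
  by (simp add: expand_def)

lemma expand_Cons: "expand C B (m # w) = lx m * expand C B w"
proof -
  let ?f = "\<lambda>w \<beta>s. Poly_Mapping.single (map2 with_elt w \<beta>s) (prod_list (map2 (coord C B) w \<beta>s))"
  let ?L = "listset (map S w)"
  have "listset (map S (m # w)) = (\<lambda>(\<beta>, \<beta>s). \<beta> # \<beta>s) ` (S m \<times> ?L)"
    by (auto simp: set_Cons_def)
  then have "expand C B (m # w) = sum (?f (m # w)) ((\<lambda>(\<beta>, \<beta>s). \<beta> # \<beta>s) ` (S m \<times> ?L))"
    unfolding expand_def by simp
  also have "\<dots> = (\<Sum>(\<beta>, \<beta>s)\<in>S m \<times> ?L. ?f (m # w) (\<beta> # \<beta>s))"
    by (subst sum.reindex) (auto simp: inj_on_def case_prod_unfold)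
  also have "\<dots> = (\<Sum>(\<beta>, \<beta>s)\<in>S m \<times> ?L. Poly_Mapping.single [with_elt m \<beta>] (coord C B m \<beta>) * ?f w \<beta>s)"
    by (rule sum.cong) (auto simp: mult_single plus_list_def)
  also have "\<dots> = lx m * expand C B w"
    unfolding lx_eq expand_def[of C B w] sum_product sum.cartesian_product by simp
  finally show ?thesis .
qed

lemma expand_append: "expand C B (u @ w) = expand C B u * expand C B w"
proof (induction u)
  case (Cons m u)
  show ?case
    unfolding append_Cons expand_Cons[of m "u @ w"] expand_Cons[of m u] Cons.IH by (rule mult.assoc[symmetric])
qed simp

lemma lookup_lx: "Poly_Mapping.lookup (lx m) u = (if \<exists>\<beta>. u = [with_elt m \<beta>] then coord C B m (elt (hd u)) else 0)"
proof (cases "\<exists>\<beta>. u = [with_elt m \<beta>]")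
  case True
  then obtain \<beta> where u: "u = [with_elt m \<beta>]" by blast
  have "Poly_Mapping.lookup (lx m) u = (\<Sum>\<gamma>\<in>S m. if \<gamma> = \<beta> then coord C B m \<beta> else 0)"
    unfolding lx_eq lookup_sum u by (rule sum.cong) (auto simp: lookup_single when_def)
  then show ?thesis using u by (simp add: sum.delta)
next
  case False
  then show ?thesis
    unfolding lx_eq lookup_sum by (auto simp: lookup_single when_def intro!: sum.neutral)
qed

lemma mor_basis:
  assumes "is_mor C m"
  shows "V.independent (B (src m) (tgt m) (deg m))" "elt m \<in> V.span (B (src m) (tgt m) (deg m))"
    "V.span (B (src m) (tgt m) (deg m)) = Hom C (src m) (tgt m) (deg m)"
  using assms bases by (auto simp: is_mor_def hom_bases_def)

lemma is_mor_add: "is_mor C (with_elt m a) \<Longrightarrow> is_mor C (with_elt m b) \<Longrightarrow> is_mor C (with_elt m (a + b))"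
  using Hom V.subspace_add by (fastforce simp: is_mor_def)

lemma is_mor_scl: "is_mor C (with_elt m a) \<Longrightarrow> is_mor C (with_elt m (scl C c a))"
  using Hom V.subspace_scale by (fastforce simp: is_mor_def)

lemma is_mor_0: "is_mor C m \<Longrightarrow> is_mor C (with_elt m 0)"
  using Hom V.subspace_0 by (fastforce simp: is_mor_def)

lemma is_mor_sum: "is_mor C m \<Longrightarrow> (\<And>i. i \<in> I \<Longrightarrow> is_mor C (with_elt m (a i))) \<Longrightarrow> is_mor C (with_elt m (sum a I))"
  by (induction I rule: infinite_finite_induct) (auto simp: is_mor_0 intro!: is_mor_add)

lemma coord_add: "is_mor C (with_elt m a) \<Longrightarrow> is_mor C (with_elt m b) \<Longrightarrow>
   coord C B (with_elt m (a + b)) \<beta> = coord C B (with_elt m a) \<beta> + coord C B (with_elt m b) \<beta>"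
  using mor_basis[of "with_elt m a"] mor_basis[of "with_elt m b"]
  by (simp add: coord_def V.representation_add)

lemma coord_scl: "is_mor C (with_elt m a) \<Longrightarrow>
   coord C B (with_elt m (scl C c a)) \<beta> = c * coord C B (with_elt m a) \<beta>"
  using mor_basis[of "with_elt m a"] by (simp add: coord_def V.representation_scale)

lemma lx_add: "is_mor C (with_elt m a) \<Longrightarrow> is_mor C (with_elt m b) \<Longrightarrow>
    lx (with_elt m (a + b)) = lx (with_elt m a) + lx (with_elt m b)"
  by (rule poly_mapping_eqI) (auto simp: lookup_add lookup_lx coord_add)

lemma lx_scl: "is_mor C (with_elt m a) \<Longrightarrow> lx (with_elt m (scl C c a)) = csc c (lx (with_elt m a))"
  by (rule poly_mapping_eqI) (auto simp: lookup_csc lookup_lx coord_scl)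

lemma lx_0: "lx (with_elt m 0) = 0"
  by (rule poly_mapping_eqI) (auto simp: lookup_lx coord_def V.representation_zero)

lemma lx_sum: "is_mor C m \<Longrightarrow> (\<And>i. i \<in> I \<Longrightarrow> is_mor C (with_elt m (a i))) \<Longrightarrow>
    lx (with_elt m (sum a I)) = (\<Sum>i\<in>I. lx (with_elt m (a i)))"
  by (induction I rule: infinite_finite_induct) (auto simp: lx_0 lx_add is_mor_sum)

lemma S_basis: "\<beta> \<in> S m \<Longrightarrow> \<beta> \<in> B (src m) (tgt m) (deg m)"
  unfolding coord_def by (simp add: V.representation_ne_zero)

lemma S_mor: "is_mor C m \<Longrightarrow> \<beta> \<in> S m \<Longrightarrow> is_mor C (with_elt m \<beta>)"
  using mor_basis(3)[of m] S_basis[of \<beta> m] V.span_base by (auto simp: is_mor_def)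

lemma elt_eq: "is_mor C m \<Longrightarrow> elt m = (\<Sum>\<beta>\<in>S m. scl C (coord C B m \<beta>) \<beta>)"
  using V.sum_nonzero_representation_eq[OF mor_basis(1,2)] by (simp add: coord_def)

lemma lx_basis:
  assumes "is_mor C m" "elt m \<in> B (src m) (tgt m) (deg m)"
  shows "lx m = word [m]"
proof -
  have c: "coord C B m = (\<lambda>\<beta>. if \<beta> = elt m then 1 else 0)"
    unfolding coord_def using V.representation_basis[OF mor_basis(1)[OF assms(1)] assms(2)]
    by simp
  then have "S m = {elt m}" by auto
  then show ?thesis by (simp add: lx_eq c)
qed

text \<open>A map that is additive and homogeneous in one entry is determined by its values on the
  basis. Reading the entry off as \<open>elt (hd u)\<close> makes it applicable to the one-letter
  words in the expansion \<open>lx m\<close>.\<close>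

lemma slot:
  fixes g :: "'a \<Rightarrow> 'w \<Rightarrow>\<^sub>0 'k"
  assumes m: "is_mor C m"
    and add: "\<And>a b. is_mor C (with_elt m a) \<Longrightarrow> is_mor C (with_elt m b) \<Longrightarrow> g (a + b) = g a + g b"
    and scl: "\<And>a c. is_mor C (with_elt m a) \<Longrightarrow> g (scl C c a) = csc c (g a)"
  shows "clin (\<lambda>u. g (elt (hd u))) (lx m) = g (elt m)"
proof -
  have g0: "g 0 = 0" using scl[of 0 0] is_mor_0[OF m] by simp
  have "g (\<Sum>\<beta>\<in>I. scl C (coord C B m \<beta>) \<beta>) = (\<Sum>\<beta>\<in>I. csc (coord C B m \<beta>) (g \<beta>))" if "I \<subseteq> S m" for I
    using finite_subset[OF that finite_S] that
  proof (induction I rule: finite_induct)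
    case (insert x I)
    have i: "is_mor C (with_elt m (\<Sum>\<beta>\<in>I. scl C (coord C B m \<beta>) \<beta>))" "is_mor C (with_elt m x)"
    proof -
      show "is_mor C (with_elt m x)" using S_mor[OF m] insert.prems by blast
      show "is_mor C (with_elt m (\<Sum>\<beta>\<in>I. scl C (coord C B m \<beta>) \<beta>))"
        using insert.prems by (intro is_mor_sum[OF m] is_mor_scl S_mor[OF m]) blast
    qed
    have "I \<subseteq> S m" using insert.prems by simp
    note IH = insert.IH[OF this]
    show ?case
      unfolding sum.insert[OF insert.hyps(1,2)] add[OF is_mor_scl[OF i(2)] i(1)] scl[OF i(2)] IH ..
  qed (simp add: g0)
  then have "g (elt m) = (\<Sum>\<beta>\<in>S m. csc (coord C B m \<beta>) (g \<beta>))"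
    using elt_eq[OF m] by simp
  then show ?thesis
    unfolding lx_eq by (simp add: clin_sum)
qed

end

locale based2 = C: based C B + D: based D B'
  for C :: "('k::field, 'o, 'y::grading_datum, 'a::ab_group_add) ainf_data" and B
    and D :: "('k, 'o, 'y, 'b::ab_group_add) ainf_data" and B'

text \<open>The matrix of an operation: its values are expanded in the basis of D, and words that do
  not compose go to 0. Arguments may be any paths, not only basis words, so that multilinearity can
  be stated as invariance under expansion of the input.\<close>

definition mop :: "('k::field, 'o, 'y::grading_datum, 'a) ainf_data \<Rightarrow> ('k, 'o, 'y, 'b::ab_group_add) ainf_data \<Rightarrow>
    ('o \<Rightarrow> 'o \<Rightarrow> 'y \<Rightarrow> 'b set) \<Rightarrow> (('o, 'y, 'a) mor list \<Rightarrow> 'b) \<Rightarrow> 'y \<Rightarrow> (('o, 'y, 'a) mor, ('o, 'y, 'b) mor list, 'k) wop"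
  where "mop C D B' f d = Op (\<lambda>w. if is_path C w then expand D B' [apply_op id f d w] else 0)"

definition eop :: "('k::field, 'o, 'y::grading_datum, 'a::ab_group_add) ainf_data \<Rightarrow> ('o \<Rightarrow> 'o \<Rightarrow> 'y \<Rightarrow> 'a set) \<Rightarrow>
   (('o, 'y, 'a) mor, ('o, 'y, 'a) mor list, 'k) wop"
  where "eop C B = on_letter (\<lambda>m. expand C B [m])"

lemma apply_op_simps [simp]: "src (apply_op Fo f d w) = Fo (src (hd w))" "tgt (apply_op Fo f d w) = Fo (tgt (last w))"
  "deg (apply_op Fo f d w) = rdeg w + d + deg_of_int 1" "elt (apply_op Fo f d w) = f w"
  by (simp_all add: apply_op_def)

lemma par_apply_op: "par (apply_op Fo f d w) = epar w + parity d"
  by (simp add: par_mor_def parity_add eps_epar[symmetric] eps_def)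

context based2
begin

lemma op1_mop: "op1 (parity d) (mop C D B' f d)"
proof -
  have k: "\<exists>\<beta>. u = [with_elt m \<beta>]" if "u \<in> Poly_Mapping.keys (D.lx m)" for u m
    using that by (auto simp: in_keys_iff D.lookup_lx split: if_splits)
  then show ?thesis
    unfolding op1_def letter_valued_def homog_def
    by (auto simp: mop_def par_apply_op dest!: k)
qed

context
  fixes f :: "('o, 'y, 'a) mor list \<Rightarrow> 'b" and d :: 'y
  assumes f: "multilinear_op C D id f d"
begin

lemma mop_mor: "is_path C w \<Longrightarrow> is_mor D (apply_op id f d w)"
  using f by (simp add: multilinear_op_def)

lemma path_with_elt: "is_path C (p @ with_elt m a # q) \<longleftrightarrow>
    is_mor C (with_elt m a) \<and> (p = [] \<or> is_path C p \<and> tgt (last p) = src m) \<and> (q = [] \<or> is_path C q \<and> tgt m = src (hd q))"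
  by (cases "p = []") (auto simp: is_path_append is_path_Cons)

lemma apply_with_elt: "apply_op id f d (p @ with_elt m a # q) = with_elt (apply_op id f d (p @ m # q)) (f (p @ with_elt m a # q))"
proof -
  have "src (hd (p @ with_elt m a # q)) = src (hd (p @ m # q))" "tgt (last (p @ with_elt m a # q)) = tgt (last (p @ m # q))"
    by (cases p, simp, simp) (cases q rule: rev_cases, simp, simp)
  then show ?thesis by (simp add: apply_op_def with_elt_def)
qed

lemma mop_slot:
  assumes "is_path C (p @ m # q)"
  shows "clin (\<lambda>u. ap (mop C D B' f d) (p @ u @ q)) (C.lx m) = ap (mop C D B' f d) (p @ m # q)"
proof -
  define w0 where "w0 = apply_op id f d (p @ m # q)"
  have w0: "apply_op id f d (p @ with_elt m a # q) = with_elt w0 (f (p @ with_elt m a # q))" for a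
    unfolding w0_def by (rule apply_with_elt)
  have path: "is_path C (p @ with_elt m a # q) \<longleftrightarrow> is_mor C (with_elt m a)" for a
    using assms path_with_elt[of p m "elt m" q] by (simp add: path_with_elt)
  have mor: "is_mor D (with_elt w0 (f (p @ with_elt m a # q)))" if "is_mor C (with_elt m a)" for a
    using mop_mor[of "p @ with_elt m a # q"] that path by (simp add: w0[symmetric])
  have fadd: "f (p @ with_elt m (a + b) # q) = f (p @ with_elt m a # q) + f (p @ with_elt m b # q)"
    if "is_mor C (with_elt m a)" "is_mor C (with_elt m b)" for a b
    using f that path unfolding multilinear_op_def by blast
  have fscl: "f (p @ with_elt m (scl C c a) # q) = scl D c (f (p @ with_elt m a # q))"
    if "is_mor C (with_elt m a)" for a c
    using f that path unfolding multilinear_op_def by blast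
  have m: "is_mor C m" using path[of "elt m"] assms by simp
  have "clin (\<lambda>u. ap (mop C D B' f d) (p @ u @ q)) (C.lx m) =
     clin (\<lambda>u. D.lx (with_elt w0 (f (p @ with_elt m (elt (hd u)) # q)))) (C.lx m)"
  proof (rule clin_cong[OF refl])
    fix u assume "u \<in> Poly_Mapping.keys (C.lx m)"
    then obtain \<beta> where "u = [with_elt m \<beta>]" "\<beta> \<in> C.S m"
      by (auto simp: in_keys_iff C.lookup_lx split: if_splits)
    then show "ap (mop C D B' f d) (p @ u @ q) = D.lx (with_elt w0 (f (p @ with_elt m (elt (hd u)) # q)))"
      using C.S_mor[OF m] path by (simp add: mop_def w0)
  qed
  also have "\<dots> = D.lx (with_elt w0 (f (p @ with_elt m (elt m) # q)))"
  proof (rule C.slot[OF m])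
    show "D.lx (with_elt w0 (f (p @ with_elt m (a + b) # q))) =
      D.lx (with_elt w0 (f (p @ with_elt m a # q))) + D.lx (with_elt w0 (f (p @ with_elt m b # q)))"
      if "is_mor C (with_elt m a)" "is_mor C (with_elt m b)" for a b
      unfolding fadd[OF that] by (rule D.lx_add[OF mor[OF that(1)] mor[OF that(2)]])
    show "D.lx (with_elt w0 (f (p @ with_elt m (scl C c a) # q))) = csc c (D.lx (with_elt w0 (f (p @ with_elt m a # q))))"
      if "is_mor C (with_elt m a)" for a c
      unfolding fscl[OF that] by (rule D.lx_scl[OF mor[OF that]])
  qed
  finally show ?thesis
    using assms w0[of "elt m"] by (simp add: mop_def)
qed

lemma mop_expand: "is_path C (p @ w) \<Longrightarrow> clin (\<lambda>u. ap (mop C D B' f d) (p @ u)) (expand C B w) = ap (mop C D B' f d) (p @ w)"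
proof (induction w arbitrary: p)
  case (Cons m w)
  have "clin (\<lambda>u. ap (mop C D B' f d) (p @ u)) (expand C B (m # w)) =
    clin (\<lambda>x. clin (\<lambda>u. ap (mop C D B' f d) ((p @ x) @ u)) (expand C B w)) (C.lx m)"
    unfolding C.expand_Cons[of m w] by (subst mult_conv_clin) (simp add: clin_clin plus_list_def)
  also have "\<dots> = clin (\<lambda>x. ap (mop C D B' f d) (p @ x @ w)) (C.lx m)"
  proof (rule clin_cong[OF refl])
    fix u assume "u \<in> Poly_Mapping.keys (C.lx m)"
    then obtain \<beta> where u: "u = [with_elt m \<beta>]" "\<beta> \<in> C.S m"
      by (auto simp: in_keys_iff C.lookup_lx split: if_splits)
    have "is_mor C m" using Cons.prems path_with_elt[of p m "elt m" w] by simp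
    then have "is_path C ((p @ u) @ w)"
      using Cons.prems u C.S_mor path_with_elt[of p m "elt m" w] by (simp add: path_with_elt)
    from Cons.IH[OF this] show "clin (\<lambda>v. ap (mop C D B' f d) ((p @ u) @ v)) (expand C B w) = ap (mop C D B' f d) (p @ u @ w)"
      by simp
  qed
  also have "\<dots> = ap (mop C D B' f d) (p @ m # w)"
    by (rule mop_slot[OF Cons.prems])
  finally show ?case .
qed simp

end

end

section \<open>The operations of an $A_\infty$ functor on basis words\<close>

text \<open>The composition from the integers to Z/2 is nonzero, and a homomorphism from the
  integers is determined by its value at 1.\<close>

lemma parity_deg_1 [simp]: "parity (deg_of_int 1 :: 'y::grading_datum) = 1"
proof (rule ccontr)
  assume "parity (deg_of_int 1 :: 'y) \<noteq> 1"
  then have z: "parity (deg_of_int 1 :: 'y) = 0" by (metis bit_not_one_iff)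
  have add: "parity (deg_of_int (m + n) :: 'y) = parity (deg_of_int m :: 'y) + parity (deg_of_int n :: 'y)" for m n
    by (simp add: deg_of_int_add parity_add)
  have "parity (deg_of_int n :: 'y) = 0" for n
  proof (induction n rule: int_induct[where k = 0])
    case base
    show ?case using add[of 0 0] by (cases "parity (deg_of_int 0 :: 'y)") auto
  next
    case (step1 i)
    then show ?case using add[of i 1] z by simp
  next
    case (step2 i)
    then show ?case using add[of "i - 1" 1] z by simp
  qed
  then show False using parity_deg_of_int_nonzero by blast
qed

text \<open>What remains of a letter without its element; matching of ends, degrees and signs depend
  on nothing else.\<close>

definition lab :: "('o, 'y, 'a) mor \<Rightarrow> 'o \<times> 'o \<times> 'y" where "lab m = (src m, tgt m, deg m)"

lemma lab_with_elt [simp]: "lab (with_elt m a) = lab m"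
  by (simp add: lab_def)

lemma lab_rdeg: 
  fixes u w :: "('o, 'y::grading_datum, 'a) mor list"
  assumes "map lab u = map lab w"
  shows "rdeg u = rdeg w"
proof -
  have "rdeg u = (\<Sum>l\<leftarrow>map lab u. snd (snd l) - deg_of_int 1)" for u :: "('o, 'y::grading_datum, 'a) mor list"
    by (simp add: rdeg_def lab_def o_def)
  then show "rdeg u = rdeg w" using assms by metis
qed

lemma lab_hd_last:
  assumes "map lab u = map lab w" "w \<noteq> []"
  shows "u \<noteq> []" "src (hd u) = src (hd w)" "tgt (last u) = tgt (last w)"
proof -
  show u: "u \<noteq> []" using assms by auto
  show "src (hd u) = src (hd w)" using arg_cong[OF assms(1), of hd] assms(2) u by (simp add: hd_map lab_def)
  show "tgt (last u) = tgt (last w)" using arg_cong[OF assms(1), of last] assms(2) u by (simp add: last_map lab_def)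
qed

lemma lab_successively:
  fixes u w :: "('o, 'y, 'a) mor list"
  assumes "map lab u = map lab w"
  shows "successively (\<lambda>m n. tgt m = src n) u \<longleftrightarrow> successively (\<lambda>m n. tgt m = src n) w"
proof -
  have "successively (\<lambda>m n. tgt m = src n) u \<longleftrightarrow> successively (\<lambda>m n. fst (snd m) = fst n) (map lab u)"
    for u :: "('o, 'y, 'a) mor list"
    by (simp add: successively_map lab_def)
  with assms show ?thesis by metis
qed

lemma path_replace:
  assumes "is_path C s" "is_mor C m" "src m = src (hd s)" "tgt m = tgt (last s)"
  shows "is_path C (p @ m # q) \<longleftrightarrow> is_path C (p @ s @ q)"
proof -
  have s: "s \<noteq> []" using assms(1) by auto
  have "is_path C (m # q) \<longleftrightarrow> is_path C (s @ q)"
    using assms s by (cases "q = []") (simp_all add: is_path_append is_path_Cons)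
  moreover have "src (hd (s @ q)) = src m" "s @ q \<noteq> []" using assms s by simp_all
  ultimately show ?thesis by (cases "p = []") (simp_all add: is_path_append)
qed

lemma path_infix: "is_path C (p @ s @ q) \<Longrightarrow> s \<noteq> [] \<Longrightarrow> is_path C s"
  by (auto simp: is_path_def successively_append_iff)

lemma path_blocks:
  assumes A: "\<And>b. is_path C b \<Longrightarrow> is_mor D (A b)" "\<And>b. src (A b) = src (hd b)" "\<And>b. tgt (A b) = tgt (last b)"
  shows "ls \<noteq> [] \<Longrightarrow> (\<And>b. b \<in> set ls \<Longrightarrow> is_path C b) \<Longrightarrow> is_path D (map A ls) \<longleftrightarrow> is_path C (concat ls)"
proof (induction ls)
  case (Cons b ls)
  have b: "is_path C b" "b \<noteq> []" using Cons.prems(2)[of b] by auto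
  show ?case
  proof (cases "ls = []")
    case True
    then show ?thesis using b A by (simp add: is_path_Cons)
  next
    case False
    then obtain b' ls' where ls: "ls = b' # ls'" by (cases ls) auto
    have "b' \<noteq> []" using Cons.prems(2)[of b'] ls by auto
    then show ?thesis using Cons b A False ls
      by (auto simp: is_path_Cons[of D] is_path_append)
  qed
qed simp

lemma rdeg_concat: "rdeg (map (apply_op g f 0) ls) = rdeg (concat ls)"
  by (induction ls) simp_all

lemma splittings_Nil: "splittings [] = {[]}"
  by (auto simp: splittings_def) (metis list.set_intros(1) neq_Nil_conv)

lemma splittings_rec:
  assumes "w \<noteq> []"
  shows "splittings w = (\<Union>i\<in>{1..length w}. (#) (take i w) ` splittings (drop i w))"
proof (intro equalityI subsetI)
  fix ls assume "ls \<in> splittings w"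
  then have ls: "concat ls = w" "[] \<notin> set ls" by (auto simp: splittings_def)
  then obtain b ls' where b: "ls = b # ls'" "b \<noteq> []" using assms by (cases ls) auto
  then have "length b \<in> {1..length w}" "b = take (length b) w" "ls' \<in> splittings (drop (length b) w)"
    using ls by (auto simp: splittings_def Suc_le_eq)
  then show "ls \<in> (\<Union>i\<in>{1..length w}. (#) (take i w) ` splittings (drop i w))" using b by blast
qed (use assms in \<open>auto simp: splittings_def\<close>)

lemma splittings_sum:
  assumes "w \<noteq> []"
  shows "(\<Sum>ls\<in>splittings w. g ls) = (\<Sum>i\<in>{1..length w}. \<Sum>ls\<in>splittings (drop i w). g (take i w # ls))"
proof -
  have "(\<Sum>ls\<in>splittings w. g ls) = (\<Sum>i\<in>{1..length w}. \<Sum>ls\<in>(#) (take i w) ` splittings (drop i w). g ls)"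
    unfolding splittings_rec[OF assms]
  proof (rule sum.UNION_disjoint)
    show "\<forall>i\<in>{1..length w}. \<forall>j\<in>{1..length w}. i \<noteq> j \<longrightarrow>
      (#) (take i w) ` splittings (drop i w) \<inter> (#) (take j w) ` splittings (drop j w) = {}"
      by (auto simp: dest!: arg_cong[of "take _ w" _ length])
  qed (auto simp: finite_splittings)
  also have "\<dots> = (\<Sum>i\<in>{1..length w}. \<Sum>ls\<in>splittings (drop i w). g (take i w # ls))"
    by (simp add: sum.reindex)
  finally show ?thesis .
qed

text \<open>The terms of the geometric series are the cuts into nonempty blocks, which is the form
  in which the functor equation is given.\<close>

lemma ap_geo_splittings:
  assumes "ap f [] = 0"
  shows "ap (geo f) w = (\<Sum>ls\<in>splittings w. prod_list (map (ap f) ls))"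
proof (induction "length w" arbitrary: w rule: less_induct)
  case less
  show ?case
  proof (cases "w = []")
    case False
    have "ap (geo f) w = ap (1 + f * geo f) w" using geo_rec[OF assms] by simp
    also have "\<dots> = (\<Sum>i\<le>length w. ap f (take i w) * ap (geo f) (drop i w))"
      using False by (simp add: ap_one ap_times)
    also have "\<dots> = (\<Sum>i\<in>{1..length w}. ap f (take i w) * ap (geo f) (drop i w))"
      by (rule sum.mono_neutral_right) (auto simp: assms not_less_eq_eq)
    also have "\<dots> = (\<Sum>i\<in>{1..length w}. \<Sum>ls\<in>splittings (drop i w). prod_list (map (ap f) (take i w # ls)))"
    proof (rule sum.cong[OF refl])
      fix i assume "i \<in> {1..length w}"
      then have "length (drop i w) < length w" by auto
      from less[OF this] show "ap f (take i w) * ap (geo f) (drop i w) =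
          (\<Sum>ls\<in>splittings (drop i w). prod_list (map (ap f) (take i w # ls)))"
        by (simp add: sum_distrib_left)
    qed
    finally show ?thesis unfolding splittings_sum[OF False] .
  qed (simp add: splittings_Nil assms)
qed

lemma ap_comp_muh0: "ap (X \<odot> muh0 m) w = (\<Sum>k\<le>length w. \<Sum>j\<le>k. csc (bsign (eps (take j w)))
    (clin (\<lambda>u. ap X (take j w @ u @ drop k w)) (ap m (slice j k w))))"
  for w :: "('o, 'y::grading_datum, 'a) mor list"
proof -
  have "ap (muh0 m) w = (\<Sum>k\<le>length w. \<Sum>j\<le>k. csc (bsign (eps (take j w)))
      (word (take j w) * ap m (slice j k w) * word (drop k w)))"
    unfolding muh0_def
    by (simp add: ap_times sum_distrib_right slice_def eps_epar min_absorb1 min_absorb2 csc_mult_left[symmetric] del: mult.assoc)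
  then show ?thesis
    by (simp add: clin_sum clin_csc mult_conv_clin clin_clin plus_list_def)
qed

context based2
begin

context
  fixes f :: "('o, 'y, 'a) mor list \<Rightarrow> 'b" and d :: 'y
  assumes f: "multilinear_op C D id f d"
begin

lemma mop_slot_mor:
  assumes "is_mor C m"
  shows "clin (\<lambda>u. ap (mop C D B' f d) (p @ u @ q)) (C.lx m) = ap (mop C D B' f d) (p @ m # q)"
proof (cases "is_path C (p @ m # q)")
  case False
  have "clin (\<lambda>u. ap (mop C D B' f d) (p @ u @ q)) (C.lx m) = clin (\<lambda>u. 0) (C.lx m)"
  proof (rule clin_cong[OF refl])
    fix u assume "u \<in> Poly_Mapping.keys (C.lx m)"
    then obtain \<beta> where "u = [with_elt m \<beta>]" by (auto simp: in_keys_iff C.lookup_lx split: if_splits)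
    then show "ap (mop C D B' f d) (p @ u @ q) = 0"
      using False assms path_with_elt[OF f, of p m \<beta> q] path_with_elt[OF f, of p m "elt m" q] by (auto simp: mop_def)
  qed
  then show ?thesis using False by (simp add: mop_def)
qed (rule mop_slot[OF f])

lemma mop_expand_mor: "\<forall>m\<in>set w. is_mor C m \<Longrightarrow>
   clin (\<lambda>u. ap (mop C D B' f d) (p @ u)) (expand C B w) = ap (mop C D B' f d) (p @ w)"
proof (induction w arbitrary: p)
  case (Cons m w)
  have "clin (\<lambda>u. ap (mop C D B' f d) (p @ u)) (expand C B (m # w)) =
    clin (\<lambda>x. clin (\<lambda>u. ap (mop C D B' f d) ((p @ x) @ u)) (expand C B w)) (C.lx m)"
    unfolding C.expand_Cons[of m w] by (subst mult_conv_clin) (simp add: clin_clin plus_list_def)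
  also have "\<dots> = clin (\<lambda>x. ap (mop C D B' f d) (p @ x @ w)) (C.lx m)"
  proof -
    have "clin (\<lambda>u. ap (mop C D B' f d) ((p @ x) @ u)) (expand C B w) = ap (mop C D B' f d) ((p @ x) @ w)" for x
      using Cons.prems by (intro Cons.IH) simp
    then show ?thesis by simp
  qed
  also have "\<dots> = ap (mop C D B' f d) (p @ m # w)"
    using Cons.prems by (intro mop_slot_mor) simp
  finally show ?case .
qed simp

text \<open>The bridge from ring identities to the A-infinity relations. All summands have the same
  ends and the same degree, so their expansions can be collected into the expansion of a single
  morphism.\<close>

lemma mop_muh0:
  assumes \<mu>: "multilinear_op C C id \<mu> (deg_of_int 1)"
  shows "ap (mop C D B' f d \<odot> muh0 (mop C C B \<mu> (deg_of_int 1))) w =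
    (if is_path C w then
      D.lx (Mor (src (hd w)) (tgt (last w)) (rdeg w + deg_of_int 1 + d + deg_of_int 1)
        (\<Sum>j<length w. \<Sum>k\<in>{j<..length w}. scl D (bsign (eps (take j w)))
          (f (take j w @ apply_op id \<mu> (deg_of_int 1) (slice j k w) # drop k w)))) else 0)"
proof -
  \<comment> \<open>\<open>M\<close> carries the ends and the degree common to all summands; its
    element 0 is a placeholder.\<close>
  define M where "M = Mor (src (hd w)) (tgt (last w)) (rdeg w + deg_of_int 1 + d + deg_of_int 1) (0::'b)"
  let ?m = "\<lambda>j k. apply_op id \<mu> (deg_of_int 1) (slice j k w)"
  let ?mm = "mop C C B \<mu> (deg_of_int 1)" and ?ff = "mop C D B' f d"
  have mor: "is_mor C (apply_op id \<mu> (deg_of_int 1) b)" if "is_path C b" for b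
    using \<mu> that by (simp add: multilinear_op_def)
  let ?t = "\<lambda>j k. csc (bsign (eps (take j w))) (clin (\<lambda>u. ap ?ff (take j w @ u @ drop k w)) (ap ?mm (slice j k w)))"
  let ?s = "\<lambda>j k. take j w @ ?m j k # drop k w"
  have w3: "w = take j w @ slice j k w @ drop k w" if "j \<le> k" for j k
  proof -
    have "take k w = take j w @ slice j k w"
      using append_take_drop_id[of j "take k w"] that by (simp add: slice_def min_absorb1)
    then show ?thesis by (metis append_assoc append_take_drop_id)
  qed
  have t: "?t j k = (if is_path C w then csc (bsign (eps (take j w))) (D.lx (with_elt M (f (?s j k))))  else 0)
     \<and> (is_path C w \<longrightarrow> is_mor D (with_elt M (f (?s j k))))"
    if jk: "j < k" "k \<le> length w" for j k
  proof -
    have ne: "slice j k w \<noteq> []" using jk by (auto simp: slice_def)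
    have rd: "rdeg (take j w) + rdeg (slice j k w) + rdeg (drop k w) = rdeg w"
      using arg_cong[OF w3[of j k], of rdeg] jk by (simp add: add.assoc)
    show ?thesis
    proof (cases "is_path C (slice j k w)")
      case True
      have P: "is_path C (?s j k) \<longleftrightarrow> is_path C w"
        using path_replace[OF True mor[OF True], of "take j w" "drop k w"] w3[of j k] jk by simp
      have hd: "src (hd (?s j k)) = src (hd w)"
      proof -
        have "hd (take j w @ slice j k w @ drop k w) = (if j = 0 then hd (slice j k w) else hd (take j w))"
          using ne jk by (cases w; cases j; auto)
        moreover have "src (hd (?s j k)) = src (if j = 0 then hd (slice j k w) else hd (take j w))"
          using jk by (cases w; cases j; auto)
        ultimately show ?thesis using w3[of j k] jk by simp
      qed
      have tl: "tgt (last (?s j k)) = tgt (last w)"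
        using arg_cong[OF w3[of j k], of last] jk ne by (cases "drop k w = []") (auto simp: last_append)
      have L: "apply_op id f d (?s j k) = with_elt M (f (?s j k))"
        using hd tl rd by (simp add: apply_op_def with_elt_def M_def algebra_simps)
      have "clin (\<lambda>u. ap ?ff (take j w @ u @ drop k w)) (ap ?mm (slice j k w)) = ap ?ff (?s j k)"
        using mop_slot_mor[OF mor[OF True], of "take j w" "drop k w"] True by (simp add: mop_def[of C C])
      moreover have "is_path C w \<longrightarrow> is_mor D (with_elt M (f (?s j k)))"
        using mop_mor[OF f, of "?s j k"] P L by simp
      ultimately show ?thesis using P L by (simp add: mop_def[of C D])
    next
      case False
      have "\<not> is_path C w"
        using False path_infix[OF _ ne, of C "take j w" "drop k w"] w3[of j k] jk by auto
      then show ?thesis using False by (simp add: mop_def)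
    qed
  qed
  have "ap (?ff \<odot> muh0 ?mm) w = (\<Sum>k\<le>length w. \<Sum>j\<le>k. ?t j k)"
    by (rule ap_comp_muh0)
  \<comment> \<open>Cuts with \<open>j = k\<close> feed the empty word to the operation and give
    0.\<close>
  also have "\<dots> = (\<Sum>k\<le>length w. \<Sum>j<k. ?t j k)"
    by (intro sum.cong refl sum.mono_neutral_right) (auto simp: mop_def slice_def)
  also have "\<dots> = (\<Sum>(k, j)\<in>Sigma {..length w} (\<lambda>k. {..<k}). ?t j k)"
    by (simp add: sum.Sigma)
  also have "\<dots> = (\<Sum>(j, k)\<in>Sigma {..<length w} (\<lambda>j. {j<..length w}). ?t j k)"
    by (rule sum.reindex_bij_witness[of _ "\<lambda>(j, k). (k, j)" "\<lambda>(k, j). (j, k)"]) auto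
  also have "\<dots> = (\<Sum>j<length w. \<Sum>k\<in>{j<..length w}. ?t j k)"
    by (simp add: sum.Sigma)
  finally have *: "ap (?ff \<odot> muh0 ?mm) w = (\<Sum>j<length w. \<Sum>k\<in>{j<..length w}. ?t j k)" .
  show ?thesis
  proof (cases "is_path C w")
    case True
    have "1 \<le> length w" using True by (cases w) auto
    then have "is_mor D (with_elt M (f (?s 0 1)))"
      using t[of 0 1] True zero_less_one by blast
    from D.is_mor_0[OF this] have Mm: "is_mor D M"
      by (simp add: M_def with_elt_def)
    have ms: "is_mor D (with_elt M (scl D (bsign (eps (take j w))) (f (?s j k))))"
      if "j < length w" "k \<in> {j<..length w}" for j k
      using t[of j k] that True by (intro D.is_mor_scl) auto
    have "(\<Sum>j<length w. \<Sum>k\<in>{j<..length w}. ?t j k) =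
      (\<Sum>j<length w. \<Sum>k\<in>{j<..length w}. D.lx (with_elt M (scl D (bsign (eps (take j w))) (f (?s j k)))))"
      using t True by (intro sum.cong refl) (auto simp: D.lx_scl)
    also have "\<dots> = D.lx (with_elt M (\<Sum>j<length w. \<Sum>k\<in>{j<..length w}. scl D (bsign (eps (take j w))) (f (?s j k))))"
      using ms Mm by (subst D.lx_sum; (subst D.lx_sum)?) (auto intro!: D.is_mor_sum)
    finally show ?thesis using * True by (simp add: M_def with_elt_def)
  qed (use * t in \<open>auto intro!: sum.neutral\<close>)
qed

end

end

context based
begin

lemma keys_expand:
  assumes "\<forall>m\<in>set w. is_mor C m" "u \<in> Poly_Mapping.keys (expand C B w)"
  shows "map lab u = map lab w \<and> (\<forall>m\<in>set u. is_mor C m \<and> elt m \<in> B (src m) (tgt m) (deg m))"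
  using assms
proof (induction w arbitrary: u)
  case (Cons m w)
  then obtain a b where "u = a @ b" "a \<in> Poly_Mapping.keys (lx m)" "b \<in> Poly_Mapping.keys (expand C B w)"
    unfolding expand_Cons[of m w] by (auto dest!: subsetD[OF keys_mult] simp: plus_list_def)
  moreover from this obtain \<beta> where "a = [with_elt m \<beta>]" "\<beta> \<in> S m"
    by (auto simp: in_keys_iff lookup_lx split: if_splits)
  ultimately show ?case using Cons S_mor[of m \<beta>] S_basis[of \<beta> m] by auto
qed (simp add: zero_list_def)

lemma lab_path:
  assumes "is_path C w" "map lab u = map lab w" "\<forall>m\<in>set u. is_mor C m"
  shows "is_path C u"
  using assms lab_successively[OF assms(2)] unfolding is_path_def by auto

end

locale ainf_based = based C B
  for C :: "('k::field, 'o, 'y::grading_datum, 'a::ab_group_add) ainf_data" and B +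
  assumes mu: "multilinear_op C C id (ainf_data.mu C) (deg_of_int 1)"
    and rel: "is_path C w \<Longrightarrow>
      (\<Sum>j<length w. \<Sum>k\<in>{j<..length w}.
        scl C (bsign (eps (take j w)))
          (ainf_data.mu C (take j w @ mu_mor C (slice j k w) # drop k w))) = 0"
begin

abbreviation "m0 \<equiv> mop C C B (ainf_data.mu C) (deg_of_int 1)"

sublocale CC: based2 C B C B ..

lemma op1_m0: "op1 1 m0"
  using CC.op1_mop[of "deg_of_int 1"] by simp

lemma lx_Mor_0: "lx (Mor X Y y 0) = 0"
  using lx_0[of "Mor X Y y 0"] by (simp add: with_elt_def)

lemma m0_sq: "m0 \<odot> muh0 m0 = 0"
proof (rule wop_eqI)
  show "ap (m0 \<odot> muh0 m0) w = ap 0 w" for w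
    unfolding CC.mop_muh0[OF mu mu] using rel[of w] by (simp add: lx_Mor_0)
qed

lemma mu_mor: "is_path C w \<Longrightarrow> is_mor C (mu_mor C w)"
  using mu by (simp add: multilinear_op_def)

text \<open>On a basis word, differentiating the coordinates of the value is the definition of
  v(mu). Both sides extend this linearly along the expansion of \<open>w\<close>, whose own
  coefficients are not differentiated.\<close>

lemma v_mu_expand:
  assumes v: "der v" and w: "is_path C w"
  shows "is_mor C (apply_op id (v_mu C B v) (deg_of_int 1) w)"
    and "clin (ap (opv v m0)) (expand C B w) = lx (apply_op id (v_mu C B v) (deg_of_int 1) w)"
proof -
  define M where "M = mu_mor C w"
  let ?g = "\<lambda>w'. \<Sum>\<gamma>\<in>S (mu_mor C w'). scl C (v (coord C B (mu_mor C w') \<gamma>)) \<gamma>"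
  have M: "is_mor C M" unfolding M_def by (rule mu_mor[OF w])
  have aw: "apply_op id f (deg_of_int 1) w = with_elt M (f w)" for f
    by (simp add: M_def apply_op_def with_elt_def)
  have 1: "is_mor C (with_elt M (?g w')) \<and> mapv v (ap m0 w') = lx (with_elt M (?g w'))"
    if k: "w' \<in> Poly_Mapping.keys (expand C B w)" for w'
  proof -
    have ll: "map lab w' = map lab w" "\<forall>m\<in>set w'. is_mor C m"
      using keys_expand[OF _ k] w by (auto simp: is_path_def)
    have p': "is_path C w'" by (rule lab_path[OF w ll])
    have "w \<noteq> []" using w by auto
    then have m': "mu_mor C w' = with_elt M (ainf_data.mu C w')"
      using lab_hd_last[OF ll(1)] lab_rdeg[OF ll(1)] by (simp add: M_def apply_op_def with_elt_def)
    have mm': "is_mor C (with_elt M (ainf_data.mu C w'))" using mu_mor[OF p'] m' by simp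
    have e: "is_mor C (with_elt M \<gamma>)" "lx (with_elt M \<gamma>) = word [with_elt M \<gamma>]" if "\<gamma> \<in> S (mu_mor C w')" for \<gamma>
    proof -
      show 1: "is_mor C (with_elt M \<gamma>)" using S_mor[OF mm'] that m' by simp
      show "lx (with_elt M \<gamma>) = word [with_elt M \<gamma>]" using S_basis[OF that] m' by (intro lx_basis[OF 1]) simp
    qed
    have "mapv v (ap m0 w') = (\<Sum>\<gamma>\<in>S (mu_mor C w'). Poly_Mapping.single [with_elt M \<gamma>] (v (coord C B (mu_mor C w') \<gamma>)))"
      using p' unfolding lx_eq mapv_sum[OF v, symmetric] by (simp add: mop_def lx_eq mapv_sum[OF v] mapv_simps(6)[OF v] m')
    also have "\<dots> = (\<Sum>\<gamma>\<in>S (mu_mor C w'). lx (with_elt M (scl C (v (coord C B (mu_mor C w') \<gamma>)) \<gamma>)))"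
      by (rule sum.cong[OF refl]) (simp add: lx_scl e)
    also have "\<dots> = lx (with_elt M (?g w'))"
      by (rule lx_sum[symmetric, OF M]) (intro is_mor_scl e)
    finally have "mapv v (ap m0 w') = lx (with_elt M (?g w'))" .
    moreover have "is_mor C (with_elt M (?g w'))" by (intro is_mor_sum[OF M] is_mor_scl e)
    ultimately show ?thesis by blast
  qed
  have vw: "v_mu C B v w = (\<Sum>w'\<in>Poly_Mapping.keys (expand C B w). scl C (Poly_Mapping.lookup (expand C B w) w') (?g w'))"
    by (simp add: v_mu_def lin_def)
  show "is_mor C (apply_op id (v_mu C B v) (deg_of_int 1) w)"
    unfolding aw vw by (rule is_mor_sum[OF M], rule is_mor_scl) (use 1 in blast)
  have "clin (ap (opv v m0)) (expand C B w) = (\<Sum>w'\<in>Poly_Mapping.keys (expand C B w).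
      csc (Poly_Mapping.lookup (expand C B w) w') (lx (with_elt M (?g w'))))"
    unfolding lin_def using 1 by (intro sum.cong refl) (simp add: ap_opv)
  also have "\<dots> = (\<Sum>w'\<in>Poly_Mapping.keys (expand C B w).
      lx (with_elt M (scl C (Poly_Mapping.lookup (expand C B w) w') (?g w'))))"
    using 1 by (intro sum.cong refl lx_scl[symmetric]) blast
  also have "\<dots> = lx (with_elt M (v_mu C B v w))"
    unfolding vw by (rule lx_sum[symmetric, OF M], rule is_mor_scl) (use 1 in blast)
  finally show "clin (ap (opv v m0)) (expand C B w) = lx (apply_op id (v_mu C B v) (deg_of_int 1) w)"
    unfolding aw .
qed

end

text \<open>Functors that are the identity on objects; the pullback construction below reduces the
  general case to this one.\<close>

locale ainf_functor_based = C: ainf_based C B + D: ainf_based D B'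
  for C :: "('k::field, 'o, 'y::grading_datum, 'a::ab_group_add) ainf_data" and B
    and D :: "('k, 'o, 'y, 'b::ab_group_add) ainf_data" and B' +
  fixes F :: "('o, 'y, 'a) mor list \<Rightarrow> 'b"
  assumes F: "ainf_functor C D id F"
begin

sublocale CD: based2 C B D B' ..

abbreviation "f0 \<equiv> mop C D B' F 0"

lemma Fml: "multilinear_op C D id F 0"
  using F by (simp add: ainf_functor_def)

lemma F_mor: "is_path C w \<Longrightarrow> is_mor D (apply_op id F 0 w)"
  using Fml by (simp add: multilinear_op_def)

lemma op1_f0: "op1 0 f0"
  using CD.op1_mop[of "0::'y"] by simp

lemma prod_f0:
  "prod_list (map (ap f0) ls) = (if \<forall>b\<in>set ls. is_path C b then expand D B' (map (apply_op id F 0) ls) else 0)"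
proof (induction ls)
  case (Cons b ls)
  have "ap f0 b = (if is_path C b then D.lx (apply_op id F 0 b) else 0)" by (simp add: mop_def)
  then show ?case unfolding list.map prod_list.Cons D.expand_Cons[of "apply_op id F 0 b" "map (apply_op id F 0) ls"] Cons
    by simp
qed simp

text \<open>On a splitting, the product of the matrices of F is the expansion of the word of values
  of F, and multilinearity evaluates \<open>D.m0\<close> on that word directly. Splittings with a
  block that does not compose contribute 0 to both sides.\<close>

lemma f0_eq: "D.m0 \<odot> geo f0 = f0 \<odot> muh0 C.m0"
proof (rule wop_eqI)
  fix w :: "('o, 'y, 'a) mor list"
  define M where "M = Mor (src (hd w)) (tgt (last w)) (rdeg w + deg_of_int 1 + 0 + deg_of_int 1) (0::'b)"
  have L: "ap (D.m0 \<odot> geo f0) w = (\<Sum>ls\<in>splittings w. clin (ap D.m0) (prod_list (map (ap f0) ls)))"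
    using op1_f0 by (simp add: ap_geo_splittings op1D clin_sum)
  have T: "clin (ap D.m0) (prod_list (map (ap f0) ls)) =
      (if is_path C w then D.lx (with_elt M (ainf_data.mu D (map (apply_op id F 0) ls))) else 0) \<and>
      (is_path C w \<longrightarrow> is_mor D (with_elt M (ainf_data.mu D (map (apply_op id F 0) ls))))"
    if "ls \<in> splittings w" for ls
  proof -
    have ls: "concat ls = w" "[] \<notin> set ls" using that by (auto simp: splittings_def)
    show ?thesis
    proof (cases "ls = [] \<or> \<not> (\<forall>b\<in>set ls. is_path C b)")
      case True
      have "\<not> is_path C w"
      proof
        assume w: "is_path C w"
        then have "\<not> (\<forall>b\<in>set ls. is_path C b)" using True ls by auto
        then obtain b p q where b: "ls = p @ b # q" "\<not> is_path C b" by (metis in_set_conv_decomp)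
        then have "w = concat p @ b @ concat q" "b \<noteq> []" using ls by auto
        then show False using w b(2) by (metis path_infix)
      qed
      moreover have "clin (ap D.m0) (prod_list (map (ap f0) ls)) = 0"
      proof (cases "ls = []")
        case False
        then have "\<not> (\<forall>b\<in>set ls. is_path C b)" using True by simp
        then show ?thesis unfolding prod_f0 by (simp only: if_False clin_0)
      qed (simp add: mop_def)
      ultimately show ?thesis by simp
    next
      case False
      let ?ls = "map (apply_op id F 0) ls"
      have P: "is_path D ?ls \<longleftrightarrow> is_path C w"
        using path_blocks[of C D "apply_op id F 0" ls, OF F_mor] False ls by simp
      have h: "hd w = hd (hd ls)" "last w = last (last ls)"
      proof -
        have "ls \<noteq> []" using False by simp
        then have "hd ls \<noteq> []" "last ls \<noteq> []" using ls(2) hd_in_set[of ls] last_in_set[of ls] by metis+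
        moreover have "concat ls = hd ls @ concat (tl ls)"
          using \<open>ls \<noteq> []\<close> by (cases ls) simp_all
        moreover have "concat ls = concat (butlast ls) @ last ls"
          using \<open>ls \<noteq> []\<close> by (cases ls rule: rev_cases) simp_all
        ultimately show "hd w = hd (hd ls)" "last w = last (last ls)" using ls(1) by (metis hd_append2, metis last_appendR)
      qed
      have A: "mu_mor D ?ls = with_elt M (ainf_data.mu D ?ls)"
        using False ls(1) h by (simp add: apply_op_def[of _ _ "deg_of_int 1"] with_elt_def M_def hd_map last_map rdeg_concat)
      have "clin (ap D.m0) (prod_list (map (ap f0) ls)) = ap D.m0 ([] @ ?ls)"
        using False F_mor D.CC.mop_expand_mor[OF D.mu, of ?ls "[]"] by (simp add: prod_f0)
      then show ?thesis using P A D.mu_mor[of ?ls] by (simp add: mop_def)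
    qed
  qed
  show "ap (D.m0 \<odot> geo f0) w = ap (f0 \<odot> muh0 C.m0) w"
  proof (cases "is_path C w")
    case True
    have fin: "finite (splittings w)" by (rule finite_splittings)
    have "[w] \<in> splittings w" using True by (auto simp: splittings_def)
    then have Mm: "is_mor D M" using T True D.is_mor_0 by (fastforce simp: M_def with_elt_def)
    have "ap (D.m0 \<odot> geo f0) w = (\<Sum>ls\<in>splittings w. D.lx (with_elt M (ainf_data.mu D (map (apply_op id F 0) ls))))"
      unfolding L using T True by (intro sum.cong refl) simp
    also have "\<dots> = D.lx (with_elt M (\<Sum>ls\<in>splittings w. ainf_data.mu D (map (apply_op id F 0) ls)))"
      using T True by (intro D.lx_sum[symmetric, OF Mm]) blast
    also have "\<dots> = ap (f0 \<odot> muh0 C.m0) w"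
      using F True unfolding CD.mop_muh0[OF Fml C.mu] ainf_functor_def by (simp add: M_def with_elt_def)
    finally show ?thesis .
  next
    case False
    then show ?thesis unfolding L CD.mop_muh0[OF Fml C.mu] using T by (auto intro!: sum.neutral)
  qed
qed

sublocale functor_ops C.m0 D.m0 f0
  by standard (rule C.op1_m0 D.op1_m0 op1_f0 C.m0_sq D.m0_sq f0_eq)+

end

section \<open>Expanding words over the augmented category\<close>

definition mk :: "nat \<Rightarrow> 'l list \<Rightarrow> 'l lt list"
  where "mk i z = map Plain (take i z) @ Marked (z ! i) # map Plain (drop (Suc i) z)"

lemma length_mk [simp]: "i < length z \<Longrightarrow> length (mk i z) = length z"
  by (simp add: mk_def)

lemma epar_mk: "i < length z \<Longrightarrow> epar (mk i z) = epar z"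
proof -
  have "epar (map Plain u) = epar u" for u :: "'a list" by (induction u) simp_all
  then show "i < length z \<Longrightarrow> epar (mk i z) = epar z"
    using epar_simps(3)[of "take i z" "z ! i # drop (Suc i) z"] by (simp add: mk_def id_take_nth_drop[symmetric])
qed

lemma epar_Plain [simp]: "epar (map Plain u) = epar u"
  by (induction u) simp_all

lemma take_mk: "i < length z \<Longrightarrow> take l (mk i z) = (if l \<le> i then map Plain (take l z) else mk i (take l z))"
  by (auto simp: mk_def take_map min_def take_Cons' drop_take Suc_diff_Suc not_le numeral_eq_Suc)

lemma drop_mk:
  assumes "i < length z"
  shows "drop l (mk i z) = (if l \<le> i then mk (i - l) (drop l z) else map Plain (drop l z))"
proof (cases "l \<le> i")
  case True
  then show ?thesis using assms by (simp add: mk_def drop_map drop_take min_def)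
next
  case False
  then obtain d where "l = Suc (i + d)" by (metis add_Suc less_imp_Suc_add not_le)
  then show ?thesis using assms by (simp add: mk_def drop_map drop_take min_def add.commute)
qed

lemma mk_0: "mk 0 (a # z) = Marked a # map Plain z"
  by (simp add: mk_def)

lemma mk_Suc: "mk (Suc i) (a # z) = Plain a # mk i z"
  by (simp add: mk_def)

text \<open>After \<open>i\<close> rotations the entry a_0 stands at position \<open>i\<close>,
  which is where \<open>mk i\<close> puts the mark.\<close>

lemma ap_NN_headM:
  "ap (W \<odot> NN \<odot> headM) w = (\<Sum>i<length w. clin (\<lambda>z. ap W (mk i z)) (rotn i w))"
proof (cases w)
  case (Cons a y)
  have "ap (W \<odot> NN \<odot> headM) w = (\<Sum>i<length w. clin (ap W) (rotn i (Marked a # map Plain y)))"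
    by (simp add: Cons NN_def ap_headM clin_sum clin_add)
  also have "\<dots> = (\<Sum>i<length w. clin (\<lambda>z. ap W (mk i z)) (rotn i w))"
  proof (rule sum.cong[OF refl])
    fix i assume i: "i \<in> {..<length w}"
    define u v where "u = take (length w - Suc i) y" and "v = drop (length w - Suc i) y"
    have "length w - i = Suc (length w - Suc i)" using i by auto
    moreover have "length (Marked a # map Plain y) = length w" by (simp add: Cons)
    ultimately have 1: "rotn i (Marked a # map Plain y) = mulrev (Marked a # map Plain u, map Plain v)"
      and 2: "rotn i w = mulrev (a # u, v)"
      unfolding rotn_def by (simp_all add: Cons u_def v_def take_map drop_map)
    have "i = length v" using i by (simp add: v_def Cons)
    then have "mk i (v @ a # u) = map Plain v @ Marked a # map Plain u" by (simp add: mk_def)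
    then show "clin (ap W) (rotn i (Marked a # map Plain y)) = clin (\<lambda>z. ap W (mk i z)) (rotn i w)"
      unfolding 1 2 by (simp add: mulrev_def)
  qed
  finally show ?thesis .
qed (simp add: headM_def Mt_def)

text \<open>Every nontrivial rotation starts with a plain letter, so an operator vanishing on such
  words sees only the unrotated one.\<close>

lemma NN_headM_head:
  assumes "ap X [] = 0" "\<And>x z. ap X (Plain x # z) = 0"
  shows "X \<odot> NN \<odot> headM = X \<odot> headM"
proof (rule wop_eqI)
  fix w
  show "ap (X \<odot> NN \<odot> headM) w = ap (X \<odot> headM) w"
  proof (cases w)
    case (Cons a y)
    have "ap (X \<odot> NN \<odot> headM) w = (\<Sum>i<length w. if i = 0 then ap X (mk 0 w) else 0)"
      unfolding ap_NN_headM
    proof (rule sum.cong[OF refl])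
      fix i assume i: "i \<in> {..<length w}"
      show "clin (\<lambda>z. ap X (mk i z)) (rotn i w) = (if i = 0 then ap X (mk 0 w) else 0)"
      proof (cases i)
        case 0
        then show ?thesis by (simp add: rotn_def mulrev_def)
      next
        case (Suc j)
        have "clin (\<lambda>z. ap X (mk i z)) (rotn i w) = clin (\<lambda>z. 0) (rotn i w)"
        proof (rule clin_cong[OF refl])
          fix z assume "z \<in> Poly_Mapping.keys (rotn i w)"
          then have "length z = length w" by (auto simp: rotn_def mulrev_def split: if_splits)
          then obtain b z' where "z = b # z'" using Cons by (cases z) auto
          then show "ap X (mk i z) = 0" using Suc by (simp add: mk_Suc assms)
        qed
        then show ?thesis using Suc by simp
      qed
    qed
    also have "\<dots> = ap X (mk 0 w)" by (simp add: Cons)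
    finally show ?thesis by (simp add: Cons mk_0)
  qed (simp add: headM_def NN_def Mt_def)
qed

lemma parity_minus_1 [simp]: "parity (- deg_of_int 1 :: 'y::grading_datum) = 1"
  using parity_add[of "deg_of_int 1 :: 'y" "- deg_of_int 1"]
  by (rule_tac p = "parity (- deg_of_int 1 :: 'y)" in bsign_cases) simp_all

lemma keys_csc_one: "u \<in> Poly_Mapping.keys (csc c (1 :: 'l list \<Rightarrow>\<^sub>0 'k::field)) \<Longrightarrow> u = []"
  by (auto simp: word_Nil[symmetric] simp del: word_Nil split: if_splits)

lemma lin1_0: "lin1 0"
  by (simp add: lin1_def)

context ainf_based
begin

text \<open>The guard makes reading off the e^+ coefficient homogeneous on all letters, also on
  those that are not morphisms. On morphisms it changes nothing, since a nonzero coefficient forces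
  degree 0.\<close>

abbreviation zc :: "('o, 'y, 'a \<times> 'k) mor \<Rightarrow> 'k" where "zc m \<equiv> if deg m = 0 then e_coeff m else 0"

text \<open>Forgets the e^+ part of a letter and expands the rest; used on the entries a_1, ...,
  a_s, where e^+ is degenerate.\<close>

definition dC :: "(('o, 'y, 'a \<times> 'k) mor, ('o, 'y, 'a) mor list, 'k) wop"
  where "dC = on_letter (\<lambda>m. lx (drop_e m))"
definition zu :: "(('o, 'y, 'a \<times> 'k) mor lt, 'w::monoid_add, 'k) wop"
  where "zu = on_letter (\<lambda>a. case a of Plain m \<Rightarrow> csc (zc m) 1 | _ \<Rightarrow> 0)"
definition zm :: "(('o, 'y, 'a \<times> 'k) mor lt, 'w::monoid_add, 'k) wop"
  where "zm = on_letter (\<lambda>a. case a of Marked m \<Rightarrow> csc (zc m) 1 | _ \<Rightarrow> 0)"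
definition ee :: "(('o, 'y, 'a \<times> 'k) mor lt, ('o, 'y, 'a) mor lt list, 'k) wop"
  where "ee = on_letter (\<lambda>a. case a of Marked m \<Rightarrow> csc (zc m) (word [Unit]) | _ \<Rightarrow> 0)"
definition Ku where "Ku = Fu dC"
definition qm where "qm = fm dC + ee"
definition Km where "Km = Ku * qm * Ku"
definition qt where "qt = Mt \<odot> dC \<odot> stu"
text \<open>The comparison map: the entry a_0 keeps its e^+ part as \<open>Unit\<close>, the other
  entries lose theirs. Its kernel will be the null chains, up to the word \<open>[Unit]\<close>; see
  \<open>null_iff\<close>.\<close>

definition Q0 where "Q0 = (qm * Ku) \<odot> headM"
text \<open>\<open>ru\<close> and \<open>rm\<close> compute the operations of the augmented category
  followed by the comparison, on plain words and on words with one mark. The terms with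
  \<open>zu\<close> are products with an e^+ sitting in a place other than a_0. \<open>Wb\<close>
  arranges them like \<open>bbar\<close>.\<close>

definition ru where "ru = muu m0 \<odot> Ku + zu * muu dC - (muu dC \<odot> sg 1) * zu"
definition rm where "rm = mm m0 \<odot> Km + zu * qm - (qm \<odot> sg 1) * zu"
definition Wb where "Wb = rm * Ku + (qm \<odot> sg 1) * ((Ku \<odot> sg 1) * ru * Ku)"

lemma drop_e_simps [simp]: "src (drop_e m) = src m" "tgt (drop_e m) = tgt m" "deg (drop_e m) = deg m"
  "elt (drop_e m) = fst (elt m)" "lab (drop_e m) = lab m" "par (drop_e m) = par m"
  by (simp_all add: drop_e_def)

lemma keys_lx: "u \<in> Poly_Mapping.keys (lx m) \<Longrightarrow> \<exists>\<beta>. u = [with_elt m \<beta>]"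
  by (auto simp: in_keys_iff lookup_lx split: if_splits)

lemma op1_dC [simp]: "op1 0 dC"
  unfolding op1_def dC_def
  by (auto intro!: letter_valued_on_letter homog_on_letter dest!: keys_lx)

lemmas dC_op [simp] = op1D[OF op1_dC]

lemma lin1_dC [simp]: "lin1 dC" "lin1 zu" "lin1 zm" "lin1 ee"
  by (simp_all add: dC_def zu_def zm_def ee_def lin1_on_letter)

lemma lv_ee [simp]: "letter_valued ee" "letter_valued qm"
proof -
  show "letter_valued ee"
    unfolding ee_def by (intro letter_valued_on_letter) (auto split: lt.splits if_splits)
  then show "letter_valued qm" by (simp add: qm_def letter_valued_add)
qed

lemma par_deg_0: "deg m = (0::'y) \<Longrightarrow> par m = 1" for m :: "('o, 'y, 'a \<times> 'k) mor"
  by (simp add: par_mor_def)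

lemma homog_zu: "homog 1 zu"
  unfolding zu_def by (intro homog_on_letter) (auto split: lt.splits if_splits simp: par_deg_0 dest!: keys_csc_one)

lemma homog_ee [simp]: "homog 0 ee" "homog 0 qm"
proof -
  show "homog 0 ee"
    unfolding ee_def by (intro homog_on_letter) (auto split: lt.splits if_splits simp: par_deg_0)
  then show "homog 0 qm" by (simp add: qm_def homog_add)
qed

lemma ee_comps [simp]: "stu \<odot> ee = 0" "stm \<odot> ee = 0" "Es \<odot> ee = zm" "1 \<odot> ee = 0"
  by (auto intro!: lin1_eqI lin1_comp_on_letter simp: ee_def zm_def lin1_on_letter lin1_0 ap_Es split: lt.splits)

lemma grpl_Ku [simp]: "grpl Ku" "grpl (Ku \<odot> sg p)" "homog 0 Ku"
  by (simp_all add: Ku_def)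

lemma Ku_rec: "Ku = 1 + muu dC * Ku" "Ku = 1 + Ku * muu dC"
proof -
  have "Fu dC = ut \<odot> (1 + dC * geo dC) \<odot> stu" using geo_rec[of dC] by (simp add: Fu_def)
  then show "Ku = 1 + muu dC * Ku" by (simp add: Ku_def Fu_def muu_def nf)
  have "Fu dC = ut \<odot> (1 + geo dC * dC) \<odot> stu" using geo_rec_right[of dC] by (simp add: Fu_def)
  then show "Ku = 1 + Ku * muu dC" by (simp add: Ku_def Fu_def muu_def nf)
qed

lemma Km_alt: "Km = Fm dC + Ku * ee * Ku"
  by (simp add: Km_def qm_def Fm_def Ku_def algebra_simps)

lemma times_Km: "(X * Y) \<odot> Km = (X \<odot> Ku) * (Y \<odot> Km) + (X \<odot> Km) * (Y \<odot> Ku)"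
  unfolding Km_def by (rule times_comp3) simp_all

lemma times_Ku: "(X * Y) \<odot> Ku = (X \<odot> Ku) * (Y \<odot> Ku)"
  by (rule times_comp_grouplike) simp

lemma Ku_comps [simp]: "im \<odot> Ku = 0" "Im \<odot> Ku = 0" "mm m \<odot> Ku = 0" "fm f \<odot> Ku = 0" "Iu \<odot> Ku = Ku" "Gu \<odot> Ku = Ku \<odot> sg 1" "Es \<odot> Ku = 0"
  "stu \<odot> Ku = geo dC \<odot> stu" "stm \<odot> Ku = 0" "1 \<odot> Ku = 1" "et \<odot> Ku = et" "iot \<odot> Ku = qt" "sg p \<odot> Ku = Ku \<odot> sg p"
  by (simp_all add: Ku_def iot_def qt_def comp_assoc sg_lt_ops et_eq)

lemma im_Km [simp]: "im \<odot> Km = qm"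
proof -
  have "im \<odot> (Ku * ee * Ku) = (Es * et) \<odot> (Ku * ee * Ku)"
    by (simp add: im_def nf)
  also have "\<dots> = zm * et"
    by (subst times_comp3) (simp_all add: Es_times)
  also have "\<dots> = ee"
    by (rule wop_eqI) (auto simp: ap_times ee_def zm_def on_letter_def ap_et_if length_Suc_conv csc_mult_left split: lt.splits intro!: sum.neutral)
  finally show ?thesis by (simp add: Km_alt qm_def)
qed

lemma stm_Km [simp]: "stm \<odot> Km = geo dC \<odot> stm"
  by (simp add: Km_alt nf)

lemma mm_Km: "mm m \<odot> Km = Mt \<odot> m \<odot> geo dC \<odot> stm + (Es + zm) * qt - (qt \<odot> sg 1) * (Es + zm)"
proof -
  have z: "Es \<odot> (Ku * ee * Ku) = zm" by (simp add: Es_times)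
  have s: "stm \<odot> (Ku * ee * Ku) = 0" "iot \<odot> (Ku \<odot> sg 1) = qt \<odot> sg 1"
    using comp_tail[OF Ku_comps(12)] by (simp_all add: nf)
  have "mm m \<odot> (Ku * ee * Ku) = zm * qt - (qt \<odot> sg 1) * zm"
    unfolding mm_def by (simp add: times_comp3 comp_assoc s z)
  then show ?thesis
    unfolding Km_alt by (simp add: mm_Fm qt_def algebra_simps comp_assoc)
qed

lemma Im_Km [simp]: "Im \<odot> Km = Km"
  unfolding Im_def by (simp add: times_Km times_Ku) (simp add: Km_def)

lemma im_sg_Km: "(im \<odot> sg 1) \<odot> Km = qm \<odot> sg 1" "(im \<odot> sg 1) \<odot> Ku = 0"
proof -
  have "sg 1 \<odot> Km = Km \<odot> sg 1"
    by (rule sg_even) (simp add: Km_def homog_times'[OF homog_times'[OF _ _ refl] _ refl, of 0 _ 0 _ 0, simplified])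
  then show "(im \<odot> sg 1) \<odot> Km = qm \<odot> sg 1"
    by (simp add: comp_assoc) (simp add: comp_assoc[symmetric])
  show "(im \<odot> sg 1) \<odot> Ku = 0" by (simp add: comp_assoc) (simp add: comp_assoc[symmetric])
qed

lemma bbar_Km: "bbar m0 \<odot> Km = (mm m0 \<odot> Km) * Ku + (qm \<odot> sg 1) * ((Ku \<odot> sg 1) * (muu m0 \<odot> Ku) * Ku)"
  unfolding bbar_def by (simp add: times_Km im_sg_Km) (simp add: muhu_def times_Ku)

lemma opp_zu: "X \<oslash> zu = (X \<odot> sg 1) * zu"
proof (rule wop_eqI)
  fix z
  have "csc (bsign (epar u * epar v)) (ap zu v * ap X u) = ap (X \<odot> sg 1) u * ap zu v" for u v
    by (auto simp: zu_def on_letter_def length_Suc_conv csc_mult_left csc_mult_right csc_csc mult.commute par_deg_0 split: lt.splits)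
  then show "ap (X \<oslash> zu) z = ap ((X \<odot> sg 1) * zu) z"
    unfolding opp_def ap_Op ap_times by simp
qed

text \<open>The products with an e^+ among a_1, ..., a_s telescope along the word. The two remaining
  terms have this e^+ at the left and at the right end; they are rotations of each other and cancel
  in front of the norm. This expresses that b preserves degenerate chains.\<close>

lemma Wb_NN: "Wb \<odot> NN = bbar m0 \<odot> Km \<odot> NN"
proof -
  have k: "Ku * muu dC = Ku - 1" "muu dC * Ku = Ku - 1" using Ku_rec by (simp_all add: algebra_simps)
  have ks: "(Ku \<odot> sg 1) * (muu dC \<odot> sg 1) = Ku \<odot> sg 1 - 1"
    using arg_cong[OF k(1), of "\<lambda>X. X \<odot> sg 1"] by (simp add: times_sg)
  have "(Ku \<odot> sg 1) * (zu * muu dC - (muu dC \<odot> sg 1) * zu) * Ku = 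
      (Ku \<odot> sg 1) * zu * (muu dC * Ku) - ((Ku \<odot> sg 1) * (muu dC \<odot> sg 1)) * zu * Ku"
    by (simp add: algebra_simps)
  also have "\<dots> = zu * Ku - (Ku \<odot> sg 1) * zu" unfolding k ks by (simp add: algebra_simps)
  finally have 1: "(Ku \<odot> sg 1) * (zu * muu dC - (muu dC \<odot> sg 1) * zu) * Ku = zu * Ku - (Ku \<odot> sg 1) * zu" .
  have "Wb - bbar m0 \<odot> Km = (zu * qm - (qm \<odot> sg 1) * zu) * Ku + (qm \<odot> sg 1) * ((Ku \<odot> sg 1) * (zu * muu dC - (muu dC \<odot> sg 1) * zu) * Ku)"
    unfolding Wb_def bbar_Km rm_def ru_def by (simp add: algebra_simps)
  also have "\<dots> = zu * (qm * Ku) - ((qm * Ku) \<odot> sg 1) * zu"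
    unfolding 1 by (simp add: algebra_simps times_sg)
  also have "\<dots> = zu * (qm * Ku) - (qm * Ku) \<oslash> zu"
    by (simp add: opp_zu)
  finally have "(Wb - bbar m0 \<odot> Km) \<odot> NN = 0"
    using opp_NN[of "qm * Ku" zu] by simp
  then show ?thesis by (simp add: comp_assoc)
qed

lemma qm_head: "ap qm [] = 0" "ap qm (Plain x # z) = 0" "lin1 qm"
proof -
  have f: "fm dC = Mt \<odot> dC \<odot> sm + Es * et" by (simp add: fm_def lin1_stm)
  show l: "lin1 qm" unfolding lin1_def
  proof (intro allI impI)
    fix w :: "('o, 'y, 'a \<times> 'k) mor lt list" assume w: "length w \<noteq> 1"
    have "ap (Es * et) w = 0"
      by (cases w rule: lin1_cases) (use w in \<open>auto simp: ap_lin1_times\<close>)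
    then show "ap qm w = 0" using w by (simp add: qm_def f sm_def on_letter_def ee_def)
  qed
  show "ap qm [] = 0" using l by (simp add: lin1_def)
  show "ap qm (Plain x # z) = 0"
  proof (cases "z = []")
    case True
    then show ?thesis by (simp add: qm_def f sm_def ee_def ap_lin1_times ap_Es)
  next
    case False
    then have "length (Plain x # z) \<noteq> 1" by simp
    then show ?thesis using l unfolding lin1_def by blast
  qed
qed

lemma homog_qK: "homog 0 (qm * Ku)"
  using homog_times[OF homog_ee(2) grpl_Ku(3)] by simp

lemma NN_Q0: "NN \<odot> Q0 = Km \<odot> NN \<odot> headM"
proof -
  have "NN \<odot> (qm * Ku) = post mulrev (lft (qm * Ku) * rgt Ku)"
    by (subst NN_letter_times) (simp_all add: mult.assoc)
  also have "\<dots> = (qm * Ku) \<oslash> Ku"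
    by (subst post_mulrev[of 0 _ 0]) (simp_all add: homog_qK)
  finally have "NN \<odot> Q0 = ((qm * Ku) \<oslash> Ku) \<odot> headM" by (simp add: Q0_def comp_assoc[symmetric])
  also have "\<dots> = ((qm * Ku) \<oslash> Ku) \<odot> NN \<odot> headM"
  proof (rule NN_headM_head[symmetric])
    have z: "ap (qm * Ku) (take i (Plain x # z)) = 0" for i x z
      by (cases i) (simp_all add: qm_head ap_lin1_times)
    show "ap ((qm * Ku) \<oslash> Ku) (Plain x # z) = 0" for x z
      unfolding opp_def by (simp only: ap_Op z mult_zero_right csc_simps sum.neutral_const)
  qed (simp add: opp_def qm_head)
  also have "\<dots> = Km \<odot> NN \<odot> headM"
    using opp_NN[of "qm * Ku" Ku] by (simp add: Km_def comp_assoc[symmetric] mult.assoc)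
  finally show ?thesis .
qed

lemma bb_Q0: "bb m0 \<odot> Q0 = Wb \<odot> NN \<odot> headM"
  unfolding bb_def comp_assoc NN_Q0 using Wb_NN by (simp add: comp_assoc[symmetric])

lemma BB_Q0: "BB \<odot> Q0 = (pre \<odot> geo dC \<odot> stm) \<odot> NN \<odot> headM"
  unfolding BB_def comp_assoc NN_Q0 by (simp add: comp_assoc[symmetric])

definition TT :: "(('o, 'y, 'a) mor, ('o, 'y, 'a) mor list, 'k) wop \<Rightarrow> _" where "TT \<phi> = (Ku \<odot> sg 1) * (muu \<phi> \<odot> Ku) * Km"

lemma Z13_Km: "Z13 idl 1 \<phi> \<odot> Km = TT \<phi>" "Z13 idl 1 \<phi> \<odot> Ku = 0"
proof -
  have "Iu \<odot> sg 1 \<odot> Ku = Ku \<odot> sg 1" by (simp add: comp_assoc[symmetric])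
  then show "Z13 idl 1 \<phi> \<odot> Km = TT \<phi>" "Z13 idl 1 \<phi> \<odot> Ku = 0"
    unfolding Z13_def by (simp_all add: times_Km times_Ku TT_def comp_assoc)
qed

lemma ii_Q0: "ii m0 idl 1 \<phi> \<odot> Q0 = ((mm m0 \<odot> TT \<phi>) * Ku) \<odot> NN \<odot> headM"
proof -
  have "ibar m0 idl 1 \<phi> \<odot> Km = (mm m0 \<odot> TT \<phi>) * Ku"
    unfolding ibar_def by (simp add: times_Km comp_assoc Z13_Km)
  then show ?thesis unfolding ii_def comp_assoc NN_Q0 by (simp add: comp_assoc[symmetric])
qed

lemma SS_Q0: "SS idl 1 \<phi> \<odot> Q0 = (pre \<odot> stm \<odot> TT \<phi>) \<odot> NN \<odot> headM"
  unfolding SS_def comp_assoc NN_Q0 using Z13_Km[of \<phi>] by (simp add: comp_assoc[symmetric])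

end

context ainf_functor_based
begin

lemma FF_Q0: "FF f0 \<odot> C.Q0 = ((fm f0 \<odot> C.Km) * (Fu f0 \<odot> C.Ku)) \<odot> NN \<odot> headM"
proof -
  have "Fbar f0 \<odot> C.Km = (fm f0 \<odot> C.Km) * (Fu f0 \<odot> C.Ku)"
    unfolding Fbar_def by (simp add: C.times_Km)
  then show ?thesis unfolding FF_def comp_assoc C.NN_Q0 by (simp add: comp_assoc[symmetric])
qed

end

section \<open>Chain operators on expanded words\<close>

lemma rotn_Suc:
  fixes w :: "('o, 'y::grading_datum, 'a) mor list"
  assumes i: "Suc i < length w"
  shows "cyc (rotn i w) = (rotn (Suc i) w :: _ \<Rightarrow>\<^sub>0 'b::field)"
proof -
  have "cyc (rotn i w) = (clin (rotn 1) (rotn i w) :: _ \<Rightarrow>\<^sub>0 'b)"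
    unfolding cyc_def
  proof (rule clin_cong[OF refl])
    fix z assume "z \<in> Poly_Mapping.keys (rotn i w :: _ \<Rightarrow>\<^sub>0 'b)"
    then have "length z = length w" by (auto simp: rotn_def mulrev_def split: if_splits)
    then obtain y l where z: "z = y @ [l]" using i by (cases z rule: rev_cases) auto
    show "csc (bsign (eps [last z] * eps (butlast z))) (word (last z # butlast z)) = (rotn 1 z :: _ \<Rightarrow>\<^sub>0 'b)"
      by (simp add: z eps_epar rotn_append mult.commute)
  qed
  then show ?thesis using clin_rotn_rotn[of i w 1] i by simp
qed

lemma cyc_power: "i < length w \<Longrightarrow> (cyc ^^ i) (word w) = rotn i w"
  for w :: "('o, 'y::grading_datum, 'a) mor list"
  by (induction i) (simp add: rotn_def mulrev_def, simp add: rotn_Suc)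

text \<open>A sum over rotations in which the summand may depend on the current position
  \<open>i\<close> of a_0; overbraces become conditions on \<open>i\<close>.\<close>

definition rsum :: "(nat \<Rightarrow> ('o, 'y::grading_datum, 'a) mor list \<Rightarrow> 'v \<Rightarrow>\<^sub>0 'k::field) \<Rightarrow> ('o, 'y, 'a) mor list \<Rightarrow> ('v \<Rightarrow>\<^sub>0 'k)"
  where "rsum P w = (\<Sum>i<length w. clin (P i) (rotn i w))"

lemma overbrace_rsum:
  assumes "q < length w"
  shows "overbrace p q P w = rsum (\<lambda>i z. if p \<le> i \<and> i \<le> q then P z else 0) w"
proof -
  have "overbrace p q P w = (\<Sum>i\<in>{p..q}. clin P (rotn i w))"
    unfolding overbrace_def using assms by (intro sum.cong) (simp_all add: cyc_power)
  also have "\<dots> = (\<Sum>i<length w. if p \<le> i \<and> i \<le> q then clin P (rotn i w) else 0)"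
    using assms by (intro sum.mono_neutral_cong_left) auto
  also have "\<dots> = rsum (\<lambda>i z. if p \<le> i \<and> i \<le> q then P z else 0) w"
    unfolding rsum_def by (intro sum.cong) auto
  finally show ?thesis .
qed

lemma rsum_sum: "(\<Sum>a\<in>A. rsum (P a) w) = rsum (\<lambda>i z. \<Sum>a\<in>A. P a i z) w"
  unfolding rsum_def by (subst sum.swap) (simp add: clin_sum_fun)

lemma clin_rsum: "clin Q (rsum P w) = rsum (\<lambda>i z. clin Q (P i z)) w"
  unfolding rsum_def by (simp add: clin_sum clin_clin)

lemma NN_headM_rsum: "ap (W \<odot> NN \<odot> headM) w = rsum (\<lambda>i z. ap W (mk i z)) w"
  unfolding ap_NN_headM rsum_def ..

lemma rsum_0: "w \<noteq> [] \<Longrightarrow> P w = rsum (\<lambda>i z. if i = 0 then P z else 0) w"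
  unfolding rsum_def
proof -
  assume "w \<noteq> []"
  have "(\<Sum>i<length w. clin (\<lambda>z. if i = 0 then P z else 0) (rotn i w)) = (\<Sum>i<length w. if i = 0 then P w else 0)"
    by (rule sum.cong) (auto simp: rotn_def mulrev_def)
  then show "P w = (\<Sum>i<length w. clin (\<lambda>z. if i = 0 then P z else 0) (rotn i w))"
    using \<open>w \<noteq> []\<close> by simp
qed

lemma rsum_add: "rsum P w + rsum P' w = rsum (\<lambda>i z. P i z + P' i z) w"
  by (simp add: rsum_def sum.distrib clin_add_fun)

lemma keys_rotn:
  assumes "z \<in> Poly_Mapping.keys (rotn i w :: _ \<Rightarrow>\<^sub>0 'k::field)" "cyc_word C w"
  shows "cyc_word C z \<and> length z = length w \<and> rdeg z = rdeg w"
proof -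
  define u v where "u = take (length w - i) w" and "v = drop (length w - i) w"
  have z: "z = v @ u" and w: "w = u @ v"
    using assms(1) by (auto simp: rotn_def mulrev_def u_def v_def split: if_splits)
  show ?thesis
  proof (cases "u = [] \<or> v = []")
    case False
    then show ?thesis using assms(2) unfolding z w cyc_word_def
      by (auto simp: is_path_append add.commute)
  qed (use assms z w in auto)
qed

lemma rsum_cong:
  assumes "\<And>i z. cyc_word C z \<Longrightarrow> length z = length w \<Longrightarrow> i < length z \<Longrightarrow> P i z = P' i z" "cyc_word C w"
  shows "rsum P w = rsum P' w"
  unfolding rsum_def
  by (intro sum.cong refl clin_cong) (use assms keys_rotn in \<open>metis lessThan_iff\<close>)

lemma sum_triangle:
  fixes f :: "nat \<Rightarrow> nat \<Rightarrow> 'b::comm_monoid_add"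
  assumes "\<And>k. k \<le> n \<Longrightarrow> f k k = 0"
  shows "(\<Sum>k\<le>n. \<Sum>j\<le>k. f j k) = (\<Sum>j<n. \<Sum>k\<in>{j<..n}. f j k)"
proof -
  have "(\<Sum>j\<le>k. f j k) = (\<Sum>j<k. f j k)" if "k \<le> n" for k
    using assms[OF that] by (simp add: lessThan_Suc_atMost[symmetric])
  then have "(\<Sum>k\<le>n. \<Sum>j\<le>k. f j k) = (\<Sum>k\<le>n. \<Sum>j<k. f j k)"
    by (rule sum.cong[OF refl]) (simp only: atMost_iff)
  also have "\<dots> = (\<Sum>(k, j)\<in>Sigma {..n} (\<lambda>k. {..<k}). f j k)"
    by (simp add: sum.Sigma)
  also have "\<dots> = (\<Sum>(j, k)\<in>Sigma {..<n} (\<lambda>j. {j<..n}). f j k)"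
    by (rule sum.reindex_bij_witness[of _ "\<lambda>(j, k). (k, j)" "\<lambda>(k, j). (j, k)"]) auto
  finally show ?thesis by (simp add: sum.Sigma)
qed

lemma ap_triple:
  assumes "ap Y [] = 0"
  shows "ap (X * Y * Z) w = (\<Sum>j<length w. \<Sum>k\<in>{j<..length w}. ap X (take j w) * ap Y (slice j k w) * ap Z (drop k w))"
proof -
  have "ap (X * Y * Z) w = (\<Sum>k\<le>length w. \<Sum>j\<le>k. ap X (take j w) * ap Y (slice j k w) * ap Z (drop k w))"
    by (simp add: ap_times sum_distrib_right slice_def min_absorb1 min_absorb2)
  also have "\<dots> = (\<Sum>j<length w. \<Sum>k\<in>{j<..length w}. ap X (take j w) * ap Y (slice j k w) * ap Z (drop k w))"
    by (rule sum_triangle) (simp add: slice_def assms)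
  finally show ?thesis .
qed

lemma stu_Plain [simp]: "ap stu (map Plain w) = word w"
  by (induction w) (simp_all add: word_Cons[symmetric])

lemma stu_mk [simp]: "ap stu (mk i w) = 0"
  by (simp add: mk_def ap_stu_append)

lemma stm_Plain [simp]: "ap stm (map Plain w) = 0"
  by (induction w) simp_all

lemma stm_mk: "i < length w \<Longrightarrow> ap stm (mk i w) = word w"
  by (simp add: mk_def ap_stm_append word_append[symmetric] word_Cons[symmetric] id_take_nth_drop[symmetric])

lemma lin1_sg: "lin1 X \<Longrightarrow> lin1 (X \<odot> sg p)"
  by (simp add: lin1_def ap_comp_sg del: ap_comp)

context ainf_based
begin

abbreviation Cp :: "('k, 'o, 'y, 'a \<times> 'k) ainf_data" where "Cp \<equiv> ainf_plus C"
abbreviation uq where "uq w \<equiv> ap Ku (map Plain w)"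
abbreviation hq where "hq m \<equiv> ap qm [Marked m]"
abbreviation muP :: "('o, 'y, 'a \<times> 'k) mor list \<Rightarrow> ('o, 'y, 'a \<times> 'k) mor" where "muP \<equiv> mu_mor Cp"

lemma Cp_simps [simp]: "Obj Cp = Obj C" "ainf_data.mu Cp = mu_plus C" "scl Cp r x = (scl C r (fst x), r * snd x)"
  "x \<in> Hom Cp X Y y \<longleftrightarrow> fst x \<in> Hom C X Y y \<and> (snd x \<noteq> 0 \<longrightarrow> X = Y \<and> y = 0)"
  by (auto simp: ainf_plus_def case_prod_beta mem_Times_iff)

lemma drop_e_mor: "is_mor Cp m \<Longrightarrow> is_mor C (drop_e m)"
  by (simp add: is_mor_def)

lemma is_mor_Cp: "is_mor Cp m \<longleftrightarrow> is_mor C (drop_e m) \<and> (e_coeff m \<noteq> 0 \<longrightarrow> src m = tgt m \<and> deg m = 0)"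
  by (auto simp: is_mor_def e_coeff_def)

lemma drop_e_path: "is_path Cp w \<Longrightarrow> is_path C (map drop_e w)"
  by (auto simp: is_path_def successively_map drop_e_mor)

lemma rdeg_drop_e [simp]: "rdeg (map drop_e w) = rdeg w" "eps (map drop_e w) = eps w"
  by (induction w) (simp_all add: eps_def)

lemma geo_dC: "ap (geo dC) w = expand C B (map drop_e w)"
proof (induction w)
  case (Cons m w)
  have "ap dC [m] = lx (drop_e m)" by (simp add: dC_def)
  then show ?case unfolding list.map expand_Cons[of "drop_e m" "map drop_e w"] Cons[symmetric]
    by (simp add: ap_geo_Cons)
qed simp

lemma uq_eq: "uq w = clin (ap ut) (expand C B (map drop_e w))"
  by (simp add: Ku_def Fu_def geo_dC del: ut_word)

lemma Ku_mk [simp]: "ap Ku (mk i w) = 0"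
  by (simp add: Ku_def Fu_def del: ut_word)

lemma clin_ut_mult: "clin (ap ut) (x * y) = clin (ap ut) x * clin (ap ut) y"
  by (subst mult_conv_clin) (simp add: clin_clin clin_mult plus_list_def, simp add: word_append)

lemma uq_append: "uq (u @ v) = uq u * uq v" "uq (m # v) = uq [m] * uq v"
proof -
  show "uq (u @ v) = uq u * uq v" for u v
    unfolding uq_eq[of "u @ v"] uq_eq[of u] uq_eq[of v] by (simp only: map_append expand_append clin_ut_mult)
  from this[of "[m]" v] show "uq (m # v) = uq [m] * uq v" by simp
qed

lemma uq_Nil [simp]: "ap Ku [] = 1"
  using uq_eq[of "[]"] by simp

lemma uq_1: "uq [m] = clin (ap ut) (lx (drop_e m))" "ap Ku [Plain m] = clin (ap ut) (lx (drop_e m))"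
  using uq_eq[of "[m]"] by simp_all

lemma muu_dC: "ap (muu dC) [Plain m] = uq [m]" "lin1 (muu dC)" "ap (muu dC) [] = 0"
proof -
  have "muu dC = ut \<odot> (dC \<odot> su)" by (simp add: muu_def lin1_geo_stu)
  moreover have "lin1 (ut \<odot> (dC \<odot> su))" unfolding su_def comp_assoc[symmetric] by (rule lin1_comp_on_letter)
  ultimately show l: "lin1 (muu dC)" by simp
  show "ap (muu dC) [Plain m] = uq [m]" by (simp add: muu_def uq_1 dC_def del: ut_word)
  show "ap (muu dC) [] = 0" using l by (simp add: lin1_def)
qed

lemma hq_eq: "hq m = clin (ap Mt) (lx (drop_e m)) + csc (zc m) (word [Unit])"
  by (simp add: qm_def fm_def dC_def ee_def ap_lin1_times[of Es] ap_Es del: csc_single)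

lemma ap_Q0: "ap Q0 (m # w) = hq m * uq w"
  by (simp add: Q0_def ap_headM ap_lin1_times[OF qm_head(3)])

lemma zv: "ap zu [Plain m] = csc (zc m) 1" "ap zu [Marked m] = 0" "ap zm [Marked m] = csc (zc m) 1" "ap zm [Plain m] = 0"
  by (simp_all add: zu_def zm_def)

text \<open>Shows that \<open>ru\<close> and \<open>rm\<close> do what they are built for. The
  formal unit is visible only to words of two letters; words of one letter or of at least three see
  just the operations of C.\<close>

lemma mu_mor_e:
  assumes p: "is_path Cp p"
  shows "is_mor Cp (muP p)" "ap ru (map Plain p) = uq [muP p]"
    "i < length p \<Longrightarrow> ap rm (mk i p) = hq (muP p)"
proof -
  define M where "M = mu_mor C (map drop_e p)"
  have Mm: "is_mor C M" unfolding M_def by (rule mu_mor[OF drop_e_path[OF p]])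
  have lab: "src (muP p) = src M" "tgt (muP p) = tgt M" "deg (muP p) = deg M"
    using p by (auto simp: M_def hd_map last_map is_path_def)
  have dM: "drop_e (muP p) = with_elt M (fst (mu_plus C p))"
    using lab by (simp add: with_elt_def drop_e_def)
  have MM: "with_elt M (ainf_data.mu C (map drop_e p)) = M" by (simp add: M_def with_elt_def apply_op_def)
  have mu1: "ap (muu m0 \<odot> Ku) (map Plain p) = clin (ap ut) (lx M)"
    and mu2: "i < length p \<Longrightarrow> ap (Mt \<odot> m0 \<odot> geo dC \<odot> stm) (mk i p) = clin (ap Mt) (lx M)" for i
  proof -
    have "clin (ap m0) (expand C B (map drop_e p)) = ap m0 ([] @ map drop_e p)"
      using CC.mop_expand_mor[OF mu, of "map drop_e p" "[]"] drop_e_path[OF p] by (simp add: is_path_def)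
    also have "\<dots> = lx M" using drop_e_path[OF p] by (simp add: mop_def M_def)
    finally have *: "clin (ap m0) (expand C B (map drop_e p)) = lx M" .
    have "muu m0 \<odot> Ku = ut \<odot> m0 \<odot> geo dC \<odot> stu" by (simp add: muu_def comp_assoc)
    then show "ap (muu m0 \<odot> Ku) (map Plain p) = clin (ap ut) (lx M)" by (simp add: geo_dC * del: ut_word)
    show "ap (Mt \<odot> m0 \<odot> geo dC \<odot> stm) (mk i p) = clin (ap Mt) (lx M)" if "i < length p"
      using that by (simp add: geo_dC * stm_mk)
  qed
  have lz: "lin1 (Es + zm)" "lin1 qt"
  proof -
    show "lin1 (Es + zm)" by (simp add: lin1_def lin1s(5)[unfolded lin1_def] lin1_dC(3)[unfolded lin1_def])
    show "lin1 qt" unfolding qt_def using lin1_comp_on_letter[of "Mt \<odot> dC"] by (simp add: lin1_geo_stu su_def comp_assoc)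
  qed
  have lq: "lin1 ((muu dC) \<odot> sg 1)" "lin1 (qm \<odot> sg 1)" "lin1 (qt \<odot> sg 1)"
    using muu_dC(2) qm_head(3) lz(2) by (auto intro: lin1_sg)
  have qtv: "ap qt [Plain m] = clin (ap Mt) (lx (drop_e m))" "ap qt [Marked m] = 0" for m
    by (simp_all add: qt_def dC_def)
  show "is_mor Cp (muP p)" "ap ru (map Plain p) = uq [muP p]" "i < length p \<Longrightarrow> ap rm (mk i p) = hq (muP p)"
  proof -
    consider m where "p = [m]" | m n where "p = [m, n]" | a b c r where "p = a # b # c # r"
      using p by (cases p rule: list.exhaust; metis list.exhaust not_path_Nil)
    then have "is_mor Cp (muP p) \<and> ap ru (map Plain p) = uq [muP p] \<and> (i < length p \<longrightarrow> ap rm (mk i p) = hq (muP p))"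
    proof cases
      case (2 m n)
      let ?x = "ainf_data.mu C [drop_e m, drop_e n]"
      let ?y1 = "scl C (e_coeff m) (elt (drop_e n))" and ?y2 = "scl C (bsign (parity (deg m)) * e_coeff n) (elt (drop_e m))"
      have mn: "is_mor C (drop_e m)" "is_mor C (drop_e n)" "tgt m = src n"
        "e_coeff m \<noteq> 0 \<Longrightarrow> src m = tgt m \<and> deg m = 0" "e_coeff n \<noteq> 0 \<Longrightarrow> src n = tgt n \<and> deg n = 0"
        using p unfolding 2 by (auto simp: is_path_Cons is_mor_Cp)
      have labM: "src M = src m" "tgt M = tgt n" "deg M = deg m + deg n" by (simp_all add: M_def 2)
      have x: "with_elt M ?x = M" using MM by (simp add: 2)
      have zz: "zc m = e_coeff m" "zc n = e_coeff n" using mn by auto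
      have y1: "is_mor C (with_elt M ?y1) \<and> lx (with_elt M ?y1) = csc (e_coeff m) (lx (drop_e n))"
      proof (cases "e_coeff m = 0")
        case False
        then have "with_elt M (elt (drop_e n)) = drop_e n" using mn labM by (simp add: with_elt_def drop_e_def)
        then show ?thesis using is_mor_scl[of M "elt (drop_e n)"] lx_scl[of M "elt (drop_e n)"] mn by simp
      qed (use is_mor_0[OF Mm] lx_0 in simp)
      have y2: "is_mor C (with_elt M ?y2) \<and> lx (with_elt M ?y2) = csc (bsign (parity (deg m)) * e_coeff n) (lx (drop_e m))"
      proof (cases "e_coeff n = 0")
        case False
        then have "with_elt M (elt (drop_e m)) = drop_e m" using mn labM by (simp add: with_elt_def drop_e_def)
        then show ?thesis using is_mor_scl[of M "elt (drop_e m)"] lx_scl[of M "elt (drop_e m)"] mn by simp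
      qed (use is_mor_0[OF Mm] lx_0 in simp)
      have fst: "fst (mu_plus C p) = ?x + ?y1 + ?y2" and snd: "e_coeff (muP p) = e_coeff m * e_coeff n"
        by (simp_all add: 2 mu_plus_def e_coeff_def)
      have m1: "is_mor C (with_elt M (?x + ?y1))" using is_mor_add[of M ?x ?y1] x y1 Mm by simp
      have lxe: "lx (drop_e (muP p)) = lx M + csc (e_coeff m) (lx (drop_e n)) + csc (bsign (parity (deg m)) * e_coeff n) (lx (drop_e m))"
        unfolding dM fst using lx_add[OF m1 conjunct1[OF y2]] lx_add[of M ?x ?y1] x y1 y2 Mm by simp
      have "is_mor C (drop_e (muP p))"
        unfolding dM fst by (rule is_mor_add[OF m1 conjunct1[OF y2]])
      then have A: "is_mor Cp (muP p)"
        using mn snd lab labM by (auto simp: is_mor_Cp)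
      have s: "bsign (par m) = - (bsign (parity (deg m)) :: 'k)"
      proof -
        have "par m = parity (deg m) + 1" by (simp add: par_mor_def parity_add diff_conv_add_uminus del: add_uminus_conv_diff)
        then show ?thesis by (simp add: bsign_add)
      qed
      have zp: "zc (muP p) = e_coeff m * e_coeff n"
        using snd mn lab labM by (cases "e_coeff m = 0 \<or> e_coeff n = 0") auto
      have B: "ap ru (map Plain p) = uq [muP p]"
        using mu1 unfolding ru_def uq_1 lxe
        by (simp add: 2 ap_lin1_times lq muu_dC uq_1 clin_add clin_csc ap_comp_sg zv csc_mult_left csc_mult_right s csc_csc
            csc_neg zz mult.commute mn del: ap_comp)
      have C: "ap rm (mk i p) = hq (muP p)" if i: "i < length p"
      proof -
        have "i = 0 \<or> i = 1" using i by (auto simp: 2)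
        then show ?thesis
        proof
          assume i0: "i = 0"
          have mk: "mk i p = [Marked m, Plain n]" by (simp add: i0 2 mk_def)
          \<comment> \<open>A nonzero e^+ coefficient forces \<open>m\<close> into degree 0, where
            the sign is 1.\<close>
          have c: "bsign (parity (deg m)) * e_coeff m = e_coeff m" "e_coeff m * bsign (parity (deg m)) = e_coeff m"
            using mn by (cases "e_coeff m = 0"; auto)+
          show ?thesis
            using mu2[OF i] unfolding rm_def mm_Km hq_eq lxe zp ap_simps mk
            by (simp add: ap_lin1_times lz lq qtv ap_comp_sg qm_head zv ap_Es zz csc_mult_left csc_mult_right s csc_neg hq_eq
              clin_add clin_csc csc_add csc_csc c csc_diff csc_minus mult.commute del: ap_comp csc_single)
        next
          assume i1: "i = 1"
          have mk: "mk i p = [Plain m, Marked n]" by (simp add: i1 2 mk_def)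
          show ?thesis
            using mu2[OF i] unfolding rm_def mm_Km hq_eq lxe zp ap_simps mk
            by (simp add: ap_lin1_times lz lq qtv ap_comp_sg qm_head zv ap_Es zz csc_mult_left csc_mult_right s csc_neg hq_eq
              clin_add clin_csc csc_add csc_csc mult.commute del: ap_comp csc_single)
        qed
      qed
      show ?thesis using A B C by blast
    next
      case (1 m)
      have e: "drop_e (muP p) = M" "zc (muP p) = 0" "e_coeff (muP p) = 0"
        using MM unfolding dM by (simp_all add: 1 mu_plus_def e_coeff_def)
      have A: "is_mor Cp (muP p)" using e Mm by (simp add: is_mor_Cp)
      have B: "ap ru (map Plain p) = uq [muP p]"
        using \<open>ap (muu m0 \<odot> Ku) (map Plain p) = clin (ap ut) (lx M)\<close> unfolding ru_def uq_1 e
        by (simp add: 1 ap_lin1_times lq muu_dC lin1_Nil[OF lin1_dC(2)] del: ap_comp)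
      have C: "ap rm (mk i p) = hq (muP p)" if i: "i < length p"
      proof -
        have mk: "mk i p = [Marked m]" using i by (simp add: 1 mk_def)
        show ?thesis
          using mu2[OF i] unfolding rm_def mm_Km hq_eq e ap_simps mk
          by (simp add: ap_lin1_times lz lq qm_head zv qtv ap_Es lin1_Nil[OF lz(2)] lin1_Nil[OF lin1_dC(2)] lin1_Nil[OF lin1_dC(3)] del: ap_comp)
      qed
      show ?thesis using A B C by blast
    next
      case (3 a b c r)
      have e: "drop_e (muP p) = M" "zc (muP p) = 0" "e_coeff (muP p) = 0"
        using MM unfolding dM by (simp_all add: 3 mu_plus_def e_coeff_def)
      have A: "is_mor Cp (muP p)" using e Mm by (simp add: is_mor_Cp)
      have l0: "ap X (x # y # w) = 0" if "lin1 X" for X :: "('u, 'w::monoid_add, 'k) wop" and x y w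
        using that by (simp add: lin1_def)
      have B: "ap ru (map Plain p) = uq [muP p]"
        using \<open>ap (muu m0 \<odot> Ku) (map Plain p) = clin (ap ut) (lx M)\<close> unfolding ru_def uq_1 e
        by (simp add: 3 ap_lin1_times lq muu_dC l0 del: ap_comp)
      have C: "ap rm (mk i p) = hq (muP p)" if i: "i < length p"
      proof -
        have "length (mk i p) = Suc (Suc (Suc (length r)))" using i by (simp add: 3)
        then obtain x y z w where mk: "mk i p = x # y # z # w" by (auto simp: length_Suc_conv)
        show ?thesis
          using mu2[OF i] unfolding rm_def mm_Km hq_eq e ap_simps mk
          by (simp add: ap_lin1_times lz lq qm_head l0 del: ap_comp)
      qed
      show ?thesis using A B C by blast
    qed
    then show "is_mor Cp (muP p)" "ap ru (map Plain p) = uq [muP p]" "i < length p \<Longrightarrow> ap rm (mk i p) = hq (muP p)"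
      by blast+
  qed
qed

end

lemma insert_nth:
  assumes "length A = j"
  shows "take (d + Suc j) (A @ x # B) = A @ x # take d B" "(A @ x # B) ! (d + Suc j) = B ! d"
    "drop (Suc (d + Suc j)) (A @ x # B) = drop (Suc d) B"
  using assms by (induction A arbitrary: j) auto

lemma split3: "j \<le> k \<Longrightarrow> z = take j z @ slice j k z @ drop k z"
proof -
  assume "j \<le> k"
  then have "take k z = take j z @ slice j k z"
    using append_take_drop_id[of j "take k z"] by (simp add: slice_def min_absorb1)
  then show ?thesis by (metis append_assoc append_take_drop_id)
qed

lemma path_slice: 
  assumes "is_path D z" "j < k" "k \<le> length z"
  shows "is_path D (slice j k z)"
proof (rule path_infix)
  show "is_path D (take j z @ slice j k z @ drop k z)"
    using assms by (simp add: split3[symmetric])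
  show "slice j k z \<noteq> []" using assms by (simp add: slice_def)
qed

lemma path_take: "is_path D z \<Longrightarrow> 0 < k \<Longrightarrow> k \<le> length z \<Longrightarrow> is_path D (take k z)"
  using path_slice[of D z 0 k] by (simp add: slice_def)

context ainf_based
begin

lemma Km_Nil: "ap Km [] = 0"
  by (simp add: Km_def qm_head)

lemma muu_dC_Marked: "ap (muu dC) [Marked m] = 0"
  by (simp add: muu_def)

lemma Km_Cons: "ap Km (Plain a # x) = uq [a] * ap Km x" "ap Km (Marked a # map Plain w) = hq a * uq w"
proof -
  have "Km = (1 + muu dC * Ku) * qm * Ku" using Ku_rec(1) by (simp add: Km_def)
  then have K: "Km = qm * Ku + muu dC * Km" by (simp add: Km_def algebra_simps)
  show "ap Km (Plain a # x) = uq [a] * ap Km x"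
    by (subst K) (simp add: ap_lin1_times qm_head muu_dC)
  show "ap Km (Marked a # map Plain w) = hq a * uq w"
    by (subst K) (simp add: ap_lin1_times qm_head muu_dC muu_dC_Marked)
qed

lemma Km_Plain: "ap Km (map Plain w) = 0"
  by (induction w) (simp_all add: Km_Nil Km_Cons)

lemma Km_mk: "i < length z \<Longrightarrow> ap Km (mk i z) = uq (take i z) * hq (z ! i) * uq (drop (Suc i) z)"
proof (induction i arbitrary: z)
  case 0
  then show ?case by (cases z) (simp_all add: mk_0 Km_Cons)
next
  case (Suc i)
  then obtain a y where z: "z = a # y" "i < length y" by (cases z) auto
  have "uq (a # take i y) = uq [a] * uq (take i y)" by (rule uq_append)
  then show ?case using Suc.IH[OF z(2)] by (simp add: z mk_Suc Km_Cons mult.assoc)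
qed

text \<open>With a_0 at position \<open>i\<close>, the first sum collects the prefixes long enough
  to contain it; the terms away from a_0 occur only when a_0 stands in front, that is for
  \<open>i = 0\<close>.\<close>

lemma Wb_mk:
  assumes z: "is_path Cp z" "i < length z"
  shows "ap Wb (mk i z) = (\<Sum>j<length z. if i \<le> j then ap Q0 (muP (take (Suc j) z) # drop (Suc j) z) else 0)
    + (if i = 0 then \<Sum>j\<in>{1..<length z}. \<Sum>k\<in>{j<..length z}. csc (bsign (eps (take j z)))
        (ap Q0 (take j z @ muP (slice j k z) # drop k z)) else 0)"
proof -
  have "ap (rm * Ku) (mk i z) = (\<Sum>l\<le>length z. ap rm (take l (mk i z)) * ap Ku (drop l (mk i z)))"
    using z by (simp add: ap_times)
  also have "\<dots> = (\<Sum>j<length z. ap rm (take (Suc j) (mk i z)) * ap Ku (drop (Suc j) (mk i z)))"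
    by (simp add: sum.atMost_shift)
  also have "\<dots> = (\<Sum>j<length z. if i \<le> j then ap Q0 (muP (take (Suc j) z) # drop (Suc j) z) else 0)"
  proof (rule sum.cong[OF refl])
    fix j assume j: "j \<in> {..<length z}"
    show "ap rm (take (Suc j) (mk i z)) * ap Ku (drop (Suc j) (mk i z)) =
      (if i \<le> j then ap Q0 (muP (take (Suc j) z) # drop (Suc j) z) else 0)"
      using z j mu_mor_e(3)[OF path_take[OF z(1), of "Suc j"], of i]
      by (simp add: take_mk drop_mk ap_Q0 not_less_eq_eq)
  qed
  finally have 1: "ap (rm * Ku) (mk i z) = (\<Sum>j<length z. if i \<le> j then ap Q0 (muP (take (Suc j) z) # drop (Suc j) z) else 0)" .
  let ?Y = "(Ku \<odot> sg 1) * ru * Ku"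
  have lq: "lin1 (qm \<odot> sg 1)" by (intro lin1_sg qm_head)
  have ru0: "ap ru [] = 0"
    by (simp add: ru_def muu_dC lin1_Nil[of zu]) (simp add: muu_def op1D[OF op1_m0])
  obtain a y where ay: "z = a # y" using z by (cases z) auto
  have 2: "ap ((qm \<odot> sg 1) * ?Y) (mk i z) = (if i = 0 then \<Sum>j\<in>{1..<length z}. \<Sum>k\<in>{j<..length z}. csc (bsign (eps (take j z)))
        (ap Q0 (take j z @ muP (slice j k z) # drop k z)) else 0)"
  proof (cases i)
    case (Suc i')
    then show ?thesis by (simp add: ay mk_Suc ap_lin1_times[OF lq] qm_head ap_comp_sg del: ap_comp)
  next
    case 0
    have s: "slice (Suc j) (Suc k) (a # y) = slice j k y" for j k by (simp add: slice_def)
    have "ap ((qm \<odot> sg 1) * ?Y) (mk i z) = csc (bsign (par a)) (hq a) * ap ?Y (map Plain y)"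
      by (simp add: 0 ay mk_0 ap_lin1_times[OF lq] ap_comp_sg del: ap_comp)
    also have "ap ?Y (map Plain y) = (\<Sum>j<length y. \<Sum>k\<in>{j<..length y}. 
        csc (bsign (epar (take j y))) (uq (take j y)) * uq [muP (slice j k y)] * uq (drop k y))"
      unfolding ap_triple[where Y = ru, OF ru0] length_map
    proof (intro sum.cong refl)
      fix j k assume jk: "j \<in> {..<length y}" "k \<in> {j<..length y}"
      have "is_path Cp (slice (Suc j) (Suc k) z)" using z(1) jk by (intro path_slice) (auto simp: ay)
      then have "is_path Cp (slice j k y)" by (simp add: ay s)
      moreover have "slice j k (map Plain y) = map Plain (slice j k y)" by (simp add: slice_def take_map drop_map)
      ultimately show "ap (Ku \<odot> sg 1) (take j (map Plain y)) * ap ru (slice j k (map Plain y)) * ap Ku (drop k (map Plain y)) =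
         csc (bsign (epar (take j y))) (uq (take j y)) * uq [muP (slice j k y)] * uq (drop k y)"
        using mu_mor_e(2) by (simp add: take_map drop_map ap_comp_sg del: ap_comp)
    qed
    also have "csc (bsign (par a)) (hq a) * \<dots> = (\<Sum>j<length y. \<Sum>k\<in>{j<..length y}. csc (bsign (eps (a # take j y)))
        (ap Q0 (a # take j y @ muP (slice j k y) # drop k y)))"
      unfolding sum_distrib_left ap_Q0 uq_append(1)[of "take _ y"] uq_append(2)[of _ "drop _ y"] eps_epar
      by (intro sum.cong refl) (simp add: csc_mult_left csc_mult_right csc_csc bsign_add mult.assoc)
    also have "\<dots> = (\<Sum>j\<in>{1..<length z}. \<Sum>k\<in>{j<..length z}. csc (bsign (eps (take j z)))
        (ap Q0 (take j z @ muP (slice j k z) # drop k z)))"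
    proof -
      have "{1..<length z} = Suc ` {..<length y}" by (simp add: ay image_Suc_lessThan atLeastLessThanSuc_atLeastAtMost)
      moreover have "{Suc j<..length z} = Suc ` {j<..length y}" for j by (simp add: ay atLeastSucAtMost_greaterThanAtMost[symmetric] image_Suc_atLeastAtMost del: atLeastSucAtMost_greaterThanAtMost)
      ultimately show ?thesis by (simp add: sum.reindex s ay)
    qed
    finally show ?thesis using 0 by simp
  qed
  show ?thesis unfolding Wb_def ap_simps 1 2 ..
qed

text \<open>Both parts of b are merged into one sum over rotations, the terms away from a_0 at
  rotation 0, and then compared rotation by rotation with \<open>Wb\<close> on marked words.\<close>

lemma Q0_b:
  assumes w: "cyc_word Cp w"
  shows "clin (ap Q0) (hochschild_b Cp w) = ap (bb m0 \<odot> Q0) w"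
proof -
  let ?P1 = "\<lambda>j z. word (muP (take (Suc j) z) # drop (Suc j) z) :: ('k, 'o, 'y, 'a \<times> 'k) chain"
  let ?P2 = "\<lambda>z. (\<Sum>j\<in>{1..<length z}. \<Sum>k\<in>{j<..length z}.
      csc (bsign (eps (take j z))) (word (take j z @ muP (slice j k z) # drop k z))) :: ('k, 'o, 'y, 'a \<times> 'k) chain"
  have ne: "w \<noteq> []" using w by (auto simp: cyc_word_def)
  have 1: "(\<Sum>j<length w. overbrace 0 j (?P1 j) w) = rsum (\<lambda>i z. \<Sum>j<length w. if 0 \<le> i \<and> i \<le> j then ?P1 j z else 0) w"
    unfolding rsum_sum[symmetric] by (intro sum.cong refl overbrace_rsum) simp
  have "hochschild_b Cp w = rsum (\<lambda>i z. (\<Sum>j<length w. if 0 \<le> i \<and> i \<le> j then ?P1 j z else 0) + (if i = 0 then ?P2 z else 0)) w"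
    unfolding hochschild_b_def 1 rsum_add[symmetric] rsum_0[OF ne, of ?P2, symmetric] ..
  then have "clin (ap Q0) (hochschild_b Cp w) = rsum (\<lambda>i z. ap Wb (mk i z)) w"
    by (simp only: clin_rsum, intro rsum_cong[OF _ w])
      (auto simp: Wb_mk cyc_word_def clin_add clin_sum clin_csc if_distrib[of "clin (ap Q0)"] simp del: sum.lessThan_Suc intro!: sum.cong)
  then show ?thesis by (simp only: bb_Q0 NN_headM_rsum)
qed

lemma hq_e_plus: "hq (e_plus X) = word [Unit]"
proof -
  define m :: "('o, 'y, 'a \<times> 'k) mor" where "m = e_plus X"
  have "drop_e m = with_elt (drop_e m) 0" "deg m = 0" "e_coeff m = 1"
    by (simp_all add: m_def e_plus_def drop_e_def with_elt_def e_coeff_def)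
  moreover from this have "lx (drop_e m) = 0" using lx_0[of "drop_e m"] by metis
  ultimately have "hq m = word [Unit]" unfolding hq_eq by simp
  then show ?thesis by (simp only: m_def)
qed

lemma clin_pre: "clin (ap pre) x = word [Unit] * clin (ap ut) x"
  unfolding mult_clin_right by (rule clin_cong) (simp_all add: word_Cons[of Unit, symmetric])

lemma Q0_B:
  assumes w: "cyc_word Cp w"
  shows "clin (ap Q0) (connes_B w) = ap (BB \<odot> Q0) w"
proof -
  have ne: "w \<noteq> []" using w by (auto simp: cyc_word_def)
  have "connes_B w = rsum (\<lambda>i z. if 0 \<le> i \<and> i \<le> length w - 1 then word (e_plus (src (hd z)) # z) else 0) w"
    unfolding connes_B_def using ne by (intro overbrace_rsum) simp
  then have "clin (ap Q0) (connes_B w) = rsum (\<lambda>i z. ap (pre \<odot> geo dC \<odot> stm) (mk i z)) w"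
    by (simp only: clin_rsum, intro rsum_cong[OF _ w])
      (auto simp: ap_Q0 hq_e_plus stm_mk clin_pre uq_eq geo_dC simp del: ut_word ap_pre)
  then show ?thesis by (simp only: BB_Q0 NN_headM_rsum)
qed

context
  fixes v :: "'k \<Rightarrow> 'k"
  assumes v: "der v"
begin

abbreviation "\<phi> \<equiv> opv v m0"
abbreviation vP :: "('o, 'y, 'a \<times> 'k) mor list \<Rightarrow> ('o, 'y, 'a \<times> 'k) mor"
  where "vP \<equiv> apply_op id (v_mu_plus C B v) (deg_of_int 1)"

lemma vP:
  assumes s: "is_path Cp s"
  shows "ap (muu \<phi> \<odot> Ku) (map Plain s) = uq [vP s]" "is_mor Cp (vP s)" "zc (vP s) = 0" "par (vP s) = epar s + 1"
    "src (vP s) = src (hd s)" "tgt (vP s) = tgt (last s)" "e_coeff (vP s) = 0"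
proof -
  have "s \<noteq> []" using s by auto
  then have d: "drop_e (vP s) = apply_op id (v_mu C B v) (deg_of_int 1) (map drop_e s)"
    by (simp add: drop_e_def[of "vP s"] with_elt_def apply_op_def[of _ "v_mu C B v"] v_mu_plus_def hd_map last_map)
  show e: "e_coeff (vP s) = 0" by (simp add: e_coeff_def v_mu_plus_def)
  then show "zc (vP s) = 0" by simp
  show "is_mor Cp (vP s)" using v_mu_expand(1)[OF v drop_e_path[OF s]] e d by (simp add: is_mor_Cp)
  show "par (vP s) = epar s + 1" by (simp add: par_apply_op)
  have "muu \<phi> \<odot> Ku = ut \<odot> \<phi> \<odot> geo dC \<odot> stu" by (simp add: muu_def comp_assoc)
  then show "ap (muu \<phi> \<odot> Ku) (map Plain s) = uq [vP s]"
    using v_mu_expand(2)[OF v drop_e_path[OF s]] by (simp add: geo_dC uq_1 d del: ut_word ap_opv)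
qed simp_all

text \<open>The letters \<open>j, ..., l - 1\<close> to the left of the mark are replaced by a
  single one, so the mark moves from \<open>i\<close> to \<open>i - l + Suc j\<close>.\<close>

lemma TT_mk:
  assumes z: "is_path Cp z" "i < length z"
  shows "ap (TT \<phi>) (mk i z) = (\<Sum>j<length z. \<Sum>l\<in>{j<..<length z}. if l \<le> i then
     csc (bsign (eps (take j z))) (ap Km (mk (i - l + Suc j) (take j z @ vP (slice j l z) # drop l z))) else 0)"
proof -
  have o: "op1 1 \<phi>" by (rule opv_op1[OF v op1_m0])
  have 0: "ap (muu \<phi> \<odot> Ku) [] = 0" using op1D(2)[OF o] by (simp add: muu_def)
  have "ap (TT \<phi>) (mk i z) = (\<Sum>j<length z. \<Sum>l\<in>{j<..length z}.
      ap (Ku \<odot> sg 1) (take j (mk i z)) * ap (muu \<phi> \<odot> Ku) (slice j l (mk i z)) * ap Km (drop l (mk i z)))"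
    unfolding TT_def ap_triple[OF 0] using z by simp
  also have "\<dots> = (\<Sum>j<length z. \<Sum>l\<in>{j<..<length z}. if l \<le> i then
     csc (bsign (eps (take j z))) (ap Km (mk (i - l + Suc j) (take j z @ vP (slice j l z) # drop l z))) else 0)"
  proof (rule sum.cong[OF refl], rule sum.mono_neutral_cong_right)
    fix j assume j: "j \<in> {..<length z}"
    have z0: "ap Km (drop l (mk i z)) = 0" if "i < l" for l
      using z that by (simp add: drop_mk Km_Plain)
    show "\<forall>l\<in>{j<..length z} - {j<..<length z}.
      ap (Ku \<odot> sg 1) (take j (mk i z)) * ap (muu \<phi> \<odot> Ku) (slice j l (mk i z)) * ap Km (drop l (mk i z)) = 0"
      using z z0 by (auto simp: Km_Nil)
    fix l assume l: "l \<in> {j<..<length z}"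
    show "ap (Ku \<odot> sg 1) (take j (mk i z)) * ap (muu \<phi> \<odot> Ku) (slice j l (mk i z)) * ap Km (drop l (mk i z)) =
      (if l \<le> i then csc (bsign (eps (take j z))) (ap Km (mk (i - l + Suc j) (take j z @ vP (slice j l z) # drop l z))) else 0)"
    proof (cases "l \<le> i")
      case True
      let ?y = "take j z @ vP (slice j l z) # drop l z"
      have p: "is_path Cp (slice j l z)" using z l by (intro path_slice) auto
      have sl: "slice j l (mk i z) = map Plain (slice j l z)"
        using True z by (simp add: slice_def take_mk drop_map)
      have i': "i - l + Suc j < length ?y" using True z l by simp
      have lt: "length (take j z) = j" using l z by simp
      have t: "take (i - l + Suc j) ?y = take j z @ vP (slice j l z) # take (i - l) (drop l z)"
        "?y ! (i - l + Suc j) = z ! i" "drop (Suc (i - l + Suc j)) ?y = drop (Suc i) z"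
        using insert_nth[OF lt, where d = "i - l" and x = "vP (slice j l z)" and B = "drop l z"] True z l by simp_all
      have "ap Km (mk (i - l + Suc j) ?y) = (uq (take j z) * uq [vP (slice j l z)] * uq (take (i - l) (drop l z))) * hq (z ! i) * uq (drop (Suc i) z)"
        unfolding Km_mk[OF i'] t uq_append(1)[of "take j z"] uq_append(2)[of "vP (slice j l z)" "take (i - l) (drop l z)"] by (simp only: mult.assoc)
      moreover have "ap Km (drop l (mk i z)) = uq (take (i - l) (drop l z)) * hq (z ! i) * uq (drop (Suc i) z)"
        using True z by (simp add: drop_mk Km_mk)
      moreover have "ap (Ku \<odot> sg 1) (take j (mk i z)) = csc (bsign (eps (take j z))) (uq (take j z))"
        using True z l by (simp add: take_mk ap_comp_sg eps_epar del: ap_comp)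
      ultimately show ?thesis using True vP(1)[OF p] unfolding sl
        by (simp add: csc_mult_left mult.assoc del: ap_comp)
    qed (use z0 in simp)
  qed auto
  finally show ?thesis .
qed

lemma path_y:
  assumes z: "is_path Cp z" "j < l" "l < length z"
  shows "is_path Cp (take j z @ vP (slice j l z) # drop l z)"
proof -
  have p: "is_path Cp (slice j l z)" using z by (intro path_slice) auto
  show ?thesis
    using path_replace[OF p vP(2)[OF p] vP(5)[OF p] vP(6)[OF p], of "take j z" "drop l z"] split3[of j l z, symmetric] z by simp
qed

lemma mm_TT_mk:
  assumes z: "is_path Cp z" "i < length z"
  shows "ap (mm m0 \<odot> TT \<phi>) (mk i z) = (\<Sum>j<length z. \<Sum>l\<in>{j<..<length z}. if l \<le> i then
     csc (bsign (eps (take j z))) (hq (muP (take j z @ vP (slice j l z) # drop l z))) else 0)"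
proof -
  have "ap (mm m0 \<odot> Km) (mk (i - l + Suc j) (take j z @ vP (slice j l z) # drop l z)) = hq (muP (take j z @ vP (slice j l z) # drop l z))"
    if jl: "j < length z" "l \<in> {j<..<length z}" "l \<le> i" for j l
  proof -
    let ?y = "take j z @ vP (slice j l z) # drop l z" and ?i = "i - l + Suc j"
    have y: "is_path Cp ?y" using z jl by (intro path_y) auto
    have i': "?i < length ?y" using z jl by simp
    obtain a y' where ay: "?y = a # y'" by (cases "take j z") auto
    have mk: "mk ?i ?y = Plain a # mk (i - l + j) y'" unfolding ay add_Suc_right mk_Suc ..
    \<comment> \<open>\<open>rm\<close> differs from \<open>mm m0 \<odot> Km\<close> by products of
      an e^+ with the marked letter, which require a word of two letters. If \<open>j > 0\<close>
      there are more; if \<open>j = 0\<close> the first letter is a value of v(mu), which has no e^+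
      part.\<close>
    have zero: "ap zu [Plain a] * ap qm (mk (i - l + j) y') = 0"
    proof (cases "j = 0")
      case True
      have "is_path Cp (slice j l z)" using z jl by (intro path_slice) auto
      from vP(7)[OF this] show ?thesis using True ay by (auto simp: zv)
    next
      case False
      then have "length y' = j + (length z - l)" "j > 0" "length z - l > 0" using arg_cong[OF ay, of length] jl z by auto
      then have "length (mk (i - l + j) y') \<noteq> 1" using i' unfolding ay by simp
      then show ?thesis using qm_head(3) unfolding lin1_def by simp
    qed
    have "ap (mm m0 \<odot> Km) (mk ?i ?y) = ap rm (mk ?i ?y)"
      unfolding rm_def mk using zero by (simp add: ap_lin1_times lin1_sg[OF qm_head(3)] qm_head ap_comp_sg del: ap_comp)
    then show ?thesis using mu_mor_e(3)[OF y i'] by simp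
  qed
  then show ?thesis
    unfolding ap_comp[of "mm m0" "TT \<phi>"] TT_mk[OF z] clin_sum
    by (intro sum.cong refl) (auto simp: clin_csc)
qed

lemma Q0_b11:
  assumes w: "cyc_word Cp w"
  shows "clin (ap Q0) (b11 Cp (v_mu_plus C B v) (deg_of_int 1) w) = ap (ii m0 idl 1 \<phi> \<odot> Q0) w"
proof -
  let ?X = "\<lambda>j l k z. csc (bsign (parity (deg_of_int 1 :: 'y) * eps (take j z)))
     (word (muP (take j z @ vP (slice j l z) # slice l k z) # drop k z)) :: ('k, 'o, 'y, 'a \<times> 'k) chain"
  have el: "b11 Cp (v_mu_plus C B v) (deg_of_int 1) w = rsum (\<lambda>i z. \<Sum>j<length w. \<Sum>l\<in>{j<..<length w}. \<Sum>k\<in>{l<..length w}.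
     if l \<le> i \<and> i \<le> k - 1 then ?X j l k z else 0) w"
    unfolding b11_def rsum_sum[symmetric] by (intro sum.cong refl overbrace_rsum) auto
  have z_eq: "clin (ap Q0) (\<Sum>j<length w. \<Sum>l\<in>{j<..<length w}. \<Sum>k\<in>{l<..length w}. if l \<le> i \<and> i \<le> k - 1 then ?X j l k z else 0) =
      ap ((mm m0 \<odot> TT \<phi>) * Ku) (mk i z)"
    if z: "cyc_word Cp z" "length z = length w" "i < length z" for i z
  proof -
    let ?h = "\<lambda>j l k. csc (bsign (eps (take j z))) (hq (muP (take j z @ vP (slice j l z) # slice l k z)) * uq (drop k z))"
    \<comment> \<open>The common index set of both triple sums, which are nested in different
      orders: \<open>\<phi>\<close> takes the positions from \<open>j\<close> to
      \<open>l - 1\<close>, and the outer operation ends before \<open>k\<close>, past the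
      mark.\<close>
    let ?T = "{(j, l, k). j < l \<and> l \<le> i \<and> i < k \<and> k \<le> length z}"
    have p: "is_path Cp z" using z by (simp add: cyc_word_def)
    have "clin (ap Q0) (\<Sum>j<length w. \<Sum>l\<in>{j<..<length w}. \<Sum>k\<in>{l<..length w}. if l \<le> i \<and> i \<le> k - 1 then ?X j l k z else 0) =
      (\<Sum>j<length z. \<Sum>l\<in>{j<..<length z}. \<Sum>k\<in>{l<..length z}. if l \<le> i \<and> i \<le> k - 1 then ?h j l k else 0)"
      unfolding z(2)[symmetric] by (simp add: clin_sum clin_csc if_distrib[of "clin (ap Q0)"] ap_Q0 cong: if_cong)
    also have "\<dots> = (\<Sum>(j, l, k)\<in>(SIGMA j:{..<length z}. SIGMA l:{j<..<length z}. {l<..length z}). if l \<le> i \<and> i \<le> k - 1 then ?h j l k else 0)"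
      by (simp add: sum.Sigma)
    also have "\<dots> = (\<Sum>(j, l, k)\<in>?T. ?h j l k)"
      using z(3) by (intro sum.mono_neutral_cong_right) (auto split: if_splits)
    finally have 1: "clin (ap Q0) (\<Sum>j<length w. \<Sum>l\<in>{j<..<length w}. \<Sum>k\<in>{l<..length w}. if l \<le> i \<and> i \<le> k - 1 then ?X j l k z else 0) =
      (\<Sum>(j, l, k)\<in>?T. ?h j l k)" .
    have "ap ((mm m0 \<odot> TT \<phi>) * Ku) (mk i z) = (\<Sum>k\<le>length z. ap (mm m0 \<odot> TT \<phi>) (take k (mk i z)) * ap Ku (drop k (mk i z)))"
      using z(3) by (simp only: ap_times length_mk)
    also have "\<dots> = (\<Sum>k\<in>{i<..length z}. \<Sum>j<k. \<Sum>l\<in>{j<..<k}. if l \<le> i then ?h j l k else 0)"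
    proof (rule sum.mono_neutral_cong_right)
      show "\<forall>k\<in>{..length z} - {i<..length z}. ap (mm m0 \<odot> TT \<phi>) (take k (mk i z)) * ap Ku (drop k (mk i z)) = 0"
        using z(3) by (auto simp: drop_mk not_less)
      fix k assume k: "k \<in> {i<..length z}"
      then have pk: "is_path Cp (take k z)" "i < length (take k z)" using p by (auto intro: path_take)
      have "ap (mm m0 \<odot> TT \<phi>) (take k (mk i z)) * ap Ku (drop k (mk i z)) = ap (mm m0 \<odot> TT \<phi>) (mk i (take k z)) * uq (drop k z)"
        using k z(3) by (simp add: take_mk drop_mk del: ap_comp)
      also have "\<dots> = (\<Sum>j<k. \<Sum>l\<in>{j<..<k}. if l \<le> i then ?h j l k else 0)"
        unfolding mm_TT_mk[OF pk] sum_distrib_right using k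
        by (intro sum.cong) (auto simp: slice_def min_def csc_mult_left)
      finally show "ap (mm m0 \<odot> TT \<phi>) (take k (mk i z)) * ap Ku (drop k (mk i z)) = (\<Sum>j<k. \<Sum>l\<in>{j<..<k}. if l \<le> i then ?h j l k else 0)" .
    qed auto
    also have "\<dots> = (\<Sum>(k, j, l)\<in>(SIGMA k:{i<..length z}. SIGMA j:{..<k}. {j<..<k}). if l \<le> i then ?h j l k else 0)"
      by (simp add: sum.Sigma)
    also have "\<dots> = (\<Sum>(k, j, l)\<in>{(k, j, l). (j, l, k) \<in> ?T}. ?h j l k)"
      by (intro sum.mono_neutral_cong_right) (auto split: if_splits)
    also have "\<dots> = (\<Sum>(j, l, k)\<in>?T. ?h j l k)"
      by (rule sum.reindex_bij_witness[of _ "\<lambda>(j, l, k). (k, j, l)" "\<lambda>(k, j, l). (j, l, k)"]) auto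
    finally show ?thesis using 1 by simp
  qed
  show ?thesis
    unfolding ii_Q0 NN_headM_rsum el clin_rsum by (rule rsum_cong[OF z_eq w])
qed

lemma Q0_B11:
  assumes w: "cyc_word Cp w"
  shows "clin (ap Q0) (B11 (v_mu_plus C B v) (deg_of_int 1) w) = ap (SS idl 1 \<phi> \<odot> Q0) w"
proof -
  let ?X = "\<lambda>j l z. csc (bsign (parity (deg_of_int 1 :: 'y) * eps (take j z)))
     (word (e_plus (src (hd z)) # take j z @ vP (slice j l z) # drop l z)) :: ('k, 'o, 'y, 'a \<times> 'k) chain"
  have el: "B11 (v_mu_plus C B v) (deg_of_int 1) w = rsum (\<lambda>i z. \<Sum>j<length w. \<Sum>l\<in>{j<..<length w}.
     if l \<le> i \<and> i \<le> length w - 1 then ?X j l z else 0) w"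
    unfolding B11_def rsum_sum[symmetric] by (intro sum.cong refl overbrace_rsum) auto
  have z_eq: "clin (ap Q0) (\<Sum>j<length w. \<Sum>l\<in>{j<..<length w}. if l \<le> i \<and> i \<le> length w - 1 then ?X j l z else 0) =
      ap (pre \<odot> stm \<odot> TT \<phi>) (mk i z)"
    if z: "cyc_word Cp z" "length z = length w" "i < length z" for i z
  proof -
    have p: "is_path Cp z" using z by (simp add: cyc_word_def)
    have "clin (ap pre) (clin (ap stm) (ap Km (mk (i - l + Suc j) (take j z @ vP (slice j l z) # drop l z)))) =
      word [Unit] * uq (take j z @ vP (slice j l z) # drop l z)" if jl: "j < length z" "l \<in> {j<..<length z}" "l \<le> i" for j l
    proof -
      have i': "i - l + Suc j < length (take j z @ vP (slice j l z) # drop l z)" using z jl by simp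
      have "ap (stm \<odot> Km) (mk (i - l + Suc j) (take j z @ vP (slice j l z) # drop l z)) = expand C B (map drop_e (take j z @ vP (slice j l z) # drop l z))"
        unfolding stm_Km by (simp only: ap_comp stm_mk[OF i'] clin_single csc_simps geo_dC)
      then show ?thesis unfolding clin_pre by (simp only: ap_comp uq_eq)
    qed
    then show ?thesis
      using z unfolding ap_comp TT_mk[OF p z(3)] z(2)[symmetric] clin_sum
      by (intro sum.cong refl) (auto simp: clin_csc ap_Q0 hq_e_plus simp del: map_append)
  qed
  show ?thesis
    unfolding SS_Q0 NN_headM_rsum el clin_rsum by (rule rsum_cong[OF z_eq w])
qed

end

end

lemma (in based) prod_lx:
  "(\<And>b. b \<in> set ls \<Longrightarrow> A b = lx (g b)) \<Longrightarrow> prod_list (map A ls) = expand C B (map g ls)"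
proof (induction ls)
  case (Cons b ls)
  have "A b = lx (g b)" using Cons.prems by simp
  moreover have "prod_list (map A ls) = expand C B (map g ls)" using Cons by simp
  ultimately show ?case unfolding list.map expand_Cons[of "g b" "map g ls"] by simp
qed simp

context ainf_functor_based
begin

abbreviation FP :: "('o, 'y, 'a \<times> 'k) mor list \<Rightarrow> ('o, 'y, 'b \<times> 'k) mor" where "FP \<equiv> apply_op id (F_plus F) 0"

lemma FP:
  assumes p: "is_path C.Cp p"
  shows "is_mor D.Cp (FP p)" "drop_e (FP p) = apply_op id F 0 (map drop_e p)"
    "i < length p \<Longrightarrow> ap (fm f0 \<odot> C.Km) (mk i p) = D.hq (FP p)"
proof -
  have "p \<noteq> []" using p by auto
  then show d: "drop_e (FP p) = apply_op id F 0 (map drop_e p)"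
    by (simp add: drop_e_def[of "FP p"] with_elt_def apply_op_def[of _ F] F_plus_def hd_map last_map)
  have e: "e_coeff (FP p) = (case p of [m] \<Rightarrow> e_coeff m | _ \<Rightarrow> 0)" by (simp add: e_coeff_def F_plus_def)
  show "is_mor D.Cp (FP p)"
    using F_mor[OF C.drop_e_path[OF p]] e p
    by (auto simp: D.is_mor_Cp d[symmetric] split: list.splits) (auto simp: is_path_Cons C.is_mor_Cp)
  assume i: "i < length p"
  have Es: "Es \<odot> C.Km = Es + C.zm"
    by (simp add: C.Km_alt Es_times)
  have "(Es * et) \<odot> C.Km = (Es + C.zm) * (et :: (_, ('o, 'y, 'b) mor lt list, 'k) wop)"
    by (simp add: C.times_Km Es)
  then have "fm f0 \<odot> C.Km = Mt \<odot> f0 \<odot> geo C.dC \<odot> stm + (Es + C.zm) * et"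
    by (simp add: fm_def comp_assoc)
  moreover have "clin (ap f0) (expand C B (map drop_e p)) = ap f0 ([] @ map drop_e p)"
    using CD.mop_expand_mor[OF Fml, of "map drop_e p" "[]"] C.drop_e_path[OF p] by (simp add: is_path_def)
  moreover have "ap ((Es + C.zm) * et) (mk i p) = csc (if deg (FP p) = 0 then e_coeff (FP p) else 0) (word [Unit] :: ('o, 'y, 'b) mor lt list \<Rightarrow>\<^sub>0 'k)"
  proof -
    have l: "lin1 (Es + C.zm :: (_, ('o, 'y, 'b) mor lt list, 'k) wop)"
      by (simp add: lin1_def lin1s(5)[unfolded lin1_def] C.lin1_dC(3)[unfolded lin1_def])
    show ?thesis
    proof (cases "length p = 1")
      case True
      then obtain m where m: "p = [m]" by (auto simp: length_Suc_conv)
      show ?thesis using i by (simp add: m mk_def ap_lin1_times[OF l] ap_Es C.zv e[unfolded m] csc_mult_left del: csc_single)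
    next
      case False
      then have "ap ((Es + C.zm) * et) (mk i p) = (0 :: ('o, 'y, 'b) mor lt list \<Rightarrow>\<^sub>0 'k)"
        using i length_mk[OF i] by (cases "mk i p" rule: lin1_cases) (simp_all add: ap_lin1_times[OF l])
      moreover have "e_coeff (FP p) = 0" using False unfolding e by (auto split: list.splits)
      ultimately show ?thesis by simp
    qed
  qed
  ultimately show "ap (fm f0 \<odot> C.Km) (mk i p) = D.hq (FP p)"
    using C.drop_e_path[OF p] i by (simp add: stm_mk C.geo_dC D.hq_eq d mop_def del: csc_single)
qed

lemma Fu_Plain:
  assumes "q = [] \<or> is_path C.Cp q"
  shows "ap (Fu f0 \<odot> C.Ku) (map Plain q) = (\<Sum>ls\<in>splittings q. D.uq (map FP ls))"
proof -
  have o: "op1 0 f0" by (rule op1_f0)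
  have "Fu f0 \<odot> C.Ku = ut \<odot> (geo f0 \<odot> geo C.dC) \<odot> stu"
    by (simp add: Fu_def comp_assoc)
  also have "geo f0 \<odot> geo C.dC = geo (f0 \<odot> geo C.dC)"
    using o by (intro geo_geo) (simp_all add: op1D[OF op1_f0])
  finally have "ap (Fu f0 \<odot> C.Ku) (map Plain q) = clin (ap ut) (ap (geo (f0 \<odot> geo C.dC)) q)"
    by (simp del: ut_word)
  also have "ap (geo (f0 \<odot> geo C.dC)) q = (\<Sum>ls\<in>splittings q. prod_list (map (ap (f0 \<odot> geo C.dC)) ls))"
    by (rule ap_geo_splittings) (simp add: op1D[OF op1_f0])
  also have "\<dots> = (\<Sum>ls\<in>splittings q. expand D B' (map drop_e (map FP ls)))"
  proof (rule sum.cong[OF refl])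
    fix ls assume "ls \<in> splittings q"
    then have ls: "concat ls = q" "[] \<notin> set ls" by (auto simp: splittings_def)
    have P: "is_path C.Cp b" if bl: "b \<in> set ls" for b
    proof -
      obtain x y where "ls = x @ b # y" using split_list[OF bl] by blast
      then have "q = concat x @ b @ concat y" using ls by auto
      moreover have "b \<noteq> []" using bl ls by auto
      ultimately show ?thesis using assms path_infix[of C.Cp "concat x" b "concat y"] by auto
    qed
    have "ap (f0 \<odot> geo C.dC) b = D.lx (drop_e (FP b))" if "b \<in> set ls" for b
    proof -
      have "clin (ap f0) (expand C B (map drop_e b)) = ap f0 ([] @ map drop_e b)"
        using CD.mop_expand_mor[OF Fml, of "map drop_e b" "[]"] C.drop_e_path[OF P[OF that]] by (simp add: is_path_def)
      then show ?thesis using C.drop_e_path[OF P[OF that]] by (simp add: C.geo_dC FP(2)[OF P[OF that]] mop_def)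
    qed
    then show "prod_list (map (ap (f0 \<odot> geo C.dC)) ls) = expand D B' (map drop_e (map FP ls))"
      unfolding map_map o_def by (rule D.prod_lx)
  qed
  finally show ?thesis by (simp only: clin_sum D.uq_eq)
qed

lemma Q0_F:
  assumes w: "cyc_word C.Cp w"
  shows "clin (ap D.Q0) (induced_chain_map id (F_plus F) w) = ap (FF f0 \<odot> C.Q0) w"
proof -
  let ?X = "\<lambda>p z. (\<Sum>ls\<in>splittings (drop p z). word (FP (take p z) # map FP ls)) :: ('k, 'o, 'y, 'b \<times> 'k) chain"
  have el: "induced_chain_map id (F_plus F) w = rsum (\<lambda>i z. \<Sum>p\<in>{1..length w}. if 0 \<le> i \<and> i \<le> p - 1 then ?X p z else 0) w"
    unfolding induced_chain_map_def rsum_sum[symmetric] by (intro sum.cong refl overbrace_rsum) auto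
  have z_eq: "clin (ap D.Q0) (\<Sum>p\<in>{1..length w}. if 0 \<le> i \<and> i \<le> p - 1 then ?X p z else 0) =
      ap ((fm f0 \<odot> C.Km) * (Fu f0 \<odot> C.Ku)) (mk i z)"
    if z: "cyc_word C.Cp z" "length z = length w" "i < length z" for i z
  proof -
    have p: "is_path C.Cp z" using z by (simp add: cyc_word_def)
    have "ap ((fm f0 \<odot> C.Km) * (Fu f0 \<odot> C.Ku)) (mk i z) =
      (\<Sum>p\<le>length z. ap (fm f0 \<odot> C.Km) (take p (mk i z)) * ap (Fu f0 \<odot> C.Ku) (drop p (mk i z)))"
      using z(3) by (simp only: ap_times length_mk)
    also have "\<dots> = (\<Sum>p\<in>{1..length z}. if 0 \<le> i \<and> i \<le> p - 1 then clin (ap D.Q0) (?X p z) else 0)"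
    proof (rule sum.mono_neutral_cong_right)
      have fu0: "ap (Fu f0 \<odot> C.Ku) (mk i y) = 0" for i y
        by (simp add: comp_assoc)
      show "\<forall>p\<in>{..length z} - {1..length z}. ap (fm f0 \<odot> C.Km) (take p (mk i z)) * ap (Fu f0 \<odot> C.Ku) (drop p (mk i z)) = 0"
        using fu0 by (auto simp: not_less_eq_eq simp del: ap_comp)
      fix q assume q: "q \<in> {1..length z}"
      show "ap (fm f0 \<odot> C.Km) (take q (mk i z)) * ap (Fu f0 \<odot> C.Ku) (drop q (mk i z)) =
        (if 0 \<le> i \<and> i \<le> q - 1 then clin (ap D.Q0) (?X q z) else 0)"
      proof (cases "q \<le> i")
        case True
        then show ?thesis using z fu0 q by (auto simp: drop_mk simp del: ap_comp)
      next
        case False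
        have pq: "is_path C.Cp (take q z)" "i < length (take q z)" using p q False by (auto intro: path_take)
        have "drop q z = [] \<or> is_path C.Cp (drop q z)"
          using path_slice[OF p, of q "length z"] q by (cases "q < length z") (auto simp: slice_def)
        from Fu_Plain[OF this] show ?thesis using z(3) False FP(3)[OF pq] q
          by (auto simp: take_mk drop_mk clin_sum D.ap_Q0 sum_distrib_left simp del: ap_comp)
      qed
    qed auto
    finally show ?thesis unfolding z(2)[symmetric] by (simp add: clin_sum if_distrib[of "clin (ap D.Q0)"] cong: if_cong)
  qed
  show ?thesis
    unfolding FF_Q0 NN_headM_rsum el clin_rsum by (rule rsum_cong[OF z_eq w])
qed

end

section \<open>Null chains and formal chains\<close>

text \<open>The word \<open>[Unit]\<close> is the image of the length-zero chain e^+, which is null;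
  it is the only trace that null chains leave on marked words.\<close>

definition nul :: "('l lt list \<Rightarrow>\<^sub>0 'k::field) \<Rightarrow> bool"
  where "nul y \<longleftrightarrow> Poly_Mapping.keys y \<subseteq> {[Unit]}"

lemma nul_closed: "nul 0" "nul x \<Longrightarrow> nul y \<Longrightarrow> nul (x + y)" "nul x \<Longrightarrow> nul y \<Longrightarrow> nul (x - y)" "nul x \<Longrightarrow> nul (csc c x)"
  unfolding nul_def using keys_add[of x y] keys_diff[of x y] keys_csc[of c x] by auto

lemma nul_clin: "(\<And>u. u \<in> Poly_Mapping.keys x \<Longrightarrow> nul (P u)) \<Longrightarrow> nul (clin P x)"
  unfolding nul_def using keys_clin[of P x] by blast

lemma null_clin: "(\<And>u. u \<in> Poly_Mapping.keys x \<Longrightarrow> P u \<in> null_chains C) \<Longrightarrow> clin P x \<in> null_chains C"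
  unfolding null_chains_def lin_def by (intro chain.span_sum chain.span_scale)

lemma null_closed: "0 \<in> null_chains C" "x \<in> null_chains C \<Longrightarrow> y \<in> null_chains C \<Longrightarrow> x + y \<in> null_chains C"
  "x \<in> null_chains C \<Longrightarrow> y \<in> null_chains C \<Longrightarrow> x - y \<in> null_chains C"
  unfolding null_chains_def by (auto intro: chain.span_zero chain.span_add chain.span_diff)

lemma fc_closed: "0 \<in> formal_chains C y" "x \<in> formal_chains C y \<Longrightarrow> x' \<in> formal_chains C y \<Longrightarrow> x + x' \<in> formal_chains C y"
  "x \<in> formal_chains C y \<Longrightarrow> x' \<in> formal_chains C y \<Longrightarrow> x - x' \<in> formal_chains C y"
  "x \<in> formal_chains C y \<Longrightarrow> csc c x \<in> formal_chains C y"
  by (auto simp: formal_chains_def in_keys_iff lookup_add lookup_minus lookup_csc)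

lemma fc_sum: "(\<And>a. a \<in> A \<Longrightarrow> f a \<in> formal_chains C y) \<Longrightarrow> sum f A \<in> formal_chains C y"
  by (induction A rule: infinite_finite_induct) (auto simp: fc_closed)

lemma fc_word: "cyc_word C w \<Longrightarrow> rdeg w + deg_of_int 1 = y \<Longrightarrow> word w \<in> formal_chains C y"
  by (auto simp: formal_chains_def)

lemma fc_clin:
  assumes "x \<in> formal_chains C y" "\<And>w. cyc_word C w \<Longrightarrow> rdeg w + deg_of_int 1 = y \<Longrightarrow> P w \<in> formal_chains D y'"
  shows "clin P x \<in> formal_chains D y'"
  unfolding lin_def by (intro fc_sum fc_closed(4) assms(2)) (use assms(1) in \<open>auto simp: formal_chains_def\<close>)

lemma fc_overbrace:
  assumes "cyc_word C w" "q < length w"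
    "\<And>z. cyc_word C z \<Longrightarrow> length z = length w \<Longrightarrow> rdeg z = rdeg w \<Longrightarrow> P z \<in> formal_chains D y"
  shows "overbrace p q P w \<in> formal_chains D y"
proof -
  have "overbrace p q P w = (\<Sum>i\<in>{p..q}. clin P (rotn i w))"
    unfolding overbrace_def using assms(2) by (intro sum.cong) (simp_all add: cyc_power)
  then show ?thesis
    unfolding lin_def by (auto intro!: fc_sum fc_closed(4) assms(3) dest: keys_rotn[OF _ assms(1)])
qed

lemma cyc_replace:
  assumes "cyc_word C (p @ s @ q)" "is_path C s" "is_mor C m" "src m = src (hd s)" "tgt m = tgt (last s)"
  shows "cyc_word C (p @ m # q)"
proof -
  have s: "s \<noteq> []" using assms(2) by auto
  have "is_path C (p @ m # q)" using assms path_replace[OF assms(2-5)] by (simp add: cyc_word_def)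
  moreover have "tgt (last (p @ m # q)) = tgt (last (p @ s @ q))"
    using assms(5) s by (cases "q = []") simp_all
  moreover have "src (hd (p @ m # q)) = src (hd (p @ s @ q))"
    using assms(4) s by (cases p) simp_all
  ultimately show ?thesis using assms(1) by (simp add: cyc_word_def)
qed

lemma cyc_with_elt:
  assumes "cyc_word C (p @ m # q)" "is_mor C (with_elt m a)"
  shows "cyc_word C (p @ with_elt m a # q)"
proof (rule cyc_replace[of C p "[m]"])
  show "is_path C [m]" using assms(1) path_infix[of C p "[m]" q] by (simp add: cyc_word_def)
qed (use assms in simp_all)

lemma cyc_op:
  assumes "cyc_word C z" "j < k" "k \<le> length z" "is_mor C (apply_op id f d (slice j k z))"
  shows "cyc_word C (take j z @ apply_op id f d (slice j k z) # drop k z)"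
    "rdeg (take j z @ apply_op id f d (slice j k z) # drop k z) = rdeg z + d"
proof -
  have z: "z = take j z @ slice j k z @ drop k z" using assms(2) by (intro split3) simp
  show "cyc_word C (take j z @ apply_op id f d (slice j k z) # drop k z)"
  proof (rule cyc_replace)
    show "cyc_word C (take j z @ slice j k z @ drop k z)" using assms(1) z by simp
    show "is_path C (slice j k z)" using assms(1-3) by (intro path_slice) (auto simp: cyc_word_def)
  qed (use assms in simp_all)
  show "rdeg (take j z @ apply_op id f d (slice j k z) # drop k z) = rdeg z + d"
    using arg_cong[OF z, of rdeg] by (simp add: algebra_simps)
qed

fun un :: "'l lt \<Rightarrow> 'l" where "un (Plain x) = x" | "un (Marked x) = x" | "un Unit = undefined"

definition emb :: "('o, 'y, 'a) mor \<Rightarrow> ('o, 'y, 'a \<times> 'k::zero) mor" where "emb m = with_elt m (elt m, 0)"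

text \<open>A section of the comparison map modulo null chains. \<open>Unit\<close> does not
  remember its object, which is recovered as the source of the next letter; for the bare word
  \<open>[Unit]\<close> the value 0 is correct because that chain is null.\<close>

definition RR :: "('o, 'y::grading_datum, 'a::ab_group_add) mor lt list \<Rightarrow> ('k::field, 'o, 'y, 'a \<times> 'k) chain"
  where "RR u = (case u of
      Marked b # ps \<Rightarrow> word (emb b # map (\<lambda>p. emb (un p)) ps)
    | Unit # p # ps \<Rightarrow> word (e_plus (src (un p)) # map (\<lambda>p. emb (un p)) (p # ps))
    | _ \<Rightarrow> 0)"

lemma RR_simps: "RR [Unit] = 0" "RR (Marked b # map Plain w) = word (emb b # map emb w)"
  "w \<noteq> [] \<Longrightarrow> RR (Unit # map Plain w) = word (e_plus (src (hd w)) # map emb w)"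
proof -
  show "RR (Unit # map Plain w) = word (e_plus (src (hd w)) # map emb w)" if "w \<noteq> []"
    using that by (cases w) (simp_all add: RR_def o_def)
qed (simp_all add: RR_def o_def)

lemma word_nz: "Poly_Mapping.single u (1::'k::field) \<noteq> 0"
  by (metis lookup_single_eq lookup_zero zero_neq_one)

lemma nul_RR: "nul y \<Longrightarrow> clin RR y = 0"
  unfolding nul_def lin_def by (intro sum.neutral) (auto simp: RR_simps)

context ainf_based
begin

lemma vsP: "vector_space (scl Cp)"
  by unfold_locales (auto simp: prod_eq_iff V.scale_right_distrib V.scale_left_distrib algebra_simps)

lemma homP:
  assumes "X \<in> Obj Cp" "Y \<in> Obj Cp"
  shows "module.subspace (scl Cp) (Hom Cp X Y y)"
proof -
  interpret W: vector_space "scl Cp" by (rule vsP)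
  have h: "V.subspace (Hom C X Y y)" using Hom assms by simp
  show ?thesis
    by (rule W.subspaceI) (auto simp: V.subspace_0[OF h] V.subspace_add[OF h] V.subspace_scale[OF h])
qed

lemma basesP: "hom_bases Cp (basis_plus B)"
  unfolding hom_bases_def
proof (intro ballI allI)
  fix X Y y assume XY: "X \<in> Obj Cp" "Y \<in> Obj Cp"
  interpret W: vector_space "scl Cp" by (rule vsP)
  let ?f = "\<lambda>\<beta>::'a. (\<beta>, 0::'k)"
  interpret f: Vector_Spaces.linear "scl C" "scl Cp" ?f
    unfolding Vector_Spaces.linear_iff using vs vsP by simp
  have b: "V.independent (B X Y y)" "V.span (B X Y y) = Hom C X Y y"
    using bases XY by (auto simp: hom_bases_def)
  have i: "W.independent (?f ` B X Y y)" by (rule f.independent_injective_image[OF b(1)]) (simp add: inj_on_def)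
  have s: "W.span (?f ` B X Y y) = ?f ` Hom C X Y y" unfolding f.span_image b(2) ..
  show "\<not> W.dependent (basis_plus B X Y y) \<and> W.span (basis_plus B X Y y) = Hom Cp X Y y"
  proof (cases "X = Y \<and> y = 0")
    case True
    then have e: "basis_plus B X Y y = insert (0, 1) (?f ` B X Y y)" by (auto simp: basis_plus_def)
    have "W.independent (insert (0, 1) (?f ` B X Y y))"
      by (rule W.independent_insertI[OF _ i]) (auto simp: s)
    moreover have "W.span (insert (0, 1) (?f ` B X Y y)) = Hom Cp X Y y"
      unfolding W.span_insert s using True by (auto simp: image_iff prod_eq_iff)
    ultimately show ?thesis unfolding e by blast
  next
    case False
    then have e: "basis_plus B X Y y = ?f ` B X Y y" by (auto simp: basis_plus_def)
    have "?f ` Hom C X Y y = Hom Cp X Y y" using False by (auto simp: image_iff prod_eq_iff)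
    then show ?thesis unfolding e using i s by simp
  qed
qed

sublocale P: based Cp "basis_plus B"
proof (rule based.intro)
  show "vector_space (scl Cp)" by (rule vsP)
  show "module.subspace (scl Cp) (Hom Cp X Y y)" if "X \<in> Obj Cp" "Y \<in> Obj Cp" for X Y y
    using that by (rule homP)
  show "hom_bases Cp (basis_plus B)" by (rule basesP)
qed

lemma drop_e_with_elt: "drop_e (with_elt m a) = with_elt (drop_e m) (fst a)"
  by (simp add: drop_e_def with_elt_def)

lemma dl_lin:
  fixes m :: "('o, 'y, 'a \<times> 'k) mor"
  assumes "is_mor Cp (with_elt m a)"
  shows "is_mor Cp (with_elt m b) \<Longrightarrow> lx (drop_e (with_elt m (a + b))) = lx (drop_e (with_elt m a)) + lx (drop_e (with_elt m b))"
    "lx (drop_e (with_elt m (scl Cp c a))) = csc c (lx (drop_e (with_elt m a)))"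
  using assms unfolding drop_e_with_elt by (simp_all add: is_mor_Cp drop_e_with_elt lx_add lx_scl)

lemma hq_lin:
  fixes m :: "('o, 'y, 'a \<times> 'k) mor"
  assumes "is_mor Cp (with_elt m a)"
  shows "is_mor Cp (with_elt m b) \<Longrightarrow> hq (with_elt m (a + b)) = hq (with_elt m a) + hq (with_elt m b)"
    "hq (with_elt m (scl Cp c a)) = csc c (hq (with_elt m a))"
  unfolding hq_eq using dl_lin[OF assms]
  by (simp_all add: e_coeff_def clin_add clin_csc csc_add csc_csc single_add del: Cp_simps(3)) (simp_all add: algebra_simps)

lemma uq_lin:
  fixes m :: "('o, 'y, 'a \<times> 'k) mor"
  assumes "is_mor Cp (with_elt m a)"
  shows "is_mor Cp (with_elt m b) \<Longrightarrow> uq [with_elt m (a + b)] = uq [with_elt m a] + uq [with_elt m b]"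
    "uq [with_elt m (scl Cp c a)] = csc c (uq [with_elt m a])"
  unfolding uq_1 using dl_lin[OF assms] by (simp_all add: clin_add clin_csc del: Cp_simps(3))

lemma Q0_Cons_mid: "ap Q0 (a # p @ m # q) = hq a * uq p * uq [m] * uq q"
  unfolding ap_Q0 uq_append(1)[of p] uq_append(2)[of m q] by (simp add: mult.assoc)

lemma Q0_lin:
  fixes m :: "('o, 'y, 'a \<times> 'k) mor"
  assumes "is_mor Cp (with_elt m a)"
  shows "is_mor Cp (with_elt m b) \<Longrightarrow> ap Q0 (p @ with_elt m (a + b) # q) = ap Q0 (p @ with_elt m a # q) + ap Q0 (p @ with_elt m b # q)"
    "ap Q0 (p @ with_elt m (scl Cp c a) # q) = csc c (ap Q0 (p @ with_elt m a # q))"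
proof -
  show "ap Q0 (p @ with_elt m (scl Cp c a) # q) = csc c (ap Q0 (p @ with_elt m a # q))"
  proof (cases p)
    case Nil
    then show ?thesis by (simp only: append_Nil ap_Q0 hq_lin(2)[OF assms] csc_mult_left)
  next
    case (Cons c p')
    then show ?thesis by (simp only: append_Cons Q0_Cons_mid uq_lin(2)[OF assms] csc_mult_left csc_mult_right)
  qed
  assume b: "is_mor Cp (with_elt m b)"
  show "ap Q0 (p @ with_elt m (a + b) # q) = ap Q0 (p @ with_elt m a # q) + ap Q0 (p @ with_elt m b # q)"
  proof (cases p)
    case Nil
    then show ?thesis by (simp only: append_Nil ap_Q0 hq_lin(1)[OF assms b] distrib_right)
  next
    case (Cons c p')
    then show ?thesis by (simp only: append_Cons Q0_Cons_mid uq_lin(1)[OF assms b] distrib_left distrib_right)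
  qed
qed

lemma Q0_slot:
  assumes m: "is_mor Cp m"
  shows "clin (\<lambda>u. ap Q0 (p @ u @ q)) (P.lx m) = ap Q0 (p @ m # q)"
proof -
  have "clin (\<lambda>u. ap Q0 (p @ u @ q)) (P.lx m) = clin (\<lambda>u. ap Q0 (p @ with_elt m (elt (hd u)) # q)) (P.lx m)"
    by (rule clin_cong[OF refl]) (auto simp: in_keys_iff P.lookup_lx split: if_splits)
  also have "\<dots> = ap Q0 (p @ with_elt m (elt m) # q)"
    by (rule P.slot[OF m]) (rule Q0_lin; assumption)+
  finally show ?thesis by simp
qed

lemma Q0_expand:
  "\<forall>m\<in>set w. is_mor Cp m \<Longrightarrow> clin (\<lambda>u. ap Q0 (p @ u)) (expand Cp (basis_plus B) w) = ap Q0 (p @ w)"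
proof (induction w arbitrary: p)
  case (Cons m w)
  have "clin (\<lambda>u. ap Q0 (p @ u)) (expand Cp (basis_plus B) (m # w)) =
    clin (\<lambda>x. clin (\<lambda>u. ap Q0 ((p @ x) @ u)) (expand Cp (basis_plus B) w)) (P.lx m)"
    unfolding P.expand_Cons[of m w] by (subst mult_conv_clin) (simp add: clin_clin plus_list_def)
  also have "\<dots> = clin (\<lambda>x. ap Q0 (p @ x @ w)) (P.lx m)"
  proof -
    have "clin (\<lambda>u. ap Q0 ((p @ x) @ u)) (expand Cp (basis_plus B) w) = ap Q0 ((p @ x) @ w)" for x
      using Cons.prems by (intro Cons.IH) simp
    then show ?thesis by simp
  qed
  also have "\<dots> = ap Q0 (p @ m # w)"
    using Cons.prems by (intro Q0_slot) simp
  finally show ?case .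
qed simp

definition bp :: "('o, 'y, 'a \<times> 'k) mor \<Rightarrow> bool"
  where "bp m \<longleftrightarrow> is_mor Cp m \<and> elt m \<in> basis_plus B (src m) (tgt m) (deg m)"

lemma bp_cases:
  assumes "bp m"
  obtains "m = emb (drop_e m)" "hq m = word [Marked (drop_e m)]" "uq [m] = word [Plain (drop_e m)]"
  | "m = e_plus (src m)" "hq m = word [Unit]" "uq [m] = 0" "src m \<in> Obj C" "tgt m = src m"
proof -
  consider \<beta> where "elt m = (\<beta>, 0)" "\<beta> \<in> B (src m) (tgt m) (deg m)" | "elt m = (0, 1)" "src m = tgt m" "deg m = 0"
    using assms by (auto simp: bp_def basis_plus_def split: if_splits)
  then show thesis
  proof cases
    case 1
    have "is_mor C (drop_e m)" using assms by (simp add: bp_def drop_e_mor)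
    then have "lx (drop_e m) = word [drop_e m]" using 1 by (intro lx_basis) simp_all
    moreover have "m = emb (drop_e m)" using 1 by (cases m) (simp add: emb_def drop_e_def with_elt_def)
    ultimately show thesis using 1 by (intro that(1)) (simp_all add: hq_eq uq_1 e_coeff_def Mt_def)
  next
    case 2
    have e: "m = e_plus (src m)" using 2 by (cases m) (simp add: e_plus_def)
    have "drop_e m = with_elt (drop_e m) 0" using 2 by (simp add: drop_e_def with_elt_def)
    then have "lx (drop_e m) = 0" using lx_0[of "drop_e m"] by metis
    moreover have "hq m = word [Unit]" using hq_e_plus[of "src m"] e by simp
    ultimately show thesis using e assms 2 by (intro that(2)) (simp_all add: uq_1 bp_def is_mor_def)
  qed
qed

lemma uq_bp: "\<forall>m\<in>set w. bp m \<and> uq [m] \<noteq> 0 \<Longrightarrow> uq w = word (map Plain (map drop_e w)) \<and> map emb (map drop_e w) = w"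
proof (induction w)
  case (Cons m w)
  then have m: "bp m" "uq [m] \<noteq> 0" by simp_all
  have e: "m = emb (drop_e m) \<and> uq [m] = word [Plain (drop_e m)]"
    by (rule bp_cases[OF m(1)]) (use m(2) in blast)+
  have IH: "uq w = word (map Plain (map drop_e w))" "map emb (map drop_e w) = w" using Cons by simp_all
  have "uq (m # w) = word [Plain (drop_e m)] * word (map Plain (map drop_e w))"
    unfolding uq_append(2)[of m w] IH(1) using e by simp
  then have "uq (m # w) = word (map Plain (map drop_e (m # w)))" by (simp only: word_append[symmetric] list.map append_Cons append_Nil)
  moreover have "map emb (map drop_e (m # w)) = m # w" using e IH(2) by (simp only: list.map)
  ultimately show ?case by blast
qed simp

lemma Q0_bp: "\<forall>m\<in>set u. bp m \<Longrightarrow> ap Q0 u = 0 \<or> (\<exists>u'. ap Q0 u = word u')"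
proof (cases u)
  case (Cons a w)
  assume u: "\<forall>m\<in>set u. bp m"
  show ?thesis
  proof (cases "\<exists>m\<in>set w. uq [m] = 0")
    case True
    then obtain m where m: "m \<in> set w" "uq [m] = 0" by blast
    from split_list[OF m(1)] m(2) obtain p q where "w = p @ m # q" "uq [m] = 0" by blast
    then show ?thesis using Q0_Cons_mid[of a p m q] Cons by simp
  next
    case False
    then have "uq w = word (map Plain (map drop_e w))" using u Cons uq_bp[of w] by simp
    moreover have "\<exists>c. hq a = word [c]" using u Cons by (auto intro: bp_cases[of a])
    ultimately show ?thesis unfolding Cons ap_Q0 by (auto simp: word_append[symmetric])
  qed
qed (simp add: Q0_def headM_def Mt_def)

lemma keys_expand_bp:
  assumes "\<forall>m\<in>set w. is_mor Cp m" "u \<in> Poly_Mapping.keys (expand Cp (basis_plus B) w)"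
  shows "map lab u = map lab w" "\<forall>m\<in>set u. bp m"
  using P.keys_expand[OF assms] by (auto simp: bp_def)

text \<open>After expansion in the bases, \<open>Q0\<close> sends each word to a single word or to
  0. Its matrix entries are then 0 or 1 and are killed by \<open>v\<close>.\<close>

lemma Q0_act:
  assumes v: "der v" and x: "\<And>w. w \<in> Poly_Mapping.keys x \<Longrightarrow> cyc_word Cp w"
  shows "clin (ap Q0) (act_coeffs Cp (basis_plus B) v x) = mapv v (clin (ap Q0) x)"
proof -
  let ?y = "clin (expand Cp (basis_plus B)) x"
  have mors: "\<forall>m\<in>set w. is_mor Cp m" if "w \<in> Poly_Mapping.keys x" for w
    using x[OF that] by (simp add: cyc_word_def is_path_def)
  have "clin (ap Q0) ?y = clin (ap Q0) x"
    unfolding clin_clin using Q0_expand[of _ "[]"] mors by (intro clin_cong refl) simp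
  moreover have "clin (\<lambda>w. mapv v (ap Q0 w)) ?y = clin (\<lambda>w. 0) ?y"
  proof (rule clin_cong[OF refl])
    fix u assume "u \<in> Poly_Mapping.keys ?y"
    from subsetD[OF keys_clin this]
    obtain w where w: "w \<in> Poly_Mapping.keys x" "u \<in> Poly_Mapping.keys (expand Cp (basis_plus B) w)"
      by blast
    from Q0_bp[OF keys_expand_bp(2)[OF mors[OF w(1)] w(2)]] show "mapv v (ap Q0 u) = 0"
      using mapv_simps(3)[OF v] mapv_word[OF v] by auto
  qed
  ultimately show ?thesis
    unfolding act_coeffs_def using mapv_clin[OF v, of "ap Q0" ?y] by simp
qed

text \<open>The multilinearity relations allow one entry to be replaced by its basis
  expansion.\<close>

lemma slot_null:
  assumes c: "cyc_word Cp (p @ m # q)"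
  shows "word (p @ m # q) - clin (\<lambda>x. word (p @ x @ q)) (P.lx m) \<in> null_chains C"
proof -
  have m: "is_mor Cp m" using c by (simp add: cyc_word_def is_path_def)
  let ?W = "\<lambda>a. word (p @ with_elt m a # q) :: ('k, 'o, 'y, 'a \<times> 'k) chain"
  have tr: "x \<in> tensor_relations Cp \<Longrightarrow> x \<in> null_chains C" for x
    unfolding null_chains_def by (rule chain.span_base) simp
  have add: "?W (a + b) - ?W a - ?W b \<in> null_chains C" if "is_mor Cp (with_elt m a)" "is_mor Cp (with_elt m b)" for a b
    by (rule tr) (use cyc_with_elt[OF c that(1)] cyc_with_elt[OF c that(2)] in \<open>unfold tensor_relations_def, blast\<close>)
  have scl: "?W (scl Cp r a) - csc r (?W a) \<in> null_chains C" if "is_mor Cp (with_elt m a)" for a r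
    by (rule tr) (use cyc_with_elt[OF c that(1)] in \<open>unfold tensor_relations_def, blast\<close>)
  let ?c = "coord Cp (basis_plus B) m"
  have I: "?W (\<Sum>\<beta>\<in>I. scl Cp (?c \<beta>) \<beta>) - (\<Sum>\<beta>\<in>I. csc (?c \<beta>) (?W \<beta>)) \<in> null_chains C" if "I \<subseteq> P.S m" for I
    using finite_subset[OF that P.finite_S] that
  proof (induction I rule: finite_induct)
    case empty
    have "scl Cp 0 0 = 0" by (simp add: zero_prod_def)
    then show ?case using scl[OF P.is_mor_0[OF m], of 0] by simp
  next
    case (insert x I)
    have i: "is_mor Cp (with_elt m x)" using P.S_mor[OF m] insert.prems by blast
    have j: "is_mor Cp (with_elt m (\<Sum>\<beta>\<in>I. scl Cp (?c \<beta>) \<beta>))"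
      using insert.prems by (intro P.is_mor_sum[OF m] P.is_mor_scl P.S_mor[OF m]) blast
    have "I \<subseteq> P.S m" using insert.prems by simp
    from null_closed(2)[OF null_closed(2)[OF add[OF P.is_mor_scl[OF i, of "?c x"] j] scl[OF i, of "?c x"]] insert.IH[OF this]]
    show ?case unfolding sum.insert[OF insert.hyps(1,2)] by (simp add: algebra_simps del: Cp_simps(3))
  qed
  have "clin (\<lambda>x. word (p @ x @ q)) (P.lx m) = (\<Sum>\<beta>\<in>P.S m. csc (?c \<beta>) (?W \<beta>))"
    unfolding P.lx_eq by (simp add: clin_sum)
  moreover have "with_elt m (\<Sum>\<beta>\<in>P.S m. scl Cp (?c \<beta>) \<beta>) = m"
    by (simp only: P.elt_eq[OF m, symmetric] with_elt_simps(6))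
  ultimately show ?thesis using I[OF subset_refl] by (simp only:)
qed

lemma expand_null:
  "cyc_word Cp (p @ w) \<Longrightarrow> word (p @ w) - clin (\<lambda>u. word (p @ u)) (expand Cp (basis_plus B) w) \<in> null_chains C"
proof (induction w arbitrary: p)
  case Nil
  then show ?case by (simp add: null_closed)
next
  case (Cons m w)
  have m: "is_mor Cp m" using Cons.prems by (simp add: cyc_word_def is_path_def)
  let ?E = "expand Cp (basis_plus B) w"
  have "clin (\<lambda>u. word (p @ u)) (expand Cp (basis_plus B) (m # w)) =
    (clin (\<lambda>x. clin (\<lambda>u. word ((p @ x) @ u)) ?E) (P.lx m) :: ('k, 'o, 'y, 'a \<times> 'k) chain)"
    unfolding P.expand_Cons[of m w] by (subst mult_conv_clin) (simp add: clin_clin plus_list_def)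
  moreover have "clin (\<lambda>x. word ((p @ x) @ w) - clin (\<lambda>u. word ((p @ x) @ u)) ?E) (P.lx m) \<in> null_chains C"
  proof (rule null_clin)
    fix u assume "u \<in> Poly_Mapping.keys (P.lx m)"
    then obtain \<beta> where u: "u = [with_elt m \<beta>]" "\<beta> \<in> P.S m"
      by (auto simp: in_keys_iff P.lookup_lx split: if_splits)
    show "word ((p @ u) @ w) - clin (\<lambda>v. word ((p @ u) @ v)) ?E \<in> null_chains C"
      using cyc_with_elt[OF Cons.prems P.S_mor[OF m u(2)]] by (intro Cons.IH) (simp add: u)
  qed
  ultimately show ?case
    using null_closed(2)[OF slot_null[OF Cons.prems]] unfolding clin_diff_fun by fastforce
qed

lemma word_RR:
  assumes c: "cyc_word Cp u" and b: "\<forall>m\<in>set u. bp m"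
  shows "word u - clin RR (ap Q0 u) \<in> null_chains C"
proof -
  obtain a w where u: "u = a # w" using c by (cases u) (auto simp: cyc_word_def)
  have deg: "word x \<in> null_chains C" if "x \<in> degenerate_words C" for x
    unfolding null_chains_def by (rule chain.span_base) (use that in simp)
  show ?thesis
  proof (cases "\<exists>m\<in>set w. uq [m] = 0")
    case True
    then obtain m where m: "m \<in> set w" "uq [m] = 0" by blast
    from split_list[OF m(1)] m(2) obtain p q where w: "w = p @ m # q" "uq [m] = 0" by blast
    have "bp m" using b u w by simp
    then have "m = e_plus (src m)" by (rule bp_cases) (use w(2) word_nz in metis)+
    then have "u ! Suc (length p) = e_plus (src m)" by (simp add: u w(1))
    moreover have "Suc (length p) < length u" by (simp add: u w(1))
    ultimately have "u \<in> degenerate_words C" using c unfolding degenerate_words_def by blast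
    then show ?thesis using Q0_Cons_mid[of a p m q] w u deg by simp
  next
    case False
    then have w: "uq w = word (map Plain (map drop_e w))" "map emb (map drop_e w) = w" using b u uq_bp[of w] by auto
    have "bp a" using b u by simp
    then show ?thesis
    proof (rule bp_cases)
      assume a: "a = emb (drop_e a)" "hq a = word [Marked (drop_e a)]"
      have "ap Q0 u = word (Marked (drop_e a) # map Plain (map drop_e w))"
        unfolding u ap_Q0 w(1) a(2) word_append[symmetric] by simp
      then have "clin RR (ap Q0 u) = RR (Marked (drop_e a) # map Plain (map drop_e w))"
        by (simp only: clin_single csc_simps)
      also have "\<dots> = word (emb (drop_e a) # map emb (map drop_e w))" by (rule RR_simps(2))
      also have "\<dots> = word u" by (simp only: w(2) u a(1)[symmetric])
      finally have "clin RR (ap Q0 u) = word u" .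
      then show ?thesis by (simp add: null_closed)
    next
      assume a: "a = e_plus (src a)" "hq a = word [Unit]" "src a \<in> Obj C" "tgt a = src a"
      have Q: "ap Q0 u = word (Unit # map Plain (map drop_e w))"
        unfolding u ap_Q0 w(1) a(2) word_append[symmetric] by simp
      show ?thesis
      proof (cases "w = []")
        case True
        have "u \<in> degenerate_words C" using True a(1,3) u unfolding degenerate_words_def by blast
        then show ?thesis using deg Q True by (simp add: RR_simps)
      next
        case False
        have "src (hd w) = src a" using c False a(4) by (simp add: u cyc_word_def is_path_Cons)
        then have "e_plus (src (hd (map drop_e w))) = a" using a(1) False by (simp add: hd_map)
        moreover have "(RR (Unit # map Plain (map drop_e w)) :: ('k, 'o, 'y, 'a \<times> 'k) chain) = word (e_plus (src (hd (map drop_e w))) # map emb (map drop_e w))"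
          by (rule RR_simps(3)) (use False in simp)
        ultimately have "clin RR (ap Q0 u) = word u"
          unfolding Q by (simp only: clin_single csc_simps w(2) u)
        then show ?thesis by (simp add: null_closed)
      qed
    qed
  qed
qed

lemma cyc_lab:
  assumes "cyc_word Cp w" "map lab u = map lab w" "\<forall>m\<in>set u. is_mor Cp m"
  shows "cyc_word Cp u"
proof -
  have p: "is_path Cp w" using assms(1) by (simp add: cyc_word_def)
  then have "w \<noteq> []" by auto
  then show ?thesis using P.lab_path[OF p assms(2,3)] lab_hd_last[OF assms(2)] assms(1) by (simp add: cyc_word_def)
qed

text \<open>Modulo null chains every word may be expanded into basis letters. On such words
  \<open>RR\<close> recovers the word from its image, unless an e^+ has been lost, and then the word
  is degenerate.\<close>

lemma Q0_RR:
  assumes "\<And>w. w \<in> Poly_Mapping.keys x \<Longrightarrow> cyc_word Cp w"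
  shows "x - clin RR (clin (ap Q0) x) \<in> null_chains C"
proof -
  have "word w - clin RR (ap Q0 w) \<in> null_chains C" if "w \<in> Poly_Mapping.keys x" for w
  proof -
    have c: "cyc_word Cp w" using assms that .
    then have mors: "\<forall>m\<in>set w. is_mor Cp m" by (simp add: cyc_word_def is_path_def)
    let ?E = "expand Cp (basis_plus B) w"
    have 1: "word w - ?E \<in> null_chains C" using expand_null[of "[]" w] c by simp
    have "clin (\<lambda>u. word u - clin RR (ap Q0 u)) ?E \<in> null_chains C"
      using keys_expand_bp[OF mors] cyc_lab[OF c] by (intro null_clin word_RR) (auto simp: bp_def)
    then have "?E - clin RR (ap Q0 w) \<in> null_chains C"
      using Q0_expand[OF mors, of "[]"] by (simp add: clin_diff_fun clin_clin[symmetric])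
    from null_closed(2)[OF 1 this] show ?thesis by simp
  qed
  then have "clin (\<lambda>w. word w - clin RR (ap Q0 w)) x \<in> null_chains C" by (rule null_clin)
  then show ?thesis by (simp add: clin_diff_fun clin_clin)
qed

lemma null_imp_nul: 
  assumes "x \<in> null_chains C"
  shows "nul (clin (ap Q0) x)"
  using assms unfolding null_chains_def
proof (rule chain.span_induct)
  show "chain.subspace {x. nul (clin (ap Q0) x)}"
    by (rule chain.subspaceI) (auto simp: nul_closed clin_add clin_csc)
  fix x assume "x \<in> tensor_relations Cp \<union> word ` degenerate_words C"
  then consider "x \<in> tensor_relations Cp" | w where "x = word w" "w \<in> degenerate_words C" by blast
  then show "nul (clin (ap Q0) x)"
  proof cases
    case 1
    have mid: "is_mor Cp m" if "cyc_word Cp (p @ m # q)" for p m q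
      using that by (simp add: cyc_word_def is_path_def)
    from 1 consider p m q a b where "x = word (p @ with_elt (m :: ('o, 'y, 'a \<times> 'k) mor) (a + b) # q) - word (p @ with_elt m a # q) - word (p @ with_elt m b # q)"
        "cyc_word Cp (p @ with_elt m a # q)" "cyc_word Cp (p @ with_elt m b # q)"
      | p m q a c where "x = word (p @ with_elt (m :: ('o, 'y, 'a \<times> 'k) mor) (scl Cp c a) # q) - csc c (word (p @ with_elt m a # q))"
        "cyc_word Cp (p @ with_elt m a # q)"
      unfolding tensor_relations_def by blast
    then have "clin (ap Q0) x = 0"
    proof cases
      case (1 p m q a b)
      show ?thesis unfolding 1(1) clin_diff clin_single csc_simps Q0_lin(1)[OF mid[OF 1(2)] mid[OF 1(3)]] by simp
    next
      case (2 p m q a c)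
      show ?thesis unfolding 2(1) clin_diff clin_csc clin_single csc_simps Q0_lin(2)[OF mid[OF 2(2)]] by simp
    qed
    then show ?thesis by (simp add: nul_closed)
  next
    case (2 w)
    show ?thesis
    proof (cases "\<exists>i X. 0 < i \<and> i < length w \<and> w ! i = e_plus X")
      case True
      then obtain i X where i: "0 < i" "i < length w" "w ! i = e_plus X" by blast
      then obtain a v where w: "w = a # v" "i - 1 < length v" by (cases w) auto
      have v: "v = take (i - 1) v @ e_plus X # drop i v"
        using id_take_nth_drop[OF w(2)] i w(1) by (simp add: nth_Cons')
      have "drop_e (e_plus X :: ('o, 'y, 'a \<times> 'k) mor) = with_elt (drop_e (e_plus X :: ('o, 'y, 'a \<times> 'k) mor)) 0"
        by (simp add: e_plus_def drop_e_def with_elt_def)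
      then have "lx (drop_e (e_plus X :: ('o, 'y, 'a \<times> 'k) mor)) = 0" by (metis lx_0)
      then have "uq [e_plus X] = 0" by (simp add: uq_1)
      then have "ap Q0 (a # take (i - 1) v @ e_plus X # drop i v) = 0" unfolding Q0_Cons_mid by simp
      then have "ap Q0 w = 0" using v w(1) by simp
      then show ?thesis using 2 by (simp add: nul_closed)
    next
      case False
      then obtain X where "w = [e_plus X]" using 2 by (auto simp: degenerate_words_def)
      then show ?thesis using 2 by (simp add: ap_Q0 hq_e_plus nul_def)
    qed
  qed
qed

text \<open>The test by which identities modulo null chains are reduced to identities of marked
  words.\<close>

lemma null_iff:
  assumes "\<And>w. w \<in> Poly_Mapping.keys x \<Longrightarrow> cyc_word Cp w"
  shows "x \<in> null_chains C \<longleftrightarrow> nul (clin (ap Q0) x)"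
  using null_imp_nul Q0_RR[OF assms] nul_RR[of "clin (ap Q0) x"] by fastforce

section \<open>Composability and degrees of the values of the chain operators\<close>

lemma fc_b:
  assumes w: "cyc_word Cp w"
  shows "hochschild_b Cp w \<in> formal_chains Cp (rdeg w + deg_of_int 1 + deg_of_int 1)"
proof -
  have op: "word (take j z @ muP (slice j k z) # drop k z) \<in> formal_chains Cp (rdeg z + deg_of_int 1 + deg_of_int 1)"
    if "cyc_word Cp z" "j < k" "k \<le> length z" for j k z
  proof -
    have "is_mor Cp (muP (slice j k z))"
      using that by (intro mu_mor_e(1) path_slice) (auto simp: cyc_word_def)
    from cyc_op[OF that this] show ?thesis by (intro fc_word) simp_all
  qed
  show ?thesis
    unfolding hochschild_b_def
  proof (intro fc_closed(2) fc_sum fc_closed(4))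
    fix j assume "j \<in> {..<length w}"
    then show "overbrace 0 j (\<lambda>w. word (muP (take (Suc j) w) # drop (Suc j) w)) w \<in> formal_chains Cp (rdeg w + deg_of_int 1 + deg_of_int 1)"
    proof (intro fc_overbrace[OF w])
      fix z assume z: "cyc_word Cp z" "length z = length w" "rdeg z = rdeg w" and j: "j \<in> {..<length w}"
      show "word (muP (take (Suc j) z) # drop (Suc j) z) \<in> formal_chains Cp (rdeg w + deg_of_int 1 + deg_of_int 1)"
        using op[OF z(1), of 0 "Suc j"] z j by (simp add: slice_def)
    qed simp
  qed (use op[OF w] in auto)
qed

lemma e_plus_cyc:
  assumes "cyc_word Cp z"
  shows "cyc_word Cp (e_plus (src (hd z)) # z)" "rdeg (e_plus (src (hd z)) # z) = rdeg z - deg_of_int 1"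
proof -
  have z: "is_path Cp z" "z \<noteq> []" "src (hd z) \<in> Obj C" 
    using assms by (cases z; auto simp: cyc_word_def is_path_Cons is_mor_def)+
  have "is_mor Cp (e_plus (src (hd z)))"
    using z(3) V.subspace_0[OF Hom[OF z(3) z(3)]] by (simp add: is_mor_def e_plus_def)
  then show "cyc_word Cp (e_plus (src (hd z)) # z)"
    using assms z by (auto simp: cyc_word_def is_path_Cons e_plus_def)
  show "rdeg (e_plus (src (hd z)) # z) = rdeg z - deg_of_int 1"
    by (simp add: e_plus_def)
qed

lemma fc_B:
  assumes w: "cyc_word Cp w"
  shows "connes_B w \<in> formal_chains Cp (rdeg w)"
proof -
  have "w \<noteq> []" using w by (auto simp: cyc_word_def)
  then show ?thesis unfolding connes_B_def
  proof (intro fc_overbrace[OF w])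
    fix z assume z: "cyc_word Cp z" "rdeg z = rdeg w"
    show "word (e_plus (src (hd z)) # z) \<in> formal_chains Cp (rdeg w)"
      by (rule fc_word[OF e_plus_cyc(1)[OF z(1)]]) (simp only: e_plus_cyc(2)[OF z(1)] z(2) diff_add_cancel)
  qed simp
qed

lemma fc_act:
  assumes v: "der v" and x: "x \<in> formal_chains Cp y"
  shows "act_coeffs Cp (basis_plus B) v x \<in> formal_chains Cp y"
proof -
  have "clin (expand Cp (basis_plus B)) x \<in> formal_chains Cp y"
  proof (rule fc_clin[OF x])
    fix w assume w: "cyc_word Cp w" "rdeg w + deg_of_int 1 = y"
    then have mors: "\<forall>m\<in>set w. is_mor Cp m" by (simp add: cyc_word_def is_path_def)
    show "expand Cp (basis_plus B) w \<in> formal_chains Cp y"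
      unfolding formal_chains_def
    proof (intro CollectI ballI)
      fix u assume u: "u \<in> Poly_Mapping.keys (expand Cp (basis_plus B) w)"
      note l = keys_expand_bp(1)[OF mors u]
      have "\<forall>m\<in>set u. is_mor Cp m" using keys_expand_bp(2)[OF mors u] unfolding bp_def by blast
      from cyc_lab[OF w(1) l this] show "cyc_word Cp u \<and> rdeg u + deg_of_int 1 = y"
        unfolding lab_rdeg[OF l] w(2) by blast
    qed
  qed
  moreover have "Poly_Mapping.keys (mapv v (clin (expand Cp (basis_plus B)) x)) \<subseteq> Poly_Mapping.keys (clin (expand Cp (basis_plus B)) x)"
    by (rule keys_mapv[OF v])
  ultimately show ?thesis unfolding act_coeffs_def formal_chains_def mem_Collect_eq by (meson subsetD)
qed

context
  fixes v :: "'k \<Rightarrow> 'k"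
  assumes v: "der v"
begin

lemma cyc_v:
  assumes z: "cyc_word Cp z" "j < l" "l \<le> length z"
  shows "cyc_word Cp (take j z @ vP v (slice j l z) # drop l z)" "rdeg (take j z @ vP v (slice j l z) # drop l z) = rdeg z + deg_of_int 1"
proof -
  have "is_mor Cp (vP v (slice j l z))"
    using z by (intro vP(2)[OF v] path_slice) (auto simp: cyc_word_def)
  from cyc_op[OF z this] show "cyc_word Cp (take j z @ vP v (slice j l z) # drop l z)" "rdeg (take j z @ vP v (slice j l z) # drop l z) = rdeg z + deg_of_int 1"
    by simp_all
qed

lemma fc_b11:
  assumes w: "cyc_word Cp w"
  shows "b11 Cp (v_mu_plus C B v) (deg_of_int 1) w \<in> formal_chains Cp (rdeg w + deg_of_int 1 + deg_of_int 1 + deg_of_int 1)"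
  unfolding b11_def
proof (intro fc_sum fc_overbrace[OF w] fc_closed(4))
  fix j l k z assume jlk: "j \<in> {..<length w}" "l \<in> {j<..<length w}" "k \<in> {l<..length w}"
    and z: "cyc_word Cp z" "length z = length w" "rdeg z = rdeg w"
  \<comment> \<open>b^{1|1} is obtained in two steps: first v(mu) is inserted, then the outer
    operation takes a prefix of the new word, made of \<open>j\<close> letters, the inserted one and
    \<open>k - l\<close> more.\<close>
  let ?y = "take j z @ vP v (slice j l z) # drop l z" and ?k = "k - l + Suc j"
  have y: "cyc_word Cp ?y" "rdeg ?y = rdeg z + deg_of_int 1" using cyc_v[of z j l] z jlk by auto
  have k: "0 < ?k" "?k \<le> length ?y" using jlk z by auto
  have lj: "length (take j z) = j" using jlk z by simp
  have "drop (Suc (k - l - 1 + Suc j)) ?y = drop (Suc (k - l - 1)) (drop l z)" by (rule insert_nth(3)[OF lj])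
  moreover have "Suc (k - l - 1) = k - l" "Suc (k - l - 1 + Suc j) = ?k" "k - l + l = k" using jlk by auto
  ultimately have "drop ?k ?y = drop k z" by (simp only: drop_drop)
  moreover have "take ?k ?y = take j z @ vP v (slice j l z) # slice l k z"
    unfolding insert_nth(1)[OF lj] by (simp add: slice_def drop_take)
  ultimately have t: "slice 0 ?k ?y = take j z @ vP v (slice j l z) # slice l k z" "drop ?k ?y = drop k z" "take 0 ?y = []"
    by (simp_all add: slice_def[of 0])
  have "is_mor Cp (muP (slice 0 ?k ?y))"
    using y k by (intro mu_mor_e(1) path_slice) (auto simp: cyc_word_def)
  from cyc_op[OF y(1) k this] show "word (muP (take j z @ vP v (slice j l z) # slice l k z) # drop k z)
      \<in> formal_chains Cp (rdeg w + deg_of_int 1 + deg_of_int 1 + deg_of_int 1)"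
    unfolding t using y(2) z(3) by (intro fc_word) (simp_all only: append_Nil)
qed auto

lemma fc_B11:
  assumes w: "cyc_word Cp w"
  shows "B11 (v_mu_plus C B v) (deg_of_int 1) w \<in> formal_chains Cp (rdeg w + deg_of_int 1)"
  unfolding B11_def
proof (intro fc_sum fc_overbrace[OF w] fc_closed(4))
  fix j l z assume jl: "j \<in> {..<length w}" "l \<in> {j<..<length w}"
    and z: "cyc_word Cp z" "length z = length w" "rdeg z = rdeg w"
  let ?y = "take j z @ vP v (slice j l z) # drop l z"
  have y: "cyc_word Cp ?y" "rdeg ?y = rdeg z + deg_of_int 1" using cyc_v[of z j l] z jl by auto
  have "src (hd ?y) = src (hd z)"
  proof (cases "j = 0")
    case True
    then show ?thesis using jl by (simp add: slice_def)
  next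
    case False
    then show ?thesis using jl z by (cases z; cases j) auto
  qed
  then show "word (e_plus (src (hd z)) # ?y) \<in> formal_chains Cp (rdeg w + deg_of_int 1)"
    using e_plus_cyc[OF y(1)] y(2) z(3) by (intro fc_word) simp_all
qed auto

end

end

lemma (in ainf_functor_based) fc_F:
  assumes w: "cyc_word C.Cp w"
  shows "induced_chain_map id (F_plus F) w \<in> formal_chains D.Cp (rdeg w + deg_of_int 1)"
  unfolding induced_chain_map_def
proof (intro fc_sum fc_overbrace[OF w])
  fix p z ls assume p: "p \<in> {1..length w}" and z: "cyc_word C.Cp z" "length z = length w" "rdeg z = rdeg w"
    and ls: "ls \<in> splittings (drop p z)"
  let ?L = "take p z # ls"
  have cc: "concat ?L = z" "[] \<notin> set ?L" using ls p z by (auto simp: splittings_def)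
  have path: "is_path C.Cp b" if bl: "b \<in> set ?L" for b
  proof -
    obtain x y where "?L = x @ b # y" using split_list[OF bl] by blast
    then have "concat ?L = concat (x @ b # y)" by (simp only:)
    then have "z = concat x @ b @ concat y" unfolding cc(1) by simp
    moreover have "b \<noteq> []" using bl cc(2) by auto
    ultimately show ?thesis using z(1) path_infix[of C.Cp "concat x" b "concat y"] by (simp add: cyc_word_def)
  qed
  have P: "is_path D.Cp (map FP ?L)"
    using path_blocks[of C.Cp D.Cp FP ?L, OF FP(1)] path cc(1) z(1) by (simp add: cyc_word_def)
  have "src (hd (map FP ?L)) = src (hd z)" "tgt (last (map FP ?L)) = tgt (last z)"
  proof -
    show "src (hd (map FP ?L)) = src (hd z)" using p z by (cases z) (auto simp: take_Cons')
    have "?L = butlast ?L @ [last ?L]" by simp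
    then obtain L' b where L: "?L = L' @ [b]" by blast
    have "b \<in> set ?L" unfolding L by simp
    then have b: "b \<noteq> []" using cc(2) by blast
    have "z = concat L' @ b" using arg_cong[OF L, of concat] unfolding cc(1) by simp
    then have "last z = last b" using b by simp
    then show "tgt (last (map FP ?L)) = tgt (last z)" unfolding L by simp
  qed
  then have "cyc_word D.Cp (map FP ?L)" using P z(1) by (simp add: cyc_word_def)
  moreover have "rdeg (map FP ?L) = rdeg w" unfolding rdeg_concat cc(1) by (rule z(3))
  ultimately show "word (FP (take p z) # map FP ls) \<in> formal_chains D.Cp (rdeg w + deg_of_int 1)"
    by (intro fc_word) simp_all
qed auto

section \<open>Typed operations\<close>

text \<open>The ring identities hold for operators on arbitrary words and track only parity. To lift
  the homotopy to chains, the ends and the full degree must be followed as well; this predicate says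
  that \<open>T\<close> keeps the ends and shifts the degree by \<open>s\<close>.\<close>

definition typed :: "('l list \<Rightarrow> 'o \<Rightarrow> 'o \<Rightarrow> 'y \<Rightarrow> bool) \<Rightarrow> ('m list \<Rightarrow> 'o \<Rightarrow> 'o \<Rightarrow> 'y \<Rightarrow> bool) \<Rightarrow>
    'y::grading_datum \<Rightarrow> ('l, 'm list, 'k::field) wop \<Rightarrow> bool"
  where "typed P Q s T \<longleftrightarrow> (\<forall>w X Y r. \<forall>u\<in>Poly_Mapping.keys (ap T w). P w X Y r \<longrightarrow> Q u X Y (r + s))"

text \<open>Compatibility with concatenation, which lets typings of two operators be
  multiplied.\<close>

definition good :: "('l list \<Rightarrow> 'o \<Rightarrow> 'o \<Rightarrow> 'y::grading_datum \<Rightarrow> bool) \<Rightarrow> bool"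
  where "good P \<longleftrightarrow> (\<forall>X Y r. P [] X Y r \<longleftrightarrow> X = Y \<and> r = 0) \<and>
    (\<forall>u v X Z r. P (u @ v) X Z r \<longleftrightarrow> (\<exists>Y s t. P u X Y s \<and> P v Y Z t \<and> r = s + t))"

lemma typD: "typed P Q s T \<Longrightarrow> P w X Y r \<Longrightarrow> u \<in> Poly_Mapping.keys (ap T w) \<Longrightarrow> Q u X Y (r + s)"
  unfolding typed_def by blast

lemma typI: "(\<And>w X Y r u. P w X Y r \<Longrightarrow> u \<in> Poly_Mapping.keys (ap T w) \<Longrightarrow> Q u X Y (r + s)) \<Longrightarrow> typed P Q s T"
  unfolding typed_def by blast

lemma good_append:
  assumes "good P"
  shows "P (u @ v) X Z r \<longleftrightarrow> (\<exists>Y s t. P u X Y s \<and> P v Y Z t \<and> r = s + t)"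
  by (rule conjunct2[OF assms[unfolded good_def], rule_format])

lemma good_Nil:
  assumes "good P"
  shows "P [] X Y r \<longleftrightarrow> X = Y \<and> r = 0"
  by (rule conjunct1[OF assms[unfolded good_def], rule_format])

lemma typ_deg: "typed P Q s T \<Longrightarrow> s = t \<Longrightarrow> typed P Q t T"
  by simp

lemma typ_times:
  assumes "good P" "good Q" "typed P Q s X" "typed P Q t Y"
  shows "typed P Q (s + t) (X * Y)"
proof (rule typI)
  fix w A Z r u assume w: "P w A Z r" and "u \<in> Poly_Mapping.keys (ap (X * Y) w)"
  then obtain i a b where u: "u = a @ b" "a \<in> Poly_Mapping.keys (ap X (take i w))" "b \<in> Poly_Mapping.keys (ap Y (drop i w))"
    using keys_ap_times[of u X Y w] by (auto simp: plus_list_def)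
  have "P (take i w @ drop i w) A Z r" using w by simp
  then obtain M p q where m: "P (take i w) A M p" "P (drop i w) M Z q" "r = p + q"
    unfolding good_append[OF assms(1)] by blast
  have "Q a A M (p + s)" "Q b M Z (q + t)"
    using typD[OF assms(3) m(1) u(2)] typD[OF assms(4) m(2) u(3)] by auto
  then have "Q (a @ b) A Z ((p + s) + (q + t))" unfolding good_append[OF assms(2)] by blast
  then show "Q u A Z (r + (s + t))" unfolding u(1) m(3) by (simp add: ac_simps)
qed

lemma typ_comp:
  assumes "typed P Q s Y" "typed Q R t X"
  shows "typed P R (s + t) (X \<odot> Y)"
proof (rule typI)
  fix w A Z r u assume w: "P w A Z r" and "u \<in> Poly_Mapping.keys (ap (X \<odot> Y) w)"
  from keys_ap_comp[OF this(2)] obtain v where v: "v \<in> Poly_Mapping.keys (ap Y w)" "u \<in> Poly_Mapping.keys (ap X v)" by blast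
  from typD[OF assms(2) typD[OF assms(1) w v(1)] v(2)] show "R u A Z (r + (s + t))" by (simp add: ac_simps)
qed

lemma typ_add: "typed P Q s X \<Longrightarrow> typed P Q s Y \<Longrightarrow> typed P Q s (X + Y)"
  by (rule typI) (auto dest!: subsetD[OF keys_add] dest: typD)

lemma typ_diff: "typed P Q s X \<Longrightarrow> typed P Q s Y \<Longrightarrow> typed P Q s (X - Y)"
  by (rule typI) (auto dest!: subsetD[OF keys_diff] dest: typD)

lemma typ_one: "good P \<Longrightarrow> good Q \<Longrightarrow> typed P Q 0 1"
  by (rule typI) (auto simp: ap_one zero_list_def good_Nil split: if_splits)

lemma typ_sg: "typed P P 0 (sg p)"
  by (rule typI) (auto split: if_splits)

lemma typ_geo:
  fixes f :: "('l, 'm list, 'k::field) wop"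
  assumes g: "good P" "good Q" and f: "ap f [] = 0" "typed P Q 0 f"
  shows "typed P Q 0 (geo f)"
proof (rule typI)
  fix w X Y r u assume "P w X Y r" "u \<in> Poly_Mapping.keys (ap (geo f) w)"
  then have "Q u X Y r"
  proof (induction "length w" arbitrary: w X r u rule: less_induct)
    case less
    have "u \<in> Poly_Mapping.keys (ap (1 + f * geo f) w)" using less.prems(2) geo_rec[OF f(1)] by simp
    then consider "u \<in> Poly_Mapping.keys (ap (1 :: ('l, 'm list, 'k) wop) w)" | "u \<in> Poly_Mapping.keys (ap (f * geo f) w)"
      using subsetD[OF keys_add] by (force simp del: ap_times_Nil)
    then show ?case
    proof cases
      case 1
      from typD[OF typ_one[OF g] less.prems(1) this] show ?thesis by simp
    next
      case 2
      then obtain i a b where u: "u = a @ b" "a \<in> Poly_Mapping.keys (ap f (take i w))" "b \<in> Poly_Mapping.keys (ap (geo f) (drop i w))"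
        using keys_ap_times[of u f "geo f" w] by (auto simp: plus_list_def)
      have "take i w \<noteq> []" using u(2) f(1) by (metis empty_iff keys_zero)
      then have l: "length (drop i w) < length w" by (cases w) auto
      have "P (take i w @ drop i w) X Y r" using less.prems(1) by simp
      then obtain M p q where m: "P (take i w) X M p" "P (drop i w) M Y q" "r = p + q"
        unfolding good_append[OF g(1)] by blast
      have "Q a X M p" using typD[OF f(2) m(1) u(2)] by simp
      moreover have "Q b M Y q" by (rule less.hyps[OF l m(2) u(3)])
      ultimately show ?thesis unfolding u(1) m(3) good_append[OF g(2)] by blast
    qed
  qed
  then show "Q u X Y (r + 0)" by simp
qed

lemma typ_on_letter:
  "(\<And>a X Y r u. P [a] X Y r \<Longrightarrow> u \<in> Poly_Mapping.keys (\<phi> a) \<Longrightarrow> Q u X Y (r + s)) \<Longrightarrow> typed P Q s (on_letter \<phi>)"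
  by (rule typI) (auto simp: on_letter_def length_Suc_conv split: if_splits)

lemma typ_opv: "der v \<Longrightarrow> typed P Q s T \<Longrightarrow> typed P Q s (opv v T)"
  by (rule typI) (auto dest!: subsetD[OF keys_mapv] dest: typD)

text \<open>\<open>Unit\<close> is transparent here, as it may stand at any object; in
  \<open>ldeg\<close> it counts with reduced degree -1.\<close>

fun ch :: "(('o, 'y, 'a) mor \<Rightarrow> bool) \<Rightarrow> ('o, 'y, 'a) mor lt list \<Rightarrow> 'o \<Rightarrow> 'o \<Rightarrow> bool" where
  "ch b [] X Y \<longleftrightarrow> X = Y"
| "ch b (Plain x # w) X Y \<longleftrightarrow> b x \<and> src x = X \<and> ch b w (tgt x) Y"
| "ch b (Marked x # w) X Y \<longleftrightarrow> b x \<and> src x = X \<and> ch b w (tgt x) Y"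
| "ch b (Unit # w) X Y \<longleftrightarrow> ch b w X Y"

fun ldeg :: "('o, 'y::grading_datum, 'a) mor lt list \<Rightarrow> 'y" where
  "ldeg [] = 0"
| "ldeg (Plain x # w) = deg x - deg_of_int 1 + ldeg w"
| "ldeg (Marked x # w) = deg x - deg_of_int 1 + ldeg w"
| "ldeg (Unit # w) = - deg_of_int 1 + ldeg w"

definition tw where "tw b w X Y r \<longleftrightarrow> ch b w X Y \<and> r = ldeg w"
definition pw where "pw b w X Y r \<longleftrightarrow> tw b (map Plain w) X Y r"

lemma ch_append: "ch b (u @ v) X Z \<longleftrightarrow> (\<exists>Y. ch b u X Y \<and> ch b v Y Z)"
  by (induction b u X Z rule: ch.induct) auto

lemma ldeg_append: "ldeg (u @ v) = ldeg u + ldeg v"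
  by (induction u rule: ldeg.induct) (simp_all add: ac_simps)

lemma good_tw [simp]: "good (tw b)"
  by (auto simp: good_def tw_def ch_append ldeg_append)

lemma good_pw [simp]: "good (pw b)"
  by (auto simp: good_def pw_def tw_def ch_append ldeg_append)

lemma ldeg_Plain: "ldeg (map Plain w) = rdeg w"
  by (induction w) simp_all

lemma ch_Plain: "w \<noteq> [] \<Longrightarrow> ch b (map Plain w) X Y \<longleftrightarrow> (\<forall>m\<in>set w. b m) \<and>
   successively (\<lambda>m n. tgt m = src n) w \<and> src (hd w) = X \<and> tgt (last w) = Y"
proof (induction w arbitrary: X)
  case (Cons m w)
  show ?case
  proof (cases "w = []")
    case False
    then show ?thesis using Cons.IH[OF False, of "tgt m"] by (auto simp: successively_Cons)
  qed simp
qed simp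

lemma typ_atoms: "typed (tw b) (pw b) 0 su" "typed (tw b) (pw b) 0 sm" "typed (pw b) (tw b) 0 iu" "typed (pw b) (tw b) 0 Mt"
  "typed (tw b) (tw b') (deg_of_int 1) Es"
  unfolding su_def sm_def iu_def Mt_def Es_def
  by (rule typ_on_letter; auto simp: tw_def pw_def zero_list_def split: lt.splits)+

lemma typ_et: "good P \<Longrightarrow> typed P (tw b) (- deg_of_int 1) et"
  by (rule typI) (auto simp: ap_et_if good_Nil tw_def split: if_splits)

lemma typ_st: "typed (tw b) (pw b) 0 stu" "typed (tw b) (pw b) 0 stm" "typed (pw b) (tw b) 0 ut"
proof -
  show s: "typed (tw b) (pw b) 0 stu" unfolding stu_def by (rule typ_geo) (simp_all add: typ_atoms)
  show "typed (pw b) (tw b) 0 ut" unfolding ut_def by (rule typ_geo) (simp_all add: typ_atoms)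
  show "typed (tw b) (pw b) 0 stm"
    unfolding stm_def using typ_times[OF _ _ typ_times[OF _ _ s typ_atoms(2)] s] by simp
qed

lemma typ_muu: "typed (pw b) (pw b') s g \<Longrightarrow> typed (tw b) (tw b') s (muu g)"
  unfolding muu_def by (rule typ_deg[OF typ_comp[OF typ_comp[OF typ_st(1)] typ_st(3)]]) simp_all

lemma typ_Fu: "typed (pw b) (pw b') 0 f \<Longrightarrow> ap f [] = 0 \<Longrightarrow> typed (tw b) (tw b') 0 (Fu f)"
  using typ_muu[OF typ_geo[OF good_pw good_pw], of f b b'] unfolding muu_def Fu_def by blast

lemma typ_Es_et: "typed (tw b) (tw b') 0 (Es * et)"
  by (rule typ_deg[OF typ_times[OF _ _ typ_atoms(5) typ_et]]) simp_all

lemma typ_Mst: "typed (pw b) (pw b') s f \<Longrightarrow> typed (tw b) (tw b') s (Mt \<odot> f \<odot> stm)"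
  using typ_comp[OF typ_comp[OF typ_st(2)] typ_atoms(4), of b b' s f] by (simp add: comp_assoc)

lemma typ_fm: "typed (pw b) (pw b') 0 f \<Longrightarrow> typed (tw b) (tw b') 0 (fm f)"
  unfolding fm_def by (intro typ_add typ_Mst typ_Es_et)

lemma typ_Fm: "typed (pw b) (pw b') 0 f \<Longrightarrow> ap f [] = 0 \<Longrightarrow> typed (tw b) (tw b') 0 (Fm f)"
proof -
  assume f: "typed (pw b) (pw b') 0 f" "ap f [] = 0"
  show ?thesis unfolding Fm_def
    by (rule typ_deg[OF typ_times[OF good_tw good_tw typ_times[OF good_tw good_tw typ_Fu[OF f] typ_fm[OF f(1)]] typ_Fu[OF f]]]) simp
qed

lemma typ_mm: "typed (pw b) (pw b) (deg_of_int 1) m \<Longrightarrow> typed (tw b) (tw b) (deg_of_int 1) (mm m)"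
proof -
  assume m: "typed (pw b) (pw b) (deg_of_int 1) m"
  have i: "typed (tw b) (tw b) 0 iot" unfolding iot_def using typ_comp[OF typ_st(1) typ_atoms(4)] by simp
  have "typed (tw b) (tw b) 0 (iot \<odot> sg 1)" using typ_comp[OF typ_sg i] by simp
  from typ_times[OF good_tw good_tw this typ_atoms(5)] typ_times[OF good_tw good_tw typ_atoms(5) i]
  show ?thesis unfolding mm_def using typ_Mst[OF m] by (intro typ_diff typ_add) simp_all
qed

lemma typ_Z13: 
  assumes "typed (pw b) (pw b') 0 f" "ap f [] = 0" "typed (pw b) (pw b') s g"
  shows "typed (tw b) (tw b') s (Z13 f p g)"
proof -
  have "typed (tw b) (tw b') 0 (Fu f \<odot> sg p)" using typ_comp[OF typ_sg typ_Fu[OF assms(1,2)]] by simp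
  from typ_times[OF good_tw good_tw typ_times[OF good_tw good_tw this typ_muu[OF assms(3)]] typ_Fm[OF assms(1,2)]]
  show ?thesis unfolding Z13_def by simp
qed

lemma typ_idl: "typed (pw b) (pw b) 0 idl"
  unfolding idl_def by (rule typ_on_letter) simp

lemma typ_pre: "typed (pw b) (tw b) (- deg_of_int 1) pre"
  unfolding pre_def using typ_times[OF good_pw good_tw typ_et[OF good_pw] typ_st(3)] by simp

text \<open>Rotation keeps a closed word closed but moves its base point, hence the existential
  conclusion.\<close>

lemma typ_NN:
  fixes T :: "(('o, 'y::grading_datum, 'a) mor lt, 'm list, 'k::field) wop"
  assumes T: "typed (tw b) Q s T" and w: "tw b w X X r" and u: "u \<in> Poly_Mapping.keys (ap (T \<odot> NN) w)"
  shows "\<exists>X'. Q u X' X' (r + s)"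
proof -
  from keys_ap_comp[OF u] obtain z where z: "z \<in> Poly_Mapping.keys (ap (NN :: (_, _, 'k) wop) w)" "u \<in> Poly_Mapping.keys (ap T z)" by blast
  from subsetD[OF keys_sum_subset z(1)[unfolded NN_def ap_Op]]
  obtain i where "z \<in> Poly_Mapping.keys (rotn i w :: _ \<Rightarrow>\<^sub>0 'k)" by blast
  then have zi: "z = drop (length w - i) w @ take (length w - i) w"
    by (auto simp: rotn_def mulrev_def split: if_splits)
  have "ch b (take (length w - i) w @ drop (length w - i) w) X X" "r = ldeg (take (length w - i) w @ drop (length w - i) w)"
    using w by (simp_all add: tw_def)
  then obtain Y where "ch b (take (length w - i) w) X Y" "ch b (drop (length w - i) w) Y X"
    "r = ldeg (drop (length w - i) w) + ldeg (take (length w - i) w)"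
    unfolding ch_append ldeg_append by (auto simp: add.commute)
  then have "tw b z Y Y r" unfolding zi tw_def ch_append ldeg_append by blast
  from typD[OF T this z(2)] show ?thesis by blast
qed

abbreviation nonplain :: "'l lt \<Rightarrow> bool" where "nonplain h \<equiv> h = Unit \<or> (\<exists>x. h = Marked x)"
text \<open>The distinguished letter stands in front: the shape in which chain operators leave their
  outputs and which \<open>RR\<close> accepts.\<close>

definition sh :: "'l lt list \<Rightarrow> bool" where "sh u \<longleftrightarrow> (\<exists>h w. u = h # map Plain w \<and> nonplain h)"
definition hl :: "('a, 'l lt list, 'k::field) wop \<Rightarrow> bool" where "hl T \<longleftrightarrow> (\<forall>w. \<forall>u\<in>Poly_Mapping.keys (ap T w). \<exists>h. u = [h] \<and> nonplain h)"
definition pl :: "('a, 'l lt list, 'k::field) wop \<Rightarrow> bool" where "pl T \<longleftrightarrow> (\<forall>w. \<forall>u\<in>Poly_Mapping.keys (ap T w). \<exists>v. u = map Plain v)"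

lemma sh_times: "hl P \<Longrightarrow> pl F \<Longrightarrow> u \<in> Poly_Mapping.keys (ap (P * F) w) \<Longrightarrow> sh u"
  by (drule keys_ap_times) (fastforce simp: hl_def pl_def sh_def plus_list_def)

lemma hl_comp: "hl X \<Longrightarrow> hl (X \<odot> Y)"
  by (auto simp: hl_def simp del: ap_comp dest!: keys_ap_comp)

lemma pl_comp: "pl X \<Longrightarrow> pl (X \<odot> Y)"
  by (auto simp: pl_def simp del: ap_comp dest!: keys_ap_comp)

lemma hl_add: "hl X \<Longrightarrow> hl Y \<Longrightarrow> hl (X + Y)" "hl X \<Longrightarrow> hl Y \<Longrightarrow> hl (X - Y)"
  unfolding hl_def by (auto dest!: subsetD[OF keys_add] subsetD[OF keys_diff])

lemma hl_atoms: "hl Mt" "hl et"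
  by (auto simp: hl_def Mt_def on_letter_def ap_et_if split: if_splits)

lemma keys_Es: "a \<in> Poly_Mapping.keys (ap Es w) \<Longrightarrow> a = []"
  by (auto simp: ap_Es zero_list_def split: if_splits)

lemma hl_Es: "hl X \<Longrightarrow> hl (Es * X)" "hl X \<Longrightarrow> hl (X * Es)"
  unfolding hl_def by (auto dest!: keys_ap_times keys_Es simp: plus_list_def)

lemma hl_ops: "hl (fm f)" "hl (mm m)" "pl (Fu f)" "pl ut"
proof -
  show u: "pl ut" by (auto simp: pl_def)
  then show "pl (Fu f)" unfolding Fu_def by (rule pl_comp)
  show "hl (fm f)" "hl (mm m)"
    unfolding fm_def mm_def iot_def comp_assoc by (intro hl_add hl_comp hl_Es hl_atoms)+
qed

definition valid where "valid b u r \<longleftrightarrow> sh u \<and> (\<exists>X. tw b u X X r)"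

lemma valid_NN:
  assumes "hl P" "pl F" "typed (tw b) (tw b') s (P * F)" "valid b w r" "u \<in> Poly_Mapping.keys (ap ((P * F) \<odot> NN) w)"
  shows "valid b' u (r + s)"
proof -
  from keys_ap_comp[OF assms(5)] have "sh u" using sh_times[OF assms(1,2)] by blast
  moreover from assms(4) obtain X where "tw b w X X r" unfolding valid_def by blast
  from typ_NN[OF assms(3) this assms(5)] have "\<exists>X. tw b' u X X (r + s)" .
  ultimately show ?thesis unfolding valid_def by blast
qed

lemma valid_ii:
  assumes "typed (pw b') (pw b') (deg_of_int 1) m" "typed (pw b) (pw b') 0 f" "ap f [] = 0" "typed (pw b) (pw b') s g"
    "valid b w r" "u \<in> Poly_Mapping.keys (ap (ii m f p g) w)"
  shows "valid b' u (r + (s + deg_of_int 1))"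
proof -
  have "typed (tw b) (tw b') (s + deg_of_int 1) ((mm m \<odot> Z13 f p g) * Fu f)"
    using typ_times[OF good_tw good_tw typ_comp[OF typ_Z13[OF assms(2-4)] typ_mm[OF assms(1)]] typ_Fu[OF assms(2,3)]] by simp
  from valid_NN[OF hl_comp[OF hl_ops(2)] hl_ops(3) this assms(5)] assms(6)
  show ?thesis by (simp add: ii_def ibar_def)
qed

lemma valid_hh:
  assumes "typed (pw b) (pw b') 0 f" "ap f [] = 0" "typed (pw b) (pw b) s \<phi>"
    "valid b w r" "u \<in> Poly_Mapping.keys (ap (hh f \<phi>) w)"
  shows "valid b' u (r + s)"
proof -
  have "ap idl [] = 0" by (simp add: idl_def)
  from typ_Z13[OF typ_idl this assms(3)] have Z: "typed (tw b) (tw b) s (Z13 idl 1 \<phi>)" .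
  have "typed (tw b) (tw b') s ((fm f \<odot> Z13 idl 1 \<phi>) * Fu f)"
    using typ_times[OF good_tw good_tw typ_comp[OF Z typ_fm[OF assms(1)]] typ_Fu[OF assms(1,2)]] by simp
  from valid_NN[OF hl_comp[OF hl_ops(1)] hl_ops(3) this assms(4)] assms(5)
  show ?thesis by (simp add: hh_def)
qed

lemma valid_SS:
  assumes "typed (pw b) (pw b') 0 f" "ap f [] = 0" "typed (pw b) (pw b') s g"
    "valid b w r" "u \<in> Poly_Mapping.keys (ap (SS f p g) w)"
  shows "valid b' u (r + (s - deg_of_int 1))"
proof -
  have T: "typed (tw b) (tw b') (s - deg_of_int 1) (pre \<odot> (stm \<odot> Z13 f p g))"
    by (rule typ_deg[OF typ_comp[OF typ_comp[OF typ_Z13[OF assms(1-3)] typ_st(2)] typ_pre]]) simp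
  have u: "u \<in> Poly_Mapping.keys (ap ((pre \<odot> (stm \<odot> Z13 f p g)) \<odot> NN) w)"
    using assms(5) unfolding SS_def comp_assoc .
  obtain X where X: "tw b w X X r" using assms(4) unfolding valid_def by blast
  have "\<exists>X. tw b' u X X (r + (s - deg_of_int 1))" by (rule typ_NN[OF T X u])
  moreover have "sh u"
  proof -
    have "u \<in> Poly_Mapping.keys (ap (pre \<odot> (stm \<odot> Z13 f p g \<odot> NN)) w)" using assms(5) by (simp add: SS_def)
    from keys_ap_comp[OF this] show ?thesis by (force simp: sh_def)
  qed
  ultimately show ?thesis unfolding valid_def by blast
qed

context ainf_based
begin

definition bl :: "('o, 'y, 'a) mor \<Rightarrow> bool" where "bl m \<longleftrightarrow> is_mor C m \<and> elt m \<in> B (src m) (tgt m) (deg m)"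

lemma emb_simps [simp]: "src (emb m) = src m" "tgt (emb m) = tgt m" "deg (emb m) = deg m" "drop_e (emb m) = m" "e_coeff (emb m) = 0"
  by (simp_all add: emb_def drop_e_def e_coeff_def with_elt_def)

lemma rdeg_emb [simp]: "rdeg (map emb w) = rdeg w"
  by (induction w) simp_all

lemma cyc_emb: "w \<noteq> [] \<Longrightarrow> ch bl (map Plain w) X X \<Longrightarrow> cyc_word Cp (map emb w)"
  unfolding ch_Plain by (auto simp: cyc_word_def is_path_def bl_def is_mor_Cp successively_map hd_map last_map)

lemma expand_bl: "\<forall>m\<in>set w. bl m \<Longrightarrow> expand C B w = word w"
proof (induction w)
  case (Cons m w)
  then show ?case unfolding expand_Cons[of m w] by (simp add: lx_basis bl_def word_append[symmetric])
qed simp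

lemma Q0_emb: "\<forall>m\<in>set w. bl m \<Longrightarrow> uq (map emb w) = word (map Plain w)" "bl x \<Longrightarrow> hq (emb x) = word [Marked x]"
proof -
  have "map drop_e (map emb w :: ('o, 'y, 'a \<times> 'k) mor list) = w" by (simp add: o_def)
  then have "uq (map emb w) = clin (ap ut) (expand C B w)" using uq_eq[of "map emb w"] by (simp only:)
  then show "\<forall>m\<in>set w. bl m \<Longrightarrow> uq (map emb w) = word (map Plain w)" by (simp add: expand_bl)
  show "bl x \<Longrightarrow> hq (emb x) = word [Marked x]" unfolding hq_eq by (simp add: lx_basis bl_def Mt_def)
qed

lemma RR_valid:
  assumes "valid bl u r"
  shows "RR u \<in> formal_chains Cp (r + deg_of_int 1)" "nul (clin (ap Q0) (RR u) - word u)"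
proof -
  obtain h w X where u: "u = h # map Plain w" "nonplain h" "ch bl u X X" "r = ldeg u"
    using assms unfolding valid_def sh_def tw_def by blast
  have "RR u \<in> formal_chains Cp (r + deg_of_int 1) \<and> nul (clin (ap Q0) (RR u) - word u)"
  proof (cases "\<exists>x. h = Marked x")
    case True
    then obtain x where h: "h = Marked x" by blast
    have "ch bl (map Plain (x # w)) X X" using u h by simp
    then have c: "cyc_word Cp (map emb (x # w))" and b: "\<forall>m\<in>set (x # w). bl m"
      using cyc_emb[of "x # w" X] ch_Plain[of "x # w" bl X X] by simp_all
    have r: "r = rdeg (x # w)" using u h ldeg_Plain[of w] by simp
    have R: "RR u = word (map emb (x # w))" using RR_simps(2)[of x w] u h by simp
    have Q: "ap Q0 (map emb (x # w)) = word u"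
      using Q0_emb b u h by (simp add: ap_Q0 word_append[symmetric])
    have "word (map emb (x # w)) \<in> formal_chains Cp (r + deg_of_int 1)"
      using fc_word[OF c refl] unfolding rdeg_emb r .
    then show ?thesis unfolding R clin_single csc_simps Q by (simp add: nul_closed)
  next
    case False
    then have h: "h = Unit" using u by blast
    show ?thesis
    proof (cases "w = []")
      case True
      then show ?thesis using u h by (simp add: RR_simps fc_closed nul_def)
    next
      case False
      have ch: "ch bl (map Plain w) X X" using u h by simp
      have c: "cyc_word Cp (map emb w)" and b: "\<forall>m\<in>set w. bl m"
        using cyc_emb[OF False ch] ch_Plain[OF False] ch by blast+
      have r: "r = rdeg w - deg_of_int 1" using u h ldeg_Plain[of w] by simp
      have s: "src (hd (map emb w)) = src (hd w)" using False by (simp add: hd_map)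
      have R: "RR u = word (e_plus (src (hd w)) # map emb w)" using RR_simps(3)[OF False] u h by simp
      have "ap Q0 (e_plus (src (hd w)) # map emb w) = word u"
        using Q0_emb(1)[OF b] u h by (simp add: ap_Q0 hq_e_plus word_append[symmetric])
      moreover have "word (e_plus (src (hd w)) # map emb w) \<in> formal_chains Cp (r + deg_of_int 1)"
        using fc_word[OF e_plus_cyc(1)[OF c] refl, unfolded e_plus_cyc(2)[OF c]] unfolding s r rdeg_emb .
      ultimately show ?thesis unfolding R by (simp add: nul_closed)
    qed
  qed
  then show "RR u \<in> formal_chains Cp (r + deg_of_int 1)" "nul (clin (ap Q0) (RR u) - word u)" by blast+
qed

lemma typ_dC: "typed (pw (is_mor Cp)) (pw bl) 0 dC"
  unfolding dC_def
proof (rule typ_on_letter)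
  fix m X Y r u assume m: "pw (is_mor Cp) [m] X Y r" and "u \<in> Poly_Mapping.keys (lx (drop_e m))"
  then obtain \<beta> where u: "u = [with_elt (drop_e m) \<beta>]" "\<beta> \<in> S (drop_e m)"
    by (auto simp: in_keys_iff lookup_lx split: if_splits)
  have "is_mor C (drop_e m)" using m by (simp add: pw_def tw_def drop_e_mor)
  then have "bl (with_elt (drop_e m) \<beta>)" using S_mor[OF _ u(2)] S_basis[OF u(2)] by (simp add: bl_def)
  then show "pw bl u X Y (r + 0)" using m u by (simp add: pw_def tw_def)
qed

lemma Q0_valid:
  assumes w: "cyc_word Cp w" and u: "u \<in> Poly_Mapping.keys (ap Q0 w)"
  shows "valid bl u (rdeg w)"
proof -
  have ne: "w \<noteq> []" using w by (auto simp: cyc_word_def)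
  have d: "ap dC [] = 0" by simp
  have "typed (tw (is_mor Cp)) (tw bl) 0 ee"
    unfolding ee_def
  proof (rule typ_on_letter)
    fix a X Y r and u :: "('o, 'y, 'a) mor lt list" assume a: "tw (is_mor Cp) [a] X Y r"
      and u: "u \<in> Poly_Mapping.keys (case a of Marked m \<Rightarrow> csc (zc m) (word [Unit]) | _ \<Rightarrow> 0)"
    then obtain m where m: "a = Marked m" by (cases a) auto
    have "zc m \<noteq> 0" "u = [Unit]" using u m by (auto split: if_splits)
    then show "tw bl u X Y (r + 0)" using a m by (auto simp: tw_def is_mor_Cp split: if_splits)
  qed
  then have q: "typed (tw (is_mor Cp)) (tw bl) 0 qm" unfolding qm_def by (intro typ_add typ_fm typ_dC)
  have "typed (pw (is_mor Cp)) (tw bl) 0 Q0"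
    using typ_comp[OF typ_times[OF good_pw good_tw typ_atoms(4) typ_st(3)] typ_times[OF good_tw good_tw q typ_Fu[OF typ_dC d]]]
    by (simp add: Q0_def headM_def Ku_def)
  then have Q: "typed (pw (is_mor Cp)) (tw bl) 0 Q0" .
  have p: "pw (is_mor Cp) w (src (hd w)) (src (hd w)) (rdeg w)"
    using w by (auto simp: pw_def tw_def ch_Plain[OF ne] ldeg_Plain cyc_word_def is_path_def)
  from typD[OF Q p u] have "tw bl u (src (hd w)) (src (hd w)) (rdeg w)" by simp
  moreover have "sh u"
  proof -
    have "hl qm" unfolding qm_def
      by (intro hl_add hl_ops) (auto simp: hl_def ee_def on_letter_def split: lt.splits if_splits)
    moreover have "pl Ku" unfolding Ku_def by (rule hl_ops)
    moreover obtain z where "u \<in> Poly_Mapping.keys (ap (qm * Ku) z)"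
      using keys_ap_comp[OF u[unfolded Q0_def]] by blast
    ultimately show ?thesis by (rule sh_times)
  qed
  ultimately show ?thesis unfolding valid_def by blast
qed

end

lemma (in based2) typ_mop:
  assumes f: "multilinear_op C D id f d" and b: "\<And>m. b m \<Longrightarrow> is_mor C m"
    and b': "\<And>m. is_mor D m \<Longrightarrow> elt m \<in> B' (src m) (tgt m) (deg m) \<Longrightarrow> b' m"
  shows "typed (pw b) (pw b') d (mop C D B' f d)"
proof (rule typI)
  fix w X Y r u assume w: "pw b w X Y r" and u: "u \<in> Poly_Mapping.keys (ap (mop C D B' f d) w)"
  then have p: "is_path C w" by (auto simp: mop_def split: if_splits)
  then have ne: "w \<noteq> []" by auto
  let ?m = "apply_op id f d w"
  obtain \<beta> where \<beta>: "u = [with_elt ?m \<beta>]" "\<beta> \<in> D.S ?m"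
    using u p by (auto simp: mop_def in_keys_iff D.lookup_lx split: if_splits)
  have "b' (with_elt ?m \<beta>)"
    using D.S_mor[OF mop_mor[OF f p] \<beta>(2)] D.S_basis[OF \<beta>(2)] by (intro b') simp_all
  then show "pw b' u X Y (r + d)"
    using w ne unfolding \<beta>(1) by (simp add: pw_def tw_def ch_Plain ldeg_Plain)
qed

section \<open>Negative cyclic homology classes\<close>

lemma Z13_Unit: "op1 p g \<Longrightarrow> ap (Z13 f q g) [Unit] = 0" "op1 p g \<Longrightarrow> ap (Z13 f q g) [] = 0"
proof -
  assume g: "op1 p g"
  have 0: "ap (muu g) [] = 0" by (simp add: muu_def op1D(2)[OF g])
  have 1: "ap (Fm f) [] = 0" by (simp add: Fm_def fm_def)
  show "ap (Z13 f q g) [] = 0" by (simp add: Z13_def 0)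
  show "ap (Z13 f q g) [Unit] = 0" by (simp add: Z13_def ap_times[of _ _ "[Unit]"] 0 1)
qed

lemma NN_Unit: "ap NN [Unit] = word [Unit]"
  by (simp add: NN_def rotn_def mulrev_def)

lemma nul_op: "nul (ap T [Unit]) \<Longrightarrow> nul x \<Longrightarrow> nul (clin (ap T) x)"
  by (rule nul_clin) (auto simp: nul_def)

text \<open>\<open>[Unit]\<close> is \<open>pre\<close> of the empty word, on which all terms of
  \<open>bbar_pre\<close> vanish. The operators therefore respect the indeterminacy measured by
  \<open>nul\<close>.\<close>

lemma unit_bb: "op1 1 m \<Longrightarrow> ap (bb m) [Unit] = 0"
proof -
  assume m: "op1 1 m"
  have "ap (bb m) [Unit] = ap (bb m \<odot> pre) []" by simp
  also have "\<dots> = 0" unfolding bbar_pre[OF m]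
    by (simp add: muh0_def op1D(2)[OF m] tt_def rotn_def mulrev_def)
  finally show ?thesis .
qed

lemma unit_BB: "ap BB [Unit] = 0"
  by (simp add: BB_def NN_Unit)

lemma unit_ii: "op1 p g \<Longrightarrow> ap (ii m f q g) [Unit] = 0"
  by (simp add: ii_def ibar_def NN_Unit ap_times[of _ _ "[Unit]"] Z13_Unit)

lemma unit_SS: "op1 p g \<Longrightarrow> ap (SS f q g) [Unit] = 0"
  by (simp add: SS_def NN_Unit Z13_Unit)

lemma unit_hh: "op1 p g \<Longrightarrow> ap (hh f g) [Unit] = 0"
  by (simp add: hh_def NN_Unit ap_times[of _ _ "[Unit]"] Z13_Unit)

lemma nul_u_times: "(\<And>i. nul (x i)) \<Longrightarrow> nul (u_times x i)"
  by (cases i) (simp_all add: u_times_def nul_closed)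

lemma nul_mapv: "der v \<Longrightarrow> nul x \<Longrightarrow> nul (mapv v x)"
  unfolding nul_def by (rule subset_trans[OF keys_mapv])

lemma nul_ser_d: "op1 1 m \<Longrightarrow> (\<And>i. nul (x i)) \<Longrightarrow> nul (ser_d m x i)"
  unfolding ser_d_def by (intro nul_closed nul_u_times nul_op) (simp_all add: unit_bb unit_BB nul_closed)

lemma nul_ser_nabla: "der v \<Longrightarrow> op1 1 m \<Longrightarrow> (\<And>i. nul (x i)) \<Longrightarrow> nul (ser_nabla m v x i)"
  unfolding ser_nabla_def
  by (intro nul_closed nul_u_times nul_op nul_mapv) (simp_all add: unit_ii[OF opv_op1] unit_SS[OF opv_op1] nul_closed)

lemma nul_ser_H: "der v \<Longrightarrow> op1 1 mC \<Longrightarrow> op1 0 f \<Longrightarrow> (\<And>i. nul (x i)) \<Longrightarrow> nul (ser_H mC mD f v x i)"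
  unfolding ser_H_def
  by (intro nul_closed nul_u_times nul_op)
    (simp_all add: unit_ii[OF opv_op1] unit_hh[OF opv_op1] unit_SS[OF opv_op1] nul_closed)

lemma ser_d_diff: "ser_d m (\<lambda>i. x i - y i) i = ser_d m x i - ser_d m y i"
  by (cases i) (simp_all add: ser_d_def u_times_def clin_diff)

lemma fc_deg: "x \<in> formal_chains C r \<Longrightarrow> r = r' \<Longrightarrow> x \<in> formal_chains C r'"
  by simp

lemma deg_2: "deg_of_int 2 = deg_of_int 1 + deg_of_int 1"
  using deg_of_int_add[of 1 1] by simp

lemma deg_2_Suc: "deg_of_int (2 * int (Suc i)) = deg_of_int (2 * int i) + (deg_of_int 1 + deg_of_int 1)"
  using deg_of_int_add[of "2 * int i" 2] by (simp add: deg_2 algebra_simps)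

lemma fsD: "x \<in> formal_series C y \<Longrightarrow> x i \<in> formal_chains C (y - deg_of_int (2 * int i))"
  by (simp add: formal_series_def)

lemma fsI: "(\<And>i. x i \<in> formal_chains C (y - deg_of_int (2 * int i))) \<Longrightarrow> x \<in> formal_series C y"
  by (simp add: formal_series_def)

lemma fs_op:
  assumes x: "x \<in> formal_series C y" and O: "\<And>w. cyc_word C w \<Longrightarrow> P w \<in> formal_chains D (rdeg w + s)"
    and y': "y' = y - deg_of_int 1 + s"
  shows "clin P (x i) \<in> formal_chains D (y' - deg_of_int (2 * int i))"
proof (rule fc_clin[OF fsD[OF x]])
  fix w assume w: "cyc_word C w" "rdeg w + deg_of_int 1 = y - deg_of_int (2 * int i)"
  have "rdeg w = y - deg_of_int (2 * int i) - deg_of_int 1" using w(2) by (simp add: eq_diff_eq)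
  then show "P w \<in> formal_chains D (y' - deg_of_int (2 * int i))"
    by (intro fc_deg[OF O[OF w(1)]]) (simp add: y')
qed

lemma fs_u_times:
  assumes "\<And>i. x i \<in> formal_chains D (y - deg_of_int (2 * int i))" "y' = y + deg_of_int 1 + deg_of_int 1"
  shows "u_times x i \<in> formal_chains D (y' - deg_of_int (2 * int i))"
proof (cases i)
  case (Suc j)
  show ?thesis unfolding Suc deg_2_Suc assms(2) using assms(1)[of j]
    by (simp add: u_times_def algebra_simps)
qed (simp add: u_times_def fc_closed)

lemma Qop:
  assumes "x \<in> formal_chains E y" "\<And>w. cyc_word E w \<Longrightarrow> clin G (P w) = ap (T \<odot> Q) w"
  shows "clin G (clin P x) = clin (ap T) (clin (ap Q) x)"
  unfolding clin_clin using assms by (intro clin_cong refl) (simp add: formal_chains_def)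

lemma u_times_apply: "(\<And>i. g (x i) = y i) \<Longrightarrow> g 0 = 0 \<Longrightarrow> g (u_times x i) = u_times y i"
  by (cases i) (simp_all add: u_times_def)

lemma u_times_lin: "u_times (\<lambda>i. x i + y i) i = u_times x i + u_times y i" "u_times (\<lambda>i. x i - y i) i = u_times x i - u_times y i"
  for x y :: "nat \<Rightarrow> 'c::ab_group_add"
  by (cases i; simp add: u_times_def)+

lemma neg_d_lin: "neg_d C (\<lambda>i. x i + y i) i = neg_d C x i + neg_d C y i" "neg_d C (\<lambda>i. x i - y i) i = neg_d C x i - neg_d C y i"
  by (simp_all add: neg_d_def clin_add clin_diff u_times_lin)

lemma neg_d_0: "neg_d C (\<lambda>i. 0) i = 0"
  by (cases i) (simp_all add: neg_d_def u_times_def)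

lemma fs_lin: "x \<in> formal_series C y \<Longrightarrow> x' \<in> formal_series C y \<Longrightarrow> (\<lambda>i. x i + x' i) \<in> formal_series C y"
  "x \<in> formal_series C y \<Longrightarrow> x' \<in> formal_series C y \<Longrightarrow> (\<lambda>i. x i - x' i) \<in> formal_series C y"
  "(\<lambda>i. 0) \<in> formal_series C y"
  by (auto simp: formal_series_def fc_closed)

lemma sym_coh: "sym (cohomologous C y)"
proof (rule symI)
  fix a b assume "(a, b) \<in> cohomologous C y"
  then obtain z where z: "a \<in> neg_cocycles C y" "b \<in> neg_cocycles C y" "z \<in> formal_series (ainf_plus C) (y - deg_of_int 1)"
    "\<And>i. b i - a i - neg_d C z i \<in> null_chains C"
    by (auto simp: cohomologous_def)
  have "a i - b i - neg_d C (\<lambda>i. 0 - z i) i \<in> null_chains C" for i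
    using null_closed(3)[OF null_closed(1) z(4)[of i]] unfolding neg_d_lin neg_d_0 by (simp add: algebra_simps)
  moreover have "(\<lambda>i. 0 - z i) \<in> formal_series (ainf_plus C) (y - deg_of_int 1)"
    by (rule fs_lin(2)[OF fs_lin(3) z(3)])
  ultimately show "(b, a) \<in> cohomologous C y" using z(1,2) unfolding cohomologous_def by blast
qed

lemma trans_coh: "trans (cohomologous C y)"
proof (rule transI)
  fix a b c assume "(a, b) \<in> cohomologous C y" "(b, c) \<in> cohomologous C y"
  then obtain z z' where z: "a \<in> neg_cocycles C y" "c \<in> neg_cocycles C y"
    "z \<in> formal_series (ainf_plus C) (y - deg_of_int 1)" "z' \<in> formal_series (ainf_plus C) (y - deg_of_int 1)"
    "\<And>i. b i - a i - neg_d C z i \<in> null_chains C" "\<And>i. c i - b i - neg_d C z' i \<in> null_chains C"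
    by (auto simp: cohomologous_def)
  have "c i - a i - neg_d C (\<lambda>i. z i + z' i) i \<in> null_chains C" for i
    using null_closed(2)[OF z(5)[of i] z(6)[of i]] unfolding neg_d_lin by (simp add: algebra_simps)
  then show "(a, c) \<in> cohomologous C y" using z(1,2) fs_lin(1)[OF z(3,4)] unfolding cohomologous_def by blast
qed

lemma refl_coh: "a \<in> neg_cocycles C y \<Longrightarrow> (a, a) \<in> cohomologous C y"
  unfolding cohomologous_def using fs_lin(3) by (auto simp: neg_d_0 null_closed intro!: bexI[of _ "\<lambda>i. 0"])

text \<open>Representatives of one class have related images, so the union defining
  \<open>induced\<close> collapses to a single class.\<close>

lemma induced_class:
  assumes "\<And>a b. (a, b) \<in> r \<Longrightarrow> (T a, T b) \<in> r'" "sym r'" "trans r'" "(x, x) \<in> r"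
  shows "induced r' T (r `` {x}) = r' `` {T x}"
  unfolding induced_def using assms by (auto dest: symD transD)

context ainf_based
begin

definition Qs :: "(nat \<Rightarrow> ('k, 'o, 'y, 'a \<times> 'k) chain) \<Rightarrow> nat \<Rightarrow> ('o, 'y, 'a) mor lt list \<Rightarrow>\<^sub>0 'k"
  where "Qs x = (\<lambda>i. clin (ap Q0) (x i))"

lemma Qs_diff: "Qs (\<lambda>i. x i - y i) i = Qs x i - Qs y i"
  by (simp add: Qs_def clin_diff)

lemma null_Qs: "x \<in> formal_series Cp y \<Longrightarrow> x i \<in> null_chains C \<longleftrightarrow> nul (Qs x i)"
  unfolding Qs_def by (intro null_iff) (use fsD[of x Cp y i] in \<open>auto simp: formal_chains_def\<close>)

lemma fs_d: "x \<in> formal_series Cp y \<Longrightarrow> neg_d C x \<in> formal_series Cp (y + deg_of_int 1)"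
proof (rule fsI)
  fix i assume x: "x \<in> formal_series Cp y"
  have "clin (hochschild_b Cp) (x i) \<in> formal_chains Cp (y + deg_of_int 1 - deg_of_int (2 * int i))"
    by (rule fs_op[OF x, where s = "deg_of_int 1 + deg_of_int 1"]) (use fc_b in \<open>simp_all add: add.assoc\<close>)
  moreover have "u_times (\<lambda>i. clin connes_B (x i)) i \<in> formal_chains Cp (y + deg_of_int 1 - deg_of_int (2 * int i))"
  proof (rule fs_u_times)
    show "clin connes_B (x i) \<in> formal_chains Cp (y - deg_of_int 1 - deg_of_int (2 * int i))" for i
      by (rule fs_op[OF x, where s = 0]) (use fc_B in simp_all)
  qed simp
  ultimately show "neg_d C x i \<in> formal_chains Cp (y + deg_of_int 1 - deg_of_int (2 * int i))"
    unfolding neg_d_def by (rule fc_closed(2))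
qed

lemma Qs_d: "x \<in> formal_series Cp y \<Longrightarrow> Qs (neg_d C x) = ser_d m0 (Qs x)"
proof (rule ext)
  fix i assume x: "x \<in> formal_series Cp y"
  have b: "clin (ap Q0) (clin (hochschild_b Cp) (x i)) = clin (ap (bb m0)) (clin (ap Q0) (x i))" for i
    by (rule Qop[OF fsD[OF x]]) (rule Q0_b)
  have B: "clin (ap Q0) (clin connes_B (x i)) = clin (ap BB) (clin (ap Q0) (x i))" for i
    by (rule Qop[OF fsD[OF x]]) (rule Q0_B)
  show "Qs (neg_d C x) i = ser_d m0 (Qs x) i"
    unfolding Qs_def neg_d_def ser_d_def clin_add b by (simp only: u_times_apply[where g = "clin (ap Q0)", OF B clin_0])
qed

context
  fixes v :: "'k \<Rightarrow> 'k"
  assumes v: "der v"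
begin

lemma fs_nabla: "x \<in> formal_series Cp y \<Longrightarrow> u_nabla C B v x \<in> formal_series Cp (y + deg_of_int 2)"
proof (rule fsI)
  fix i assume x: "x \<in> formal_series Cp y"
  let ?d = "deg_of_int 1 :: 'y"
  have "u_times (\<lambda>i. act_coeffs Cp (basis_plus B) v (x i)) i \<in> formal_chains Cp (y + deg_of_int 2 - deg_of_int (2 * int i))"
    by (rule fs_u_times, rule fc_act[OF v fsD[OF x]]) (simp add: deg_2 add.assoc)
  moreover have "clin (b11 Cp (v_mu_plus C B v) ?d) (x i) \<in> formal_chains Cp (y + deg_of_int 2 - deg_of_int (2 * int i))"
    by (rule fs_op[OF x, where s = "?d + ?d + ?d"]) (use fc_b11[OF v] in \<open>simp_all add: add.assoc deg_2\<close>)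
  moreover have "u_times (\<lambda>i. clin (B11 (v_mu_plus C B v) ?d) (x i)) i \<in> formal_chains Cp (y + deg_of_int 2 - deg_of_int (2 * int i))"
  proof (rule fs_u_times)
    show "clin (B11 (v_mu_plus C B v) ?d) (x i) \<in> formal_chains Cp (y - deg_of_int (2 * int i))" for i
      by (rule fs_op[OF x, where s = ?d]) (use fc_B11[OF v] in simp_all)
  qed (simp add: deg_2 add.assoc)
  ultimately show "u_nabla C B v x i \<in> formal_chains Cp (y + deg_of_int 2 - deg_of_int (2 * int i))"
    unfolding u_nabla_def by (intro fc_closed(3))
qed

lemma Qs_nabla: "x \<in> formal_series Cp y \<Longrightarrow> Qs (u_nabla C B v x) = ser_nabla m0 v (Qs x)"
proof (rule ext)
  fix i assume x: "x \<in> formal_series Cp y"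
  have a: "clin (ap Q0) (act_coeffs Cp (basis_plus B) v (x i)) = mapv v (clin (ap Q0) (x i))" for i
    by (rule Q0_act[OF v]) (use fsD[OF x, of i] in \<open>auto simp: formal_chains_def\<close>)
  have b: "clin (ap Q0) (clin (b11 Cp (v_mu_plus C B v) (deg_of_int 1)) (x i)) = clin (ap (ii m0 idl 1 (opv v m0))) (clin (ap Q0) (x i))" for i
    by (rule Qop[OF fsD[OF x]]) (rule Q0_b11[OF v])
  have B: "clin (ap Q0) (clin (B11 (v_mu_plus C B v) (deg_of_int 1)) (x i)) = clin (ap (SS idl 1 (opv v m0))) (clin (ap Q0) (x i))" for i
    by (rule Qop[OF fsD[OF x]]) (rule Q0_B11[OF v])
  show "Qs (u_nabla C B v x) i = ser_nabla m0 v (Qs x) i"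
    unfolding Qs_def u_nabla_def ser_nabla_def clin_diff b
    by (simp only: u_times_apply[where g = "clin (ap Q0)", OF a clin_0] u_times_apply[where g = "clin (ap Q0)", OF B clin_0])
qed

lemma nabla_diff: "u_nabla C B v (\<lambda>i. x i - y i) i = u_nabla C B v x i - u_nabla C B v y i"
proof -
  have "act_coeffs Cp (basis_plus B) v (a - b) = act_coeffs Cp (basis_plus B) v a - act_coeffs Cp (basis_plus B) v b" for a b
    by (simp add: act_coeffs_def clin_diff mapv_simps(2)[OF v])
  then show ?thesis by (simp add: u_nabla_def clin_diff u_times_lin)
qed

lemma nabla_null: "x \<in> formal_series Cp y \<Longrightarrow> (\<And>i. x i \<in> null_chains C) \<Longrightarrow> u_nabla C B v x i \<in> null_chains C"
  unfolding null_Qs[OF fs_nabla] Qs_nabla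
  by (rule nul_ser_nabla[OF v op1_m0]) (simp add: null_Qs)

text \<open>Operators are given on formal chains, before the quotient, so u nabla commutes with the
  differential only up to null chains. The first equation merely exhibits this defect.\<close>

lemma nabla_d:
  assumes x: "x \<in> formal_series Cp y"
  shows "u_nabla C B v (neg_d C x) = (\<lambda>i. neg_d C (u_nabla C B v x) i - (neg_d C (u_nabla C B v x) i - u_nabla C B v (neg_d C x) i))"
    "neg_d C (u_nabla C B v x) i - u_nabla C B v (neg_d C x) i \<in> null_chains C"
proof -
  interpret I: functor_ops m0 m0 idl by (rule functor_ops_idl[OF op1_m0 m0_sq])
  have "Qs (u_nabla C B v (neg_d C x)) = Qs (neg_d C (u_nabla C B v x))"
    unfolding Qs_nabla[OF fs_d[OF x]] Qs_d[OF x] Qs_d[OF fs_nabla[OF x]] Qs_nabla[OF x]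
    by (rule I.ser_d_nabla[OF v])
  then have "Qs (\<lambda>i. neg_d C (u_nabla C B v x) i - u_nabla C B v (neg_d C x) i) i = 0" unfolding Qs_diff by simp
  moreover have "u_nabla C B v (neg_d C x) \<in> formal_series Cp (y + deg_of_int 2 + deg_of_int 1)"
    using fs_nabla[OF fs_d[OF x]] by (simp add: ac_simps)
  ultimately show "neg_d C (u_nabla C B v x) i - u_nabla C B v (neg_d C x) i \<in> null_chains C"
    using null_Qs[OF fs_lin(2)[OF fs_d[OF fs_nabla[OF x]]], of "u_nabla C B v (neg_d C x)" i] by (simp add: nul_closed)
qed simp

lemma nabla_coh:
  assumes "(a, b) \<in> cohomologous C y"
  shows "(u_nabla C B v a, u_nabla C B v b) \<in> cohomologous C (y + deg_of_int 2)"
proof -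
  have coc: "u_nabla C B v x \<in> neg_cocycles C (y + deg_of_int 2)" if x: "x \<in> neg_cocycles C y" for x
  proof -
    have f: "x \<in> formal_series Cp y" "\<And>i. neg_d C x i \<in> null_chains C" using x by (auto simp: neg_cocycles_def)
    have "neg_d C (u_nabla C B v x) i \<in> null_chains C" for i
      using null_closed(2)[OF nabla_d(2)[OF f(1), of i] nabla_null[OF fs_d[OF f(1)] f(2), of i]] by simp
    then show ?thesis using fs_nabla[OF f(1)] by (simp add: neg_cocycles_def)
  qed
  obtain z where z: "a \<in> neg_cocycles C y" "b \<in> neg_cocycles C y" "z \<in> formal_series Cp (y - deg_of_int 1)"
    "\<And>i. b i - a i - neg_d C z i \<in> null_chains C"
    using assms by (auto simp: cohomologous_def)
  have dz: "neg_d C z \<in> formal_series Cp y" using fs_d[OF z(3)] by simp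
  have f: "(\<lambda>i. b i - a i - neg_d C z i) \<in> formal_series Cp y"
    using z(1,2) dz by (intro fs_lin(2)) (auto simp: neg_cocycles_def)
  have "u_nabla C B v b i - u_nabla C B v a i - neg_d C (u_nabla C B v z) i \<in> null_chains C" for i
    using null_closed(3)[OF nabla_null[OF f z(4), of i] nabla_d(2)[OF z(3), of i]] unfolding nabla_diff
    by (simp add: algebra_simps)
  moreover have "u_nabla C B v z \<in> formal_series Cp (y + deg_of_int 2 - deg_of_int 1)"
    using fs_nabla[OF z(3)] by (simp add: algebra_simps)
  ultimately show ?thesis unfolding cohomologous_def using coc z(1,2) by blast
qed

end

end

context ainf_functor_based
begin

definition Fs :: "(nat \<Rightarrow> ('k, 'o, 'y, 'a \<times> 'k) chain) \<Rightarrow> nat \<Rightarrow> ('k, 'o, 'y, 'b \<times> 'k) chain"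
  where "Fs x = (\<lambda>i. clin (induced_chain_map id (F_plus F)) (x i))"

lemma fs_F: "x \<in> formal_series C.Cp y \<Longrightarrow> Fs x \<in> formal_series D.Cp y"
  unfolding Fs_def by (rule fsI, rule fs_op[where s = "deg_of_int 1"]) (use fc_F in simp_all)

lemma Qs_F: "x \<in> formal_series C.Cp y \<Longrightarrow> D.Qs (Fs x) = ser_F f0 (C.Qs x)"
  unfolding D.Qs_def C.Qs_def Fs_def ser_F_def by (rule ext, rule Qop[OF fsD], assumption) (rule Q0_F)

lemma F_diff: "Fs (\<lambda>i. x i - y i) i = Fs x i - Fs y i"
  by (simp add: Fs_def clin_diff)

lemma F_null: 
  assumes x: "x \<in> formal_series C.Cp y" "\<And>i. x i \<in> null_chains C"
  shows "Fs x i \<in> null_chains D"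
proof -
  have "ap (FF f0) [Unit] = ap (FF f0 \<odot> pre) []" by simp
  also have "\<dots> = word [Unit]" unfolding FF_pre by simp
  finally have "nul (ap (FF f0) [Unit])" by (simp add: nul_def)
  then show ?thesis unfolding D.null_Qs[OF fs_F[OF x(1)]] Qs_F[OF x(1)] ser_F_def
    using x C.null_Qs[OF x(1)] by (intro nul_op) auto
qed

lemma F_d:
  assumes x: "x \<in> formal_series C.Cp y"
  shows "neg_d D (Fs x) i - Fs (neg_d C x) i \<in> null_chains D"
proof -
  have "D.Qs (neg_d D (Fs x)) = D.Qs (Fs (neg_d C x))"
    unfolding Qs_F[OF C.fs_d[OF x]] D.Qs_d[OF fs_F[OF x]] Qs_F[OF x] C.Qs_d[OF x] by (rule ser_F_d[symmetric])
  then have "D.Qs (\<lambda>i. neg_d D (Fs x) i - Fs (neg_d C x) i) i = 0" unfolding D.Qs_diff by simp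
  then show ?thesis
    using D.null_Qs[OF fs_lin(2)[OF D.fs_d[OF fs_F[OF x]] fs_F[OF C.fs_d[OF x]]], of i] by (simp add: nul_closed)
qed

lemma F_coh:
  assumes "(a, b) \<in> cohomologous C y"
  shows "(Fs a, Fs b) \<in> cohomologous D y"
proof -
  have coc: "Fs x \<in> neg_cocycles D y" if x: "x \<in> neg_cocycles C y" for x
  proof -
    have f: "x \<in> formal_series C.Cp y" "\<And>i. neg_d C x i \<in> null_chains C" using x by (auto simp: neg_cocycles_def)
    have "neg_d D (Fs x) i \<in> null_chains D" for i
      using null_closed(2)[OF F_d[OF f(1), of i] F_null[OF C.fs_d[OF f(1)] f(2), of i]] by simp
    then show ?thesis using fs_F[OF f(1)] by (simp add: neg_cocycles_def)
  qed
  obtain z where z: "a \<in> neg_cocycles C y" "b \<in> neg_cocycles C y" "z \<in> formal_series C.Cp (y - deg_of_int 1)"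
    "\<And>i. b i - a i - neg_d C z i \<in> null_chains C"
    using assms by (auto simp: cohomologous_def)
  have dz: "neg_d C z \<in> formal_series C.Cp y" using C.fs_d[OF z(3)] by simp
  have f: "(\<lambda>i. b i - a i - neg_d C z i) \<in> formal_series C.Cp y"
    using z(1,2) dz by (intro fs_lin(2)) (auto simp: neg_cocycles_def)
  have "Fs b i - Fs a i - neg_d D (Fs z) i \<in> null_chains D" for i
    using null_closed(3)[OF F_null[OF f z(4), of i] F_d[OF z(3), of i]] unfolding F_diff
    by (simp add: algebra_simps)
  then show ?thesis unfolding cohomologous_def using coc z(1,2) fs_F[OF z(3)] by blast
qed

lemma typ_f0: "typed (pw C.bl) (pw D.bl) 0 f0"
  by (rule CD.typ_mop[OF Fml]) (simp_all add: C.bl_def D.bl_def)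

lemma typ_mC: "typed (pw C.bl) (pw C.bl) (deg_of_int 1) C.m0"
  by (rule C.CC.typ_mop[OF C.mu]) (simp_all add: C.bl_def)

lemma typ_mD: "typed (pw D.bl) (pw D.bl) (deg_of_int 1) D.m0"
  by (rule D.CC.typ_mop[OF D.mu]) (simp_all add: D.bl_def)

text \<open>The two cocycles differ by the boundary of the lifted homotopy. Lifting costs only
  multiples of \<open>[Unit]\<close>, because \<open>Q0\<close> after \<open>RR\<close> is the
  identity up to these, and the differential preserves them.\<close>

lemma F_nabla:
  assumes v: "der v" and x: "x \<in> neg_cocycles C y"
  shows "(u_nabla D B' v (Fs x), Fs (u_nabla C B v x)) \<in> cohomologous D (y + deg_of_int 2)"
proof -
  have f: "x \<in> formal_series C.Cp y" "\<And>i. neg_d C x i \<in> null_chains C" using x by (auto simp: neg_cocycles_def)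
  have xx: "(x, x) \<in> cohomologous C y" by (rule refl_coh[OF x])
  \<comment> \<open>\<open>Z\<close> is the homotopy on marked words; \<open>z\<close>, its lift by
    \<open>RR\<close>, is the primitive.\<close>
  define Z where "Z = ser_H C.m0 D.m0 f0 v (C.Qs x)"
  define z where "z = (\<lambda>i. clin RR (Z i) :: ('k, 'o, 'y, 'b \<times> 'k) chain)"
  have f00: "ap f0 [] = 0" using op1D(2)[OF op1_f0] .
  have Qv: "valid C.bl u (y - deg_of_int (2 * int i) - deg_of_int 1)" if u: "u \<in> Poly_Mapping.keys (C.Qs x i)" for u i
  proof -
    from subsetD[OF keys_clin u[unfolded C.Qs_def]]
    obtain w where w: "w \<in> Poly_Mapping.keys (x i)" "u \<in> Poly_Mapping.keys (ap C.Q0 w)" by blast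
    have c: "cyc_word C.Cp w" "rdeg w + deg_of_int 1 = y - deg_of_int (2 * int i)"
      using fsD[OF f(1), of i] w(1) by (auto simp: formal_chains_def)
    have "rdeg w = y - deg_of_int (2 * int i) - deg_of_int 1" using c(2) by (simp add: eq_diff_eq)
    then show ?thesis using C.Q0_valid[OF c(1) w(2)] by simp
  qed
  \<comment> \<open>All parts of the homotopy have degree 1 in total: the contraction and the
    correction raise the degree by 1, while \<open>SS\<close> lowers it by 1 but comes with u, which
    has degree 2.\<close>
  have valid: "valid D.bl u (y - deg_of_int (2 * int i))" if u: "u \<in> Poly_Mapping.keys (Z i)" for u i
  proof -
    have Zi: "Z i = clin (ap (ii D.m0 f0 0 (opv v f0))) (C.Qs x i) - clin (ap (hh f0 (opv v C.m0))) (C.Qs x i)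
        + u_times (\<lambda>i. clin (ap (SS f0 0 (opv v f0))) (C.Qs x i)) i"
      by (simp only: Z_def ser_H_def ap_fun clin_diff_fun)
    have "u \<in> Poly_Mapping.keys (clin (ap (ii D.m0 f0 0 (opv v f0))) (C.Qs x i)) \<union>
       Poly_Mapping.keys (clin (ap (hh f0 (opv v C.m0))) (C.Qs x i)) \<union>
       Poly_Mapping.keys (u_times (\<lambda>i. clin (ap (SS f0 0 (opv v f0))) (C.Qs x i)) i)"
      using subsetD[OF keys_add u[unfolded Zi]]
        subsetD[OF keys_diff, of u "clin (ap (ii D.m0 f0 0 (opv v f0))) (C.Qs x i)" "clin (ap (hh f0 (opv v C.m0))) (C.Qs x i)"] by blast
    then consider "u \<in> Poly_Mapping.keys (clin (ap (ii D.m0 f0 0 (opv v f0))) (C.Qs x i))"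
      | "u \<in> Poly_Mapping.keys (clin (ap (hh f0 (opv v C.m0))) (C.Qs x i))"
      | "u \<in> Poly_Mapping.keys (u_times (\<lambda>i. clin (ap (SS f0 0 (opv v f0))) (C.Qs x i)) i)" by blast
    then consider w where "w \<in> Poly_Mapping.keys (C.Qs x i)" "u \<in> Poly_Mapping.keys (ap (ii D.m0 f0 0 (opv v f0)) w)"
      | w where "w \<in> Poly_Mapping.keys (C.Qs x i)" "u \<in> Poly_Mapping.keys (ap (hh f0 (opv v C.m0)) w)"
      | j w where "i = Suc j" "w \<in> Poly_Mapping.keys (C.Qs x j)" "u \<in> Poly_Mapping.keys (ap (SS f0 0 (opv v f0)) w)"
    proof cases
      case 1
      from subsetD[OF keys_clin 1] show ?thesis using that(1) by blast
    next
      case 2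
      from subsetD[OF keys_clin 2] show ?thesis using that(2) by blast
    next
      case 3
      then obtain j where j: "i = Suc j" by (cases i) (simp_all add: u_times_def)
      have "u \<in> Poly_Mapping.keys (clin (ap (SS f0 0 (opv v f0))) (C.Qs x j))" using 3 by (simp add: j u_times_def)
      from subsetD[OF keys_clin this] show ?thesis using that(3) j by blast
    qed
    then show ?thesis
    proof cases
      case (1 w)
      show ?thesis using valid_ii[OF typ_mD typ_f0 f00 typ_opv[OF v typ_f0] Qv[OF 1(1)] 1(2)] by simp
    next
      case (2 w)
      show ?thesis using valid_hh[OF typ_f0 f00 typ_opv[OF v typ_mC] Qv[OF 2(1)] 2(2)] by simp
    next
      case (3 j w)
      show ?thesis using valid_SS[OF typ_f0 f00 typ_opv[OF v typ_f0] Qv[OF 3(2)] 3(3)]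
        unfolding 3(1) deg_2_Suc by (simp add: algebra_simps)
    qed
  qed
  have zf: "z \<in> formal_series D.Cp (y + deg_of_int 2 - deg_of_int 1)"
  proof (rule fsI)
    fix i
    have "z i \<in> formal_chains D.Cp (y - deg_of_int (2 * int i) + deg_of_int 1)"
      unfolding z_def lin_def by (intro fc_sum fc_closed(4) D.RR_valid(1) valid)
    then show "z i \<in> formal_chains D.Cp (y + deg_of_int 2 - deg_of_int 1 - deg_of_int (2 * int i))"
      by (rule fc_deg) (simp add: deg_2 algebra_simps)
  qed
  have Qz: "nul (D.Qs z i - Z i)" for i
  proof -
    have "D.Qs z i - Z i = clin (\<lambda>u. clin (ap D.Q0) (RR u) - word u) (Z i)"
      by (simp add: D.Qs_def z_def clin_diff_fun clin_clin)
    then show ?thesis using nul_clin[OF D.RR_valid(2)[OF valid]] by simp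
  qed
  have fN: "Fs (u_nabla C B v x) \<in> formal_series D.Cp (y + deg_of_int 2)" "u_nabla D B' v (Fs x) \<in> formal_series D.Cp (y + deg_of_int 2)"
    using fs_F[OF C.fs_nabla[OF v f(1)]] D.fs_nabla[OF v fs_F[OF f(1)]] by auto
  have dz: "neg_d D z \<in> formal_series D.Cp (y + deg_of_int 2)" using D.fs_d[OF zf] by simp
  have "Fs (u_nabla C B v x) i - u_nabla D B' v (Fs x) i - neg_d D z i \<in> null_chains D" for i
  proof -
    have "D.Qs (\<lambda>i. Fs (u_nabla C B v x) i - u_nabla D B' v (Fs x) i - neg_d D z i) i =
      ser_F f0 (ser_nabla C.m0 v (C.Qs x)) i - ser_nabla D.m0 v (ser_F f0 (C.Qs x)) i - ser_d D.m0 (D.Qs z) i"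
      unfolding D.Qs_diff Qs_F[OF C.fs_nabla[OF v f(1)]] C.Qs_nabla[OF v f(1)] D.Qs_nabla[OF v fs_F[OF f(1)]] Qs_F[OF f(1)] D.Qs_d[OF zf] ..
    also have "\<dots> = ser_H C.m0 D.m0 f0 v (ser_d C.m0 (C.Qs x)) i - ser_d D.m0 (\<lambda>i. D.Qs z i - Z i) i"
      unfolding ser_homotopy[OF v] ser_d_diff Z_def by (simp add: algebra_simps)
    finally have eq: "D.Qs (\<lambda>i. Fs (u_nabla C B v x) i - u_nabla D B' v (Fs x) i - neg_d D z i) i =
      ser_H C.m0 D.m0 f0 v (ser_d C.m0 (C.Qs x)) i - ser_d D.m0 (\<lambda>i. D.Qs z i - Z i) i" .
    \<comment> \<open>As \<open>x\<close> is a cocycle, the term of the homotopy formula with the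
      differential applied first is null.\<close>
    have "nul (ser_d C.m0 (C.Qs x) i)" for i
      using C.null_Qs[OF C.fs_d[OF f(1)], of i] f(2) unfolding C.Qs_d[OF f(1)] by simp
    then have "nul (ser_H C.m0 D.m0 f0 v (ser_d C.m0 (C.Qs x)) i)"
      by (rule nul_ser_H[OF v C.op1_m0 op1_f0])
    moreover have "nul (ser_d D.m0 (\<lambda>i. D.Qs z i - Z i) i)"
      by (rule nul_ser_d[OF D.op1_m0 Qz])
    ultimately show ?thesis
      using D.null_Qs[OF fs_lin(2)[OF fs_lin(2)[OF fN] dz], of i] eq by (simp add: nul_closed)
  qed
  moreover have "Fs (u_nabla C B v x) \<in> neg_cocycles D (y + deg_of_int 2)" "u_nabla D B' v (Fs x) \<in> neg_cocycles D (y + deg_of_int 2)"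
    using F_coh[OF C.nabla_coh[OF v xx]] D.nabla_coh[OF v F_coh[OF xx]] by (auto simp: cohomologous_def)
  ultimately show ?thesis unfolding cohomologous_def using zf by blast
qed

end

section \<open>Pulling back along the object map\<close>

definition rho :: "('o \<Rightarrow> 'p) \<Rightarrow> ('o, 'y, 'a) mor \<Rightarrow> ('p, 'y, 'a) mor"
  where "rho Fo m = Mor (Fo (src m)) (Fo (tgt m)) (deg m) (elt m)"

text \<open>The objects are those of C, the morphisms those of D between the images. A functor from
  C to D factors as one that is the identity on objects, followed by the relabelling
  \<open>rho\<close>, which is strictly compatible with all operations.\<close>

definition pullback :: "('k, 'p, 'y, 'b) ainf_data \<Rightarrow> ('o \<Rightarrow> 'p) \<Rightarrow> 'o set \<Rightarrow> ('k, 'o, 'y, 'b) ainf_data"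
  where "pullback D Fo X = \<lparr>scl = scl D, Obj = X, Hom = (\<lambda>X Y. Hom D (Fo X) (Fo Y)), mu = (\<lambda>w. ainf_data.mu D (map (rho Fo) w))\<rparr>"

lemma pullback_simps [simp]: "scl (pullback D Fo X) = scl D" "Obj (pullback D Fo X) = X"
  "Hom (pullback D Fo X) = (\<lambda>X Y. Hom D (Fo X) (Fo Y))" "ainf_data.mu (pullback D Fo X) w = ainf_data.mu D (map (rho Fo) w)"
  by (simp_all add: pullback_def)

lemma rho_simps [simp]: "src (rho Fo m) = Fo (src m)" "tgt (rho Fo m) = Fo (tgt m)" "deg (rho Fo m) = deg m" "elt (rho Fo m) = elt m"
  by (simp_all add: rho_def)

lemma rho_with_elt [simp]: "rho Fo (with_elt m a) = with_elt (rho Fo m) a"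
  by (simp add: rho_def with_elt_def)

lemma rho_drop_e [simp]: "drop_e (rho Fo m) = rho Fo (drop_e m)" "e_coeff (rho Fo m) = e_coeff m"
  by (simp_all add: rho_def with_elt_def drop_e_def e_coeff_def)

lemma rho_e_plus [simp]: "rho Fo (e_plus X) = e_plus (Fo X)"
  by (simp add: rho_def e_plus_def)

lemma rdeg_rho [simp]: "rdeg (map (rho Fo) w) = rdeg w" "eps (map (rho Fo) w) = eps w"
  by (induction w) (simp_all add: eps_def)

lemma epar_rho [simp]: "epar (map (rho Fo) w) = epar w"
  by (simp add: eps_epar[symmetric])

lemma rho_apply_op: "rho Fo (apply_op id f d w) = apply_op Fo f d w"
  by (simp add: rho_def apply_op_def)

lemma rho_apply_op': "w \<noteq> [] \<Longrightarrow> f w = g (map (rho Fo) w) \<Longrightarrow> rho Fo (apply_op id f d w) = apply_op id g d (map (rho Fo) w)"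
  by (simp add: rho_def apply_op_def hd_map last_map)

lemma slice_map: "slice j k (map f w) = map f (slice j k w)"
  by (simp add: slice_def take_map drop_map)

lemma slice_ne: "j < k \<Longrightarrow> k \<le> length w \<Longrightarrow> slice j k w \<noteq> []"
  by (simp add: slice_def)

abbreviation R :: "('o \<Rightarrow> 'p) \<Rightarrow> (('o, 'y, 'a) mor list \<Rightarrow>\<^sub>0 'k::field) \<Rightarrow> (('p, 'y, 'a) mor list \<Rightarrow>\<^sub>0 'k)"
  where "R Fo x \<equiv> clin (\<lambda>w. word (map (rho Fo) w)) x"

lemma R_overbrace:
  assumes q: "q < length w" and P: "\<And>z. length z = length w \<Longrightarrow> R Fo (P z) = P' (map (rho Fo) z)"
  shows "R Fo (overbrace p q P w) = overbrace p q P' (map (rho Fo) w)"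
proof -
  have "R Fo (clin P (rotn i w)) = clin P' (rotn i (map (rho Fo) w))" for i
    using P[of "drop (length w - i) w @ take (length w - i) w"]
    by (simp add: rotn_def mulrev_def clin_csc take_map[symmetric] drop_map[symmetric])
      (simp add: take_map drop_map)
  then show ?thesis
    unfolding overbrace_def using q by (simp add: clin_sum cyc_power cong: sum.cong_simp)
qed

lemma R_mult: "R Fo (x * y) = R Fo x * R Fo y"
  by (subst mult_conv_clin) (simp add: clin_clin clin_mult plus_list_def, simp add: word_append)

lemma mu_plus_rho: "mu_plus (pullback D Fo X) w = mu_plus D (map (rho Fo) w)"
  by (auto simp: mu_plus_def o_def split: list.splits)

locale pulled = D: ainf_based D B
  for D :: "('k::field, 'p, 'y::grading_datum, 'b::ab_group_add) ainf_data" and B +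
  fixes Fo :: "'o \<Rightarrow> 'p" and X0 :: "'o set"
  assumes FoX: "X \<in> X0 \<Longrightarrow> Fo X \<in> Obj D"
begin

abbreviation "E \<equiv> pullback D Fo X0"
abbreviation "BE \<equiv> \<lambda>X Y. B (Fo X) (Fo Y)"
abbreviation "r \<equiv> rho Fo"

lemma rho_mor: "is_mor E m \<Longrightarrow> is_mor D (r m)"
  by (simp add: is_mor_def FoX)

lemma rho_path: "is_path E w \<Longrightarrow> is_path D (map r w)"
  unfolding is_path_def successively_map by (auto simp: rho_mor elim: successively_mono)

lemma mor_E: "is_mor E m \<longleftrightarrow> src m \<in> X0 \<and> tgt m \<in> X0 \<and> elt m \<in> Hom D (Fo (src m)) (Fo (tgt m)) (deg m)"
  by (simp add: is_mor_def)

lemma path_ends: "is_path E w \<Longrightarrow> src (hd w) \<in> X0 \<and> tgt (last w) \<in> X0"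
  by (auto simp: is_path_def mor_E)

lemma mu_mor_rho: "w \<noteq> [] \<Longrightarrow> r (mu_mor E w) = mu_mor D (map r w)"
  by (rule rho_apply_op') simp_all

lemma mu_E: "multilinear_op E E id (ainf_data.mu E) (deg_of_int 1)"
  unfolding multilinear_op_def
proof (intro conjI allI impI)
  fix w assume w: "is_path E w"
  then have ne: "w \<noteq> []" by auto
  have "is_mor D (mu_mor D (map r w))" by (rule D.mu_mor[OF rho_path[OF w]])
  then have "is_mor D (r (mu_mor E w))" using mu_mor_rho[OF ne] by simp
  then show "is_mor E (mu_mor E w)" using path_ends[OF w] by (simp add: mor_E is_mor_def)
next
  fix p q and m :: "('o, 'y, 'b) mor" and a b
  assume "is_path E (p @ with_elt m a # q)" "is_path E (p @ with_elt m b # q)"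
  from rho_path[OF this(1)] rho_path[OF this(2)]
  show "ainf_data.mu E (p @ with_elt m (a + b) # q) = ainf_data.mu E (p @ with_elt m a # q) + ainf_data.mu E (p @ with_elt m b # q)"
    using D.mu unfolding multilinear_op_def by simp
next
  fix p q and m :: "('o, 'y, 'b) mor" and a c
  assume "is_path E (p @ with_elt m a # q)"
  from rho_path[OF this]
  show "ainf_data.mu E (p @ with_elt m (scl E c a) # q) = scl E c (ainf_data.mu E (p @ with_elt m a # q))"
    using D.mu unfolding multilinear_op_def by simp
qed

sublocale E: ainf_based E BE
proof (intro ainf_based.intro based.intro ainf_based_axioms.intro)
  show "vector_space (scl E)" using D.vs by simp
  show "module.subspace (scl E) (Hom E X Y y)" if "X \<in> Obj E" "Y \<in> Obj E" for X Y y
    using D.Hom[OF FoX FoX] that by simp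
  show "hom_bases E BE" using D.bases FoX by (simp add: hom_bases_def)
  show "multilinear_op E E id (ainf_data.mu E) (deg_of_int 1)" by (rule mu_E)
  fix w assume w: "is_path E w"
  have "(\<Sum>j<length w. \<Sum>k\<in>{j<..length w}. scl E (bsign (eps (take j w))) (ainf_data.mu E (take j w @ mu_mor E (slice j k w) # drop k w))) =
    (\<Sum>j<length (map r w). \<Sum>k\<in>{j<..length (map r w)}. scl D (bsign (eps (take j (map r w)))) (ainf_data.mu D (take j (map r w) @ mu_mor D (slice j k (map r w)) # drop k (map r w))))"
    unfolding length_map
    by (intro sum.cong refl) (simp add: take_map drop_map slice_map mu_mor_rho[OF slice_ne])
  then show "(\<Sum>j<length w. \<Sum>k\<in>{j<..length w}. scl E (bsign (eps (take j w))) (ainf_data.mu E (take j w @ mu_mor E (slice j k w) # drop k w))) = 0"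
    using D.rel[OF rho_path[OF w]] by simp
qed

lemma muP_rho: "w \<noteq> [] \<Longrightarrow> r (mu_mor E.Cp w) = mu_mor D.Cp (map r w)"
  by (rule rho_apply_op') (simp_all add: mu_plus_rho)

lemma CpE_mor: "is_mor E.Cp m \<Longrightarrow> is_mor D.Cp (r m)"
  by (simp add: E.is_mor_Cp D.is_mor_Cp rho_mor)

lemma cyc_rho: "cyc_word E.Cp w \<Longrightarrow> cyc_word D.Cp (map r w)"
  by (cases "w = []") (auto simp: cyc_word_def is_path_def successively_map CpE_mor hd_map last_map elim: successively_mono)

lemma R_fc: "x \<in> formal_chains E.Cp y \<Longrightarrow> R Fo x \<in> formal_chains D.Cp y"
  by (rule fc_clin) (auto intro: fc_word cyc_rho)

lemma R_null:
  assumes "x \<in> null_chains E"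
  shows "R Fo x \<in> null_chains D"
  using assms unfolding null_chains_def[of E]
proof (rule chain.span_induct)
  show "chain.subspace {x. R Fo x \<in> null_chains D}"
    by (rule chain.subspaceI) (auto simp: null_closed clin_add clin_csc null_chains_def intro: chain.span_add chain.span_scale chain.span_zero)
  have tr: "x \<in> tensor_relations D.Cp \<Longrightarrow> x \<in> null_chains D" for x
    unfolding null_chains_def by (rule chain.span_base) simp
  fix x assume "x \<in> tensor_relations E.Cp \<union> word ` degenerate_words E"
  then consider p m q a b where "x = word (p @ with_elt (m :: ('o, 'y, 'b \<times> 'k) mor) (a + b) # q) - word (p @ with_elt m a # q) - word (p @ with_elt m b # q)"
        "cyc_word E.Cp (p @ with_elt m a # q)" "cyc_word E.Cp (p @ with_elt m b # q)"
      | p m q a c where "x = word (p @ with_elt (m :: ('o, 'y, 'b \<times> 'k) mor) (scl E.Cp c a) # q) - csc c (word (p @ with_elt m a # q))"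
        "cyc_word E.Cp (p @ with_elt m a # q)"
      | w where "x = word w" "w \<in> degenerate_words E"
    unfolding tensor_relations_def by blast
  then show "R Fo x \<in> null_chains D"
  proof cases
    case (1 p m q a b)
    have c: "cyc_word D.Cp (map r p @ with_elt (r m) a # map r q)" "cyc_word D.Cp (map r p @ with_elt (r m) b # map r q)"
      using cyc_rho[OF 1(2)] cyc_rho[OF 1(3)] by simp_all
    have "R Fo x = word (map r p @ with_elt (r m) (a + b) # map r q) - word (map r p @ with_elt (r m) a # map r q) - word (map r p @ with_elt (r m) b # map r q)"
      by (simp add: 1(1) clin_diff)
    with c show ?thesis by (intro tr) (unfold tensor_relations_def, blast)
  next
    case (2 p m q a c)
    have cc: "cyc_word D.Cp (map r p @ with_elt (r m) a # map r q)" using cyc_rho[OF 2(2)] by simp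
    have "R Fo x = word (map r p @ with_elt (r m) (scl D.Cp c a) # map r q) - csc c (word (map r p @ with_elt (r m) a # map r q))"
      by (simp add: 2(1) clin_diff)
    with cc show ?thesis by (intro tr) (unfold tensor_relations_def, blast)
  next
    case (3 w)
    have "map r w \<in> degenerate_words D"
    proof (cases "\<exists>i X. 0 < i \<and> i < length w \<and> w ! i = e_plus X")
      case True
      then obtain i X where i: "0 < i" "i < length w" "w ! i = e_plus X" by blast
      then have "cyc_word E.Cp w" using 3(2) by (auto simp: degenerate_words_def)
      then have "cyc_word D.Cp (map r w)" by (rule cyc_rho)
      moreover have "i < length (map r w)" "map r w ! i = e_plus (Fo X)" using i by simp_all
      ultimately show ?thesis using i(1) unfolding degenerate_words_def by blast
    next
      case False
      then obtain X where "w = [e_plus X]" "X \<in> X0" using 3(2) by (auto simp: degenerate_words_def)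
      then show ?thesis using FoX by (auto simp: degenerate_words_def)
    qed
    then show ?thesis unfolding 3(1) null_chains_def by (intro chain.span_base) simp
  qed
qed

lemma R_b: "R Fo (hochschild_b E.Cp w) = hochschild_b D.Cp (map r w)"
proof -
  have "R Fo (overbrace 0 j (\<lambda>w. word (mu_mor E.Cp (take (Suc j) w) # drop (Suc j) w)) w) =
    overbrace 0 j (\<lambda>w. word (mu_mor D.Cp (take (Suc j) w) # drop (Suc j) w)) (map r w)" if j: "j < length w" for j
  proof (rule R_overbrace[OF j])
    fix z :: "('o, 'y, 'b \<times> 'k) mor list" assume z: "length z = length w"
    then have "take (Suc j) z \<noteq> []" using j by auto
    then have "r (mu_mor E.Cp (take (Suc j) z)) = mu_mor D.Cp (map r (take (Suc j) z))" by (rule muP_rho)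
    then show "R Fo (word (mu_mor E.Cp (take (Suc j) z) # drop (Suc j) z)) = word (mu_mor D.Cp (take (Suc j) (map r z)) # drop (Suc j) (map r z))"
      unfolding take_map drop_map by (simp only: clin_single csc_simps list.map)
  qed
  moreover have "R Fo (csc (bsign (eps (take j w))) (word (take j w @ mu_mor E.Cp (slice j k w) # drop k w))) =
      csc (bsign (eps (take j (map r w)))) (word (take j (map r w) @ mu_mor D.Cp (slice j k (map r w)) # drop k (map r w)))"
    if "j < k" "k \<le> length w" for j k
    unfolding take_map drop_map slice_map rdeg_rho clin_csc clin_single csc_simps map_append list.map muP_rho[OF slice_ne[OF that]] ..
  ultimately show ?thesis
    unfolding hochschild_b_def clin_add clin_sum length_map
    by (intro arg_cong2[where f = "(+)"] sum.cong refl) auto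
qed

lemma R_B: "w \<noteq> [] \<Longrightarrow> R Fo (connes_B w) = connes_B (map r w)" for w :: "('o, 'y, 'b \<times> 'k) mor list"
  unfolding connes_B_def length_map
proof (rule R_overbrace)
  fix z :: "('o, 'y, 'b \<times> 'k) mor list" assume "w \<noteq> []" "length z = length w"
  then have "z \<noteq> []" by auto
  then show "R Fo (word (e_plus (src (hd z)) # z)) = word (e_plus (src (hd (map r z))) # map r z)"
    by (simp add: hd_map)
qed simp

lemma R_neg_d: "x \<in> formal_series E.Cp y \<Longrightarrow> R Fo (neg_d E x i) = neg_d D (\<lambda>i. R Fo (x i)) i"
proof -
  assume x: "x \<in> formal_series E.Cp y"
  have b: "R Fo (clin (hochschild_b E.Cp) (x i)) = clin (hochschild_b D.Cp) (R Fo (x i))" for i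
    by (simp add: clin_clin R_b)
  have B: "R Fo (clin connes_B (x i)) = clin connes_B (R Fo (x i))" for i
    unfolding clin_clin by (rule clin_cong[OF refl]) (use fsD[OF x, of i] in \<open>auto simp: formal_chains_def cyc_word_def intro!: R_B\<close>)
  show ?thesis
    unfolding neg_d_def clin_add b by (simp only: u_times_apply[where g = "R Fo", OF B clin_0])
qed

lemma R_fs: "x \<in> formal_series E.Cp y \<Longrightarrow> (\<lambda>i. R Fo (x i)) \<in> formal_series D.Cp y"
  by (rule fsI) (rule R_fc, rule fsD)

lemma R_coh:
  assumes "(a, b) \<in> cohomologous E y"
  shows "((\<lambda>i. R Fo (a i)), (\<lambda>i. R Fo (b i))) \<in> cohomologous D y"
proof -
  have coc: "(\<lambda>i. R Fo (x i)) \<in> neg_cocycles D y" if x: "x \<in> neg_cocycles E y" for x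
  proof -
    have f: "x \<in> formal_series E.Cp y" "\<And>i. neg_d E x i \<in> null_chains E" using x by (auto simp: neg_cocycles_def)
    show ?thesis using R_fs[OF f(1)] R_null[OF f(2)] by (simp add: neg_cocycles_def R_neg_d[OF f(1)])
  qed
  obtain z where z: "a \<in> neg_cocycles E y" "b \<in> neg_cocycles E y" "z \<in> formal_series E.Cp (y - deg_of_int 1)"
    "\<And>i. b i - a i - neg_d E z i \<in> null_chains E"
    using assms by (auto simp: cohomologous_def)
  have "R Fo (b i) - R Fo (a i) - neg_d D (\<lambda>i. R Fo (z i)) i \<in> null_chains D" for i
    using R_null[OF z(4)[of i]] unfolding clin_diff R_neg_d[OF z(3)] .
  then show ?thesis unfolding cohomologous_def using coc z(1,2) R_fs[OF z(3)] by blast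
qed

lemma expand_rho: "R Fo (expand E BE w) = expand D B (map r w)"
proof (induction w)
  case (Cons m w)
  have c: "coord D B (r m) = coord E BE m" by (simp add: coord_def)
  have "R Fo (E.lx m) = D.lx (r m)" unfolding E.lx_eq D.lx_eq c by (simp add: clin_sum)
  then show ?case unfolding list.map E.expand_Cons[of m w] D.expand_Cons[of "r m" "map r w"] R_mult Cons by simp
qed simp

text \<open>If \<open>Fo\<close> identifies two distinct objects, the augmented basis over D
  contains e^+ between their images while the one over the pullback does not. The coordinates agree
  nevertheless, because a morphism over the pullback lies in the span of the smaller basis.\<close>

lemma expand_plus_rho: "\<forall>m\<in>set w. is_mor E.Cp m \<Longrightarrow> R Fo (expand E.Cp (basis_plus BE) w) = expand D.Cp (basis_plus B) (map r w)"
proof (induction w)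
  case (Cons m w)
  have m: "is_mor E.Cp m" using Cons.prems by simp
  have "scl E.Cp = scl D.Cp" by (simp add: ainf_plus_def)
  then have "coord E.Cp (basis_plus BE) m = D.P.V.representation (basis_plus BE (src m) (tgt m) (deg m)) (elt m)"
    by (simp add: coord_def)
  also have "\<dots> = D.P.V.representation (basis_plus B (Fo (src m)) (Fo (tgt m)) (deg m)) (elt m)"
  proof (rule D.P.V.representation_extend[symmetric])
    show "D.P.V.independent (basis_plus B (Fo (src m)) (Fo (tgt m)) (deg m))"
      using D.P.mor_basis(1)[OF CpE_mor[OF m]] by simp
    show "elt m \<in> D.P.V.span (basis_plus BE (src m) (tgt m) (deg m))"
      using E.P.mor_basis(2)[OF m] \<open>scl E.Cp = scl D.Cp\<close> by simp
    show "basis_plus BE (src m) (tgt m) (deg m) \<subseteq> basis_plus B (Fo (src m)) (Fo (tgt m)) (deg m)"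
      by (auto simp: basis_plus_def)
  qed
  finally have c: "coord D.Cp (basis_plus B) (r m) = coord E.Cp (basis_plus BE) m" by (simp add: coord_def)
  have "R Fo (E.P.lx m) = D.P.lx (r m)" unfolding E.P.lx_eq D.P.lx_eq c by (simp add: clin_sum)
  moreover have "R Fo (expand E.Cp (basis_plus BE) w) = expand D.Cp (basis_plus B) (map r w)" using Cons by simp
  ultimately show ?case unfolding list.map E.P.expand_Cons[of m w] D.P.expand_Cons[of "r m" "map r w"] R_mult by simp
qed simp

lemma lin_single: "lin (scl D) G (Poly_Mapping.single u c) = scl D c (G u)"
  by (cases "c = 0") (simp_all add: lin_def)

lemma lin_add: "lin (scl D) G (x + y) = lin (scl D) G x + lin (scl D) G y"
proof -
  have s: "lin (scl D) G z = (\<Sum>w\<in>S. scl D (Poly_Mapping.lookup z w) (G w))"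
    if "finite S" "Poly_Mapping.keys z \<subseteq> S" for S z
    unfolding lin_def using that by (intro sum.mono_neutral_left) (auto simp: in_keys_iff)
  let ?S = "Poly_Mapping.keys x \<union> Poly_Mapping.keys y"
  have "Poly_Mapping.keys (x + y) \<subseteq> ?S" by (rule keys_add)
  then show ?thesis
    by (simp add: s[of ?S] lookup_add D.V.scale_left_distrib sum.distrib)
qed

lemma lin_sum: "lin (scl D) G (sum f A) = (\<Sum>a\<in>A. lin (scl D) G (f a))"
  by (induction A rule: infinite_finite_induct) (simp_all add: lin_add, simp_all add: lin_def)

lemma lin_R: "lin (scl D) G (R Fo x) = lin (scl D) (\<lambda>w. G (map r w)) x"
  by (subst (2) lin_def) (simp add: lin_sum lin_single, simp add: lin_def[of "scl D" "\<lambda>w. G (map r w)"])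

context
  fixes v :: "'k \<Rightarrow> 'k"
  assumes v: "der v"
begin

lemma v_mu_rho: "is_path E w \<Longrightarrow> v_mu E BE v w = v_mu D B v (map r w)"
proof -
  assume w: "is_path E w"
  let ?g = "\<lambda>w'. \<Sum>\<gamma> | coord D B (mu_mor D w') \<gamma> \<noteq> 0. scl D (v (coord D B (mu_mor D w') \<gamma>)) \<gamma>"
  have "v_mu D B v (map r w) = lin (scl D) ?g (R Fo (expand E BE w))"
    unfolding v_mu_def expand_rho ..
  also have "\<dots> = lin (scl D) (\<lambda>w'. ?g (map r w')) (expand E BE w)" by (rule lin_R)
  also have "\<dots> = v_mu E BE v w"
  proof -
    have eq: "?g (map r w') = (\<Sum>\<gamma> | coord E BE (mu_mor E w') \<gamma> \<noteq> 0. scl E (v (coord E BE (mu_mor E w') \<gamma>)) \<gamma>)"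
      if w': "w' \<in> Poly_Mapping.keys (expand E BE w)" for w'
    proof -
      have "map lab w' = map lab w" using E.keys_expand[OF _ w'] w by (simp add: is_path_def)
      then have ne: "w' \<noteq> []" using w by auto
      have c: "coord D B (mu_mor D (map r w')) = coord E BE (mu_mor E w')"
        unfolding mu_mor_rho[symmetric, OF ne] by (simp add: coord_def)
      show ?thesis unfolding c pullback_simps(1) ..
    qed
    show ?thesis unfolding v_mu_def lin_def by (intro sum.cong refl) (simp only: eq pullback_simps(1))
  qed
  finally show ?thesis ..
qed

abbreviation "vE \<equiv> apply_op id (v_mu_plus E BE v) (deg_of_int 1)"
abbreviation "vD \<equiv> apply_op id (v_mu_plus D B v) (deg_of_int 1)"

lemma vP_rho: "is_path E.Cp s \<Longrightarrow> r (vE s) = vD (map r s)"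
proof (rule rho_apply_op')
  assume s: "is_path E.Cp s"
  then show "s \<noteq> []" by auto
  show "v_mu_plus E BE v s = v_mu_plus D B v (map r s)"
    using v_mu_rho[OF E.drop_e_path[OF s]] by (simp add: v_mu_plus_def o_def)
qed

text \<open>A variant for v(mu), whose compatibility with the relabelling is available only on
  composable words; rotations of cyclic words remain composable.\<close>

lemma R_overbrace_cyc:
  assumes "q < length w" "cyc_word E.Cp w" and P: "\<And>z. cyc_word E.Cp z \<Longrightarrow> length z = length w \<Longrightarrow> R Fo (P z) = P' (map r z)"
  shows "R Fo (overbrace p q P w) = overbrace p q P' (map r w)"
proof -
  have "R Fo (clin P (rotn i w)) = clin P' (rotn i (map r w))" for i
  proof -
    let ?z = "drop (length w - i) w @ take (length w - i) w"
    have "?z \<in> Poly_Mapping.keys (rotn i w :: _ \<Rightarrow>\<^sub>0 'k)" by (simp add: rotn_def mulrev_def bsign_def)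
    from P keys_rotn[OF this assms(2)] have "R Fo (P ?z) = P' (map r ?z)" by blast
    then show ?thesis
      by (simp add: rotn_def mulrev_def clin_csc take_map[symmetric] drop_map[symmetric]) (simp add: take_map drop_map)
  qed
  then show ?thesis
    unfolding overbrace_def using assms(1) by (simp add: clin_sum cyc_power cong: sum.cong_simp)
qed

lemma R_b11:
  assumes w: "cyc_word E.Cp w"
  shows "R Fo (b11 E.Cp (v_mu_plus E BE v) (deg_of_int 1) w) = b11 D.Cp (v_mu_plus D B v) (deg_of_int 1) (map r w)"
  unfolding b11_def clin_sum length_map
proof (intro sum.cong refl R_overbrace_cyc[OF _ w])
  fix j l k z assume jlk: "j \<in> {..<length w}" "l \<in> {j<..<length w}" "k \<in> {l<..length w}" and z: "cyc_word E.Cp z" "length z = length w"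
  have p: "is_path E.Cp (slice j l z)" using z jlk by (intro path_slice) (auto simp: cyc_word_def)
  have "r (mu_mor E.Cp (take j z @ vE (slice j l z) # slice l k z)) = mu_mor D.Cp (take j (map r z) @ vD (slice j l (map r z)) # slice l k (map r z))"
    by (subst muP_rho) (simp_all add: vP_rho[OF p] take_map slice_map)
  then show "R Fo (csc (bsign (parity (deg_of_int 1) * eps (take j z))) (word (mu_mor E.Cp (take j z @ vE (slice j l z) # slice l k z) # drop k z))) =
    csc (bsign (parity (deg_of_int 1) * eps (take j (map r z)))) (word (mu_mor D.Cp (take j (map r z) @ vD (slice j l (map r z)) # slice l k (map r z)) # drop k (map r z)))"
    unfolding clin_csc clin_single csc_simps list.map by (simp add: take_map drop_map)
qed auto

lemma R_B11:
  assumes w: "cyc_word E.Cp w"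
  shows "R Fo (B11 (v_mu_plus E BE v) (deg_of_int 1) w) = B11 (v_mu_plus D B v) (deg_of_int 1) (map r w)"
  unfolding B11_def clin_sum length_map
proof (intro sum.cong refl R_overbrace_cyc[OF _ w])
  fix j l z assume jl: "j \<in> {..<length w}" "l \<in> {j<..<length w}" and z: "cyc_word E.Cp z" "length z = length w"
  have p: "is_path E.Cp (slice j l z)" using z jl by (intro path_slice) (auto simp: cyc_word_def)
  have "z \<noteq> []" using z by (auto simp: cyc_word_def)
  then show "R Fo (csc (bsign (parity (deg_of_int 1) * eps (take j z))) (word (e_plus (src (hd z)) # take j z @ vE (slice j l z) # drop l z))) =
    csc (bsign (parity (deg_of_int 1) * eps (take j (map r z)))) (word (e_plus (src (hd (map r z))) # take j (map r z) @ vD (slice j l (map r z)) # drop l (map r z)))"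
    unfolding clin_csc clin_single csc_simps list.map map_append vP_rho[OF p] by (simp add: take_map drop_map slice_map hd_map)
qed auto

lemma R_act:
  assumes x: "x \<in> formal_chains E.Cp y"
  shows "R Fo (act_coeffs E.Cp (basis_plus BE) v x) = act_coeffs D.Cp (basis_plus B) v (R Fo x)"
proof -
  have "R Fo (mapv v u) = mapv v (R Fo u)" for u :: "('k, 'o, 'y, 'b \<times> 'k) chain"
    using mapv_clin[OF v, of "\<lambda>w. word (map r w)" u] by (simp add: mapv_word[OF v])
  moreover have "R Fo (clin (expand E.Cp (basis_plus BE)) x) = clin (expand D.Cp (basis_plus B)) (R Fo x)"
    unfolding clin_clin using x
    by (intro clin_cong refl) (auto simp: formal_chains_def cyc_word_def is_path_def expand_plus_rho)
  ultimately show ?thesis unfolding act_coeffs_def by simp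
qed

lemma R_nabla:
  assumes x: "x \<in> formal_series E.Cp y"
  shows "(\<lambda>i. R Fo (u_nabla E BE v x i)) = u_nabla D B v (\<lambda>i. R Fo (x i))"
proof (rule ext)
  fix i
  have cyc: "cyc_word E.Cp w" if "w \<in> Poly_Mapping.keys (x i)" for w i
    using fsD[OF x, of i] that by (simp add: formal_chains_def)
  have a: "R Fo (act_coeffs E.Cp (basis_plus BE) v (x i)) = act_coeffs D.Cp (basis_plus B) v (R Fo (x i))" for i
    by (rule R_act[OF fsD[OF x]])
  have b: "R Fo (clin (b11 E.Cp (v_mu_plus E BE v) (deg_of_int 1)) (x i)) = clin (b11 D.Cp (v_mu_plus D B v) (deg_of_int 1)) (R Fo (x i))" for i
    unfolding clin_clin by (rule clin_cong[OF refl]) (simp add: R_b11 cyc)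
  have B: "R Fo (clin (B11 (v_mu_plus E BE v) (deg_of_int 1)) (x i)) = clin (B11 (v_mu_plus D B v) (deg_of_int 1)) (R Fo (x i))" for i
    unfolding clin_clin by (rule clin_cong[OF refl]) (simp add: R_B11 cyc)
  show "R Fo (u_nabla E BE v x i) = u_nabla D B v (\<lambda>i. R Fo (x i)) i"
    unfolding u_nabla_def clin_diff b
    by (simp only: u_times_apply[where g = "R Fo", OF a clin_0] u_times_apply[where g = "R Fo", OF B clin_0])
qed

end

end

lemma ainf_category_based:
  assumes "ainf_category C" "hom_bases C B"
  shows "ainf_based C B"
proof -
  interpret C: ainf_category C by fact
  show ?thesis
    by (intro ainf_based.intro based.intro ainf_based_axioms.intro C.scl C.Hom C.mu C.ainf_relation assms(2))
qed

theorem theorem3p32: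
  fixes C :: "('k::field, 'o, 'y::grading_datum, 'a::ab_group_add) ainf_data"
    and D :: "('k, 'p, 'y, 'b::ab_group_add) ainf_data"
    and k :: "'k set"
  assumes "is_subfield k"
    and "ainf_category C" and "ainf_category D"
    and "hom_bases C B\<^sub>C" and "hom_bases D B\<^sub>D"
    and "ainf_functor C D Fo F"
  shows "\<forall>v\<in>Der k. \<forall>y. \<forall>\<xi>\<in>HC_neg C y.
    HC_map D Fo F (y + deg_of_int 2) (HC_u_nabla C B\<^sub>C v y \<xi>) =
    HC_u_nabla D B\<^sub>D v y (HC_map D Fo F y \<xi>)"
proof (intro ballI allI)
  fix v y \<xi> assume "v \<in> Der k" and \<xi>: "\<xi> \<in> HC_neg C y"
  then have v: "der v" by (simp add: Der_def der_def)
  interpret C: ainf_based C B\<^sub>C by (rule ainf_category_based[OF assms(2,4)])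
  interpret D0: ainf_based D B\<^sub>D by (rule ainf_category_based[OF assms(3,5)])
  have Fml: "multilinear_op C D Fo F 0" using assms(6) by (simp add: ainf_functor_def)
  have Fmor: "is_mor D (apply_op Fo F 0 w)" if "is_path C w" for w
    using Fml that by (simp add: multilinear_op_def)
  interpret P: pulled D B\<^sub>D Fo "Obj C"
  proof
    fix X assume X: "X \<in> Obj C"
    \<comment> \<open>The zero morphism at \<open>X\<close> is a path of length one; the typing of
      its image under F places \<open>Fo X\<close> among the objects of D.\<close>
    have "is_path C [Mor X X 0 0]" using X C.V.subspace_0[OF C.Hom[OF X X]] by (simp add: is_path_def is_mor_def)
    from Fmor[OF this] show "Fo X \<in> Obj D" by (simp add: is_mor_def)
  qed
  \<comment> \<open>The same components, read with values in the pullback, form a functor that is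
    the identity on objects.\<close>
  have fE: "ainf_functor C P.E id F"
    unfolding ainf_functor_def multilinear_op_def
  proof (intro conjI allI impI)
    fix w assume w: "is_path C w"
    have "src (hd w) \<in> Obj C" "tgt (last w) \<in> Obj C"
      using w by (auto simp: is_path_def is_mor_def)
    then show "is_mor P.E (apply_op id F 0 w)" using Fmor[OF w] by (simp add: P.mor_E is_mor_def)
    have "ainf_data.mu P.E (map (apply_op id F 0) ls) = ainf_data.mu D (map (apply_op Fo F 0) ls)" for ls
      unfolding pullback_simps map_map o_def rho_apply_op ..
    then show "(\<Sum>bs\<in>splittings w. ainf_data.mu P.E (map (apply_op id F 0) bs)) =
      (\<Sum>j<length w. \<Sum>k\<in>{j<..length w}. scl P.E (bsign (eps (take j w))) (F (take j w @ mu_mor C (slice j k w) # drop k w)))"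
      using assms(6) w unfolding ainf_functor_def by simp
  qed (use Fml in \<open>simp_all add: multilinear_op_def\<close>)
  interpret F: ainf_functor_based C B\<^sub>C P.E P.BE F
    by unfold_locales (rule fE)
  let ?F = "\<lambda>x i. clin (induced_chain_map Fo (F_plus F)) (x i)"
  \<comment> \<open>On chains F_* factors accordingly, as relabelling after the map induced on the
    pullback.\<close>
  have icm: "induced_chain_map Fo (F_plus F) w = R Fo (induced_chain_map id (F_plus F) w)" for w :: "('o, 'y, 'a \<times> 'k) mor list"
    unfolding induced_chain_map_def overbrace_def
    by (simp add: clin_sum clin_clin o_def rho_apply_op)
  have FR: "?F x = (\<lambda>i. R Fo (F.Fs x i))" for x
    unfolding F.Fs_def clin_clin icm ..
  have Fcoh: "(?F a, ?F b) \<in> cohomologous D z" if "(a, b) \<in> cohomologous C z" for a b z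
    unfolding FR by (rule P.R_coh[OF F.F_coh[OF that]])
  obtain x where x: "x \<in> neg_cocycles C y" "\<xi> = cohomologous C y `` {x}"
    using \<xi> by (auto simp: HC_neg_def quotient_def)
  have xx: "(x, x) \<in> cohomologous C y" by (rule refl_coh[OF x(1)])
  have nx: "(u_nabla C B\<^sub>C v x, u_nabla C B\<^sub>C v x) \<in> cohomologous C (y + deg_of_int 2)"
    by (rule C.nabla_coh[OF v xx])
  have 1: "HC_u_nabla C B\<^sub>C v y \<xi> = cohomologous C (y + deg_of_int 2) `` {u_nabla C B\<^sub>C v x}"
    unfolding HC_u_nabla_def x(2) by (rule induced_class[OF C.nabla_coh[OF v] sym_coh trans_coh xx])
  have 2: "HC_map D Fo F (y + deg_of_int 2) (HC_u_nabla C B\<^sub>C v y \<xi>) = cohomologous D (y + deg_of_int 2) `` {?F (u_nabla C B\<^sub>C v x)}"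
    unfolding 1 HC_map_def by (rule induced_class[OF Fcoh sym_coh trans_coh nx])
  have 3: "HC_map D Fo F y \<xi> = cohomologous D y `` {?F x}"
    unfolding x(2) HC_map_def by (rule induced_class[OF Fcoh sym_coh trans_coh xx])
  have 4: "HC_u_nabla D B\<^sub>D v y (HC_map D Fo F y \<xi>) = cohomologous D (y + deg_of_int 2) `` {u_nabla D B\<^sub>D v (?F x)}"
    unfolding 3 HC_u_nabla_def by (rule induced_class[OF D0.nabla_coh[OF v] sym_coh trans_coh Fcoh[OF xx]])
  have fx: "F.Fs x \<in> formal_series P.E.Cp y" using F.fs_F x(1) by (simp add: neg_cocycles_def)
  have "(u_nabla D B\<^sub>D v (?F x), ?F (u_nabla C B\<^sub>C v x)) \<in> cohomologous D (y + deg_of_int 2)"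
    using P.R_coh[OF F.F_nabla[OF v x(1)]] unfolding FR P.R_nabla[OF v fx] .
  then have "cohomologous D (y + deg_of_int 2) `` {?F (u_nabla C B\<^sub>C v x)} = cohomologous D (y + deg_of_int 2) `` {u_nabla D B\<^sub>D v (?F x)}"
    using sym_coh[of D "y + deg_of_int 2"] trans_coh[of D "y + deg_of_int 2"] by (auto dest: symD transD)
  then show "HC_map D Fo F (y + deg_of_int 2) (HC_u_nabla C B\<^sub>C v y \<xi>) = HC_u_nabla D B\<^sub>D v y (HC_map D Fo F y \<xi>)"
    unfolding 2 4 .
qed

end
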